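(* Consider the macroscopic nonlocal system described in the context, with solution $(\rho,\omega)$, moving right boundary $\beta(t)=b+t\bar v$ and equilibrium density $\bar\rho(t,x)$. Let $\rho\in C^1(\mathbb{R}^+;H^2(\mathbb{R}))$, and assume that there is a constant $v'_{\max}<0$ with $\partial_\rho v(\rho,\omega)\le v'_{\max}$ for all values $\omega$ taken by $\omega_0$ and all admissible densities $\rho$. Further assume either (a) the kernel $w$ is constant, $w\equiv\frac1\eta$; or (b) the kernel $w$ is concave on $[0,\eta]$, and the initial data satisfy on $[b-\eta,b]$: $\omega_0(x)=\omega$ is constant, and (with $\bar\rho$ the constant equilibrium density given by $v(\bar\rho,\omega)=\bar v$) either $\rho_0(x)\ge\bar\rho$ and $\rho_0$ is monotone decreasing on $[b-\eta,b]$, or $\rho_0(x)\le\bar\rho$ and $\rho_0$ is monotone increasing on $[b-\eta,b]$. Define $$L(t):=\int_{\alpha(t)}^{\beta(t)}\big(\rho(t,x)-\bar\rho(t,x)\big)^2\,dx,$$ with $$\alpha(t):=\sup\left\{x\ge\beta(t)-\eta:\ \int_x^{\beta(t)}\rho(t,y)\,dy\ge c_\rho\right\},\qquad c_\rho:=\min_{t\ge0}\int_{\beta(t)-\eta}^{\beta(t)}\rho(t,x)\,dx .$$ Then, for all $t\ge 0$, $$L(t)\le L(0)\exp\left(2\,v'_{\max}\,\rho_{\min}\int_0^t w\big(\beta(s)-\alpha(s)\big)\,ds\right),$$ where $\rho_{\min}:=\inf_{x\in[\alpha(0),b]}\min\{\rho_0(x),\bar\rho(0,x)\}$.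
   Context: Kernel. Fix $\eta>0$ and $w\in C^1([0,\eta];[0,\infty))$ with $w'\le 0$ and $\int_0^\eta w(x)\,dx=1$. Velocity. $v(\rho,\omega)$ is twice continuously differentiable in $\rho$ and continuously differentiable in $\omega$. For every $\omega>0$ there is $\rho^{\max}_\omega>0$ with $v(\rho^{\max}_\omega,\omega)=0$; the admissible densities for $\omega$ are $\rho\in[0,\rho^{\max}_\omega]$. On admissible densities: $v(\rho,\omega)\ge 0$, $v(0,\omega)=\omega$; $\frac{\partial^2}{\partial\rho^2}\big(\rho v(\rho,\omega)\big)<0$ for $\omega>0$; and $\frac{\partial v}{\partial\omega}(\rho,\omega)>0$. Moreover $v(\rho,0)=0$. Macroscopic system. The density $\rho$ and Lagrangian marker $\omega$ satisfy $$\partial_t\rho+\partial_x\big(\rho\,V(t,x)\big)=0,\qquad \partial_t\omega+V(t,x)\,\partial_x\omega=0,$$ $$V(t,x)=\int_x^{x+\eta}w(y-x)\,v(\rho(t,y),\omega(t,y))\,dy .$$ Let $b>a+\eta$ and let $\bar v>0$ be the prescribed velocity of the right boundary $\beta(t)=b+t\bar v$. The system is considered for $t>0$ on $[a,\beta(t)]$ with initial data $\rho(0,x)=\rho_0(x)$, $\omega(0,x)=\omega_0(x)$ on $[a,b]$, where $\omega_0>0$, $\rho_0,\omega_0$ are of bounded variation, $\rho_0$ is nonnegative with $\rho_0\le\max_{\omega}\rho^{\max}_\omega$ and has compact connected support on which it is strictly positive, and with boundary conditions $$(\rho(t,a),\omega(t,a))=(0,\omega_0(a)),\qquad (\rho(t,y),\omega(t,y))=(\bar\rho_b,\omega_0(b))\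 \text{ for } y\ge\beta(t),$$ where $\bar\rho_b$ is determined by $v(\bar\rho_b,\omega_0(b))=\bar v$. (The problem can also be viewed as the Cauchy problem on $\mathbb{R}$ with initial data extended by $(0,\omega_0(a))$ for $x<a$ and by $(\bar\rho_b,\omega_0(b))$ for $x>b$.) All densities are understood to take admissible values. Equilibrium density. $\bar\rho(t,x)$ is defined by $v(\bar\rho(t,x),\omega(t,x))=\bar v$ (it is assumed that $\bar v$ is such that this is solvable, in particular $\bar v\le\omega_0(x)$); it satisfies $\partial_t\bar\rho+V(t,x)\partial_x\bar\rho=0$ with initial data $\bar\rho_0$ given by $v(\bar\rho_0(x),\omega_0(x))=\bar v$. *)

theory Defs
  imports "HOL-Analysis.Analysis"
begin

definition bounded_variation_on :: "(real \<Rightarrow> real) \<Rightarrow> real \<Rightarrow> real \<Rightarrow> bool" where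
  "bounded_variation_on f a b \<longleftrightarrow>
     (\<exists>M. \<forall>n. \<forall>p :: nat \<Rightarrow> real. mono p \<and> range p \<subseteq> {a..b} \<longrightarrow>
        (\<Sum>i<n. \<bar>f (p (Suc i)) - f (p i)\<bar>) \<le> M)"

definition nonlocal_kernel :: "real \<Rightarrow> (real \<Rightarrow> real) \<Rightarrow> bool" where
  "nonlocal_kernel \<eta> w \<longleftrightarrow>
     (\<forall>x\<in>{0..\<eta>}. 0 \<le> w x) \<and>
     (\<exists>w'. continuous_on {0..\<eta>} w' \<and>
        (\<forall>x\<in>{0..\<eta>}. (w has_real_derivative w' x) (at x within {0..\<eta>}) \<and> w' x \<le> 0)) \<and>
     (w has_integral 1) {0..\<eta>}"


section \<open>Velocity functions\<close>

definition admissible :: "(real \<Rightarrow> real) \<Rightarrow> (real \<times> real) set" where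
  "admissible rmax = {(r, om). 0 < om \<and> 0 \<le> r \<and> r \<le> rmax om}"

text \<open>
  Partial derivatives relative to the admissible set, hence one-sided on its boundary. In this way
  truncated laws such as \<open>v r om = max 0 (om - r)\<close>, which are smooth only for
  admissible densities, are covered as well.
\<close>

definition d_rho :: "(real \<Rightarrow> real) \<Rightarrow> (real \<Rightarrow> real \<Rightarrow> real) \<Rightarrow> real \<Rightarrow> real \<Rightarrow> real" where
  "d_rho rmax f r om = vector_derivative (\<lambda>s. f s om) (at r within {0..rmax om})"

definition d_omega :: "(real \<Rightarrow> real) \<Rightarrow> (real \<Rightarrow> real \<Rightarrow> real) \<Rightarrow> real \<Rightarrow> real \<Rightarrow> real" where
  "d_omega rmax f r om = vector_derivative (\<lambda>s. f r s) (at om within {s. 0 < s \<and> r \<le> rmax s})"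

definition velocity_law :: "(real \<Rightarrow> real \<Rightarrow> real) \<Rightarrow> (real \<Rightarrow> real) \<Rightarrow> bool" where
  "velocity_law v rmax \<longleftrightarrow>
     continuous_on ({0..} \<times> {0..}) (\<lambda>(r, om). v r om) \<and>
     (\<forall>(r, om) \<in> admissible rmax.
        (\<lambda>s. v s om) differentiable (at r within {0..rmax om}) \<and>
        (\<lambda>s. d_rho rmax v s om) differentiable (at r within {0..rmax om}) \<and>
        (\<lambda>s. v r s) differentiable (at om within {s. 0 < s \<and> r \<le> rmax s})) \<and>
     continuous_on (admissible rmax) (\<lambda>(r, om). d_rho rmax v r om) \<and>
     continuous_on (admissible rmax) (\<lambda>(r, om). d_rho rmax (d_rho rmax v) r om) \<and>
     continuous_on (admissible rmax) (\<lambda>(r, om). d_omega rmax v r om) \<and>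
     (\<forall>om>0. 0 < rmax om \<and> v (rmax om) om = 0 \<and> v 0 om = om) \<and>
     (\<forall>(r, om) \<in> admissible rmax.
        0 \<le> v r om \<and>
        d_rho rmax (d_rho rmax (\<lambda>r om. r * v r om)) r om < 0 \<and>
        0 < d_omega rmax v r om) \<and>
     (\<forall>r\<ge>0. v r 0 = 0)"


section \<open>Local Sobolev regularity\<close>

text \<open>
  Test functions are continuously differentiable with compact support; for weak derivatives and
  weak formulations this is equivalent to using smooth ones.
\<close>

definition weak_deriv :: "(real \<Rightarrow> real) \<Rightarrow> (real \<Rightarrow> real) \<Rightarrow> bool" where
  "weak_deriv f g \<longleftrightarrow>
     (\<forall>k. f absolutely_integrable_on {-k..k} \<and> g absolutely_integrable_on {-k..k}) \<and>
     (\<forall>\<phi> \<phi>'. (\<forall>x. (\<phi> has_real_derivative \<phi>' x) (at x)) \<and> continuous_on UNIV \<phi>' \<and>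
        (\<exists>N. \<forall>x. N \<le> \<bar>x\<bar> \<longrightarrow> \<phi> x = 0) \<longrightarrow>
        integral UNIV (\<lambda>x. f x * \<phi>' x) = - integral UNIV (\<lambda>x. g x * \<phi> x))"

definition wderiv :: "(real \<Rightarrow> real) \<Rightarrow> real \<Rightarrow> real" where
  "wderiv f = (SOME g. weak_deriv f g)"

definition L2_loc :: "(real \<Rightarrow> real) \<Rightarrow> bool" where
  "L2_loc f \<longleftrightarrow> f \<in> borel_measurable lebesgue \<and> (\<forall>k. (\<lambda>x. (f x)\<^sup>2) integrable_on {-k..k})"

text \<open>Elements of the local Sobolev space are represented by their continuous version.\<close>

definition H2_loc :: "(real \<Rightarrow> real) \<Rightarrow> bool" where
  "H2_loc f \<longleftrightarrow> continuous_on UNIV f \<and> L2_loc f \<and>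
     (\<exists>g h. weak_deriv f g \<and> L2_loc g \<and> weak_deriv g h \<and> L2_loc h)"

text \<open>
  Sobolev norm on \<open>{-k..k}\<close>. Weak derivatives are unique almost everywhere, so the norm
  does not depend on the choice made in \<open>wderiv\<close>.
\<close>

definition H2_norm :: "real \<Rightarrow> (real \<Rightarrow> real) \<Rightarrow> real" where
  "H2_norm k f =
     sqrt (integral {-k..k} (\<lambda>x. (f x)\<^sup>2 + (wderiv f x)\<^sup>2 + (wderiv (wderiv f) x)\<^sup>2))"

text \<open>
  \<open>C\<^sup>1([0,\<infinity>); H\<^sup>2\<^sub>l\<^sub>o\<^sub>c(\<real>))\<close>. The local space is forced by the
  boundary data: to the right of the moving boundary the density is a constant, in general
  nonzero, so the solution is not square integrable on the whole line.
\<close>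

definition C1_H2_loc :: "(real \<Rightarrow> real \<Rightarrow> real) \<Rightarrow> bool" where
  "C1_H2_loc \<rho> \<longleftrightarrow>
     (\<exists>\<rho>t. (\<forall>t\<ge>0. H2_loc (\<rho> t) \<and> H2_loc (\<rho>t t)) \<and>
        (\<forall>k>0. \<forall>t\<ge>0.
           ((\<lambda>s. H2_norm k (\<lambda>x. (\<rho> s x - \<rho> t x) / (s - t) - \<rho>t t x)) \<longlongrightarrow> 0) (at t within {0..}) \<and>
           ((\<lambda>s. H2_norm k (\<lambda>x. \<rho>t s x - \<rho>t t x)) \<longlongrightarrow> 0) (at t within {0..})))"


section \<open>The nonlocal system\<close>

definition nonlocal_V ::
  "real \<Rightarrow> (real \<Rightarrow> real) \<Rightarrow> (real \<Rightarrow> real \<Rightarrow> real) \<Rightarrow> (real \<Rightarrow> real \<Rightarrow> real) \<Rightarrow> (real \<Rightarrow> real \<Rightarrow> real)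
     \<Rightarrow> real \<Rightarrow> real \<Rightarrow> real" where
  "nonlocal_V \<eta> w v \<rho> \<omega> t x = integral {x..x + \<eta>} (\<lambda>y. w (y - x) * v (\<rho> t y) (\<omega> t y))"

definition test_function ::
  "(real \<Rightarrow> real \<Rightarrow> real) \<Rightarrow> (real \<Rightarrow> real \<Rightarrow> real) \<Rightarrow> (real \<Rightarrow> real \<Rightarrow> real) \<Rightarrow> bool" where
  "test_function \<phi> \<phi>t \<phi>x \<longleftrightarrow>
     (\<forall>t x. ((\<lambda>s. \<phi> s x) has_real_derivative \<phi>t t x) (at t) \<and>
            ((\<lambda>y. \<phi> t y) has_real_derivative \<phi>x t x) (at x)) \<and>
     continuous_on UNIV (\<lambda>(t, x). \<phi>t t x) \<and> continuous_on UNIV (\<lambda>(t, x). \<phi>x t x) \<and>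
     (\<exists>N. \<forall>t x. N \<le> \<bar>t\<bar> \<or> N \<le> \<bar>x\<bar> \<longrightarrow> \<phi> t x = 0)"

text \<open>
  Weak solutions of the Cauchy problem for
  \<open>\<partial>\<^sub>t \<rho> + \<partial>\<^sub>x (\<rho> V) = 0\<close> and \<open>\<partial>\<^sub>t \<omega> + V \<partial>\<^sub>x \<omega> = 0\<close> on the real line, with
  initial data \<open>\<rho> 0\<close> and \<open>\<omega> 0\<close>. The nonconservative product is understood as
  \<open>\<partial>\<^sub>x (V \<omega>) - \<omega> \<partial>\<^sub>x V\<close>; for bounded \<open>\<omega>\<close> the velocity is Lipschitz in space, so the
  derivative in the second identity exists almost everywhere. Since the marker is only of bounded
  variation, it is taken in \<open>C([0,\<infinity>); L\<^sup>1\<^sub>l\<^sub>o\<^sub>c)\<close>, which fixes its values at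
  every single time up to null sets.
\<close>

definition weak_solution ::
  "real \<Rightarrow> (real \<Rightarrow> real) \<Rightarrow> (real \<Rightarrow> real \<Rightarrow> real) \<Rightarrow> (real \<Rightarrow> real) \<Rightarrow> (real \<Rightarrow> real \<Rightarrow> real)
     \<Rightarrow> (real \<Rightarrow> real \<Rightarrow> real) \<Rightarrow> bool" where
  "weak_solution \<eta> w v rmax \<rho> \<omega> \<longleftrightarrow>
     (\<lambda>(t, x). \<rho> t x) \<in> borel_measurable (restrict_space borel ({0..} \<times> UNIV)) \<and>
     (\<lambda>(t, x). \<omega> t x) \<in> borel_measurable (restrict_space borel ({0..} \<times> UNIV)) \<and>
     (\<forall>t\<ge>0. \<forall>x. (\<rho> t x, \<omega> t x) \<in> admissible rmax) \<and>
     (\<exists>M. \<forall>t\<ge>0. \<forall>x. \<omega> t x \<le> M) \<and>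
     (\<forall>k>0. \<forall>t\<ge>0.
        ((\<lambda>s. integral {-k..k} (\<lambda>x. \<bar>\<omega> s x - \<omega> t x\<bar>)) \<longlongrightarrow> 0) (at t within {0..})) \<and>
     (\<forall>\<phi> \<phi>t \<phi>x. test_function \<phi> \<phi>t \<phi>x \<longrightarrow>
        integral ({0..} \<times> UNIV)
            (\<lambda>(t, x). \<rho> t x * (\<phi>t t x + nonlocal_V \<eta> w v \<rho> \<omega> t x * \<phi>x t x))
          + integral UNIV (\<lambda>x. \<rho> 0 x * \<phi> 0 x) = 0 \<and>
        integral ({0..} \<times> UNIV)
            (\<lambda>(t, x). \<omega> t x * (\<phi>t t x + deriv (\<lambda>y. nonlocal_V \<eta> w v \<rho> \<omega> t y * \<phi> t y) x))
          + integral UNIV (\<lambda>x. \<omega> 0 x * \<phi> 0 x) = 0)"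

definition right_boundary :: "real \<Rightarrow> real \<Rightarrow> real \<Rightarrow> real" where
  "right_boundary b vbar t = b + t * vbar"

definition extend_data :: "real \<Rightarrow> real \<Rightarrow> real \<Rightarrow> real \<Rightarrow> (real \<Rightarrow> real) \<Rightarrow> real \<Rightarrow> real" where
  "extend_data a b l r f x = (if x < a then l else if x \<le> b then f x else r)"

text \<open>
  A continuous density vanishing at \<open>a\<close> cannot be positive at the left end point of its support,
  so positivity is required in the interior of the support only.
\<close>

definition initial_data ::
  "(real \<Rightarrow> real) \<Rightarrow> real \<Rightarrow> real \<Rightarrow> (real \<Rightarrow> real) \<Rightarrow> (real \<Rightarrow> real) \<Rightarrow> bool" where
  "initial_data rmax a b \<rho>0 \<omega>0 \<longleftrightarrow>
     bounded_variation_on \<rho>0 a b \<and> bounded_variation_on \<omega>0 a b \<and>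
     (\<forall>x\<in>{a..b}. (\<rho>0 x, \<omega>0 x) \<in> admissible rmax) \<and>
     (let K = closure {x\<in>{a..b}. \<rho>0 x \<noteq> 0}
      in compact K \<and> connected K \<and> (\<forall>x\<in>interior K. 0 < \<rho>0 x))"

definition boundary_value_solution ::
  "real \<Rightarrow> (real \<Rightarrow> real) \<Rightarrow> (real \<Rightarrow> real \<Rightarrow> real) \<Rightarrow> (real \<Rightarrow> real) \<Rightarrow> real \<Rightarrow> real \<Rightarrow> real \<Rightarrow> real
     \<Rightarrow> (real \<Rightarrow> real) \<Rightarrow> (real \<Rightarrow> real) \<Rightarrow> (real \<Rightarrow> real \<Rightarrow> real) \<Rightarrow> (real \<Rightarrow> real \<Rightarrow> real) \<Rightarrow> bool" where
  "boundary_value_solution \<eta> w v rmax a b vbar rb \<rho>0 \<omega>0 \<rho> \<omega> \<longleftrightarrow>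
     weak_solution \<eta> w v rmax \<rho> \<omega> \<and>
     \<rho> 0 = extend_data a b 0 rb \<rho>0 \<and>
     \<omega> 0 = extend_data a b (\<omega>0 a) (\<omega>0 b) \<omega>0 \<and>
     (\<forall>t>0. \<rho> t a = 0 \<and> \<omega> t a = \<omega>0 a \<and>
        (\<forall>y\<ge>right_boundary b vbar t. \<rho> t y = rb \<and> \<omega> t y = \<omega>0 b))"

definition equilibrium_density ::
  "(real \<Rightarrow> real \<Rightarrow> real) \<Rightarrow> (real \<Rightarrow> real) \<Rightarrow> real \<Rightarrow> real \<Rightarrow> real
     \<Rightarrow> (real \<Rightarrow> real \<Rightarrow> real) \<Rightarrow> (real \<Rightarrow> real \<Rightarrow> real) \<Rightarrow> bool" where
  "equilibrium_density v rmax a b vbar \<omega> \<rho>bar \<longleftrightarrow>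
     (\<forall>t\<ge>0. \<forall>x\<in>{a..right_boundary b vbar t}.
        (\<rho>bar t x, \<omega> t x) \<in> admissible rmax \<and> v (\<rho>bar t x) (\<omega> t x) = vbar)"


section \<open>The Lyapunov functional\<close>

text \<open>
  The minimum over all times need not be attained, hence the infimum.
\<close>

definition c_rho :: "real \<Rightarrow> real \<Rightarrow> real \<Rightarrow> (real \<Rightarrow> real \<Rightarrow> real) \<Rightarrow> real" where
  "c_rho \<eta> b vbar \<rho> =
     (INF t\<in>{0..}. integral {right_boundary b vbar t - \<eta>..right_boundary b vbar t} (\<rho> t))"

text \<open>
  The integral from \<open>x\<close> to the boundary presupposes that \<open>x\<close> does not exceed the boundary; in the
  degenerate case where the density vanishes to the right of the boundary and \<open>c_rho\<close> is zero
  the set would otherwise be unbounded above.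
\<close>

definition alpha :: "real \<Rightarrow> real \<Rightarrow> real \<Rightarrow> (real \<Rightarrow> real \<Rightarrow> real) \<Rightarrow> real \<Rightarrow> real" where
  "alpha \<eta> b vbar \<rho> t =
     Sup {x \<in> {right_boundary b vbar t - \<eta>..right_boundary b vbar t}.
            c_rho \<eta> b vbar \<rho> \<le> integral {x..right_boundary b vbar t} (\<rho> t)}"

definition lyapunov ::
  "real \<Rightarrow> real \<Rightarrow> real \<Rightarrow> (real \<Rightarrow> real \<Rightarrow> real) \<Rightarrow> (real \<Rightarrow> real \<Rightarrow> real) \<Rightarrow> real \<Rightarrow> real" where
  "lyapunov \<eta> b vbar \<rho> \<rho>bar t =
     integral {alpha \<eta> b vbar \<rho> t..right_boundary b vbar t} (\<lambda>x. (\<rho> t x - \<rho>bar t x)\<^sup>2)"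

definition rho_min ::
  "real \<Rightarrow> real \<Rightarrow> real \<Rightarrow> (real \<Rightarrow> real) \<Rightarrow> (real \<Rightarrow> real \<Rightarrow> real) \<Rightarrow> (real \<Rightarrow> real \<Rightarrow> real) \<Rightarrow> real" where
  "rho_min \<eta> b vbar \<rho>0 \<rho> \<rho>bar = (INF x\<in>{alpha \<eta> b vbar \<rho> 0..b}. min (\<rho>0 x) (\<rho>bar 0 x))"

end

(*
  Follow the characteristics X(t, xi) of the velocity V issued from labels xi in [b - eta, b]. The mass
  between two characteristics is conserved, so alpha(t) = X(t, alpha(0)), and beta(t) = X(t, b).
  Where there is mass, the marker is constant along characteristics (compare the conserved integrals of rho
  and of omega rho), hence so is the equilibrium density P(xi). In the variable xi,

    L(t) = integral of rho0(xi) (r - P)^2 / r,   r(t, xi) = rho(t, X(t, xi)),   r' = - r V_x.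

  If (r - P) V_x >= - v'max w(beta - alpha) (r - P)^2, then (r - P)^2 / r decays at the asserted rate.
  For a constant kernel V_x = (vbar - v(r, omega)) / eta and the inequality is immediate. For a
  concave kernel it follows once vbar - v has a sign and is monotone between x and the boundary; both
  properties are propagated by the equation for r.

  When the support of rho0 ends at k < b, there is vacuum on [X(t, k), beta(t)], rho_min is zero, and it
  remains to see that the integral of P^2 over this interval does not increase: the marker is at least vbar
  there, so characteristics contract, and the marker does not increase along them.
*)
theory Submission
  imports Defs
begin

section \<open>Lebesgue points and weak derivatives\<close>

text \<open>The marker is only bounded, measurable and continuous in time in the L1 sense. Hence
  \<open>V\<close> is merely Lipschitz in x and \<open>V_x\<close> exists only almost everywhere,
  whereas the density is C1. Three devices bridge the gap. The flux \<open>\<rho> V\<close> is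
  differentiable in x everywhere, because its weak derivative is the continuous function
  \<open>- rt\<close>; so \<open>r\<close> can be followed along every characteristic. The Jacobian
  of the flow in the labels is read off from the conserved mass as \<open>\<rho>0 / r\<close>, not
  from the equation of the flow. And what holds off a null set depending on time is either collected
  at countably many times or stated between continuous functions, and then extended by continuity.
  Since the marker solves only a weak equation, it is tested with intervals carried by the flow
  instead of being followed pointwise. In vacuum the mass carries no information: for a constant
  kernel the mean of the marker over such intervals decreases, which gives an inequality; for a
  concave kernel the marker is constant near the boundary, and a Gronwall argument keeps it
  so.\<close>

lemmas integral_split = Henstock_Kurzweil_Integration.integral_combine

lemma absolutely_integrable_abs_diff:
  fixes f :: "real \<Rightarrow> real"
  assumes "f absolutely_integrable_on {a..b}"
  shows "(\<lambda>y. \<bar>f y - q\<bar>) absolutely_integrable_on {a..b}"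
proof -
  have "(\<lambda>y. q) absolutely_integrable_on {a..b}"
    by (rule absolutely_integrable_on_const) simp
  from absolutely_integrable_norm[OF set_integral_diff(1)[OF assms this]]
  show ?thesis by (simp add: o_def)
qed

text \<open>Apply the differentiation theorem to \<open>\<bar>f y - q\<bar>\<close> for each
  rational \<open>q\<close> and collect the countably many null sets; at any other point choose
  \<open>q\<close> close to \<open>f x\<close>. The theorem averages over intervals to the right of
  \<open>x\<close>, so the left half of the symmetric interval comes from the reflected
  function.\<close>

lemma lebesgue_points:
  fixes f :: "real \<Rightarrow> real"
  assumes f: "\<And>a b. f absolutely_integrable_on {a..b}"
  obtains N where "negligible N"
    "\<And>x e. \<lbrakk>x \<notin> N; 0 < e\<rbrakk> \<Longrightarrow>
       \<exists>d>0. \<forall>h. 0 < h \<and> h < d \<longrightarrow> integral {x - h..x + h} (\<lambda>y. \<bar>f y - f x\<bar>) < e * h"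
proof -
  have dev: "(\<lambda>y. \<bar>f y - q\<bar>) absolutely_integrable_on {a..b}" for q a b
    by (intro absolutely_integrable_abs_diff f)
  then have int: "(\<lambda>y. \<bar>f y - q\<bar>) integrable_on {a..b}" for q a b
    using absolutely_integrable_on_def by blast
  have right: "\<exists>N. negligible N \<and> (\<forall>x e. x \<notin> N \<and> 0 < e \<longrightarrow>
      (\<exists>d>0. \<forall>h. 0 < h \<and> h < d \<longrightarrow> \<bar>integral {x..x + h} g / h - g x\<bar> < e))"
    if g: "\<And>a b. g integrable_on {a..b}" for g :: "real \<Rightarrow> real"
  proof -
    obtain N where "negligible N" "\<And>x e. \<lbrakk>x \<notin> N; 0 < e\<rbrakk> \<Longrightarrow>
               \<exists>d>0. \<forall>h. 0 < h \<and> h < d \<longrightarrow>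
                         norm(integral (cbox x (x + h *\<^sub>R One)) g /\<^sub>R h ^ DIM(real) - g x) < e"
      using integrable_ccontinuous_explicit[of g] g by (metis interval_cbox)
    then show ?thesis by (intro exI[of _ N]) (auto simp: divide_inverse mult.commute)
  qed
  have "\<exists>N. negligible N \<and> (\<forall>x e. x \<notin> N \<and> 0 < e \<longrightarrow>
      (\<exists>d>0. \<forall>h. 0 < h \<and> h < d \<longrightarrow> \<bar>integral {x..x + h} (\<lambda>y. \<bar>f y - q\<bar>) / h - \<bar>f x - q\<bar>\<bar> < e))" for q
    using right[OF int] by blast
  then obtain N1 where N1: "\<And>q. negligible (N1 q)" "\<And>q x e. \<lbrakk>x \<notin> N1 q; 0 < e\<rbrakk> \<Longrightarrow>
      (\<exists>d>0. \<forall>h. 0 < h \<and> h < d \<longrightarrow> \<bar>integral {x..x + h} (\<lambda>y. \<bar>f y - q\<bar>) / h - \<bar>f x - q\<bar>\<bar> < e)"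
    by metis
  have neg: "((\<lambda>y. \<bar>f (- y) - q\<bar>) has_integral i) {a..b} \<longleftrightarrow> ((\<lambda>y. \<bar>f y - q\<bar>) has_integral i) {-b..-a}" for q a b i
    using has_integral_reflect_real[of "\<lambda>y. \<bar>f y - q\<bar>" i "-a" "-b"] by simp
  have "(\<lambda>y. \<bar>f (- y) - q\<bar>) integrable_on {a..b}" for q a b
    using neg int[of q "-b" "-a"] unfolding integrable_on_def by blast
  from right[OF this]
  have "\<exists>N. negligible N \<and> (\<forall>x e. x \<notin> N \<and> 0 < e \<longrightarrow>
      (\<exists>d>0. \<forall>h. 0 < h \<and> h < d \<longrightarrow> \<bar>integral {x..x + h} (\<lambda>y. \<bar>f (-y) - q\<bar>) / h - \<bar>f (-x) - q\<bar>\<bar> < e))" for q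
    by blast
  then obtain N2 where N2: "\<And>q. negligible (N2 q)" "\<And>q x e. \<lbrakk>x \<notin> N2 q; 0 < e\<rbrakk> \<Longrightarrow>
      (\<exists>d>0. \<forall>h. 0 < h \<and> h < d \<longrightarrow> \<bar>integral {x..x + h} (\<lambda>y. \<bar>f (-y) - q\<bar>) / h - \<bar>f (-x) - q\<bar>\<bar> < e)"
    by metis
  define N where "N = (\<Union>q\<in>\<rat>. N1 q \<union> uminus ` N2 q)"
  show ?thesis
  proof (rule that[of N])
    show "negligible N" unfolding N_def
    proof (rule negligible_countable_Union)
      show "countable ((\<lambda>q. N1 q \<union> uminus ` N2 q) ` \<rat>)" by (intro countable_image countable_rat)
      fix S assume "S \<in> (\<lambda>q. N1 q \<union> uminus ` N2 q) ` \<rat>"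
      then show "negligible S"
        using N1(1) N2(1) negligible_differentiable_image_negligible[of _ uminus]
        by (auto intro!: negligible_differentiable_image_negligible derivative_intros simp: differentiable_on_def)
    qed
    fix x e :: real assume x: "x \<notin> N" and e: "0 < e"
    \<comment> \<open>Each half of the interval will contribute less than \<open>e/4\<close>, and
      replacing \<open>q\<close> by \<open>f x\<close> costs another \<open>e/4\<close>.\<close>
    obtain q where q: "q \<in> \<rat>" "\<bar>f x - q\<bar> < e/8"
      using Rats_dense_in_real[of "f x - e/8" "f x + e/8"] e by (auto simp: abs_if)
    have "x \<notin> N1 q" using x q unfolding N_def by blast
    then obtain d1 where d1: "d1 > 0" "\<And>h. 0 < h \<Longrightarrow> h < d1 \<Longrightarrow> \<bar>integral {x..x + h} (\<lambda>y. \<bar>f y - q\<bar>) / h - \<bar>f x - q\<bar>\<bar> < e/8"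
      using N1(2)[of x q "e/8"] e by auto
    have "- x \<notin> N2 q"
    proof
      assume "-x \<in> N2 q"
      then have "x \<in> uminus ` N2 q" by force
      then show False using x q unfolding N_def by blast
    qed
    then obtain d2 where d2: "d2 > 0" "\<And>h. 0 < h \<Longrightarrow> h < d2 \<Longrightarrow> \<bar>integral {-x..-x + h} (\<lambda>y. \<bar>f (-y) - q\<bar>) / h - \<bar>f x - q\<bar>\<bar> < e/8"
      using N2(2)[of "-x" q "e/8"] e by auto
    show "\<exists>d>0. \<forall>h. 0 < h \<and> h < d \<longrightarrow> integral {x - h..x + h} (\<lambda>y. \<bar>f y - f x\<bar>) < e * h"
    proof (intro exI[of _ "min d1 d2"] conjI allI impI)
      fix h assume h: "0 < h \<and> h < min d1 d2"
      have "integral {-x..-x + h} (\<lambda>y. \<bar>f (-y) - q\<bar>) = integral {x - h..x} (\<lambda>y. \<bar>f y - q\<bar>)"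
        using neg[of q _ "-x" "-x+h"] int[of q "x-h" "x"] by (intro integral_unique) (simp add: integrable_integral)
      then have "\<bar>integral {x - h..x} (\<lambda>y. \<bar>f y - q\<bar>) / h - \<bar>f x - q\<bar>\<bar> < e/8"
        "\<bar>integral {x..x + h} (\<lambda>y. \<bar>f y - q\<bar>) / h - \<bar>f x - q\<bar>\<bar> < e/8"
        using d1(2)[of h] d2(2)[of h] h by auto
      then have "integral {x - h..x} (\<lambda>y. \<bar>f y - q\<bar>) / h < e/4"
        "integral {x..x + h} (\<lambda>y. \<bar>f y - q\<bar>) / h < e/4" using q(2) by linarith+
      then have *: "integral {x - h..x} (\<lambda>y. \<bar>f y - q\<bar>) < e/4 * h"
        "integral {x..x + h} (\<lambda>y. \<bar>f y - q\<bar>) < e/4 * h" using h by (auto simp: divide_simps)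
      have "integral {x - h..x + h} (\<lambda>y. \<bar>f y - f x\<bar>) \<le> integral {x - h..x + h} (\<lambda>y. \<bar>f y - q\<bar> + \<bar>f x - q\<bar>)"
        by (intro integral_le int integrable_add) auto
      also have "\<dots> = integral {x - h..x + h} (\<lambda>y. \<bar>f y - q\<bar>) + 2 * h * \<bar>f x - q\<bar>"
        using h by (subst integral_add) (auto intro: int)
      also have "integral {x - h..x + h} (\<lambda>y. \<bar>f y - q\<bar>) = integral {x - h..x} (\<lambda>y. \<bar>f y - q\<bar>) + integral {x..x + h} (\<lambda>y. \<bar>f y - q\<bar>)"
        using h by (intro integral_split[symmetric] int) auto
      also have "2 * h * \<bar>f x - q\<bar> \<le> 2 * h * (e/8)" using h q(2) by (intro mult_left_mono) auto
      finally have "integral {x - h..x + h} (\<lambda>y. \<bar>f y - f x\<bar>) \<le> integral {x - h..x} (\<lambda>y. \<bar>f y - q\<bar>) + integral {x..x + h} (\<lambda>y. \<bar>f y - q\<bar>) + 2 * h * (e/8)" by simp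
      also have "\<dots> < e/4 * h + e/4 * h + 2 * h * (e/8)" using * by linarith
      also have "\<dots> \<le> e * h" using h e by (simp add: field_simps)
      finally show "integral {x - h..x + h} (\<lambda>y. \<bar>f y - f x\<bar>) < e * h" .
    qed (use d1 d2 in auto)
  qed
qed

text \<open>The error of the difference quotient is controlled by the integral of
  \<open>\<bar>f y - f x\<bar>\<close> over the symmetric interval of radius
  \<open>\<bar>y - x\<bar>\<close>, which serves both signs of \<open>y - x\<close>.\<close>

lemma DERIV_indefinite_integral_lebesgue_point:
  fixes f :: "real \<Rightarrow> real"
  assumes f: "\<And>a b. f absolutely_integrable_on {a..b}" and "c < x"
    and L: "\<And>e. 0 < e \<Longrightarrow> \<exists>d>0. \<forall>h. 0 < h \<and> h < d \<longrightarrow> integral {x - h..x + h} (\<lambda>y. \<bar>f y - f x\<bar>) < e * h"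
  shows "((\<lambda>y. integral {c..y} f) has_real_derivative f x) (at x)"
  unfolding has_field_derivative_def has_derivative_at_within
proof (intro conjI bounded_linear_mult_right tendstoI)
  have int: "f integrable_on {a..b}" for a b
    using f set_lebesgue_integral_eq_integral(1) by blast
  have aint: "(\<lambda>y. \<bar>f y - q\<bar>) absolutely_integrable_on {a..b}" for q a b
    by (intro absolutely_integrable_abs_diff f)
  fix e :: real assume e: "0 < e"
  obtain d where d: "d > 0" "\<And>h. 0 < h \<Longrightarrow> h < d \<Longrightarrow> integral {x - h..x + h} (\<lambda>y. \<bar>f y - f x\<bar>) < e * h"
    using L[OF e] by auto
  have D: "\<forall>\<^sub>F y in at x. y \<noteq> x \<and> dist y x < min d (x - c)"
    unfolding eventually_at using d(1) assms(2) by (intro exI[of _ "min d (x - c)"]) auto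
  then show "\<forall>\<^sub>F y in at x. dist ((integral {c..y} f - integral {c..x} f - f x * (y - x)) /\<^sub>R norm (y - x)) 0 < e"
  proof (rule eventually_mono, goal_cases)
    case elim: (1 y)
    define h where "h = \<bar>y - x\<bar>"
    have h: "0 < h" "h < d" "c < y" using elim assms(2) by (auto simp: h_def dist_real_def)
    have *: "\<bar>integral {c..y} f - integral {c..x} f - f x * (y - x)\<bar> \<le> integral {x - h..x + h} (\<lambda>y. \<bar>f y - f x\<bar>)"
    proof -
      have main: "\<bar>integral {p..q} f - f x * (q - p)\<bar> \<le> integral {x - h..x + h} (\<lambda>y. \<bar>f y - f x\<bar>)"
        if "p \<le> q" "x - h \<le> p" "q \<le> x + h" for p q
      proof -
        have "integral {p..q} f - f x * (q - p) = integral {p..q} (\<lambda>y. f y - f x)"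
          using that by (subst integral_diff) (auto intro: int)
        also have "\<bar>\<dots>\<bar> \<le> integral {p..q} (\<lambda>y. \<bar>f y - f x\<bar>)"
          using aint[where q="f x" and a=p and b=q]
          by (intro integral_norm_bound_integral[where 'a=real, simplified real_norm_def])
             (auto intro: int integrable_diff set_lebesgue_integral_eq_integral)
        also have "\<dots> \<le> integral {x - h..x + h} (\<lambda>y. \<bar>f y - f x\<bar>)"
          using that aint by (intro integral_subset_le) (auto intro: set_lebesgue_integral_eq_integral)
        finally show ?thesis .
      qed
      show ?thesis
      proof (cases "x \<le> y")
        case True
        have "integral {c..x} f + integral {x..y} f = integral {c..y} f"
          using True assms(2) by (intro integral_split int) auto
        then show ?thesis using main[of x y] True by (simp add: h_def algebra_simps)
      next
        case False
        have "integral {c..y} f + integral {y..x} f = integral {c..x} f"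
          using False h by (intro integral_split int) auto
        then show ?thesis using main[of y x] False by (simp add: h_def algebra_simps)
      qed
    qed
    have "\<dots> < e * h" using d h by auto
    with * have "\<bar>integral {c..y} f - integral {c..x} f - f x * (y - x)\<bar> < e * h" by simp
    then show ?case using h by (simp add: h_def divide_simps mult.commute)
  qed
qed

section \<open>Smooth steps and weak derivatives in one variable\<close>

text \<open>A continuously differentiable step, assembled from shifted copies of the squared positive part.\<close>

definition sstep :: "real \<Rightarrow> real" where
  "sstep x = 2 * ((max 0 x)\<^sup>2 - 2 * (max 0 (x - 1/2))\<^sup>2 + (max 0 (x - 1))\<^sup>2)"

definition sstep' :: "real \<Rightarrow> real" where
  "sstep' x = 4 * (max 0 x - 2 * max 0 (x - 1/2) + max 0 (x - 1))"

lemma DERIV_max0_square: "((\<lambda>x::real. (max 0 x)\<^sup>2) has_real_derivative 2 * max 0 x) (at x)"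
proof -
  consider "x < 0" | "x = 0" | "x > 0" by linarith
  then show ?thesis
  proof cases
    case 1
    have "((\<lambda>x::real. 0) has_real_derivative 2 * max 0 x) (at x)" using 1 by (simp add: max_def)
    then show ?thesis
      by (rule has_field_derivative_transform_within_open[where S="{..<0}"]) (use 1 in auto)
  next
    case 3
    have "((\<lambda>x::real. x\<^sup>2) has_real_derivative 2 * max 0 x) (at x)" using 3 by (auto intro!: derivative_eq_intros)
    then show ?thesis
      by (rule has_field_derivative_transform_within_open[where S="{0<..}"]) (use 3 in auto)
  next
    case 2
    have "((\<lambda>h. ((max 0 (0 + h))\<^sup>2 - (max 0 0)\<^sup>2) / h) \<longlongrightarrow> 0) (at (0::real))"
    proof (rule Lim_null_comparison)
      show "\<forall>\<^sub>F h in at 0. norm (((max 0 (0 + h))\<^sup>2 - (max 0 0)\<^sup>2) / h) \<le> \<bar>h::real\<bar>"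
        by (intro always_eventually allI) (auto simp: max_def power2_eq_square)
      show "((\<lambda>h. \<bar>h::real\<bar>) \<longlongrightarrow> 0) (at 0)" by (intro tendsto_rabs_zero tendsto_ident_at)
    qed
    then show ?thesis unfolding 2 DERIV_def by simp
  qed
qed

lemma DERIV_sstep: "(sstep has_real_derivative sstep' x) (at x)"
proof -
  have shift: "((\<lambda>x. (max 0 (x - c))\<^sup>2) has_real_derivative 2 * max 0 (x - c)) (at x)" for c
    using DERIV_shift[of "\<lambda>x. (max 0 x)\<^sup>2" "2 * max 0 (x - c)" x "-c"] DERIV_max0_square[of "x - c"] by simp
  have "((\<lambda>x. 2 * ((max 0 x)\<^sup>2 - 2 * (max 0 (x - 1/2))\<^sup>2 + (max 0 (x - 1))\<^sup>2)) has_real_derivative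
     2 * (2 * max 0 x - 2 * (2 * max 0 (x - 1/2)) + 2 * max 0 (x - 1))) (at x)"
    by (intro DERIV_cmult DERIV_add DERIV_diff shift DERIV_max0_square)
  then show ?thesis by (simp add: sstep_def[abs_def] sstep'_def algebra_simps)
qed

lemma continuous_sstep'[continuous_intros]: "continuous_on S g \<Longrightarrow> continuous_on S (\<lambda>x. sstep' (g x))"
  unfolding sstep'_def by (intro continuous_intros)

lemma continuous_sstep[continuous_intros]: "continuous_on S g \<Longrightarrow> continuous_on S (\<lambda>x. sstep (g x))"
  unfolding sstep_def by (intro continuous_intros)

lemma sstep_eq_0: "x \<le> 0 \<Longrightarrow> sstep x = 0" by (simp add: sstep_def max_def)
lemma sstep_eq_1: "1 \<le> x \<Longrightarrow> sstep x = 1" by (auto simp: sstep_def max_def power2_eq_square algebra_simps)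
lemma sstep'_eq_0: "x \<le> 0 \<or> 1 \<le> x \<Longrightarrow> sstep' x = 0" by (auto simp: sstep'_def max_def)
lemma sstep'_bounds: "0 \<le> sstep' x" "sstep' x \<le> 2" by (auto simp: sstep'_def max_def)

lemma sstep_mono: "x \<le> y \<Longrightarrow> sstep x \<le> sstep y"
  using DERIV_nonneg_imp_nondecreasing[of x y sstep] DERIV_sstep sstep'_bounds by blast

lemma sstep_bounds: "0 \<le> sstep x" "sstep x \<le> 1"
  using sstep_mono[of "min 0 x" x] sstep_mono[of x "max 1 x"] sstep_eq_0[of "min 0 x"] sstep_eq_1[of "max 1 x"] by auto

lemma DERIV_sstep_scaled: "0 < e \<Longrightarrow> ((\<lambda>x. sstep ((x - s) / e)) has_real_derivative sstep' ((x - s) / e) / e) (at x)"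
proof -
  have "((\<lambda>x. (x - s) / e) has_real_derivative 1 / e) (at x)"
    by (rule DERIV_cdivide) (auto intro!: derivative_eq_intros)
  from DERIV_chain2[OF DERIV_sstep this] show ?thesis by simp
qed

lemma integral_sstep'_scaled: "0 < e \<Longrightarrow> ((\<lambda>x. sstep' ((x - s) / e) / e) has_integral 1) {s..s + e}"
  using fundamental_theorem_of_calculus[of s "s + e" "\<lambda>x. sstep ((x - s) / e)" "\<lambda>x. sstep' ((x - s) / e) / e"]
    DERIV_sstep_scaled[of e s] sstep_eq_0[of 0] sstep_eq_1[of 1]
  by (auto simp: has_real_derivative_iff_has_vector_derivative intro: has_vector_derivative_at_within)

lemma absolutely_integrable_mult_continuous:
  fixes f g :: "real \<Rightarrow> real"
  assumes "f absolutely_integrable_on {a..b}" "continuous_on {a..b} g"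
  shows "(\<lambda>x. f x * g x) absolutely_integrable_on {a..b}"
proof -
  have "bounded (g ` {a..b})" using assms(2) by (simp add: compact_continuous_image compact_imp_bounded)
  moreover have "g \<in> borel_measurable (lebesgue_on {a..b})"
    using assms(2) by (simp add: continuous_imp_measurable_on_sets_lebesgue)
  ultimately show ?thesis
    using absolutely_integrable_bounded_measurable_product_real[of g "{a..b}" f] assms(1) by (simp add: mult.commute)
qed

lemma absolutely_integrable_imp_integrable:
  fixes f :: "real \<Rightarrow> real"
  shows "f absolutely_integrable_on S \<Longrightarrow> f integrable_on S"
  using set_lebesgue_integral_eq_integral(1) by blast

lemma integral_eq_on_support:
  fixes f :: "real \<Rightarrow> real"
  assumes "T \<subseteq> S" "\<And>x. x \<in> S - T \<Longrightarrow> f x = 0"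
  shows "integral S f = integral T f"
proof -
  have "(\<lambda>x. if x \<in> S then f x else 0) = (\<lambda>x. if x \<in> T then f x else 0)" using assms by fastforce
  then show ?thesis
    using Henstock_Kurzweil_Integration.integral_restrict_UNIV[of S f] Henstock_Kurzweil_Integration.integral_restrict_UNIV[of T f] by simp
qed

text \<open>The kernel has mass one, lives on \<open>{s..s + e}\<close> and is at most
  \<open>2 / e\<close>. So the error is at most \<open>2 / e\<close> times the integral of
  \<open>\<bar>g x - g s\<bar>\<close> over an interval of length \<open>e\<close>, which tends to
  zero at a Lebesgue point; the tolerance \<open>r/2\<close> absorbs the factor 2.\<close>

lemma sstep'_approx_identity:
  fixes g :: "real \<Rightarrow> real"
  assumes g: "g absolutely_integrable_on {p..q}" and "p < s" "s < q"
    and L: "\<And>e. 0 < e \<Longrightarrow> \<exists>d>0. \<forall>h. 0 < h \<and> h < d \<longrightarrow> integral {s - h..s + h} (\<lambda>y. \<bar>g y - g s\<bar>) < e * h"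
  shows "((\<lambda>e. integral {p..q} (\<lambda>x. g x * (sstep' ((x - s) / e) / e))) \<longlongrightarrow> g s) (at_right 0)"
proof (rule tendstoI)
  fix r :: real assume "r > 0"
  then obtain d where d: "d > 0" "\<And>h. 0 < h \<Longrightarrow> h < d \<Longrightarrow> integral {s - h..s + h} (\<lambda>y. \<bar>g y - g s\<bar>) < r/2 * h"
    using L[of "r/2"] by auto
  have "\<forall>\<^sub>F e in at_right 0. 0 < e \<and> e < min d (min (s - p) (q - s))"
    using d(1) assms(2,3) by (auto simp: eventually_at_right_field intro!: exI[of _ "min d (min (s - p) (q - s))"])
  then show "\<forall>\<^sub>F e in at_right 0. dist (integral {p..q} (\<lambda>x. g x * (sstep' ((x - s) / e) / e))) (g s) < r"
  proof (rule eventually_mono, goal_cases)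
    case (1 e)
    then have e: "0 < e" "e < d" "p \<le> s - e" "s + e \<le> q" by auto
    let ?k = "\<lambda>x. sstep' ((x - s) / e) / e"
    have sub: "g absolutely_integrable_on {s..s + e}" "g absolutely_integrable_on {s - e..s + e}"
      using g e by (auto intro: absolutely_integrable_on_subinterval)
    have k0: "?k x = 0" if "x \<notin> {s..s + e}" for x using that e by (auto simp: sstep'_eq_0 divide_simps)
    have cont: "continuous_on {s..s + e} ?k" using e by (intro continuous_intros) auto
    have kk: "0 \<le> ?k x" "?k x \<le> 2 / e" for x using e sstep'_bounds by (auto intro!: divide_right_mono)
    have int1: "(\<lambda>x. g x * ?k x) integrable_on {s..s + e}"
      by (intro absolutely_integrable_imp_integrable absolutely_integrable_mult_continuous sub cont)
    have int2: "(\<lambda>x. g s * ?k x) integrable_on {s..s + e}"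
      by (intro integrable_continuous_interval continuous_intros cont) (use e in auto)
    have int3: "(\<lambda>y. \<bar>g y - g s\<bar>) integrable_on {s..s + e}" "(\<lambda>y. \<bar>g y - g s\<bar>) integrable_on {s - e..s + e}"
      using sub by (auto intro!: absolutely_integrable_imp_integrable absolutely_integrable_abs_diff)
    have "integral {p..q} (\<lambda>x. g x * ?k x) = integral {s..s + e} (\<lambda>x. g x * ?k x)"
      using e k0 by (intro integral_eq_on_support) auto
    moreover have "integral {s..s + e} (\<lambda>x. g s * ?k x) = g s"
      using integral_unique[OF has_integral_mult_right[OF integral_sstep'_scaled[OF e(1), of s], of "g s"]] by simp
    ultimately have D: "integral {p..q} (\<lambda>x. g x * ?k x) - g s = integral {s..s + e} (\<lambda>x. g x * ?k x - g s * ?k x)"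
      using int1 int2 by (simp add: integral_diff)
    have "\<bar>integral {p..q} (\<lambda>x. g x * ?k x) - g s\<bar> \<le> integral {s..s + e} (\<lambda>x. 2 / e * \<bar>g x - g s\<bar>)"
      unfolding D
    proof (intro integral_norm_bound_integral[where 'a=real, simplified real_norm_def])
      fix x
      have "\<bar>g x * ?k x - g s * ?k x\<bar> = \<bar>g x - g s\<bar> * ?k x" using kk(1)[of x] by (metis abs_mult abs_of_nonneg left_diff_distrib)
      also have "\<dots> \<le> \<bar>g x - g s\<bar> * (2 / e)" using kk(2)[of x] by (intro mult_left_mono) auto
      finally show "\<bar>g x * ?k x - g s * ?k x\<bar> \<le> 2 / e * \<bar>g x - g s\<bar>" by (simp add: mult.commute)
    qed (intro integrable_diff int1 int2 integrable_on_mult_right int3)+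
    also have "\<dots> < r"
    proof -
      have "integral {s..s + e} (\<lambda>x. \<bar>g x - g s\<bar>) \<le> integral {s - e..s + e} (\<lambda>x. \<bar>g x - g s\<bar>)"
        using e int3 by (intro integral_subset_le) auto
      also have "\<dots> < r / 2 * e" using d(2)[of e] e by auto
      finally show ?thesis using e by (simp add: divide_simps mult.commute)
    qed
    finally show ?case by (simp add: dist_real_def)
  qed
qed

text \<open>Du Bois-Reymond's lemma, evaluated at given end points. The test function is a trapezoid
  rising at \<open>s\<close> and falling at \<open>t\<close>: its derivative reproduces
  \<open>g s - g t\<close> in the limit, and the function itself tends to the indicator of the
  interval. Supports strictly inside \<open>{p..q}\<close> let the lemma serve in space as well as
  in time, where test functions have to stay away from time zero.\<close>

lemma weak_derivative_increment:
  fixes g h :: "real \<Rightarrow> real"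
  assumes g: "g absolutely_integrable_on {p..q}" and h: "h absolutely_integrable_on {p..q}"
    and weak: "\<And>\<psi> \<psi>'. \<lbrakk>\<And>x. (\<psi> has_real_derivative \<psi>' x) (at x); continuous_on UNIV \<psi>';
        \<exists>p' q'. p < p' \<and> q' < q \<and> (\<forall>x. x \<notin> {p'..q'} \<longrightarrow> \<psi> x = 0 \<and> \<psi>' x = 0)\<rbrakk>
        \<Longrightarrow> integral {p..q} (\<lambda>x. g x * \<psi>' x + h x * \<psi> x) = 0"
    and st: "p < s" "s \<le> t" "t < q"
    and L: "\<And>x e. x = s \<or> x = t \<Longrightarrow> 0 < e \<Longrightarrow>
       \<exists>d>0. \<forall>h. 0 < h \<and> h < d \<longrightarrow> integral {x - h..x + h} (\<lambda>y. \<bar>g y - g x\<bar>) < e * h"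
  shows "g t - g s = integral {s..t} h"
proof -
  let ?k = "\<lambda>s e x. sstep' ((x - s) / e) / e"
  let ?\<psi> = "\<lambda>e x. sstep ((x - s) / e) - sstep ((x - t) / e)"
  have 1: "((\<lambda>e. integral {p..q} (\<lambda>x. g x * ?k s e x) - integral {p..q} (\<lambda>x. g x * ?k t e x)) \<longlongrightarrow> g s - g t) (at_right 0)"
    by (intro tendsto_diff sstep'_approx_identity g L) (use st in auto)
  have \<psi>b: "\<bar>?\<psi> e x\<bar> \<le> 1" for e x using sstep_bounds[of "(x - s)/e"] sstep_bounds[of "(x - t)/e"] by linarith
  have \<psi>c: "continuous_on S (?\<psi> e)" if "0 < e" for e S using that by (intro continuous_intros) auto
  have 2: "((\<lambda>e. integral {p..q} (\<lambda>x. h x * ?\<psi> e x)) \<longlongrightarrow> integral {s..t} h) (at_right 0)"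
  proof (rule tendsto_at_right_sequentially[of 0 1])
    fix S :: "nat \<Rightarrow> real" assume S: "\<And>n. 0 < S n" "\<And>n. S n < 1" "decseq S" "S \<longlonglongrightarrow> 0"
    have "(\<lambda>n. integral {p..q} (\<lambda>x. h x * ?\<psi> (S n) x)) \<longlonglongrightarrow> integral {p..q} (\<lambda>x. if x \<in> {s<..t} then h x else 0)"
    proof (rule dominated_convergence(2)[where h="\<lambda>x. \<bar>h x\<bar>"])
      show "(\<lambda>x. h x * ?\<psi> (S n) x) integrable_on {p..q}" for n
        by (intro absolutely_integrable_imp_integrable absolutely_integrable_mult_continuous h \<psi>c S)
      show "(\<lambda>x. \<bar>h x\<bar>) integrable_on {p..q}"
        using absolutely_integrable_imp_integrable[OF absolutely_integrable_abs_diff[OF h, of 0]] by simp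
      show "norm (h x * ?\<psi> (S n) x) \<le> \<bar>h x\<bar>" for n x
        using mult_left_mono[OF \<psi>b[where e="S n" and x=x], of "\<bar>h x\<bar>"] by (simp add: abs_mult)
      fix x
      \<comment> \<open>The step vanishes at its left end, so the limit is the indicator of a
        half-open interval.\<close>
      have one: "(\<lambda>n. sstep ((x - r) / S n)) \<longlonglongrightarrow> (if x \<le> r then 0 else 1)" for r
      proof (cases "x \<le> r")
        case True
        then have "sstep ((x - r) / S n) = 0" for n using S(1)[of n] by (intro sstep_eq_0) (auto simp: divide_le_0_iff)
        then show ?thesis using True by simp
      next
        case False
        have "\<forall>\<^sub>F n in sequentially. S n < x - r" using False S(4) by (intro order_tendstoD(2)[of S 0]) auto
        then have "\<forall>\<^sub>F n in sequentially. sstep ((x - r) / S n) = 1"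
        proof eventually_elim
          case (elim n) then show ?case using S(1)[of n] by (intro sstep_eq_1) (simp add: le_divide_eq)
        qed
        then show ?thesis using False by (simp add: tendsto_eventually)
      qed
      have "(\<lambda>n. h x * ?\<psi> (S n) x) \<longlonglongrightarrow> h x * ((if x \<le> s then 0 else 1) - (if x \<le> t then 0 else 1))"
        by (intro tendsto_mult tendsto_const tendsto_diff one)
      then show "(\<lambda>n. h x * ?\<psi> (S n) x) \<longlonglongrightarrow> (if x \<in> {s<..t} then h x else 0)"
        using st by (auto split: if_splits)
    qed
    also have "integral {p..q} (\<lambda>x. if x \<in> {s<..t} then h x else 0) = integral {s<..t} h"
      using st by (subst Henstock_Kurzweil_Integration.integral_restrict_Int) (auto intro!: arg_cong[where f="\<lambda>S. integral S h"])
    also have "\<dots> = integral {s..t} h"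
      by (rule integral_subset_negligible) (auto intro: negligible_subset[of "{s}"])
    finally show "(\<lambda>n. integral {p..q} (\<lambda>x. h x * ?\<psi> (S n) x)) \<longlonglongrightarrow> integral {s..t} h" .
  qed simp
  have 3: "\<forall>\<^sub>F e in at_right 0. integral {p..q} (\<lambda>x. g x * ?k s e x) - integral {p..q} (\<lambda>x. g x * ?k t e x)
      + integral {p..q} (\<lambda>x. h x * ?\<psi> e x) = 0"
  proof -
    have "\<forall>\<^sub>F e in at_right 0. 0 < e \<and> e < q - t"
      using st by (auto simp: eventually_at_right_field intro!: exI[of _ "q - t"])
    then show ?thesis
    proof (rule eventually_mono, goal_cases)
      case (1 e)
      then have e: "0 < e" "t + e < q" by auto
      have "integral {p..q} (\<lambda>x. g x * (?k s e x - ?k t e x) + h x * ?\<psi> e x) = 0"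
      proof (rule weak)
        show "(?\<psi> e has_real_derivative ?k s e x - ?k t e x) (at x)" for x
          by (intro DERIV_diff DERIV_sstep_scaled e)
        show "continuous_on UNIV (\<lambda>x. ?k s e x - ?k t e x)" using e by (intro continuous_intros) auto
        have "?\<psi> e x = 0 \<and> ?k s e x - ?k t e x = 0" if "x \<notin> {s..t + e}" for x
        proof -
          have "x < s \<or> x > t + e" using that by auto
          then consider "x < s" | "x > t + e" by blast
          then show ?thesis
          proof cases
            case 1
            then have "(x - s)/e \<le> 0" "(x - t) / e \<le> 0" using e st by (auto simp: divide_le_0_iff)
            then show ?thesis by (simp add: sstep_eq_0 sstep'_eq_0)
          next
            case 2
            then have "1 \<le> (x - s)/e" "1 \<le> (x - t) / e" using e st by (auto simp: le_divide_eq)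
            then show ?thesis by (simp add: sstep_eq_1 sstep'_eq_0)
          qed
        qed
        then show "\<exists>p' q'. p < p' \<and> q' < q \<and> (\<forall>x. x \<notin> {p'..q'} \<longrightarrow> ?\<psi> e x = 0 \<and> ?k s e x - ?k t e x = 0)"
          using st e by blast
      qed
      moreover have "(\<lambda>x. g x * ?k r e x) integrable_on {p..q}" for r
        by (intro absolutely_integrable_imp_integrable absolutely_integrable_mult_continuous g continuous_intros) (use e in auto)
      moreover have "(\<lambda>x. h x * ?\<psi> e x) integrable_on {p..q}"
        by (intro absolutely_integrable_imp_integrable absolutely_integrable_mult_continuous h \<psi>c e)
      moreover have "(\<lambda>x. g x * (?k s e x - ?k t e x) + h x * ?\<psi> e x) = (\<lambda>x. (g x * ?k s e x - g x * ?k t e x) + h x * ?\<psi> e x)"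
        by (simp add: right_diff_distrib)
      ultimately show ?case by (simp add: integral_add integral_diff integrable_diff)
    qed
  qed
  have "((\<lambda>e. integral {p..q} (\<lambda>x. g x * ?k s e x) - integral {p..q} (\<lambda>x. g x * ?k t e x)
      + integral {p..q} (\<lambda>x. h x * ?\<psi> e x)) \<longlongrightarrow> (g s - g t) + integral {s..t} h) (at_right 0)"
    by (intro tendsto_add 1 2)
  moreover have "((\<lambda>e. integral {p..q} (\<lambda>x. g x * ?k s e x) - integral {p..q} (\<lambda>x. g x * ?k t e x)
      + integral {p..q} (\<lambda>x. h x * ?\<psi> e x)) \<longlongrightarrow> 0) (at_right 0)"
    using 3 by (rule tendsto_eventually)
  ultimately have "(g s - g t) + integral {s..t} h = 0"
    using tendsto_unique[OF trivial_limit_at_right_real] by blast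
  then show ?thesis by simp
qed

lemma continuous_lebesgue_point:
  fixes f :: "real \<Rightarrow> real"
  assumes "continuous_on {p..q} f" "p < x" "x < q" "0 < e"
  shows "\<exists>d>0. \<forall>h. 0 < h \<and> h < d \<longrightarrow> integral {x - h..x + h} (\<lambda>y. \<bar>f y - f x\<bar>) < e * h"
proof -
  obtain d where d: "d > 0" "\<And>y. y \<in> {p..q} \<Longrightarrow> dist y x < d \<Longrightarrow> dist (f y) (f x) < e / 4"
    using assms unfolding continuous_on_iff by (metis atLeastAtMost_iff less_eq_real_def zero_less_divide_iff zero_less_numeral)
  show ?thesis
  proof (intro exI[of _ "min d (min (x - p) (q - x))"] conjI allI impI)
    fix h assume h: "0 < h \<and> h < min d (min (x - p) (q - x))"
    have "integral {x - h..x + h} (\<lambda>y. \<bar>f y - f x\<bar>) \<le> integral {x - h..x + h} (\<lambda>y. e / 4)"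
    proof (intro integral_le)
      show "(\<lambda>y. \<bar>f y - f x\<bar>) integrable_on {x - h..x + h}"
        using h by (intro integrable_continuous_interval continuous_intros continuous_on_subset[OF assms(1)]) auto
      fix y assume "y \<in> {x - h..x + h}"
      then have "y \<in> {p..q}" "dist y x < d" using h by (auto simp: dist_real_def)
      from d(2)[OF this] show "\<bar>f y - f x\<bar> \<le> e / 4" by (simp add: dist_real_def)
    qed auto
    also have "\<dots> = e / 2 * h" using h by simp
    also have "\<dots> < e * h" using h assms(4) by simp
    finally show "integral {x - h..x + h} (\<lambda>y. \<bar>f y - f x\<bar>) < e * h" .
  qed (use d assms in auto)
qed

lemma integral_by_parts_indefinite:
  fixes f W W' :: "real \<Rightarrow> real"
  assumes f: "f absolutely_integrable_on {a..b}" and ab: "a \<le> b"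
    and W: "\<And>x. x \<in> {a..b} \<Longrightarrow> (W has_real_derivative W' x) (at x within {a..b})"
    and W': "continuous_on {a..b} W'"
  shows "integral {a..b} (\<lambda>x. W x * f x) = W b * integral {a..b} f - integral {a..b} (\<lambda>x. W' x * integral {a..x} f)"
proof -
  define F where "F x = integral {a..x} f" for x
  define G where "G x = integral {a..x} (\<lambda>x. \<bar>f x\<bar>)" for x
  have sub: "f absolutely_integrable_on {x..y}" if "a \<le> x" "y \<le> b" for x y
    using absolutely_integrable_on_subinterval[OF f] that by auto
  note int = absolutely_integrable_imp_integrable[OF sub]
  have iabs: "(\<lambda>x. \<bar>f x\<bar>) integrable_on {x..y}" if "a \<le> x" "y \<le> b" for x y
    using absolutely_integrable_imp_integrable[OF absolutely_integrable_abs_diff[OF sub[OF that], of 0]] by simp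
  have Fc: "continuous_on {a..b} F" unfolding F_def using int[of a b] by (intro indefinite_integral_continuous_1) auto
  have Gc: "continuous_on {a..b} G" unfolding G_def using iabs[of a b] by (intro indefinite_integral_continuous_1) auto
  have Wc: "continuous_on {a..b} W" using W by (meson DERIV_continuous continuous_on_eq_continuous_within)
  obtain C where C: "\<And>x. x \<in> {a..b} \<Longrightarrow> \<bar>W' x\<bar> \<le> C"
    using compact_imp_bounded[OF compact_continuous_image[OF W']] unfolding bounded_iff by force
  have iWf: "(\<lambda>x. W x * f x) integrable_on {x..y}" if "a \<le> x" "y \<le> b" for x y
    using absolutely_integrable_imp_integrable[OF absolutely_integrable_mult_continuous[OF sub[OF that] continuous_on_subset[OF Wc]]] that
    by (simp add: mult.commute)
  have iWF: "(\<lambda>x. W' x * F x) integrable_on {x..y}" if "a \<le> x" "y \<le> b" for x y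
    using that by (intro integrable_continuous_interval continuous_intros continuous_on_subset[OF Fc] continuous_on_subset[OF W']) auto
  define D where "D x = integral {a..x} (\<lambda>x. W x * f x) - W x * F x + integral {a..x} (\<lambda>x. W' x * F x)" for x
  have Wdiff: "integral {x..y} W' = W y - W x" if "a \<le> x" "x \<le> y" "y \<le> b" for x y
    using that by (intro integral_unique fundamental_theorem_of_calculus)
      (auto simp: has_real_derivative_iff_has_vector_derivative[symmetric] intro!: DERIV_subset[OF W])
  have Fdiff: "integral {x..y} f = F y - F x" "integral {x..y} (\<lambda>x. \<bar>f x\<bar>) = G y - G x"
     if "a \<le> x" "x \<le> y" "y \<le> b" for x y
    using integral_split[of a x y f] int[of a y]
      integral_split[of a x y "\<lambda>x. \<bar>f x\<bar>"] iabs[of a y] that by (auto simp: F_def G_def)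
  have Gmono: "0 \<le> G y - G x" if "a \<le> x" "x \<le> y" "y \<le> b" for x y
    using Fdiff(2)[OF that] integral_nonneg[OF iabs[of x y]] that by auto
  have Fb: "\<bar>F y - F x\<bar> \<le> G y - G x" if "a \<le> x" "x \<le> y" "y \<le> b" for x y
    using Fdiff[OF that] integral_norm_bound_integral[OF int[of x y] iabs[of x y]] that by auto
  have C0: "0 \<le> C" using C[of a] ab by force
  have key: "\<bar>D y - D x\<bar> \<le> 2 * C * (y - x) * (G y - G x)" if xy: "a \<le> x" "x \<le> y" "y \<le> b" for x y
  proof -
    \<comment> \<open>Subtracting the values at one end turns the defect into integrals of
      increments: of \<open>W\<close> against \<open>f\<close>, and of \<open>F\<close> against
      \<open>W'\<close>.\<close>
    have "D y - D x = integral {x..y} (\<lambda>z. W z * f z) - W x * integral {x..y} f - ((W y - W x) * F y - integral {x..y} (\<lambda>z. W' z * F z))"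
      using integral_split[of a x y "\<lambda>x. W x * f x"] iWf[of a y]
       integral_split[of a x y "\<lambda>x. W' x * F x"] iWF[of a y] xy
      by (simp add: D_def Fdiff[OF xy]) (simp add: algebra_simps)
    also have "integral {x..y} (\<lambda>z. W z * f z) - W x * integral {x..y} f = integral {x..y} (\<lambda>z. (W z - W x) * f z)"
      using iWf[of x y] integrable_on_mult_right[OF int[of x y], of "W x"] xy by (simp add: left_diff_distrib integral_diff)
    also have "(W y - W x) * F y - integral {x..y} (\<lambda>z. W' z * F z) = integral {x..y} (\<lambda>z. W' z * (F y - F z))"
    proof -
      have "W' integrable_on {x..y}" using xy by (intro integrable_continuous_interval continuous_on_subset[OF W']) auto
      then show ?thesis using Wdiff[OF xy] iWF[of x y] xy by (simp add: right_diff_distrib integral_diff integrable_on_mult_left)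
    qed
    finally have D: "D y - D x = integral {x..y} (\<lambda>z. (W z - W x) * f z) - integral {x..y} (\<lambda>z. W' z * (F y - F z))" .
    have "\<bar>integral {x..y} (\<lambda>z. (W z - W x) * f z)\<bar> \<le> integral {x..y} (\<lambda>z. C * (y - x) * \<bar>f z\<bar>)"
    proof (intro integral_norm_bound_integral[where 'a=real, simplified real_norm_def])
      show "(\<lambda>z. (W z - W x) * f z) integrable_on {x..y}"
        using iWf[of x y] integrable_on_mult_right[OF int[of x y], of "W x"] xy by (simp add: left_diff_distrib integrable_diff)
      show "(\<lambda>z. C * (y - x) * \<bar>f z\<bar>) integrable_on {x..y}" using iabs xy by (intro integrable_on_mult_right)
      fix z assume z: "z \<in> {x..y}"
      have "W' integrable_on {x..z}" using xy z by (intro integrable_continuous_interval continuous_on_subset[OF W']) auto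
      then have "\<bar>integral {x..z} W'\<bar> \<le> integral {x..z} (\<lambda>_. C)"
        using C xy z by (intro integral_norm_bound_integral[where 'a=real, simplified real_norm_def]) auto
      then have "\<bar>W z - W x\<bar> \<le> C * (z - x)" using Wdiff[of x z] xy z by (simp add: mult.commute)
      also have "\<dots> \<le> C * (y - x)" using z C0 by (intro mult_left_mono) auto
      finally show "\<bar>(W z - W x) * f z\<bar> \<le> C * (y - x) * \<bar>f z\<bar>" by (simp add: abs_mult mult_right_mono)
    qed
    then have 1: "\<bar>integral {x..y} (\<lambda>z. (W z - W x) * f z)\<bar> \<le> C * (y - x) * (G y - G x)" using Fdiff[OF xy] by simp
    have "\<bar>integral {x..y} (\<lambda>z. W' z * (F y - F z))\<bar> \<le> integral {x..y} (\<lambda>z. C * (G y - G x))"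
    proof (intro integral_norm_bound_integral[where 'a=real, simplified real_norm_def])
      show "(\<lambda>z. W' z * (F y - F z)) integrable_on {x..y}"
        using xy by (intro integrable_continuous_interval continuous_intros continuous_on_subset[OF Fc] continuous_on_subset[OF W']) auto
      fix z assume z: "z \<in> {x..y}"
      have "\<bar>F y - F z\<bar> \<le> G y - G x" using Fb[of z y] Gmono[of x z] xy z by auto
      then show "\<bar>W' z * (F y - F z)\<bar> \<le> C * (G y - G x)"
        using C[of z] xy z C0 by (auto simp: abs_mult intro!: mult_mono)
    qed auto
    then have 2: "\<bar>integral {x..y} (\<lambda>z. W' z * (F y - F z))\<bar> \<le> C * (y - x) * (G y - G x)" using xy by (simp add: algebra_simps)
    show ?thesis using 1 2 D by (simp add: algebra_simps)
  qed
  have "(D has_real_derivative 0) (at x within {a..b})" if x: "x \<in> {a..b}" for x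
    unfolding has_field_derivative_iff
  proof (rule Lim_null_comparison)
    show "\<forall>\<^sub>F y in at x within {a..b}. norm ((D y - D x) / (y - x)) \<le> 2 * C * \<bar>G y - G x\<bar>"
      unfolding eventually_at
    proof (intro exI[of _ 1] conjI ballI impI)
      fix y assume y: "y \<in> {a..b}" "y \<noteq> x \<and> dist y x < 1"
      have "\<bar>D y - D x\<bar> \<le> 2 * C * \<bar>G y - G x\<bar> * \<bar>y - x\<bar>"
        using key[of x y] key[of y x] Gmono[of x y] Gmono[of y x] x y
        by (cases "x \<le> y") (auto simp: abs_minus_commute algebra_simps)
      then show "norm ((D y - D x) / (y - x)) \<le> 2 * C * \<bar>G y - G x\<bar>" using y by (simp add: divide_le_eq)
    qed simp
    have "(G \<longlongrightarrow> G x) (at x within {a..b})" using Gc x by (simp add: continuous_on)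
    then have "((\<lambda>y. 2 * C * \<bar>G y - G x\<bar>) \<longlongrightarrow> 2 * C * \<bar>G x - G x\<bar>) (at x within {a..b})" by (intro tendsto_intros)
    then show "((\<lambda>y. 2 * C * \<bar>G y - G x\<bar>) \<longlongrightarrow> 0) (at x within {a..b})" by simp
  qed
  then obtain c where "\<And>x. x \<in> {a..b} \<Longrightarrow> D x = c"
    using has_field_derivative_zero_constant[of "{a..b}" D] by auto
  then have "D b = D a" using ab by auto
  then show ?thesis by (simp add: D_def F_def)
qed

text \<open>The difference, extended by zero to the line, has a vanishing primitive on
  \<open>{p..q}\<close>, while at Lebesgue points the derivative of that primitive is the difference
  itself.\<close>

lemma negligible_diff_if_integrals_eq:
  fixes f g :: "real \<Rightarrow> real"
  assumes f: "f absolutely_integrable_on {p..q}" and g: "g absolutely_integrable_on {p..q}"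
    and eq: "\<And>x y. p \<le> x \<Longrightarrow> x \<le> y \<Longrightarrow> y \<le> q \<Longrightarrow> integral {x..y} f = integral {x..y} g"
  shows "negligible {x\<in>{p..q}. f x \<noteq> g x}"
proof -
  define h where "h x = (if x \<in> {p..q} then f x - g x else 0)" for x
  have h: "h absolutely_integrable_on S" if "S \<in> sets lebesgue" for S
    using set_integral_diff(1)[OF f g] absolutely_integrable_restrict_UNIV[of "{p..q}" "\<lambda>x. f x - g x"]
      set_integrable_subset[of lebesgue UNIV h S] that unfolding h_def by auto
  have "h absolutely_integrable_on {a..b}" for a b by (rule h) simp
  from lebesgue_points[of h, OF this] obtain N where N: "negligible N"
    "\<And>x e. \<lbrakk>x \<notin> N; 0 < e\<rbrakk> \<Longrightarrow>
       \<exists>d>0. \<forall>k. 0 < k \<and> k < d \<longrightarrow> integral {x - k..x + k} (\<lambda>y. \<bar>h y - h x\<bar>) < e * k" by blast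
  have "f x = g x" if x: "x \<in> {p<..<q}" "x \<notin> N" for x
  proof -
    have "((\<lambda>y. integral {p..y} h) has_real_derivative h x) (at x)"
      using x by (intro DERIV_indefinite_integral_lebesgue_point N h) auto
    moreover have "((\<lambda>y. integral {p..y} h) has_real_derivative 0) (at x)"
    proof (rule has_field_derivative_transform_within_open[where S="{p<..<q}" and f="\<lambda>_. 0"])
      fix y assume y: "y \<in> {p<..<q}"
      have "integral {p..y} h = integral {p..y} (\<lambda>x. f x - g x)" using y by (intro integral_cong) (auto simp: h_def)
      also have "\<dots> = integral {p..y} f - integral {p..y} g"
        using y by (intro integral_diff absolutely_integrable_imp_integrable absolutely_integrable_on_subinterval[OF f] absolutely_integrable_on_subinterval[OF g]) auto
      finally show "0 = integral {p..y} h" using eq[of p y] y by simp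
    qed (use x in auto)
    ultimately have "h x = 0" using DERIV_unique by blast
    then show ?thesis using x by (simp add: h_def)
  qed
  then have "{x\<in>{p..q}. f x \<noteq> g x} \<subseteq> N \<union> {p, q}" by force
  then show ?thesis using N(1) by (meson finite.emptyI finite_insert negligible_Un negligible_finite negligible_subset)
qed

section \<open>Differential inequalities and flows\<close>

lemma DERIV_within_nonneg_imp_le:
  fixes f f' :: "real \<Rightarrow> real"
  assumes "a \<le> b" "\<And>t. t \<in> {a..b} \<Longrightarrow> (f has_real_derivative f' t) (at t within {a..b})"
    "\<And>t. t \<in> {a<..<b} \<Longrightarrow> 0 \<le> f' t"
  shows "f a \<le> f b"
proof (rule DERIV_nonneg_imp_increasing_open[OF assms(1)])
  show "continuous_on {a..b} f" using assms(2) by (meson DERIV_continuous continuous_on_eq_continuous_within)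
  fix x assume x: "a < x" "x < b"
  then have "(f has_real_derivative f' x) (at x)" using assms(2)[of x] by (simp add: at_within_Icc_at)
  then show "\<exists>y. (f has_real_derivative y) (at x) \<and> 0 \<le> y" using assms(3) x by auto
qed

text \<open>The squared negative part of \<open>f\<close> is differentiable; weighted with
  \<open>exp (- 2 * C * s)\<close> it does not increase and starts at zero, so it stays zero. Since
  \<open>f'\<close> is constrained only where \<open>f\<close> is negative, the lemma can trap
  characteristics and propagate sign conditions.\<close>

lemma DERIV_within_barrier:
  fixes f f' :: "real \<Rightarrow> real"
  assumes D: "\<And>t. t \<in> {0..T} \<Longrightarrow> (f has_real_derivative f' t) (at t within {0..T})"
    and le: "\<And>t. t \<in> {0..T} \<Longrightarrow> f t < 0 \<Longrightarrow> C * f t \<le> f' t"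
    and "0 \<le> f 0" "t \<in> {0..T}"
  shows "0 \<le> f t"
proof -
  define h where "h s = - ((max 0 (- f s))\<^sup>2 * exp (- 2 * C * s))" for s
  define h' where "h' s = (2 * max 0 (- f s) * f' s + 2 * C * (max 0 (- f s))\<^sup>2) * exp (- 2 * C * s)" for s
  have "(h has_real_derivative h' s) (at s within {0..t})" if s: "s \<in> {0..t}" for s
  proof -
    have Ds: "(f has_real_derivative f' s) (at s within {0..t})" using s assms(4) by (intro DERIV_subset[OF D]) auto
    have "((\<lambda>s. (max 0 (- f s))\<^sup>2) has_real_derivative 2 * max 0 (- f s) * - f' s) (at s within {0..t})"
      using DERIV_chain2[OF DERIV_max0_square DERIV_minus[OF Ds]] by simp
    moreover have "((\<lambda>s. exp (- 2 * C * s)) has_real_derivative exp (- 2 * C * s) * (- 2 * C)) (at s within {0..t})"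
      by (auto intro!: derivative_eq_intros)
    ultimately have "(h has_real_derivative - (2 * max 0 (- f s) * - f' s * exp (- 2 * C * s) + exp (- 2 * C * s) * (- 2 * C) * (max 0 (- f s))\<^sup>2)) (at s within {0..t})"
      unfolding h_def by (intro DERIV_minus DERIV_mult)
    then show ?thesis by (simp add: h'_def algebra_simps)
  qed
  moreover have "0 \<le> h' s" if s: "s \<in> {0<..<t}" for s
  proof (cases "f s < 0")
    case True
    then have "C * f s \<le> f' s" using le s assms(4) by auto
    then have "0 \<le> (-2 * f s) * (f' s - C * f s)" using True by (intro mult_nonneg_nonneg[of "-2 * f s"]) linarith+
    then have "0 \<le> 2 * max 0 (- f s) * f' s + 2 * C * (max 0 (- f s))\<^sup>2" using True by (simp add: max_def power2_eq_square algebra_simps)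
    then show ?thesis by (simp add: h'_def)
  qed (auto simp: h'_def max_def)
  ultimately have "h 0 \<le> h t" using assms(4) by (intro DERIV_within_nonneg_imp_le[of 0 t h h']) auto
  then have "(max 0 (- f t))\<^sup>2 * exp (- 2 * C * t) \<le> 0" using assms(3) by (simp add: h_def max_absorb1)
  then have "(max 0 (- f t))\<^sup>2 \<le> 0" by (simp add: mult_le_0_iff)
  then show ?thesis by (simp add: max_def split: if_splits)
qed

text \<open>Argue with \<open>f\<^sup>2\<close>, which is insensitive to the sign and the zeros of
  \<open>f\<close>. The lower bound is what keeps distinct characteristics apart and positive
  densities positive.\<close>

lemma DERIV_within_abs_le_exp:
  fixes f f' :: "real \<Rightarrow> real"
  assumes D: "\<And>t. t \<in> {0..T} \<Longrightarrow> (f has_real_derivative f' t) (at t within {0..T})"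
    and le: "\<And>t. t \<in> {0..T} \<Longrightarrow> \<bar>f' t\<bar> \<le> L * \<bar>f t\<bar>" and t: "t \<in> {0..T}"
  shows "\<bar>f 0\<bar> * exp (- (L * t)) \<le> \<bar>f t\<bar>" "\<bar>f t\<bar> \<le> \<bar>f 0\<bar> * exp (L * t)"
proof -
  have D2: "((\<lambda>s. (f s)\<^sup>2 * exp (2 * c * s)) has_real_derivative (2 * f s * f' s + 2 * c * (f s)\<^sup>2) * exp (2 * c * s)) (at s within {0..t})"
    if "s \<in> {0..t}" for s c
  proof -
    have Ds: "(f has_real_derivative f' s) (at s within {0..t})" using that t by (intro DERIV_subset[OF D]) auto
    show ?thesis by (rule derivative_eq_intros Ds refl | simp add: algebra_simps)+
  qed
  have ff: "\<bar>f s * f' s\<bar> \<le> L * (f s)\<^sup>2" if "s \<in> {0..t}" for s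
    using mult_left_mono[OF le[of s], of "\<bar>f s\<bar>"] that t by (auto simp: abs_mult power2_eq_square algebra_simps)
  have "(\<lambda>s. (f s)\<^sup>2 * exp (2 * L * s)) 0 \<le> (\<lambda>s. (f s)\<^sup>2 * exp (2 * L * s)) t"
  proof (rule DERIV_within_nonneg_imp_le[OF _ D2])
    fix s assume "s \<in> {0<..<t}"
    then have "\<bar>f s * f' s\<bar> \<le> L * (f s)\<^sup>2" using ff by auto
    then show "0 \<le> (2 * f s * f' s + 2 * L * (f s)\<^sup>2) * exp (2 * L * s)" by (intro mult_nonneg_nonneg) auto
  qed (use t in auto)
  then have 1: "(f 0)\<^sup>2 \<le> (f t)\<^sup>2 * exp (2 * L * t)" by simp
  have "(\<bar>f 0\<bar> * exp (- (L * t)))\<^sup>2 = (f 0)\<^sup>2 * exp (- (2 * L * t))"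
    by (simp add: power_mult_distrib power2_eq_square exp_add[symmetric] algebra_simps)
  also have "\<dots> \<le> (f t)\<^sup>2 * exp (2 * L * t) * exp (- (2 * L * t))" by (intro mult_right_mono 1) auto
  also have "\<dots> = \<bar>f t\<bar>\<^sup>2" by (simp add: mult.assoc exp_add[symmetric])
  finally show "\<bar>f 0\<bar> * exp (- (L * t)) \<le> \<bar>f t\<bar>" by (rule power2_le_imp_le) simp
  have "- (\<lambda>s. (f s)\<^sup>2 * exp (2 * (-L) * s)) 0 \<le> - (\<lambda>s. (f s)\<^sup>2 * exp (2 * (-L) * s)) t"
  proof (rule DERIV_within_nonneg_imp_le[OF _ DERIV_minus[OF D2]])
    fix s assume "s \<in> {0<..<t}"
    then have "\<bar>f s * f' s\<bar> \<le> L * (f s)\<^sup>2" using ff by auto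
    then have "2 * f s * f' s + 2 * (-L) * (f s)\<^sup>2 \<le> 0" by auto
    then show "0 \<le> - ((2 * f s * f' s + 2 * (-L) * (f s)\<^sup>2) * exp (2 * (-L) * s))" by (simp add: mult_le_0_iff)
  qed (use t in auto)
  then have 2: "(f t)\<^sup>2 * exp (- (2 * L * t)) \<le> (f 0)\<^sup>2" by simp
  have "\<bar>f t\<bar>\<^sup>2 = (f t)\<^sup>2 * exp (- (2 * L * t)) * exp (2 * L * t)" by (simp add: mult.assoc exp_add[symmetric])
  also have "\<dots> \<le> (f 0)\<^sup>2 * exp (2 * L * t)" by (intro mult_right_mono 2) auto
  also have "\<dots> = (\<bar>f 0\<bar> * exp (L * t))\<^sup>2" by (simp add: power_mult_distrib power2_eq_square exp_add[symmetric] algebra_simps)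
  finally show "\<bar>f t\<bar> \<le> \<bar>f 0\<bar> * exp (L * t)" by (rule power2_le_imp_le) simp
qed

lemma integral_has_derivative_within:
  fixes f :: "real \<Rightarrow> real"
  assumes "continuous_on {a..b} f" "t \<in> {a..b}"
  shows "((\<lambda>t. integral {a..t} f) has_real_derivative f t) (at t within {a..b})"
  using integral_has_real_derivative[OF assms] .

text \<open>The barrier lemma for minus the integral of \<open>A\<close>: its derivative
  \<open>- A\<close> is at least \<open>C\<close> times it.\<close>

lemma gronwall_zero:
  fixes A :: "real \<Rightarrow> real"
  assumes c: "continuous_on {0..T} A" and C: "0 \<le> C"
    and le: "\<And>t. t \<in> {0..T} \<Longrightarrow> A t \<le> C * integral {0..t} A" and t: "t \<in> {0..T}"
  shows "A t \<le> 0"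
proof -
  have "0 \<le> - integral {0..t} A"
  proof (rule DERIV_within_barrier[where f="\<lambda>t. - integral {0..t} A" and f'="\<lambda>t. - A t" and C=C and T=T])
    show "((\<lambda>t. - integral {0..t} A) has_real_derivative - A s) (at s within {0..T})" if "s \<in> {0..T}" for s
      by (intro DERIV_minus integral_has_derivative_within c that)
  qed (use le t in auto)
  then have "C * integral {0..t} A \<le> 0" using C by (simp add: mult_le_0_iff)
  then show ?thesis using le[OF t] by simp
qed

section \<open>Flows of Lipschitz velocities, and iterated integrals on the half plane\<close>

lemma picard_lindelof_real:
  fixes V :: "real \<Rightarrow> real \<Rightarrow> real"
  assumes T: "0 \<le> T" and V: "continuous_on ({0..T} \<times> UNIV) (\<lambda>(t, x). V t x)"
    and L: "\<And>t x y. t \<in> {0..T} \<Longrightarrow> \<bar>V t x - V t y\<bar> \<le> L * \<bar>x - y\<bar>" and L0: "0 \<le> L"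
  obtains X where "X 0 = \<xi>" "\<And>t. t \<in> {0..T} \<Longrightarrow> (X has_real_derivative V t (X t)) (at t within {0..T})"
proof -
  define X where "X = rec_nat (\<lambda>_. \<xi>) (\<lambda>n Y t. \<xi> + integral {0..t} (\<lambda>s. V s (Y s)))"
  have X0: "X 0 t = \<xi>" and XS: "X (Suc n) t = \<xi> + integral {0..t} (\<lambda>s. V s (X n s))" for n t
    by (auto simp: X_def)
  have Vc: "continuous_on {0..T} (\<lambda>s. V s (Y s))" if "continuous_on {0..T} Y" for Y
  proof -
    have "continuous_on {0..T} (\<lambda>s. (s, Y s))" using that by (intro continuous_intros)
    from continuous_on_compose2[OF V this] show ?thesis by auto
  qed
  have Xc: "continuous_on {0..T} (X n)" for n
  proof (induction n)
    case 0 then show ?case by (simp add: X_def)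
  next
    case (Suc n)
    have "(\<lambda>s. V s (X n s)) integrable_on {0..T}" by (intro integrable_continuous_interval Vc Suc)
    then show ?case unfolding XS[abs_def] by (intro continuous_intros indefinite_integral_continuous_1)
  qed
  have int: "(\<lambda>s. V s (X n s)) integrable_on {0..t}" if "t \<in> {0..T}" for n t
    using that by (intro integrable_continuous_interval continuous_on_subset[OF Vc[OF Xc]]) auto
  have "bounded ((\<lambda>s. V s \<xi>) ` {0..T})"
    by (intro compact_imp_bounded compact_continuous_image Vc continuous_intros) auto
  then obtain M where M: "\<And>s. s \<in> {0..T} \<Longrightarrow> \<bar>V s \<xi>\<bar> \<le> M" unfolding bounded_iff by force
  have M0: "0 \<le> M" using M[of 0] T by auto
  have step: "\<bar>X (Suc n) t - X n t\<bar> \<le> M * T * (L * t) ^ n / fact n" if "t \<in> {0..T}" for n t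
    using that
  proof (induction n arbitrary: t)
    case 0
    have "\<bar>integral {0..t} (\<lambda>s. V s \<xi>)\<bar> \<le> integral {0..t} (\<lambda>s. M)"
      using 0 M int[of t 0] X0 by (intro integral_norm_bound_integral[where 'a=real, simplified real_norm_def]) auto
    also have "\<dots> \<le> M * T" using 0 M0 by (simp add: mult.commute mult_left_mono)
    finally show ?case by (simp add: XS X0)
  next
    case (Suc n)
    have "\<bar>X (Suc (Suc n)) t - X (Suc n) t\<bar> = \<bar>integral {0..t} (\<lambda>s. V s (X (Suc n) s) - V s (X n s))\<bar>"
      using int[OF Suc.prems, of "Suc n"] int[OF Suc.prems, of n] unfolding XS[of "Suc n" t] XS[of n t]
      by (simp only: integral_diff add_diff_add diff_self add_0)
    also have "\<dots> \<le> integral {0..t} (\<lambda>s. (M * T * L ^ Suc n / fact n) * s ^ n)"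
    proof (intro integral_norm_bound_integral[where 'a=real, simplified real_norm_def])
      fix s assume s: "s \<in> {0..t}"
      have "\<bar>V s (X (Suc n) s) - V s (X n s)\<bar> \<le> L * \<bar>X (Suc n) s - X n s\<bar>" using L s Suc.prems by auto
      also have "\<dots> \<le> L * (M * T * (L * s) ^ n / fact n)" using Suc.IH[of s] s Suc.prems L0 by (intro mult_left_mono) auto
      finally show "\<bar>V s (X (Suc n) s) - V s (X n s)\<bar> \<le> M * T * L ^ Suc n / fact n * s ^ n"
        by (simp add: power_mult_distrib algebra_simps)
    next
      show "(\<lambda>s. V s (X (Suc n) s) - V s (X n s)) integrable_on {0..t}" by (intro integrable_diff int Suc.prems)
      show "(\<lambda>s. M * T * L ^ Suc n / fact n * s ^ n) integrable_on {0..t}" by (intro integrable_continuous_interval continuous_intros)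
    qed
    also have "\<dots> = (M * T * L ^ Suc n / fact n) * (t ^ Suc n / Suc n)"
    proof -
      have "((\<lambda>s. s ^ n) has_integral (t ^ Suc n / Suc n - 0 ^ Suc n / Suc n)) {0..t}"
        using Suc.prems by (intro fundamental_theorem_of_calculus)
         (auto simp: has_real_derivative_iff_has_vector_derivative[symmetric] simp del: power_Suc of_nat_Suc intro!: derivative_eq_intros)
      from integral_unique[OF has_integral_mult_right[OF this, of "M * T * L ^ Suc n / fact n"]]
      show ?thesis by simp
    qed
    also have "\<dots> = M * T * (L * t) ^ Suc n / fact (Suc n)" by (simp add: power_mult_distrib field_simps)
    finally show ?case .
  qed
  have "uniform_limit {0..T} (\<lambda>n t. \<Sum>i<n. X (Suc i) t - X i t) (\<lambda>t. \<Sum>i. X (Suc i) t - X i t) sequentially"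
  proof (rule Weierstrass_m_test)
    fix n t assume t: "t \<in> {0..T}"
    have "norm (X (Suc n) t - X n t) \<le> M * T * (L * t) ^ n / fact n" using step[OF t] by simp
    also have "\<dots> \<le> M * T * (L * T) ^ n / fact n"
      using t L0 M0 by (intro divide_right_mono mult_left_mono power_mono) auto
    finally show "norm (X (Suc n) t - X n t) \<le> M * T * (L * T) ^ n / fact n" .
  next
    have "summable (\<lambda>n. M * T * (inverse (fact n) * (L * T) ^ n))" by (intro summable_mult summable_exp)
    then show "summable (\<lambda>n. M * T * (L * T) ^ n / fact n)" by (simp add: field_simps)
  qed
  moreover have "(\<Sum>i<n. X (Suc i) t - X i t) = X n t - \<xi>" for n t
    by (induction n) (auto simp: X0)
  ultimately have UL0: "uniform_limit {0..T} (\<lambda>n t. X n t - \<xi>) (\<lambda>t. \<Sum>i. X (Suc i) t - X i t) sequentially" by simp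
  define Z where "Z t = (\<Sum>i. X (Suc i) t - X i t) + \<xi>" for t
  have UL: "uniform_limit {0..T} X Z sequentially"
    unfolding Z_def using uniform_limit_add[OF UL0 uniform_limit_const[of "\<lambda>_. \<xi>" "{0..T}"]] by simp
  have Zc: "continuous_on {0..T} Z"
    by (rule uniform_limit_theorem[OF _ UL]) (auto intro: always_eventually Xc)
  have ULV: "uniform_limit {0..T} (\<lambda>n s. V s (X n s)) (\<lambda>s. V s (Z s)) sequentially"
  proof (rule uniform_limitI)
    fix e :: real assume e: "0 < e"
    have "\<forall>\<^sub>F n in sequentially. \<forall>s\<in>{0..T}. dist (X n s) (Z s) < e / (L + 1)"
      using uniform_limitD[OF UL, of "e / (L + 1)"] e L0 by auto
    then show "\<forall>\<^sub>F n in sequentially. \<forall>s\<in>{0..T}. dist (V s (X n s)) (V s (Z s)) < e"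
    proof (rule eventually_mono, intro ballI)
      fix n s assume "\<forall>s\<in>{0..T}. dist (X n s) (Z s) < e / (L + 1)" "s \<in> {0..T}"
      then have elim: "s \<in> {0..T}" "dist (X n s) (Z s) < e / (L + 1)" by auto
      have "dist (V s (X n s)) (V s (Z s)) \<le> L * dist (X n s) (Z s)" using L elim by (simp add: dist_real_def)
      also have "\<dots> \<le> (L + 1) * dist (X n s) (Z s)" using L0 by (intro mult_right_mono) auto
      also have "\<dots> < (L + 1) * (e / (L + 1))" using elim L0 by (intro mult_strict_left_mono) auto
      finally show "dist (V s (X n s)) (V s (Z s)) < e" using L0 by simp
    qed
  qed
  have Zeq: "Z t = \<xi> + integral {0..t} (\<lambda>s. V s (Z s))" if t: "t \<in> {0..T}" for t
  proof -
    have sub: "{0..t} \<subseteq> {0..T}" using t by auto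
    obtain I J where I: "\<And>n. ((\<lambda>s. V s (X n s)) has_integral I n) {0..t}" "((\<lambda>s. V s (Z s)) has_integral J) {0..t}" "(I \<longlonglongrightarrow> J)"
      using uniform_limit_integral[OF uniform_limit_on_subset[OF ULV sub] continuous_on_subset[OF Vc[OF Xc] sub]] by auto
    have "(\<lambda>n. \<xi> + I n) \<longlonglongrightarrow> \<xi> + J" using I(3) by (intro tendsto_intros)
    moreover have "\<xi> + I n = X (Suc n) t" for n using I(1)[of n] by (simp add: XS integral_unique)
    ultimately have "(\<lambda>n. X (Suc n) t) \<longlonglongrightarrow> \<xi> + J" by simp
    moreover have "(\<lambda>n. X (Suc n) t) \<longlonglongrightarrow> Z t" using tendsto_uniform_limitI[OF UL t] by (rule LIMSEQ_Suc)
    ultimately have "Z t = \<xi> + J" using LIMSEQ_unique by blast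
    then show ?thesis using I(2) by (simp add: integral_unique)
  qed
  show ?thesis
  proof (rule that[of Z])
    show "Z 0 = \<xi>" using Zeq[of 0] T by simp
    fix t assume t: "t \<in> {0..T}"
    have "((\<lambda>t. \<xi> + integral {0..t} (\<lambda>s. V s (Z s))) has_real_derivative 0 + V t (Z t)) (at t within {0..T})"
      by (intro DERIV_add DERIV_const integral_has_derivative_within Vc Zc t)
    then have "((\<lambda>t. \<xi> + integral {0..t} (\<lambda>s. V s (Z s))) has_real_derivative V t (Z t)) (at t within {0..T})" by simp
    then show "(Z has_real_derivative V t (Z t)) (at t within {0..T})"
      by (rule has_field_derivative_transform_within[where d=1]) (use Zeq t in auto)
  qed
qed

text \<open>The weak formulation integrates over the half plane. A bounded Borel function supported
  in a rectangle can be passed to Lebesgue measure, where Fubini's theorem applies; the cut-off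
  \<open>G\<close> enforces the support condition also at negative times.\<close>

lemma integral_halfplane_iterated:
  fixes F :: "real \<times> real \<Rightarrow> real"
  assumes F: "F \<in> borel_measurable borel" and b: "\<And>p. \<bar>F p\<bar> \<le> C"
    and supp: "\<And>t x. 0 \<le> t \<Longrightarrow> t \<notin> {0..T} \<or> x \<notin> {-k..k} \<Longrightarrow> F (t, x) = 0"
  shows "integral ({0..} \<times> UNIV) F = integral {0..T} (\<lambda>t. integral {-k..k} (\<lambda>x. F (t, x)))"
    "(\<lambda>t. integral {-k..k} (\<lambda>x. F (t, x))) absolutely_integrable_on {0..T}"
proof -
  define G where "G p = indicator ({0..T} \<times> {-k..k}) p * F p" for p
  have box: "({0..T} \<times> {-k..k}) \<in> sets (borel :: (real \<times> real) measure)" by (simp add: borel_Times)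
  have Gm: "G \<in> borel_measurable borel" unfolding G_def using box F by measurable
  have fin: "emeasure lborel ({0..T} \<times> {-k..k}) < \<infinity>"
    using emeasure_lborel_cbox_finite[of "(0, -k)" "(T, k)"] by (simp add: cbox_Pair_eq)
  have Gi: "integrable lborel G"
  proof (rule Bochner_Integration.integrable_bound)
    show "integrable lborel (\<lambda>p. C * indicator ({0..T} \<times> {-k..k}) p)"
      using box fin by (intro integrable_mult_right integrable_real_indicator) auto
    show "G \<in> borel_measurable lborel" using Gm by simp
    show "AE p in lborel. norm (G p) \<le> norm (C * indicator ({0..T} \<times> {-k..k}) p)"
      using b abs_ge_self[of C] by (intro AE_I2) (auto simp: G_def indicator_def intro: order_trans)
  qed
  have sec: "(\<lambda>x. G (t, x)) \<in> borel_measurable borel" for t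
    by (rule measurable_compose[OF _ Gm]) (simp add: borel_prod[symmetric])
  have seci: "integrable lborel (\<lambda>x. G (t, x))" for t
  proof (rule Bochner_Integration.integrable_bound)
    show "integrable lborel (\<lambda>x. C * indicator {-k..k} x)"
      by (intro integrable_mult_right integrable_real_indicator) (auto simp: emeasure_lborel_Icc_eq)
    show "(\<lambda>x. G (t, x)) \<in> borel_measurable lborel" using sec by simp
    show "AE x in lborel. norm (G (t, x)) \<le> norm (C * indicator {-k..k} x)"
      using b abs_ge_self[of C] by (intro AE_I2) (auto simp: G_def indicator_def intro: order_trans)
  qed
  have sl: "(LBINT x. G (t, x)) = (if t \<in> {0..T} then integral {-k..k} (\<lambda>x. F (t, x)) else 0)" for t
  proof -
    have "(LBINT x. G (t, x)) = integral UNIV (\<lambda>x. G (t, x))"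
      using integral_unique[OF has_integral_integral_lborel[OF seci]] by simp
    also have "\<dots> = (if t \<in> {0..T} then integral UNIV (\<lambda>x. if x \<in> {-k..k} then F (t, x) else 0) else 0)"
      by (auto simp: G_def indicator_def intro!: integral_cong)
    finally show ?thesis using Henstock_Kurzweil_Integration.integral_restrict_UNIV[of "{-k..k}" "\<lambda>x. F (t, x)"] by simp
  qed
  have Gi2: "integrable (lborel \<Otimes>\<^sub>M lborel) (\<lambda>(t, x). G (t, x))" using Gi by (simp add: lborel_prod)
  have outer: "integrable lborel (\<lambda>t. LBINT x. G (t, x))"
    using lborel_pair.integrable_fst[OF Gi2] by simp
  have "integral ({0..} \<times> UNIV) F = integral UNIV (\<lambda>p. if p \<in> {0..} \<times> UNIV then F p else 0)"
    by (simp only: Henstock_Kurzweil_Integration.integral_restrict_UNIV)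
  also have "(\<lambda>p. if p \<in> {0..} \<times> UNIV then F p else 0) = G"
    using supp by (fastforce simp: G_def indicator_def)
  also have "integral UNIV G = (\<integral>p. G p \<partial>lborel)"
    using has_integral_integral_lborel[OF Gi] by (simp add: integral_unique)
  also have "\<dots> = (LBINT t. LBINT x. G (t, x))"
    using lborel_pair.integral_fst[OF Gi2] by (simp add: lborel_prod)
  also have "\<dots> = integral UNIV (\<lambda>t. LBINT x. G (t, x))"
    using has_integral_integral_lborel[OF outer] by (simp add: integral_unique)
  also have "\<dots> = integral {0..T} (\<lambda>t. integral {-k..k} (\<lambda>x. F (t, x)))"
    unfolding sl by (simp only: Henstock_Kurzweil_Integration.integral_restrict_UNIV)
  finally show "integral ({0..} \<times> UNIV) F = integral {0..T} (\<lambda>t. integral {-k..k} (\<lambda>x. F (t, x)))" .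
  have "(\<lambda>t. LBINT x. G (t, x)) absolutely_integrable_on UNIV"
    using outer by (simp add: set_integrable_def integrable_completion)
  then show "(\<lambda>t. integral {-k..k} (\<lambda>x. F (t, x))) absolutely_integrable_on {0..T}"
    unfolding sl by (simp only: absolutely_integrable_restrict_UNIV)
qed

section \<open>Classical regularity of the density\<close>

lemma weak_deriv_abs_int:
  assumes "weak_deriv f g"
  shows "f absolutely_integrable_on {a..b}" "g absolutely_integrable_on {a..b}"
proof -
  have "{a..b} \<subseteq> {- max \<bar>a\<bar> \<bar>b\<bar>..max \<bar>a\<bar> \<bar>b\<bar>}" by auto
  then show "f absolutely_integrable_on {a..b}" "g absolutely_integrable_on {a..b}"
    using assms absolutely_integrable_on_subinterval unfolding weak_deriv_def by blast+
qed

lemma weak_deriv_increment: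
  assumes fg: "weak_deriv f g" and xy: "x \<le> y"
    and L: "\<And>z e. z = x \<or> z = y \<Longrightarrow> 0 < e \<Longrightarrow>
       \<exists>d>0. \<forall>h. 0 < h \<and> h < d \<longrightarrow> integral {z - h..z + h} (\<lambda>y. \<bar>f y - f z\<bar>) < e * h"
  shows "f y - f x = integral {x..y} g"
proof (rule weak_derivative_increment[where p="x - 1" and q="y + 1"])
  fix \<psi> \<psi>' assume 1: "\<And>x. (\<psi> has_real_derivative \<psi>' x) (at x)" "continuous_on UNIV \<psi>'"
    "\<exists>p' q'. x - 1 < p' \<and> q' < y + 1 \<and> (\<forall>x. x \<notin> {p'..q'} \<longrightarrow> \<psi> x = 0 \<and> \<psi>' x = 0)"
  then have z: "\<psi> z = 0 \<and> \<psi>' z = 0" if "z \<notin> {x - 1..y + 1}" for z using that by fastforce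
  have "\<exists>N. \<forall>x. N \<le> \<bar>x\<bar> \<longrightarrow> \<psi> x = 0"
    by (rule exI[of _ "\<bar>x\<bar> + \<bar>y\<bar> + 2"]) (use z in force)
  then have "integral UNIV (\<lambda>x. f x * \<psi>' x) = - integral UNIV (\<lambda>x. g x * \<psi> x)"
    using fg 1 unfolding weak_deriv_def by blast
  moreover have "integral UNIV (\<lambda>x. f x * \<psi>' x) = integral {x - 1..y + 1} (\<lambda>x. f x * \<psi>' x)"
    "integral UNIV (\<lambda>x. g x * \<psi> x) = integral {x - 1..y + 1} (\<lambda>x. g x * \<psi> x)"
    using z by (auto intro!: integral_eq_on_support)
  moreover have "continuous_on UNIV \<psi>" using 1(1) by (meson DERIV_isCont continuous_at_imp_continuous_on)
  then have "(\<lambda>x. g x * \<psi> x) integrable_on {x - 1..y + 1}" "(\<lambda>x. f x * \<psi>' x) integrable_on {x - 1..y + 1}"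
    by (auto intro!: absolutely_integrable_imp_integrable absolutely_integrable_mult_continuous
      weak_deriv_abs_int[OF fg] continuous_on_subset[OF 1(2)] intro: continuous_on_subset)
  ultimately show "integral {x - 1..y + 1} (\<lambda>x. f x * \<psi>' x + g x * \<psi> x) = 0" by (simp add: integral_add)
qed (use xy L weak_deriv_abs_int[OF fg] in auto)

lemma weak_deriv_increment_continuous:
  assumes fg: "weak_deriv f g" and xy: "x \<le> y" and "continuous_on UNIV f"
  shows "f y - f x = integral {x..y} g"
proof (rule weak_deriv_increment[OF fg xy])
  fix z e :: real assume "0 < e"
  then show "\<exists>d>0. \<forall>h. 0 < h \<and> h < d \<longrightarrow> integral {z - h..z + h} (\<lambda>y. \<bar>f y - f z\<bar>) < e * h"
    by (intro continuous_lebesgue_point[where p="z - 1" and q="z + 1"] continuous_on_subset[OF assms(3)]) auto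
qed

lemma negligible_realD: "negligible (N :: real set) \<Longrightarrow> a < b \<Longrightarrow> \<exists>x\<in>{a<..<b}. x \<notin> N"
proof (rule ccontr)
  assume "negligible N" "a < b" "\<not> (\<exists>x\<in>{a<..<b}. x \<notin> N)"
  then have "negligible {a<..<b}" by (meson negligible_subset subsetI)
  moreover have "\<not> negligible {a<..<b}" using \<open>a < b\<close> by (intro open_not_negligible) auto
  ultimately show False by simp
qed

text \<open>A weak derivative knows \<open>g\<close> only up to null sets, so the integration of
  \<open>h\<close> has to start at a Lebesgue point \<open>x0\<close> of \<open>g\<close>; the
  resulting function then agrees with \<open>g\<close> at every Lebesgue point.\<close>

lemma weak_deriv_continuous_rep:
  assumes gh: "weak_deriv g h"
  obtains g1 where "continuous_on UNIV g1" "negligible {x. g x \<noteq> g1 x}"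
    "\<And>x y. x \<le> y \<Longrightarrow> g1 y - g1 x = integral {x..y} h"
proof -
  obtain N where N: "negligible N" "\<And>x e. \<lbrakk>x \<notin> N; 0 < e\<rbrakk> \<Longrightarrow>
       \<exists>d>0. \<forall>h. 0 < h \<and> h < d \<longrightarrow> integral {x - h..x + h} (\<lambda>y. \<bar>g y - g x\<bar>) < e * h"
    using lebesgue_points[of g] weak_deriv_abs_int[OF gh] by blast
  have inth: "h integrable_on {a..b}" for a b using weak_deriv_abs_int[OF gh] absolutely_integrable_imp_integrable by blast
  obtain x0 where x0: "x0 \<notin> N" using negligible_realD[OF N(1), of 0 1] by auto
  define H where "H x = (if x0 \<le> x then integral {x0..x} h else - integral {x..x0} h)" for x
  have Hinc: "H y - H x = integral {x..y} h" if "x \<le> y" for x y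
    using that integral_split[of x0 x y h]
      integral_split[of x x0 y h]
      integral_split[of x y x0 h] inth by (auto simp: H_def)
  show ?thesis
  proof (rule that[of "\<lambda>x. g x0 + H x"])
    show "continuous_on UNIV (\<lambda>x. g x0 + H x)"
    proof (intro continuous_intros continuous_at_imp_continuous_on ballI)
      fix z
      have "continuous_on {z - 1..z + 1} (\<lambda>x. H (z - 1) + integral {z - 1..x} h)"
        by (intro continuous_intros indefinite_integral_continuous_1 inth)
      then have "continuous_on {z - 1..z + 1} H"
        by (rule continuous_on_eq) (use Hinc[of "z - 1"] in fastforce)
      then show "isCont H z" by (rule continuous_on_interior) auto
    qed
    have "g x = g x0 + H x" if x: "x \<notin> N" for x
    proof (cases "x0 \<le> x")
      case True
      then have "g x - g x0 = integral {x0..x} h" using x x0 N(2) by (intro weak_deriv_increment gh) auto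
      then show ?thesis using True by (simp add: H_def)
    next
      case False
      then have "g x0 - g x = integral {x..x0} h" using x x0 N(2) by (intro weak_deriv_increment gh) auto
      then show ?thesis using False by (simp add: H_def)
    qed
    then show "negligible {x. g x \<noteq> g x0 + H x}" by (intro negligible_subset[OF N(1)]) auto
    show "(g x0 + H y) - (g x0 + H x) = integral {x..y} h" if "x \<le> y" for x y using Hinc[OF that] by simp
  qed
qed

lemma weak_deriv_cong_ae:
  assumes "weak_deriv f g" "negligible {x. f x \<noteq> f1 x}" "negligible {x. g x \<noteq> g1 x}"
  shows "weak_deriv f1 g1"
  unfolding weak_deriv_def
proof (intro conjI allI impI)
  fix k :: real
  show "f1 absolutely_integrable_on {-k..k}" "g1 absolutely_integrable_on {-k..k}"
    using absolutely_integrable_spike[OF weak_deriv_abs_int(1)[OF assms(1)] assms(2)]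
      absolutely_integrable_spike[OF weak_deriv_abs_int(2)[OF assms(1)] assms(3)] by auto
next
  fix \<phi> \<phi>' :: "real \<Rightarrow> real"
  assume 1: "(\<forall>x. (\<phi> has_real_derivative \<phi>' x) (at x)) \<and> continuous_on UNIV \<phi>' \<and> (\<exists>N. \<forall>x. N \<le> \<bar>x\<bar> \<longrightarrow> \<phi> x = 0)"
  have "integral UNIV (\<lambda>x. f x * \<phi>' x) = integral UNIV (\<lambda>x. f1 x * \<phi>' x)"
    by (rule integral_spike[OF assms(2)]) auto
  moreover have "integral UNIV (\<lambda>x. g x * \<phi> x) = integral UNIV (\<lambda>x. g1 x * \<phi> x)"
    by (rule integral_spike[OF assms(3)]) auto
  ultimately show "integral UNIV (\<lambda>x. f1 x * \<phi>' x) = - integral UNIV (\<lambda>x. g1 x * \<phi> x)"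
    using assms(1) 1 unfolding weak_deriv_def by metis
qed

lemma negligible_UNIV_if_intervals:
  fixes P :: "real \<Rightarrow> bool"
  assumes "\<And>n::nat. negligible {x\<in>{- real n..real n}. P x}"
  shows "negligible {x. P x}"
proof -
  have "{x. P x} = (\<Union>n. {x\<in>{- real n..real n}. P x})"
  proof (intro set_eqI iffI)
    fix x assume x: "x \<in> {x. P x}"
    obtain n where "\<bar>x\<bar> \<le> real n" using real_arch_simple by blast
    then have "x \<in> {- real n..real n}" by auto
    then show "x \<in> (\<Union>n. {x\<in>{- real n..real n}. P x})" using x by blast
  qed auto
  then show ?thesis using negligible_countable_Union[of "range (\<lambda>n. {x\<in>{- real n..real n}. P x})"] assms by auto
qed

lemma weak_deriv_unique:
  assumes "weak_deriv f g" "weak_deriv f h" "continuous_on UNIV f"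
  shows "negligible {x. g x \<noteq> h x}"
proof (rule negligible_UNIV_if_intervals, rule negligible_diff_if_integrals_eq)
  fix x y :: real assume "x \<le> y"
  then show "integral {x..y} g = integral {x..y} h"
    using weak_deriv_increment_continuous assms by metis
qed (auto intro: weak_deriv_abs_int[OF assms(1)] weak_deriv_abs_int[OF assms(2)])

lemma L2_loc_cong_ae:
  assumes "L2_loc f" "negligible {x. f x \<noteq> g x}"
  shows "L2_loc g"
  unfolding L2_loc_def
proof (intro conjI allI)
  have "f \<in> borel_measurable lebesgue" using assms(1) by (simp add: L2_loc_def)
  then have "f measurable_on UNIV" by (simp add: measurable_on_iff_borel_measurable)
  then have "g measurable_on UNIV" by (rule measurable_on_spike) (use assms(2) in auto)
  then show "g \<in> borel_measurable lebesgue" by (simp add: measurable_on_iff_borel_measurable)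
  show "(\<lambda>x. (g x)\<^sup>2) integrable_on {-k..k}" for k
    by (rule integrable_spike[OF _ assms(2), of "\<lambda>x. (f x)\<^sup>2"]) (use assms(1) in \<open>auto simp: L2_loc_def\<close>)
qed

lemma weak_deriv_lincomb:
  assumes "weak_deriv f g" "weak_deriv f' g'"
  shows "weak_deriv (\<lambda>x. a * f x + b * f' x) (\<lambda>x. a * g x + b * g' x)"
  unfolding weak_deriv_def
proof (intro conjI allI impI)
  fix k :: real
  show "(\<lambda>x. a * f x + b * f' x) absolutely_integrable_on {-k..k}" "(\<lambda>x. a * g x + b * g' x) absolutely_integrable_on {-k..k}"
    using weak_deriv_abs_int[OF assms(1)] weak_deriv_abs_int[OF assms(2)]
    by (auto intro!: set_integral_add set_integrable_mult_right)
next
  fix \<phi> \<phi>' :: "real \<Rightarrow> real"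
  assume 1: "(\<forall>x. (\<phi> has_real_derivative \<phi>' x) (at x)) \<and> continuous_on UNIV \<phi>' \<and> (\<exists>N. \<forall>x. N \<le> \<bar>x\<bar> \<longrightarrow> \<phi> x = 0)"
  then obtain N where N: "\<And>x. N \<le> \<bar>x\<bar> \<Longrightarrow> \<phi> x = 0" by blast
  have \<phi>c: "continuous_on UNIV \<phi>" using 1 by (meson DERIV_isCont continuous_at_imp_continuous_on)
  have z: "\<phi> x = 0 \<and> \<phi>' x = 0" if "x \<notin> {- \<bar>N\<bar> - 1..\<bar>N\<bar> + 1}" for x
  proof -
    have "\<bar>x\<bar> > \<bar>N\<bar>" using that by auto
    have "(\<phi> has_real_derivative 0) (at x)"
    proof (rule has_field_derivative_transform_within_open[where S="{y. \<bar>N\<bar> < \<bar>y\<bar>}" and f="\<lambda>_. 0"])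
      show "open {y. \<bar>N\<bar> < \<bar>y::real\<bar>}" by (intro open_Collect_less continuous_intros)
    qed (use N \<open>\<bar>x\<bar> > \<bar>N\<bar>\<close> in auto)
    then have "\<phi>' x = 0" using 1 DERIV_unique by blast
    then show ?thesis using N \<open>\<bar>x\<bar> > \<bar>N\<bar>\<close> by simp
  qed
  have int: "(\<lambda>x. u x * \<phi>' x) integrable_on UNIV" "(\<lambda>x. v x * \<phi> x) integrable_on UNIV" if "weak_deriv u v" for u v
  proof -
    have 2: "(\<lambda>x. u x * \<phi>' x) integrable_on {- \<bar>N\<bar> - 1..\<bar>N\<bar> + 1}" "(\<lambda>x. v x * \<phi> x) integrable_on {- \<bar>N\<bar> - 1..\<bar>N\<bar> + 1}"
      using weak_deriv_abs_int[OF that] 1 \<phi>c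
      by (auto intro!: absolutely_integrable_imp_integrable absolutely_integrable_mult_continuous intro: continuous_on_subset)
    show "(\<lambda>x. u x * \<phi>' x) integrable_on UNIV" "(\<lambda>x. v x * \<phi> x) integrable_on UNIV"
      using z by (auto intro!: integrable_on_superset[OF 2(1)] integrable_on_superset[OF 2(2)])
  qed
  have e: "integral UNIV (\<lambda>x. u x * \<phi>' x) = - integral UNIV (\<lambda>x. v x * \<phi> x)" if "weak_deriv u v" for u v
    using that 1 unfolding weak_deriv_def by blast
  have "integral UNIV (\<lambda>x. (a * f x + b * f' x) * \<phi>' x) = integral UNIV (\<lambda>x. a * (f x * \<phi>' x) + b * (f' x * \<phi>' x))"
    by (simp add: algebra_simps)
  also have "\<dots> = a * integral UNIV (\<lambda>x. f x * \<phi>' x) + b * integral UNIV (\<lambda>x. f' x * \<phi>' x)"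
    using int(1)[OF assms(1)] int(1)[OF assms(2)] by (subst integral_add) (auto intro: integrable_on_mult_right)
  also have "\<dots> = - (a * integral UNIV (\<lambda>x. g x * \<phi> x) + b * integral UNIV (\<lambda>x. g' x * \<phi> x))"
    by (simp add: e[OF assms(1)] e[OF assms(2)])
  also have "\<dots> = - integral UNIV (\<lambda>x. a * (g x * \<phi> x) + b * (g' x * \<phi> x))"
    using int(2)[OF assms(1)] int(2)[OF assms(2)] by (subst integral_add) (auto intro: integrable_on_mult_right)
  also have "\<dots> = - integral UNIV (\<lambda>x. (a * g x + b * g' x) * \<phi> x)" by (simp add: algebra_simps)
  finally show "integral UNIV (\<lambda>x. (a * f x + b * f' x) * \<phi>' x) = - integral UNIV (\<lambda>x. (a * g x + b * g' x) * \<phi> x)" .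
qed

lemma L2_loc_lincomb:
  assumes "L2_loc f" "L2_loc g"
  shows "L2_loc (\<lambda>x. a * f x + b * g x)"
  unfolding L2_loc_def
proof (intro conjI allI)
  have m: "f \<in> borel_measurable lebesgue" "g \<in> borel_measurable lebesgue" using assms by (auto simp: L2_loc_def)
  then show m2: "(\<lambda>x. a * f x + b * g x) \<in> borel_measurable lebesgue" by measurable
  fix k
  have i: "(\<lambda>x. 2 * a\<^sup>2 * (f x)\<^sup>2 + 2 * b\<^sup>2 * (g x)\<^sup>2) integrable_on {-k..k}"
    using assms by (intro integrable_add integrable_on_mult_right) (auto simp: L2_loc_def)
  show "(\<lambda>x. (a * f x + b * g x)\<^sup>2) integrable_on {-k..k}"
  proof (rule measurable_bounded_by_integrable_imp_integrable[OF _ i])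
    have "(\<lambda>x. (a * f x + b * g x)\<^sup>2) \<in> borel_measurable lebesgue" using m2 by measurable
    then show "(\<lambda>x. (a * f x + b * g x)\<^sup>2) \<in> borel_measurable (lebesgue_on {-k..k})" by (rule measurable_restrict_space1)
    fix x
    have "(a * f x + b * g x)\<^sup>2 \<le> 2 * a\<^sup>2 * (f x)\<^sup>2 + 2 * b\<^sup>2 * (g x)\<^sup>2"
      using zero_le_power2[of "a * f x - b * g x"] by (simp add: power2_eq_square algebra_simps)
    then show "norm ((a * f x + b * g x)\<^sup>2) \<le> 2 * a\<^sup>2 * (f x)\<^sup>2 + 2 * b\<^sup>2 * (g x)\<^sup>2" by simp
  qed auto
qed

lemma H2_loc_lincomb:
  assumes "H2_loc f" "H2_loc f'"
  shows "H2_loc (\<lambda>x. a * f x + b * f' x)"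
proof -
  obtain g h where 1: "weak_deriv f g" "L2_loc g" "weak_deriv g h" "L2_loc h" using assms(1) by (auto simp: H2_loc_def)
  obtain g' h' where 2: "weak_deriv f' g'" "L2_loc g'" "weak_deriv g' h'" "L2_loc h'" using assms(2) by (auto simp: H2_loc_def)
  have "continuous_on UNIV (\<lambda>x. a * f x + b * f' x)" "L2_loc (\<lambda>x. a * f x + b * f' x)"
    using assms by (auto simp: H2_loc_def intro!: continuous_intros L2_loc_lincomb)
  then show ?thesis unfolding H2_loc_def
    using weak_deriv_lincomb[OF 1(1) 2(1)] weak_deriv_lincomb[OF 1(3) 2(3)] L2_loc_lincomb[OF 1(2) 2(2)] L2_loc_lincomb[OF 1(4) 2(4)]
    by blast
qed

text \<open>\<open>wderiv\<close> is a choice, made independently of the witnesses in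
  \<open>H2_loc\<close>. Choices and witnesses coincide almost everywhere, and the first derivative
  has a continuous version. The latter makes \<open>f\<close> classically differentiable, and the
  former passes the square integrability of the witness on to the chosen second derivative.\<close>

lemma H2_loc_structure:
  assumes "H2_loc f"
  shows "(f has_real_derivative deriv f x) (at x)" "continuous_on UNIV (deriv f)"
    "negligible {x. wderiv f x \<noteq> deriv f x}" "L2_loc (wderiv (wderiv f))"
    "\<And>x y. x \<le> y \<Longrightarrow> deriv f y - deriv f x = integral {x..y} (wderiv (wderiv f))"
    "wderiv (wderiv f) absolutely_integrable_on {a..b}"
proof -
  obtain g h where gh: "weak_deriv f g" "L2_loc g" "weak_deriv g h" "L2_loc h" and fc: "continuous_on UNIV f"
    using assms by (auto simp: H2_loc_def)
  define g1 h1 where "g1 = wderiv f" and "h1 = wderiv g1"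
  have g1: "weak_deriv f g1" unfolding g1_def wderiv_def by (rule someI[of "weak_deriv f", OF gh(1)])
  have "negligible {x. g x \<noteq> g1 x}" by (rule weak_deriv_unique[OF gh(1) g1 fc])
  then have g1h: "weak_deriv g1 h" by (rule weak_deriv_cong_ae[OF gh(3)]) simp
  have h1: "weak_deriv g1 h1" unfolding h1_def wderiv_def by (rule someI[of "weak_deriv g1", OF g1h])
  obtain f1 where f1: "continuous_on UNIV f1" "negligible {x. g1 x \<noteq> f1 x}"
    "\<And>x y. x \<le> y \<Longrightarrow> f1 y - f1 x = integral {x..y} h1"
    using weak_deriv_continuous_rep[OF h1] by blast
  have inc: "f y - f x = integral {x..y} f1" if "x \<le> y" for x y
  proof -
    have "f y - f x = integral {x..y} g1" by (rule weak_deriv_increment_continuous[OF g1 that fc])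
    also have "\<dots> = integral {x..y} f1" by (rule integral_spike[OF f1(2)]) auto
    finally show ?thesis .
  qed
  have D: "(f has_real_derivative f1 x) (at x)" for x
  proof -
    have "((\<lambda>y. f (x - 1) + integral {x - 1..y} f1) has_real_derivative 0 + f1 x) (at x within {x - 1..x + 1})"
      by (intro DERIV_add DERIV_const integral_has_derivative_within continuous_on_subset[OF f1(1)]) auto
    then have "((\<lambda>y. f (x - 1) + integral {x - 1..y} f1) has_real_derivative f1 x) (at x)"
      by (simp add: at_within_Icc_at)
    then show ?thesis
    proof (rule has_field_derivative_transform_within_open)
      show "f (x - 1) + integral {x - 1..y} f1 = f y" if "y \<in> {x - 1<..<x + 1}" for y
        using inc[of "x - 1" y] that by simp
    qed auto
  qed
  then have df: "deriv f = f1" by (auto intro: DERIV_imp_deriv)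
  \<comment> \<open>Uniqueness of weak derivatives is available for continuous functions, so the two
    candidates for the second derivative are compared through the continuous version
    \<open>f1\<close>.\<close>
  have "weak_deriv f1 h1" "weak_deriv f1 h" by (rule weak_deriv_cong_ae[OF h1 f1(2)] weak_deriv_cong_ae[OF g1h f1(2)]; simp)+
  then have "negligible {x. h x \<noteq> h1 x}" using weak_deriv_unique f1(1) by blast
  then have "L2_loc h1" by (rule L2_loc_cong_ae[OF gh(4)])
  then show "(f has_real_derivative deriv f x) (at x)" "continuous_on UNIV (deriv f)"
    "negligible {x. wderiv f x \<noteq> deriv f x}" "L2_loc (wderiv (wderiv f))"
    "\<And>x y. x \<le> y \<Longrightarrow> deriv f y - deriv f x = integral {x..y} (wderiv (wderiv f))"
    "wderiv (wderiv f) absolutely_integrable_on {a..b}"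
    using D f1 weak_deriv_abs_int[OF h1] unfolding df g1_def h1_def by auto
qed

text \<open>The one-dimensional Sobolev inequality: \<open>\<bar>F x\<bar>\<close> is at most
  \<open>\<bar>F y\<bar>\<close> plus the integral of \<open>\<bar>G\<bar>\<close>, and this is
  averaged over \<open>y\<close>. Integrating
  \<open>\<bar>H\<bar> \<le> r / 2 + H\<^sup>2 / (2 * r)\<close> over length \<open>2 * k\<close>
  bounds the L1 norms by \<open>(k + 1/2) * r\<close>, the first factor of the constant.\<close>

lemma sup_bound_of_L2:
  fixes F G :: "real \<Rightarrow> real"
  assumes Fc: "continuous_on {-k..k} F" and G: "G absolutely_integrable_on {-k..k}" and k: "0 < k"
    and inc: "\<And>x y. -k \<le> x \<Longrightarrow> x \<le> y \<Longrightarrow> y \<le> k \<Longrightarrow> F y - F x = integral {x..y} G"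
    and G2: "(\<lambda>x. (G x)\<^sup>2) integrable_on {-k..k}"
    and r: "0 < r" "integral {-k..k} (\<lambda>x. (F x)\<^sup>2) \<le> r\<^sup>2" "integral {-k..k} (\<lambda>x. (G x)\<^sup>2) \<le> r\<^sup>2"
    and x: "x \<in> {-k..k}"
  shows "\<bar>F x\<bar> \<le> (k + 1/2) * (1 / (2 * k) + 1) * r"
proof -
  have L1: "integral {-k..k} (\<lambda>x. \<bar>H x\<bar>) \<le> (k + 1/2) * r"
    if H: "(\<lambda>x. \<bar>H x\<bar>) integrable_on {-k..k}" "(\<lambda>x. (H x)\<^sup>2) integrable_on {-k..k}" "integral {-k..k} (\<lambda>x. (H x)\<^sup>2) \<le> r\<^sup>2" for H :: "real \<Rightarrow> real"
  proof -
    have i2: "(\<lambda>x. 1 / (2 * r) * (H x)\<^sup>2) integrable_on {-k..k}" by (intro integrable_on_mult_right H)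
    have "integral {-k..k} (\<lambda>x. \<bar>H x\<bar>) \<le> integral {-k..k} (\<lambda>x. r / 2 + 1 / (2 * r) * (H x)\<^sup>2)"
    proof (intro integral_le H integrable_add integrable_const_ivl i2)
      fix x
      have "0 \<le> (\<bar>H x\<bar> - r)\<^sup>2 / (2 * r)" using r(1) by simp
      also have "\<dots> = (r / 2 + 1 / (2 * r) * (H x)\<^sup>2) - \<bar>H x\<bar>" using r(1) by (simp add: power2_diff field_simps power2_eq_square)
      finally show "\<bar>H x\<bar> \<le> r / 2 + 1 / (2 * r) * (H x)\<^sup>2" by simp
    qed
    also have "\<dots> = k * r + 1 / (2 * r) * integral {-k..k} (\<lambda>x. (H x)\<^sup>2)"
      using i2 k by (subst integral_add) auto
    also have "\<dots> \<le> k * r + 1 / (2 * r) * r\<^sup>2" using H(3) r(1) by (intro add_left_mono mult_left_mono) auto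
    also have "\<dots> = (k + 1/2) * r" using r(1) by (simp add: power2_eq_square field_simps)
    finally show ?thesis .
  qed
  have Gi: "(\<lambda>x. \<bar>G x\<bar>) integrable_on {-k..k}" using absolutely_integrable_imp_integrable[OF absolutely_integrable_abs_diff[OF G, of 0]] by simp
  have Fi: "(\<lambda>x. \<bar>F x\<bar>) integrable_on {-k..k}" "(\<lambda>x. (F x)\<^sup>2) integrable_on {-k..k}"
    by (intro integrable_continuous_interval continuous_intros Fc)+
  define B where "B = integral {-k..k} (\<lambda>x. \<bar>G x\<bar>)"
  have pt: "\<bar>F x\<bar> \<le> \<bar>F y\<bar> + B" if y: "y \<in> {-k..k}" for y
  proof -
    have b: "\<bar>F q - F p\<bar> \<le> B" if "-k \<le> p" "p \<le> q" "q \<le> k" for p q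
    proof -
      have sub: "G integrable_on {p..q}" "(\<lambda>x. \<bar>G x\<bar>) integrable_on {p..q}"
        using absolutely_integrable_imp_integrable[OF G] Gi that by (auto intro: integrable_on_subinterval)
      have "\<bar>integral {p..q} G\<bar> \<le> integral {p..q} (\<lambda>x. \<bar>G x\<bar>)"
        using sub by (intro integral_norm_bound_integral[where 'a=real, simplified real_norm_def]) auto
      also have "\<dots> \<le> B" unfolding B_def using that by (intro integral_subset_le sub Gi) auto
      finally show ?thesis using inc that by simp
    qed
    show ?thesis using b[of x y] b[of y x] x y by (cases "x \<le> y") auto
  qed
  have "2 * k * \<bar>F x\<bar> = integral {-k..k} (\<lambda>y. \<bar>F x\<bar>)" using k by simp
  also have "\<dots> \<le> integral {-k..k} (\<lambda>y. \<bar>F y\<bar> + B)" using pt by (intro integral_le integrable_add Fi) auto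
  also have "\<dots> = integral {-k..k} (\<lambda>y. \<bar>F y\<bar>) + 2 * k * B" using Fi k by (subst integral_add) auto
  also have "\<dots> \<le> (k + 1/2) * r + 2 * k * ((k + 1/2) * r)"
    using L1[OF Fi r(2)] L1[OF Gi G2 r(3)] k unfolding B_def by (intro add_mono mult_left_mono) auto
  finally show ?thesis using k by (simp add: field_simps)
qed

lemma H2_norm_sup_bound:
  assumes H: "H2_loc f" and k: "0 < k" and r: "H2_norm k f < r" and x: "x \<in> {-k..k}"
  shows "\<bar>f x\<bar> \<le> (k + 1/2) * (1 / (2 * k) + 1) * r" "\<bar>deriv f x\<bar> \<le> (k + 1/2) * (1 / (2 * k) + 1) * r"
proof -
  note S = H2_loc_structure[OF H]
  let ?g = "wderiv f" and ?h = "wderiv (wderiv f)"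
  have fc: "continuous_on {-k..k} f" using H by (auto simp: H2_loc_def intro: continuous_on_subset)
  have dc: "continuous_on {-k..k} (deriv f)" using S(2) by (rule continuous_on_subset) simp
  have i: "(\<lambda>x. (f x)\<^sup>2) integrable_on {-k..k}" "(\<lambda>x. (deriv f x)\<^sup>2) integrable_on {-k..k}"
    by (intro integrable_continuous_interval continuous_intros fc dc)+
  have ih: "(\<lambda>x. (?h x)\<^sup>2) integrable_on {-k..k}" using S(4) by (simp add: L2_loc_def)
  have "integral {-k..k} (\<lambda>x. (f x)\<^sup>2 + (?g x)\<^sup>2 + (?h x)\<^sup>2) = integral {-k..k} (\<lambda>x. (f x)\<^sup>2 + (deriv f x)\<^sup>2 + (?h x)\<^sup>2)"
    by (rule integral_spike[OF S(3)]) auto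
  also have "\<dots> = integral {-k..k} (\<lambda>x. (f x)\<^sup>2) + integral {-k..k} (\<lambda>x. (deriv f x)\<^sup>2) + integral {-k..k} (\<lambda>x. (?h x)\<^sup>2)"
    using i ih by (simp add: integral_add integrable_add)
  finally have I: "integral {-k..k} (\<lambda>x. (f x)\<^sup>2 + (?g x)\<^sup>2 + (?h x)\<^sup>2) =
    integral {-k..k} (\<lambda>x. (f x)\<^sup>2) + integral {-k..k} (\<lambda>x. (deriv f x)\<^sup>2) + integral {-k..k} (\<lambda>x. (?h x)\<^sup>2)" .
  have nn: "0 \<le> integral {-k..k} (\<lambda>x. (f x)\<^sup>2)" "0 \<le> integral {-k..k} (\<lambda>x. (deriv f x)\<^sup>2)" "0 \<le> integral {-k..k} (\<lambda>x. (?h x)\<^sup>2)"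
    using integral_nonneg[OF i(1)] integral_nonneg[OF i(2)] integral_nonneg[OF ih] by auto
  have e: "(H2_norm k f)\<^sup>2 = integral {-k..k} (\<lambda>x. (f x)\<^sup>2) + integral {-k..k} (\<lambda>x. (deriv f x)\<^sup>2) + integral {-k..k} (\<lambda>x. (?h x)\<^sup>2)"
    unfolding H2_norm_def I using nn by simp
  have n0: "0 \<le> H2_norm k f" unfolding H2_norm_def I using nn by simp
  then have "0 < r" "(H2_norm k f)\<^sup>2 \<le> r\<^sup>2" using r by (auto intro: power_mono)
  then have b: "integral {-k..k} (\<lambda>x. (f x)\<^sup>2) \<le> r\<^sup>2" "integral {-k..k} (\<lambda>x. (deriv f x)\<^sup>2) \<le> r\<^sup>2" "integral {-k..k} (\<lambda>x. (?h x)\<^sup>2) \<le> r\<^sup>2"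
    using e nn by auto
  show "\<bar>deriv f x\<bar> \<le> (k + 1/2) * (1 / (2 * k) + 1) * r"
    by (rule sup_bound_of_L2[OF dc S(6) k S(5) ih \<open>0 < r\<close> b(2,3) x])
  show "\<bar>f x\<bar> \<le> (k + 1/2) * (1 / (2 * k) + 1) * r"
  proof (rule sup_bound_of_L2[OF fc _ k _ i(2) \<open>0 < r\<close> b(1,2) x])
    show "deriv f absolutely_integrable_on {-k..k}" using absolutely_integrable_continuous_real[OF dc] .
    show "f y - f x = integral {x..y} (deriv f)" if "x \<le> y" for x y
      using that S(1) by (intro integral_unique[symmetric] fundamental_theorem_of_calculus)
        (auto simp: has_real_derivative_iff_has_vector_derivative[symmetric] intro: DERIV_subset)
  qed
qed

section \<open>Joint continuity in time and space\<close>

abbreviation halfplane_continuous :: "(real \<Rightarrow> real \<Rightarrow> real) \<Rightarrow> bool" where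
  "halfplane_continuous f \<equiv> continuous_on ({0..} \<times> UNIV) (\<lambda>(t, x). f t x)"

text \<open>Freezing negative times at 0 extends a function on the half plane to the whole plane, so
  that measurability refers to \<open>borel\<close> on the plane.\<close>

abbreviation halfplane_measurable :: "(real \<Rightarrow> real \<Rightarrow> real) \<Rightarrow> bool" where
  "halfplane_measurable f \<equiv> (\<lambda>p. f (max 0 (fst p)) (snd p)) \<in> borel_measurable borel"

lemma continuous_on_halfplane:
  fixes f :: "real \<Rightarrow> real \<Rightarrow> real"
  assumes x: "\<And>t. 0 \<le> t \<Longrightarrow> continuous_on UNIV (f t)"
    and t: "\<And>k t e. 0 < k \<Longrightarrow> 0 \<le> t \<Longrightarrow> 0 < e \<Longrightarrow> \<forall>\<^sub>F s in at t within {0..}. \<forall>x\<in>{-k..k}. \<bar>f s x - f t x\<bar> < e"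
  shows "halfplane_continuous f"
  unfolding continuous_on_iff
proof (intro ballI allI impI, clarify)
  fix t z e :: real assume t0: "0 \<le> t" and e: "0 < e"
  obtain d1 where d1: "0 < d1" "\<And>x. \<bar>x - z\<bar> < d1 \<Longrightarrow> \<bar>f t x - f t z\<bar> < e / 2"
    using x[OF t0] e unfolding continuous_on_iff dist_real_def by (metis UNIV_I half_gt_zero)
  have "\<forall>\<^sub>F s in at t within {0..}. \<forall>x\<in>{-(\<bar>z\<bar> + 1)..\<bar>z\<bar> + 1}. \<bar>f s x - f t x\<bar> < e / 2"
    using t[of "\<bar>z\<bar> + 1" t "e / 2"] t0 e by auto
  then obtain d2 where d2: "0 < d2" "\<And>s. s \<in> {0..} \<Longrightarrow> s \<noteq> t \<Longrightarrow> dist s t < d2 \<Longrightarrow> \<forall>x\<in>{-(\<bar>z\<bar> + 1)..\<bar>z\<bar> + 1}. \<bar>f s x - f t x\<bar> < e / 2"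
    unfolding eventually_at by auto
  have "dist (f s y) (f t z) < e" if s: "0 \<le> s" and d: "dist (s, y) (t, z) < min (min d1 d2) 1" for s y
  proof -
    have "dist s t \<le> dist (s, y) (t, z)" "dist y z \<le> dist (s, y) (t, z)"
      using dist_fst_le[of "(s, y)" "(t, z)"] dist_snd_le[of "(s, y)" "(t, z)"] by auto
    with d have d': "dist s t < d2" "\<bar>y - z\<bar> < d1" "\<bar>y - z\<bar> < 1" by (auto simp: dist_real_def)
    have "\<bar>f s y - f t y\<bar> < e / 2"
    proof (cases "s = t")
      case False
      then have "\<forall>x\<in>{-(\<bar>z\<bar> + 1)..\<bar>z\<bar> + 1}. \<bar>f s x - f t x\<bar> < e / 2" using d2(2)[of s] s d' by auto
      moreover have "y \<in> {-(\<bar>z\<bar> + 1)..\<bar>z\<bar> + 1}" using d'(3) by auto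
      ultimately show ?thesis by blast
    qed (use e in auto)
    moreover have "\<bar>f t y - f t z\<bar> < e / 2" by (rule d1(2)[OF d'(2)])
    ultimately show "dist (f s y) (f t z) < e" unfolding dist_real_def by linarith
  qed
  then show "\<exists>d>0. \<forall>x'\<in>{0..} \<times> UNIV. dist x' (t, z) < d \<longrightarrow> dist (case x' of (t, x) \<Rightarrow> f t x) (f t z) < e"
    using d1(1) d2(1) by (intro exI[of _ "min (min d1 d2) 1"]) auto
qed

text \<open>By the Sobolev bound, convergence in \<open>H2_norm k\<close> makes functions and their
  first derivatives converge uniformly on \<open>{-k..k}\<close>. The difference quotients in time
  of \<open>\<rho>\<close> and of its space derivative therefore stay bounded there, whence both are
  jointly continuous.\<close>

lemma C1_H2_loc_classical:
  assumes "C1_H2_loc \<rho>"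
  obtains rt where
    "\<And>t x. 0 \<le> t \<Longrightarrow> (\<rho> t has_real_derivative deriv (\<rho> t) x) (at x)"
    "halfplane_continuous \<rho>"
    "continuous_on ({0..} \<times> UNIV) (\<lambda>(t, x). deriv (\<rho> t) x)"
    "halfplane_continuous rt"
    "\<And>t x. 0 \<le> t \<Longrightarrow> ((\<lambda>s. \<rho> s x) has_real_derivative rt t x) (at t within {0..})"
proof -
  obtain rt where rt: "\<And>t. 0 \<le> t \<Longrightarrow> H2_loc (\<rho> t)" "\<And>t. 0 \<le> t \<Longrightarrow> H2_loc (rt t)"
    "\<And>k t. 0 < k \<Longrightarrow> 0 \<le> t \<Longrightarrow> ((\<lambda>s. H2_norm k (\<lambda>x. (\<rho> s x - \<rho> t x) / (s - t) - rt t x)) \<longlongrightarrow> 0) (at t within {0..})"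
    "\<And>k t. 0 < k \<Longrightarrow> 0 \<le> t \<Longrightarrow> ((\<lambda>s. H2_norm k (\<lambda>x. rt s x - rt t x)) \<longlongrightarrow> 0) (at t within {0..})"
    using assms unfolding C1_H2_loc_def by blast
  define C where "C k = (k + 1/2) * (1 / (2 * k) + 1)" for k :: real
  have C: "0 < C k" if "0 < k" for k using that unfolding C_def by (intro mult_pos_pos) (auto intro!: add_pos_pos)
  have sup: "\<forall>\<^sub>F s in F. \<forall>x\<in>{-k..k}. \<bar>f s x\<bar> < e \<and> \<bar>deriv (f s) x\<bar> < e"
    if k: "0 < k" and e: "0 < e" and lim: "((\<lambda>s. H2_norm k (f s)) \<longlongrightarrow> 0) F" and H: "\<forall>\<^sub>F s in F. H2_loc (f s)"
    for k e F and f :: "real \<Rightarrow> real \<Rightarrow> real"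
  proof -
    have "0 < e / (2 * C k)" using C[OF k] e by simp
    then have "\<forall>\<^sub>F s in F. H2_norm k (f s) < e / (2 * C k)" using lim by (rule order_tendstoD(2)[rotated])
    then show ?thesis using H
    proof eventually_elim
      case (elim s)
      have "C k * (e / (2 * C k)) < e" using C[OF k] e by (simp add: field_simps)
      then show ?case using H2_norm_sup_bound[OF elim(2) k elim(1)] unfolding C_def[symmetric] by fastforce
    qed
  qed
  have H: "H2_loc (\<lambda>x. (\<rho> s x - \<rho> t x) / (s - t) - rt t x)" if "0 \<le> s" "0 \<le> t" for s t
  proof -
    have "H2_loc (\<lambda>x. 1 / (s - t) * (1 * \<rho> s x + (-1) * \<rho> t x) + (-1) * rt t x)" by (intro H2_loc_lincomb rt that)
    then show ?thesis by simp
  qed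
  have q: "\<forall>\<^sub>F s in at t within {0..}. \<forall>x\<in>{-k..k}. \<bar>(\<rho> s x - \<rho> t x) / (s - t) - rt t x\<bar> < e \<and>
       \<bar>(deriv (\<rho> s) x - deriv (\<rho> t) x) / (s - t) - deriv (rt t) x\<bar> < e" if k: "0 < k" and t: "0 \<le> t" and e: "0 < e" for k t e
  proof -
    have ev: "\<forall>\<^sub>F s in at t within {0..}. 0 \<le> s" by (simp add: eventually_at_filter)
    then have "\<forall>\<^sub>F s in at t within {0..}. H2_loc (\<lambda>x. (\<rho> s x - \<rho> t x) / (s - t) - rt t x)"
      by eventually_elim (use H t in auto)
    from sup[OF k e rt(3)[OF k t] this] ev show ?thesis
    proof eventually_elim
      case (elim s)
      have "deriv (\<lambda>x. (\<rho> s x - \<rho> t x) / (s - t) - rt t x) x = (deriv (\<rho> s) x - deriv (\<rho> t) x) / (s - t) - deriv (rt t) x" for x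
        by (intro DERIV_imp_deriv DERIV_diff DERIV_cdivide H2_loc_structure(1) rt t elim)
      then show ?case using elim(1) by simp
    qed
  qed
  have r: "\<forall>\<^sub>F s in at t within {0..}. \<forall>x\<in>{-k..k}. \<bar>rt s x - rt t x\<bar> < e" if k: "0 < k" and t: "0 \<le> t" and e: "0 < e" for k t e
  proof -
    have "\<forall>\<^sub>F s in at t within {0..}. 0 \<le> s" by (simp add: eventually_at_filter)
    then have "\<forall>\<^sub>F s in at t within {0..}. H2_loc (\<lambda>x. rt s x - rt t x)"
    proof eventually_elim
      case (elim s)
      then have "H2_loc (\<lambda>x. 1 * rt s x + (-1) * rt t x)" by (intro H2_loc_lincomb rt t)
      then show ?case by simp
    qed
    from sup[OF k e rt(4)[OF k t] this] show ?thesis by eventually_elim auto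
  qed
  have c: "continuous_on UNIV (\<rho> t)" "continuous_on UNIV (rt t)" "continuous_on UNIV (deriv (\<rho> t))" "continuous_on UNIV (deriv (rt t))" if "0 \<le> t" for t
    using rt that H2_loc_structure(2) by (auto simp: H2_loc_def)
  have quot: "\<forall>\<^sub>F s in at t within {0..}. \<forall>x\<in>{-k..k}. \<bar>f s x - f t x\<bar> < e"
    if t: "0 \<le> t" and e: "0 < e" and gc: "continuous_on UNIV g"
      and ev: "\<forall>\<^sub>F s in at t within {0..}. \<forall>x\<in>{-k..k}. \<bar>(f s x - f t x) / (s - t) - g x\<bar> < 1" for k t e and f :: "real \<Rightarrow> real \<Rightarrow> real" and g
  proof -
    have "bounded (g ` {-k..k})" using gc by (intro compact_imp_bounded compact_continuous_image) (auto intro: continuous_on_subset)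
    then obtain M where M: "\<And>x. x \<in> {-k..k} \<Longrightarrow> \<bar>g x\<bar> \<le> M" unfolding bounded_iff by force
    have "\<forall>\<^sub>F s in at t within {0..}. s \<noteq> t \<and> \<bar>s - t\<bar> < e / (\<bar>M\<bar> + 1)"
      unfolding eventually_at using e by (intro exI[of _ "e / (\<bar>M\<bar> + 1)"]) (auto simp: dist_real_def)
    with ev show ?thesis
    proof eventually_elim
      case (elim s)
      show ?case
      proof
        fix x assume x: "x \<in> {-k..k}"
        have "\<bar>(f s x - f t x) / (s - t)\<bar> \<le> \<bar>M\<bar> + 1" using bspec[OF elim(1) x] M[OF x] by linarith
        then have "\<bar>f s x - f t x\<bar> \<le> (\<bar>M\<bar> + 1) * \<bar>s - t\<bar>" using elim by (simp add: divide_simps abs_divide)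
        also have "\<dots> < (\<bar>M\<bar> + 1) * (e / (\<bar>M\<bar> + 1))" using elim by (intro mult_strict_left_mono) auto
        finally show "\<bar>f s x - f t x\<bar> < e" by simp
      qed
    qed
  qed
  show ?thesis
  proof (rule that[of rt])
    show "(\<rho> t has_real_derivative deriv (\<rho> t) x) (at x)" if "0 \<le> t" for t x
      by (rule H2_loc_structure(1)[OF rt(1)[OF that]])
    show "halfplane_continuous rt" by (intro continuous_on_halfplane c r)
    show "halfplane_continuous \<rho>"
    proof (intro continuous_on_halfplane c)
      fix k t e :: real assume *: "0 < k" "0 \<le> t" "0 < e"
      show "\<forall>\<^sub>F s in at t within {0..}. \<forall>x\<in>{-k..k}. \<bar>\<rho> s x - \<rho> t x\<bar> < e"
        using q[OF *(1,2), of 1] by (intro quot[OF *(2,3) c(2)[OF *(2)]]) (auto elim: eventually_mono)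
    qed
    show "continuous_on ({0..} \<times> UNIV) (\<lambda>(t, x). deriv (\<rho> t) x)"
    proof (intro continuous_on_halfplane c)
      fix k t e :: real assume *: "0 < k" "0 \<le> t" "0 < e"
      show "\<forall>\<^sub>F s in at t within {0..}. \<forall>x\<in>{-k..k}. \<bar>deriv (\<rho> s) x - deriv (\<rho> t) x\<bar> < e"
        using q[OF *(1,2), of 1] by (intro quot[OF *(2,3) c(4)[OF *(2)]]) (auto elim: eventually_mono)
    qed
    show "((\<lambda>s. \<rho> s x) has_real_derivative rt t x) (at t within {0..})" if "0 \<le> t" for t x
      unfolding has_field_derivative_iff
    proof (rule tendstoI)
      fix e :: real assume "0 < e"
      have x: "x \<in> {-(\<bar>x\<bar> + 1)..\<bar>x\<bar> + 1}" by auto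
      show "\<forall>\<^sub>F s in at t within {0..}. dist ((\<rho> s x - \<rho> t x) / (s - t)) (rt t x) < e"
        by (rule eventually_mono[OF q[OF _ that \<open>0 < e\<close>, of "\<bar>x\<bar> + 1"]])
           (use x in \<open>auto simp: dist_real_def simp del: atLeastAtMost_iff\<close>)
    qed
  qed
qed

section \<open>Primitives and convolution with the kernel\<close>

definition primitive :: "(real \<Rightarrow> real) \<Rightarrow> real \<Rightarrow> real" where
  "primitive f x = (if 0 \<le> x then integral {0..x} f else - integral {x..0} f)"

lemma primitive_diff:
  assumes "\<And>a b. f absolutely_integrable_on {a..b}" "x \<le> y"
  shows "primitive f y - primitive f x = integral {x..y} f"
proof -
  have int: "f integrable_on {a..b}" for a b using assms(1) absolutely_integrable_imp_integrable by blast
  show ?thesis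
    using assms(2) integral_split[of 0 x y f]
      integral_split[of x 0 y f]
      integral_split[of x y 0 f] int by (auto simp: primitive_def)
qed

lemma primitive_lipschitz:
  assumes f: "\<And>a b. f absolutely_integrable_on {a..b}" and C: "\<And>y. y \<in> {p..q} \<Longrightarrow> \<bar>f y\<bar> \<le> C"
    and xy: "x \<in> {p..q}" "y \<in> {p..q}"
  shows "\<bar>primitive f y - primitive f x\<bar> \<le> C * \<bar>y - x\<bar>"
proof -
  have main: "\<bar>primitive f y - primitive f x\<bar> \<le> C * \<bar>y - x\<bar>" if "x \<le> y" "p \<le> x" "y \<le> q" for x y
  proof -
    have "\<bar>integral {x..y} f\<bar> \<le> integral {x..y} (\<lambda>_. C)"
      using that C absolutely_integrable_imp_integrable[OF f]
      by (intro integral_norm_bound_integral[where 'a=real, simplified real_norm_def]) auto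
    then show ?thesis using that primitive_diff[OF f, of x y] by (simp add: mult.commute)
  qed
  show ?thesis using main[of x y] main[of y x] xy by (cases "x \<le> y") (auto simp: abs_minus_commute)
qed

lemma continuous_on_primitive:
  assumes f: "\<And>a b. f absolutely_integrable_on {a..b}"
  shows "continuous_on S (primitive f)"
proof -
  have "isCont (primitive f) z" for z
  proof -
    have int: "f integrable_on {a..b}" for a b using f absolutely_integrable_imp_integrable by blast
    have "continuous_on {z - 1..z + 1} (\<lambda>x. primitive f (z - 1) + integral {z - 1..x} f)"
      by (intro continuous_intros indefinite_integral_continuous_1 int)
    then have "continuous_on {z - 1..z + 1} (primitive f)"
      by (rule continuous_on_eq) (use primitive_diff[OF f, of "z - 1"] in fastforce)
    then show ?thesis by (rule continuous_on_interior) auto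
  qed
  then show ?thesis by (simp add: continuous_at_imp_continuous_on)
qed

lemma continuous_on_compose_primitive[continuous_intros]:
  assumes f: "\<And>a b. f absolutely_integrable_on {a..b}" "continuous_on S h"
  shows "continuous_on S (\<lambda>x. primitive f (h x))"
  using continuous_on_compose2[OF continuous_on_primitive[OF f(1), of UNIV] f(2)] by simp

lemma DERIV_primitive_lebesgue_point:
  assumes f: "\<And>a b. f absolutely_integrable_on {a..b}"
    and L: "\<And>e. 0 < e \<Longrightarrow> \<exists>d>0. \<forall>h. 0 < h \<and> h < d \<longrightarrow> integral {x - h..x + h} (\<lambda>y. \<bar>f y - f x\<bar>) < e * h"
  shows "(primitive f has_real_derivative f x) (at x)"
proof -
  have "((\<lambda>y. primitive f (x - 1) + integral {x - 1..y} f) has_real_derivative 0 + f x) (at x)"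
    by (intro DERIV_add DERIV_const DERIV_indefinite_integral_lebesgue_point f L) auto
  then have "((\<lambda>y. primitive f (x - 1) + integral {x - 1..y} f) has_real_derivative f x) (at x)" by simp
  then show ?thesis
  proof (rule has_field_derivative_transform_within_open)
    show "primitive f (x - 1) + integral {x - 1..y} f = primitive f y" if "y \<in> {x - 1<..<x + 1}" for y
      using primitive_diff[OF f, of "x - 1" y] that by simp
  qed auto
qed

lemma ae_DERIV_primitive:
  assumes f: "\<And>a b. f absolutely_integrable_on {a..b}"
  shows "negligible {x. \<not> (primitive f has_real_derivative f x) (at x)}"
proof -
  obtain N where N: "negligible N"
    "\<And>x e. \<lbrakk>x \<notin> N; 0 < e\<rbrakk> \<Longrightarrow>
       \<exists>d>0. \<forall>h. 0 < h \<and> h < d \<longrightarrow> integral {x - h..x + h} (\<lambda>y. \<bar>f y - f x\<bar>) < e * h"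
    using lebesgue_points[OF f] by blast
  then have "{x. \<not> (primitive f has_real_derivative f x) (at x)} \<subseteq> N"
    using DERIV_primitive_lebesgue_point[OF f] by blast
  then show ?thesis using N(1) negligible_subset by blast
qed

lemma negligible_translation_real: "negligible S \<Longrightarrow> negligible {x. x + (c::real) \<in> S}"
proof -
  assume "negligible S"
  then have "negligible ((+) (- c) ` S)" by (rule negligible_translation)
  moreover have "{x. x + c \<in> S} \<subseteq> (+) (- c) ` S" by force
  ultimately show ?thesis using negligible_subset by blast
qed

lemma integral_shift_real:
  fixes f :: "real \<Rightarrow> real"
  shows "integral {a..b} (\<lambda>t. f (x + t)) = integral {x + a..x + b} f"
  using integral_shift_Icc_real[of a b f x] by (simp add: o_def add.commute)

lemma absolutely_integrable_shift_real:
  fixes f :: "real \<Rightarrow> real"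
  assumes f: "f absolutely_integrable_on {x + a..x + b}"
  shows "(\<lambda>t. f (x + t)) absolutely_integrable_on {a..b}"
proof -
  have *: "((\<lambda>t. h (t + x)) has_integral i) {a..b} \<longleftrightarrow> (h has_integral i) {a + x..b + x}" for i and h :: "real \<Rightarrow> real"
    using has_integral_shift_Icc_real[of h x i a b] by (simp add: o_def add.commute)
  show ?thesis using f *[of f] *[of "\<lambda>t. \<bar>f t\<bar>"]
    unfolding absolutely_integrable_on_def integrable_on_def by (simp add: add.commute)
qed

text \<open>Moving the derivative to the kernel leaves only the primitive of \<open>f\<close>. Since
  \<open>f\<close> will be the speed \<open>v \<rho> \<omega>\<close>, which may be discontinuous,
  this is the form in which continuity, Lipschitz bounds and derivatives of \<open>V\<close> become
  accessible.\<close>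

lemma kernel_integral_eq:
  fixes w w' f :: "real \<Rightarrow> real"
  assumes w: "\<And>x. x \<in> {0..\<eta>} \<Longrightarrow> (w has_real_derivative w' x) (at x within {0..\<eta>})"
    and w': "continuous_on {0..\<eta>} w'" and \<eta>: "0 \<le> \<eta>"
    and f: "\<And>a b. f absolutely_integrable_on {a..b}"
  shows "integral {x..x + \<eta>} (\<lambda>y. w (y - x) * f y) =
    w \<eta> * (primitive f (x + \<eta>) - primitive f x) - integral {0..\<eta>} (\<lambda>\<tau>. w' \<tau> * (primitive f (x + \<tau>) - primitive f x))"
proof -
  have "integral {x..x + \<eta>} (\<lambda>y. w (y - x) * f y) = integral {0..\<eta>} (\<lambda>\<tau>. w \<tau> * f (x + \<tau>))"
    using integral_shift_real[of 0 \<eta> "\<lambda>y. w (y - x) * f y" x] by simp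
  also have "\<dots> = w \<eta> * integral {0..\<eta>} (\<lambda>\<tau>. f (x + \<tau>)) - integral {0..\<eta>} (\<lambda>\<tau>. w' \<tau> * integral {0..\<tau>} (\<lambda>\<tau>. f (x + \<tau>)))"
    by (rule integral_by_parts_indefinite[OF absolutely_integrable_shift_real[OF f] \<eta> w w'])
  also have "integral {0..\<eta>} (\<lambda>\<tau>. w' \<tau> * integral {0..\<tau>} (\<lambda>\<tau>. f (x + \<tau>))) =
     integral {0..\<eta>} (\<lambda>\<tau>. w' \<tau> * (primitive f (x + \<tau>) - primitive f x))"
    by (intro integral_cong) (auto simp: integral_shift_real primitive_diff[OF f])
  also have "integral {0..\<eta>} (\<lambda>\<tau>. f (x + \<tau>)) = primitive f (x + \<eta>) - primitive f x"
    using \<eta> by (simp add: integral_shift_real primitive_diff[OF f])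
  finally show ?thesis .
qed

text \<open>The primitive is differentiable only almost everywhere, but its convolution with the
  continuous \<open>w'\<close> is differentiable at every point: the difference quotients of the
  primitive are bounded by \<open>C\<close> and converge for almost every shift
  \<open>\<tau>\<close>.\<close>

lemma DERIV_convolution_primitive:
  fixes w' f :: "real \<Rightarrow> real"
  assumes w': "continuous_on {0..\<eta>} w'" and \<eta>: "0 \<le> \<eta>"
    and f: "\<And>a b. f absolutely_integrable_on {a..b}"
    and C: "\<And>y. y \<in> {x - 1..x + \<eta> + 1} \<Longrightarrow> \<bar>f y\<bar> \<le> C"
  shows "((\<lambda>y. integral {0..\<eta>} (\<lambda>\<tau>. w' \<tau> * primitive f (y + \<tau>))) has_real_derivative
    integral {0..\<eta>} (\<lambda>\<tau>. w' \<tau> * f (x + \<tau>))) (at x)"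
  unfolding has_field_derivative_iff tendsto_at_iff_sequentially
proof (intro allI impI)
  fix X :: "nat \<Rightarrow> real" assume X0: "\<forall>i. X i \<in> UNIV - {x}" and X: "X \<longlonglongrightarrow> x"
  let ?P = "primitive f"
  let ?q = "\<lambda>i \<tau>. w' \<tau> * ((?P (X i + \<tau>) - ?P (x + \<tau>)) / (X i - x))"
  define N where "N = {\<tau>. \<not> (?P has_real_derivative f (x + \<tau>)) (at (x + \<tau>))}"
  have N: "negligible N"
    using negligible_translation_real[OF ae_DERIV_primitive[OF f], of x] by (simp add: N_def add.commute)
  \<comment> \<open>From \<open>n0\<close> on the points are within distance 1 of \<open>x\<close>,
    where the bound \<open>C\<close> is available.\<close>
  obtain n0 where n0: "\<And>n. n0 \<le> n \<Longrightarrow> \<bar>X n - x\<bar> < 1"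
    using X unfolding LIMSEQ_def dist_real_def by (metis zero_less_one)
  have int: "?q i integrable_on {0..\<eta>}" for i
    by (intro integrable_continuous_interval continuous_intros w' f) (use X0 in auto)
  have "bounded (w' ` {0..\<eta>})" by (intro compact_imp_bounded compact_continuous_image w') auto
  then obtain M where M: "\<And>\<tau>. \<tau> \<in> {0..\<eta>} \<Longrightarrow> \<bar>w' \<tau>\<bar> \<le> M" unfolding bounded_iff by force
  have "(\<lambda>i. integral {0..\<eta>} (\<lambda>\<tau>. if \<tau> \<in> N then 0 else ?q (i + n0) \<tau>)) \<longlonglongrightarrow>
     integral {0..\<eta>} (\<lambda>\<tau>. if \<tau> \<in> N then 0 else w' \<tau> * f (x + \<tau>))"
  proof (rule dominated_convergence(2)[where h="\<lambda>_. M * C"])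
    show "(\<lambda>\<tau>. if \<tau> \<in> N then 0 else ?q (i + n0) \<tau>) integrable_on {0..\<eta>}" for i
      by (rule integrable_spike[OF int N]) auto
    fix i \<tau> assume \<tau>: "\<tau> \<in> {0..\<eta>}"
    have Xi: "\<bar>X (i + n0) - x\<bar> < 1" by (rule n0) simp
    have "\<bar>?P (X (i + n0) + \<tau>) - ?P (x + \<tau>)\<bar> \<le> C * \<bar>(X (i + n0) + \<tau>) - (x + \<tau>)\<bar>"
      using \<tau> Xi by (intro primitive_lipschitz[OF f C]) auto
    then have "\<bar>(?P (X (i + n0) + \<tau>) - ?P (x + \<tau>)) / (X (i + n0) - x)\<bar> \<le> C"
      using X0 by (simp add: abs_divide divide_le_eq)
    moreover have "0 \<le> M" using M[OF \<tau>] by linarith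
    ultimately have "\<bar>?q (i + n0) \<tau>\<bar> \<le> M * C" using M[OF \<tau>] unfolding abs_mult by (intro mult_mono) auto
    moreover have "0 \<le> M * C" using \<open>0 \<le> M\<close> C[of x] \<eta> by (intro mult_nonneg_nonneg) force+
    ultimately show "norm (if \<tau> \<in> N then 0 else ?q (i + n0) \<tau>) \<le> M * C" by simp
  next
    fix \<tau> assume \<tau>: "\<tau> \<in> {0..\<eta>}"
    show "(\<lambda>i. if \<tau> \<in> N then 0 else ?q (i + n0) \<tau>) \<longlonglongrightarrow> (if \<tau> \<in> N then 0 else w' \<tau> * f (x + \<tau>))"
    proof (cases "\<tau> \<in> N")
      case False
      then have "((\<lambda>z. (?P z - ?P (x + \<tau>)) / (z - (x + \<tau>))) \<longlongrightarrow> f (x + \<tau>)) (at (x + \<tau>))"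
        by (simp add: N_def has_field_derivative_iff)
      then have "((\<lambda>z. (?P z - ?P (x + \<tau>)) / (z - (x + \<tau>))) \<circ> (\<lambda>i. X i + \<tau>)) \<longlonglongrightarrow> f (x + \<tau>)"
        unfolding tendsto_at_iff_sequentially
      proof (elim allE[of _ "\<lambda>i. X i + \<tau>"] impE)
        show "(\<lambda>i. X i + \<tau>) \<longlonglongrightarrow> x + \<tau>" by (intro tendsto_add X tendsto_const)
      qed (use X0 in auto)
      then have "(\<lambda>i. (?P (X i + \<tau>) - ?P (x + \<tau>)) / (X i - x)) \<longlonglongrightarrow> f (x + \<tau>)" by (simp add: o_def)
      then have "(\<lambda>i. ?q (i + n0) \<tau>) \<longlonglongrightarrow> w' \<tau> * f (x + \<tau>)" by (intro tendsto_mult tendsto_const LIMSEQ_ignore_initial_segment)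
      then show ?thesis using False by simp
    qed simp
  qed auto
  moreover have "integral {0..\<eta>} (\<lambda>\<tau>. if \<tau> \<in> N then 0 else ?q (i + n0) \<tau>) = integral {0..\<eta>} (?q (i + n0))" for i
    by (rule integral_spike[OF N]) auto
  moreover have "integral {0..\<eta>} (\<lambda>\<tau>. if \<tau> \<in> N then 0 else w' \<tau> * f (x + \<tau>)) = integral {0..\<eta>} (\<lambda>\<tau>. w' \<tau> * f (x + \<tau>))"
    by (rule integral_spike[OF N]) auto
  ultimately have "(\<lambda>i. integral {0..\<eta>} (?q i)) \<longlonglongrightarrow> integral {0..\<eta>} (\<lambda>\<tau>. w' \<tau> * f (x + \<tau>))"
    using LIMSEQ_offset[of "\<lambda>i. integral {0..\<eta>} (?q i)" n0] by simp
  moreover have "integral {0..\<eta>} (?q i) = (integral {0..\<eta>} (\<lambda>\<tau>. w' \<tau> * ?P (X i + \<tau>)) - integral {0..\<eta>} (\<lambda>\<tau>. w' \<tau> * ?P (x + \<tau>))) / (X i - x)" for i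
  proof -
    have "(\<lambda>\<tau>. w' \<tau> * ?P (z + \<tau>)) integrable_on {0..\<eta>}" for z
      by (intro integrable_continuous_interval continuous_intros w' f)
    then have "integral {0..\<eta>} (\<lambda>\<tau>. w' \<tau> * ?P (X i + \<tau>)) - integral {0..\<eta>} (\<lambda>\<tau>. w' \<tau> * ?P (x + \<tau>)) =
       integral {0..\<eta>} (\<lambda>\<tau>. w' \<tau> * ?P (X i + \<tau>) - w' \<tau> * ?P (x + \<tau>))" by (simp add: integral_diff)
    moreover have "integral {0..\<eta>} (?q i) = integral {0..\<eta>} (\<lambda>\<tau>. (w' \<tau> * ?P (X i + \<tau>) - w' \<tau> * ?P (x + \<tau>)) / (X i - x))"
      by (simp add: right_diff_distrib diff_divide_distrib)
    ultimately show ?thesis by simp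
  qed
  ultimately show "((\<lambda>y. (integral {0..\<eta>} (\<lambda>\<tau>. w' \<tau> * ?P (y + \<tau>)) - integral {0..\<eta>} (\<lambda>\<tau>. w' \<tau> * ?P (x + \<tau>))) / (y - x)) \<circ> X)
     \<longlonglongrightarrow> integral {0..\<eta>} (\<lambda>\<tau>. w' \<tau> * f (x + \<tau>))"
    unfolding o_def by (simp only:)
qed

section \<open>Slices, bounds and measurability on the half plane; continuity in time with values in
  L1\<close>

lemma halfplane_uniform:
  fixes f :: "real \<Rightarrow> real \<Rightarrow> real"
  assumes f: "halfplane_continuous f" and t: "0 \<le> t" and e: "0 < e"
  shows "\<forall>\<^sub>F s in at t within {0..}. \<forall>x\<in>{-k..k}. \<bar>f s x - f t x\<bar> < e"
proof -
  have "compact ({0..t + 1} \<times> {-k..k})" by (intro compact_Times) auto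
  moreover have "continuous_on ({0..t + 1} \<times> {-k..k}) (\<lambda>(t, x). f t x)" by (rule continuous_on_subset[OF f]) auto
  ultimately have "uniformly_continuous_on ({0..t + 1} \<times> {-k..k}) (\<lambda>(t, x). f t x)" by (rule compact_uniformly_continuous[rotated])
  then obtain d where d: "0 < d" "\<And>p q. p \<in> {0..t + 1} \<times> {-k..k} \<Longrightarrow> q \<in> {0..t + 1} \<times> {-k..k} \<Longrightarrow> dist q p < d \<Longrightarrow>
      dist (case q of (t, x) \<Rightarrow> f t x) (case p of (t, x) \<Rightarrow> f t x) < e"
    using e unfolding uniformly_continuous_on_def by metis
  have "\<forall>\<^sub>F s in at t within {0..}. 0 \<le> s \<and> dist s t < min d 1"
    unfolding eventually_at using d(1) by (intro exI[of _ "min d 1"]) auto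
  then show ?thesis
  proof (rule eventually_mono, intro ballI)
    fix s x assume s: "0 \<le> s \<and> dist s t < min d 1" and x: "x \<in> {-k..k}"
    then have "dist (case (s, x) of (t, x) \<Rightarrow> f t x) (case (t, x) of (t, x) \<Rightarrow> f t x) < e"
      using t by (intro d(2)) (auto simp: dist_real_def dist_Pair_Pair)
    then show "\<bar>f s x - f t x\<bar> < e" by (simp add: dist_real_def)
  qed
qed

lemma continuous_on_halfplane_curve:
  assumes f: "halfplane_continuous f"
    and "S \<subseteq> {0..}" "continuous_on S h"
  shows "continuous_on S (\<lambda>t. f t (h t))"
proof -
  have "continuous_on S (\<lambda>t. (t, h t))" using assms by (intro continuous_intros)
  from continuous_on_compose2[OF f this] show ?thesis using assms(2) by fastforce
qed

lemma continuous_on_halfplane_slice: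
  assumes f: "halfplane_continuous f" and "0 \<le> t"
  shows "continuous_on S (f t)"
proof -
  have "continuous_on S (\<lambda>x. (t, x))" by (intro continuous_intros)
  from continuous_on_compose2[OF f this] show ?thesis using assms(2) by auto
qed

lemma bounded_on_halfplane_rectangle:
  fixes f :: "real \<Rightarrow> real \<Rightarrow> real"
  assumes f: "halfplane_continuous f"
  obtains C where "0 \<le> C" "\<And>t x. t \<in> {0..T} \<Longrightarrow> x \<in> {p..q} \<Longrightarrow> \<bar>f t x\<bar> \<le> C"
proof -
  have "compact ((\<lambda>(t, x). f t x) ` ({0..T} \<times> {p..q}))"
    by (intro compact_continuous_image continuous_on_subset[OF f] compact_Times compact_Icc) auto
  from compact_imp_bounded[OF this]
  obtain C where "\<And>t x. t \<in> {0..T} \<Longrightarrow> x \<in> {p..q} \<Longrightarrow> \<bar>f t x\<bar> \<le> C"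
    unfolding bounded_iff by fastforce
  then show ?thesis by (intro that[of "max C 0"]) fastforce+
qed

lemma absolutely_integrable_bounded_borel:
  fixes f :: "real \<Rightarrow> real"
  assumes "f \<in> borel_measurable borel" "\<And>x. x \<in> {a..b} \<Longrightarrow> \<bar>f x\<bar> \<le> C"
  shows "f absolutely_integrable_on {a..b}"
proof (rule measurable_bounded_by_integrable_imp_absolutely_integrable)
  show "f \<in> borel_measurable (lebesgue_on {a..b})"
    using assms(1) by (simp add: borel_measurable_if_D measurable_completion measurable_restrict_space1)
  show "(\<lambda>_. C) integrable_on {a..b}" by (rule integrable_const_ivl)
qed (use assms in auto)

lemma measurable_extend:
  fixes f :: "real \<Rightarrow> real \<Rightarrow> real"
  assumes "(\<lambda>(t, x). f t x) \<in> borel_measurable (restrict_space borel ({0..} \<times> UNIV))"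
  shows "halfplane_measurable f"
proof -
  have "(\<lambda>p. (max 0 (fst p), snd p)) \<in> borel_measurable (borel :: (real \<times> real) measure)"
    by (simp add: borel_prod[symmetric])
  then have "(\<lambda>p. (max 0 (fst p), snd p)) \<in> (borel :: (real \<times> real) measure) \<rightarrow>\<^sub>M restrict_space borel ({0..} \<times> UNIV)"
    by (intro measurable_restrict_space2) auto
  from measurable_compose[OF this assms] show ?thesis by (simp add: case_prod_beta)
qed

lemma slice_measurable:
  fixes f :: "real \<Rightarrow> real \<Rightarrow> real"
  assumes "halfplane_measurable f" "0 \<le> t"
  shows "f t \<in> borel_measurable borel"
proof -
  have "(\<lambda>x. (t, x)) \<in> borel \<rightarrow>\<^sub>M (borel :: (real \<times> real) measure)" by (simp add: borel_prod[symmetric])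
  from measurable_compose[OF this assms(1)] show ?thesis using assms(2) by (simp add: max_absorb2)
qed

lemma continuous_on_extend:
  fixes f :: "real \<Rightarrow> real \<Rightarrow> real"
  assumes "halfplane_continuous f"
  shows "continuous_on UNIV (\<lambda>p. f (max 0 (fst p)) (snd p))"
proof -
  have "continuous_on UNIV (\<lambda>p. (max 0 (fst p), snd p) :: real \<times> real)" by (intro continuous_intros)
  from continuous_on_compose2[OF assms this] show ?thesis by (auto simp: image_subset_iff)
qed

lemma borel_extend:
  fixes f :: "real \<Rightarrow> real \<Rightarrow> real"
  assumes "halfplane_continuous f"
  shows "halfplane_measurable f"
  by (intro borel_measurable_continuous_onI continuous_on_extend assms)

text \<open>The regularity shared by the marker and by the speed \<open>v \<rho> \<omega>\<close>.
  Local bounds are included because they make the class closed under composition with continuous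
  functions.\<close>

definition L1_continuous :: "(real \<Rightarrow> real \<Rightarrow> real) \<Rightarrow> bool" where
  "L1_continuous u \<longleftrightarrow> halfplane_measurable u \<and>
     (\<forall>T k. \<exists>C. \<forall>t\<in>{0..T}. \<forall>x\<in>{-k..k}. \<bar>u t x\<bar> \<le> C) \<and>
     (\<forall>t\<ge>0. \<forall>k. ((\<lambda>s. integral {-k..k} (\<lambda>x. \<bar>u s x - u t x\<bar>)) \<longlongrightarrow> 0) (at t within {0..}))"

lemma L1_continuous_slice: "L1_continuous u \<Longrightarrow> 0 \<le> t \<Longrightarrow> u t \<in> borel_measurable borel"
  unfolding L1_continuous_def using slice_measurable by blast

lemma L1_continuous_bound:
  assumes "L1_continuous u"
  obtains C where "0 \<le> C" "\<And>t x. t \<in> {0..T} \<Longrightarrow> x \<in> {p..q} \<Longrightarrow> \<bar>u t x\<bar> \<le> C"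
proof -
  obtain C where C: "\<And>t x. t \<in> {0..T} \<Longrightarrow> x \<in> {- max \<bar>p\<bar> \<bar>q\<bar>..max \<bar>p\<bar> \<bar>q\<bar>} \<Longrightarrow> \<bar>u t x\<bar> \<le> C"
    using assms unfolding L1_continuous_def by metis
  have "x \<in> {- max \<bar>p\<bar> \<bar>q\<bar>..max \<bar>p\<bar> \<bar>q\<bar>}" if "x \<in> {p..q}" for x using that by auto
  then show ?thesis using C by (intro that[of "max C 0"]) (fastforce intro: order_trans)+
qed

lemma L1_continuous_aint:
  assumes "L1_continuous u" "0 \<le> t"
  shows "u t absolutely_integrable_on {p..q}"
proof -
  obtain C where "\<And>s x. s \<in> {0..t} \<Longrightarrow> x \<in> {p..q} \<Longrightarrow> \<bar>u s x\<bar> \<le> C" using L1_continuous_bound[OF assms(1)] by metis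
  then show ?thesis using assms by (intro absolutely_integrable_bounded_borel L1_continuous_slice) auto
qed

lemma L1_continuous_diff_integrable:
  assumes "L1_continuous u" "0 \<le> s" "0 \<le> t"
  shows "(\<lambda>x. \<bar>u s x - u t x\<bar>) integrable_on {p..q}"
proof -
  have "(\<lambda>x. u s x - u t x) absolutely_integrable_on {p..q}"
    by (rule set_integral_diff(1)) (intro L1_continuous_aint assms)+
  from absolutely_integrable_imp_integrable[OF absolutely_integrable_abs_diff[OF this, of 0]] show ?thesis by simp
qed

lemma L1_continuous_ev:
  assumes "L1_continuous u" "0 \<le> t" "0 < e"
  shows "\<forall>\<^sub>F s in at t within {0..}. integral {-k..k} (\<lambda>x. \<bar>u s x - u t x\<bar>) < e"
proof -
  have "((\<lambda>s. integral {-k..k} (\<lambda>x. \<bar>u s x - u t x\<bar>)) \<longlongrightarrow> 0) (at t within {0..})"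
    using assms unfolding L1_continuous_def by blast
  then show ?thesis using assms(3) by (rule order_tendstoD(2))
qed

lemma L1_continuousI:
  assumes "halfplane_measurable u"
    and "\<And>T k. \<exists>C. \<forall>t\<in>{0..T}. \<forall>x\<in>{-k..k}. \<bar>u t x\<bar> \<le> C"
    and ev: "\<And>t k e. 0 \<le> t \<Longrightarrow> 0 < k \<Longrightarrow> 0 < e \<Longrightarrow> \<forall>\<^sub>F s in at t within {0..}. integral {-k..k} (\<lambda>x. \<bar>u s x - u t x\<bar>) \<le> e"
  shows "L1_continuous u"
  unfolding L1_continuous_def
proof (intro conjI allI impI assms(1,2))
  fix t k :: real assume t: "0 \<le> t"
  show "((\<lambda>s. integral {-k..k} (\<lambda>x. \<bar>u s x - u t x\<bar>)) \<longlongrightarrow> 0) (at t within {0..})"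
  proof (cases "0 < k")
    case True
    have nn: "0 \<le> integral {-k..k} (\<lambda>x. \<bar>u s x - u t x\<bar>)" for s
      by (cases "(\<lambda>x. \<bar>u s x - u t x\<bar>) integrable_on {-k..k}") (auto intro!: integral_nonneg simp: not_integrable_integral)
    show ?thesis
    proof (rule tendstoI)
      fix e :: real assume "0 < e"
      then have "\<forall>\<^sub>F s in at t within {0..}. integral {-k..k} (\<lambda>x. \<bar>u s x - u t x\<bar>) \<le> e / 2" using ev[OF t True, of "e / 2"] by simp
      then show "\<forall>\<^sub>F s in at t within {0..}. dist (integral {-k..k} (\<lambda>x. \<bar>u s x - u t x\<bar>)) 0 < e"
        by (rule eventually_mono) (use nn \<open>0 < e\<close> in \<open>auto simp: dist_real_def\<close>)
    qed
  next
    case False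
    then have "integral {-k..k} f = 0" for f :: "real \<Rightarrow> real" by (cases "k = 0") auto
    then show ?thesis by simp
  qed
qed

lemma L1_continuous_continuous:
  assumes u: "halfplane_continuous u"
  shows "L1_continuous u"
proof (rule L1_continuousI)
  show "halfplane_measurable u" by (rule borel_extend[OF u])
  show "\<exists>C. \<forall>t\<in>{0..T}. \<forall>x\<in>{-k..k}. \<bar>u t x\<bar> \<le> C" for T k
    using bounded_on_halfplane_rectangle[OF u] by metis
  fix t k e :: real assume t: "0 \<le> t" and k: "0 < k" and e: "0 < e"
  have "\<forall>\<^sub>F s in at t within {0..}. \<forall>x\<in>{-k..k}. \<bar>u s x - u t x\<bar> < e / (2 * k)"
    using e k by (intro halfplane_uniform[OF u t]) auto
  moreover have "\<forall>\<^sub>F s in at t within {0..}. 0 \<le> s" by (simp add: eventually_at_filter)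
  ultimately show "\<forall>\<^sub>F s in at t within {0..}. integral {-k..k} (\<lambda>x. \<bar>u s x - u t x\<bar>) \<le> e"
  proof eventually_elim
    case (elim s)
    have "integral {-k..k} (\<lambda>x. \<bar>u s x - u t x\<bar>) \<le> integral {-k..k} (\<lambda>x. e / (2 * k))"
    proof (rule integral_le)
      show "(\<lambda>x. \<bar>u s x - u t x\<bar>) integrable_on {-k..k}"
        by (intro integrable_continuous_interval continuous_intros continuous_on_halfplane_slice[OF u] elim t)
    qed (use elim in \<open>auto intro: less_imp_le\<close>)
    then show ?case using k by simp
  qed
qed

lemma L1_continuous_cong:
  assumes "\<And>t x. 0 \<le> t \<Longrightarrow> u t x = u' t x" and "L1_continuous u"
  shows "L1_continuous u'"
proof -
  have e: "u t x = u' t x" if "0 \<le> t" for t x by (rule assms(1)[OF that])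
  show ?thesis
  proof (rule L1_continuousI)
    show "halfplane_measurable u'" using assms(2) by (simp add: L1_continuous_def e)
    show "\<exists>C. \<forall>t\<in>{0..T}. \<forall>x\<in>{-k..k}. \<bar>u' t x\<bar> \<le> C" for T k
      using L1_continuous_bound[OF assms(2), of T "-k" k] e by (metis atLeastAtMost_iff)
    fix t k d :: real assume t: "0 \<le> t" and d: "0 < d"
    have "\<forall>\<^sub>F s in at t within {0..}. 0 \<le> s" by (simp add: eventually_at_filter)
    with L1_continuous_ev[OF assms(2) t d, of k]
    show "\<forall>\<^sub>F s in at t within {0..}. integral {-k..k} (\<lambda>x. \<bar>u' s x - u' t x\<bar>) \<le> d"
      by eventually_elim (simp add: e t)
  qed
qed

text \<open>Where the arguments move by less than \<open>d\<close>, uniform continuity makes the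
  values change little; elsewhere the change is at most \<open>2 * C\<close>, which is at most
  \<open>2 * C / d\<close> times the distance. The sum of the two bounds holds everywhere and can be
  integrated.\<close>

lemma L1_continuous_compose:
  fixes F :: "real \<times> real \<Rightarrow> real"
  assumes F: "continuous_on UNIV F" and u: "L1_continuous u" and u': "L1_continuous u'"
  shows "L1_continuous (\<lambda>t x. F (u t x, u' t x))"
proof (rule L1_continuousI)
  have "(\<lambda>p. (u (max 0 (fst p)) (snd p), u' (max 0 (fst p)) (snd p))) \<in> borel \<rightarrow>\<^sub>M (borel \<Otimes>\<^sub>M borel)"
    using u u' unfolding L1_continuous_def by (intro measurable_Pair) auto
  then show m: "(\<lambda>p. F (u (max 0 (fst p)) (snd p), u' (max 0 (fst p)) (snd p))) \<in> borel_measurable borel"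
    unfolding borel_prod by (rule measurable_compose) (intro borel_measurable_continuous_onI F)
  have bound: "\<exists>R C. (\<forall>t\<in>{0..T}. \<forall>x\<in>{-k..k}. (u t x, u' t x) \<in> {-R..R} \<times> {-R..R}) \<and> (\<forall>p\<in>{-R..R} \<times> {-R..R}. \<bar>F p\<bar> \<le> C)" for T k
  proof -
    obtain C where C: "\<And>t x. t \<in> {0..T} \<Longrightarrow> x \<in> {-k..k} \<Longrightarrow> \<bar>u t x\<bar> \<le> C" using L1_continuous_bound[OF u] by metis
    obtain C' where C': "\<And>t x. t \<in> {0..T} \<Longrightarrow> x \<in> {-k..k} \<Longrightarrow> \<bar>u' t x\<bar> \<le> C'" using L1_continuous_bound[OF u'] by metis
    let ?Q = "{- max C C'..max C C'} \<times> {- max C C'..max C C'}"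
    have "compact (F ` ?Q)" by (intro compact_continuous_image continuous_on_subset[OF F] compact_Times compact_Icc) auto
    from compact_imp_bounded[OF this] obtain B where "\<And>p. p \<in> ?Q \<Longrightarrow> \<bar>F p\<bar> \<le> B" unfolding bounded_iff by fastforce
    moreover have "(u t x, u' t x) \<in> ?Q" if "t \<in> {0..T}" "x \<in> {-k..k}" for t x using C[OF that] C'[OF that] by auto
    ultimately show ?thesis by blast
  qed
  show "\<exists>C. \<forall>t\<in>{0..T}. \<forall>x\<in>{-k..k}. \<bar>F (u t x, u' t x)\<bar> \<le> C" for T k using bound[of T k] by blast
  fix t k e :: real assume t: "0 \<le> t" and k: "0 < k" and e: "0 < e"
  obtain R C where R: "\<And>s x. s \<in> {0..t+1} \<Longrightarrow> x \<in> {-k..k} \<Longrightarrow> (u s x, u' s x) \<in> {-R..R} \<times> {-R..R}"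
    and C: "\<And>p. p \<in> {-R..R} \<times> {-R..R} \<Longrightarrow> \<bar>F p\<bar> \<le> C" using bound[of "t + 1" k] by blast
  have C0: "0 \<le> C" using C[OF R[of t 0]] t k by fastforce
  have "uniformly_continuous_on ({-R..R} \<times> {-R..R}) F"
    by (intro compact_uniformly_continuous continuous_on_subset[OF F] compact_Times compact_Icc) auto
  then obtain d where d: "0 < d"
    "\<And>p q. p \<in> {-R..R} \<times> {-R..R} \<Longrightarrow> q \<in> {-R..R} \<times> {-R..R} \<Longrightarrow> dist q p < d \<Longrightarrow> dist (F q) (F p) < e / (4 * k)"
    unfolding uniformly_continuous_on_def using e k by (metis divide_pos_pos mult_pos_pos zero_less_numeral)
  define A where "A = 2 * C / d"
  have A: "0 \<le> A" using C0 d by (simp add: A_def)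
  let ?N = "\<lambda>s x. \<bar>u s x - u t x\<bar> + \<bar>u' s x - u' t x\<bar>" and ?F = "\<lambda>s x. F (u s x, u' s x)"
  have pt: "\<bar>?F s x - ?F t x\<bar> \<le> e / (4 * k) + A * ?N s x" if s: "s \<in> {0..t+1}" and x: "x \<in> {-k..k}" for s x
  proof (cases "?N s x < d")
    case True
    have "dist (u s x, u' s x) (u t x, u' t x) \<le> ?N s x"
      using sqrt_sum_squares_le_sum_abs[of "u s x - u t x" "u' s x - u' t x"] by (simp add: dist_Pair_Pair dist_real_def)
    then have "dist (?F s x) (?F t x) < e / (4 * k)" using True t by (intro d(2) R s x) auto
    then show ?thesis using mult_nonneg_nonneg[OF A, of "?N s x"] by (simp add: dist_real_def)
  next
    case False
    have "\<bar>?F s x - ?F t x\<bar> \<le> 2 * C" using C[OF R[OF s x]] C[OF R[of t x]] t x by auto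
    also have "\<dots> = A * d" using d(1) by (simp add: A_def)
    also have "\<dots> \<le> A * ?N s x" using False A by (intro mult_left_mono) auto
    finally show ?thesis using e k by (smt (verit) divide_nonneg_pos)
  qed
  \<comment> \<open>With both L1 distances below \<open>e2\<close>, the term weighted by
    \<open>A\<close> stays below \<open>e / 2\<close>; \<open>A + 1\<close> stands in for
    \<open>A\<close> because \<open>A\<close> may vanish.\<close>
  define e2 where "e2 = e / (4 * (A + 1))"
  have e2: "0 < e2" using e A unfolding e2_def by (intro divide_pos_pos) auto
  have "\<forall>\<^sub>F s in at t within {0..}. 0 \<le> s \<and> dist s t < 1"
    unfolding eventually_at by (intro exI[of _ 1]) auto
  with L1_continuous_ev[OF u t e2, of k] L1_continuous_ev[OF u' t e2, of k]
  show "\<forall>\<^sub>F s in at t within {0..}. integral {-k..k} (\<lambda>x. \<bar>?F s x - ?F t x\<bar>) \<le> e"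
  proof eventually_elim
    case (elim s)
    then have s: "s \<in> {0..t+1}" "0 \<le> s" using t by (auto simp: dist_real_def)
    note i = L1_continuous_diff_integrable[OF u s(2) t] L1_continuous_diff_integrable[OF u' s(2) t]
    have "(\<lambda>x. ?F s x - ?F t x) absolutely_integrable_on {-k..k}"
      by (rule absolutely_integrable_bounded_borel[where C="2 * C"])
         (use slice_measurable[of ?F, OF m] s t C[OF R[OF s(1)]] C[OF R[of t]] in \<open>fastforce intro!: borel_measurable_diff\<close>)+
    then have "(\<lambda>x. \<bar>?F s x - ?F t x\<bar>) integrable_on {-k..k}"
      using absolutely_integrable_imp_integrable[OF absolutely_integrable_abs_diff[of _ _ _ 0]] by simp
    then have "integral {-k..k} (\<lambda>x. \<bar>?F s x - ?F t x\<bar>) \<le> integral {-k..k} (\<lambda>x. e / (4 * k) + A * ?N s x)"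
      by (rule integral_le) (use i pt s in \<open>auto intro!: integrable_add integrable_on_mult_right\<close>)
    also have "\<dots> = e / 2 + A * (integral {-k..k} (\<lambda>x. \<bar>u s x - u t x\<bar>) + integral {-k..k} (\<lambda>x. \<bar>u' s x - u' t x\<bar>))"
      unfolding integral_add[OF i, symmetric]
      using k integrable_on_mult_right[OF integrable_add[OF i], of A] by (subst integral_add) auto
    also have "\<dots> \<le> e / 2 + (A + 1) * (e2 + e2)" using elim A e2 by (intro add_left_mono mult_mono add_mono) (auto intro!: add_nonneg_nonneg integral_nonneg i)
    also have "(A + 1) * (e2 + e2) = 2 * ((A + 1) * e2)" by (simp add: algebra_simps)
    also have "(A + 1) * e2 = e / 4" using A unfolding e2_def by (simp add: divide_simps)
    finally show ?case by simp
  qed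
qed

lemma L1_continuous_mult: "L1_continuous u \<Longrightarrow> L1_continuous u' \<Longrightarrow> L1_continuous (\<lambda>t x. u t x * u' t x)"
  using L1_continuous_compose[of "\<lambda>p. fst p * snd p" u u'] by (simp add: continuous_intros)

lemma L1_continuous_add: "L1_continuous u \<Longrightarrow> L1_continuous u' \<Longrightarrow> L1_continuous (\<lambda>t x. u t x + u' t x)"
  using L1_continuous_compose[of "\<lambda>p. fst p + snd p" u u'] by (simp add: continuous_intros)

lemma L1_continuous_const: "L1_continuous (\<lambda>t x. c)"
  by (intro L1_continuous_continuous) (auto simp: case_prod_beta)

text \<open>Integration turns the L1 distance between two times into a bound uniform in
  \<open>x\<close>. This is why integrals over moving intervals are continuous in time although the
  integrand may jump in space.\<close>

lemma L1_continuous_primitive: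
  assumes u: "L1_continuous u"
  shows "continuous_on ({0..} \<times> UNIV) (\<lambda>(t, x). primitive (u t) x)"
proof (rule continuous_on_halfplane)
  show "continuous_on UNIV (primitive (u t))" if "0 \<le> t" for t
    by (intro continuous_on_primitive L1_continuous_aint u that)
  fix k t e :: real assume k: "0 < k" and t: "0 \<le> t" and e: "0 < e"
  have "\<forall>\<^sub>F s in at t within {0..}. integral {-k..k} (\<lambda>x. \<bar>u s x - u t x\<bar>) < e" by (rule L1_continuous_ev[OF u t e])
  moreover have "\<forall>\<^sub>F s in at t within {0..}. 0 \<le> s" by (simp add: eventually_at_filter)
  ultimately show "\<forall>\<^sub>F s in at t within {0..}. \<forall>x\<in>{-k..k}. \<bar>primitive (u s) x - primitive (u t) x\<bar> < e"
  proof eventually_elim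
    case (elim s)
    show ?case
    proof
      fix x assume x: "x \<in> {-k..k}"
      have main: "\<bar>integral {p..q} (u s) - integral {p..q} (u t)\<bar> < e" if "-k \<le> p" "q \<le> k" for p q
      proof -
        have "integral {p..q} (u s) - integral {p..q} (u t) = integral {p..q} (\<lambda>x. u s x - u t x)"
          by (intro integral_diff[symmetric] absolutely_integrable_imp_integrable L1_continuous_aint u elim t)
        also have "\<bar>\<dots>\<bar> \<le> integral {p..q} (\<lambda>x. \<bar>u s x - u t x\<bar>)"
          by (intro integral_norm_bound_integral[where 'a=real, simplified real_norm_def] L1_continuous_diff_integrable
              integrable_diff absolutely_integrable_imp_integrable L1_continuous_aint u elim t) auto
        also have "\<dots> \<le> integral {-k..k} (\<lambda>x. \<bar>u s x - u t x\<bar>)"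
          using that by (intro integral_subset_le L1_continuous_diff_integrable u elim t) auto
        finally show ?thesis using elim(1) by simp
      qed
      show "\<bar>primitive (u s) x - primitive (u t) x\<bar> < e"
        using main[of 0 x] main[of x 0] x k by (auto simp: primitive_def abs_minus_commute)
    qed
  qed
qed

lemma L1_continuous_moving_integral:
  assumes u: "L1_continuous u" and X: "continuous_on {0..T} X" "continuous_on {0..T} Y" and le: "\<And>t. t \<in> {0..T} \<Longrightarrow> X t \<le> Y t"
  shows "continuous_on {0..T} (\<lambda>t. integral {X t..Y t} (u t))"
proof -
  have "continuous_on {0..T} (\<lambda>t. primitive (u t) (Y t) - primitive (u t) (X t))"
    by (intro continuous_intros continuous_on_halfplane_curve[OF L1_continuous_primitive[OF u]] X) auto
  then show ?thesis
    by (rule continuous_on_eq) (use le in \<open>auto intro!: primitive_diff L1_continuous_aint u\<close>)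
qed

section \<open>The nonlocal velocity\<close>

locale boundary_flow =
  fixes \<eta> a b vbar rb vmax' :: real
    and w rmax \<rho>0 \<omega>0 :: "real \<Rightarrow> real"
    and v \<rho> \<omega> \<rho>bar :: "real \<Rightarrow> real \<Rightarrow> real"
  assumes \<eta>_pos: "0 < \<eta>" and ab: "a + \<eta> < b" and vbar_pos: "0 < vbar"
    and kernel: "nonlocal_kernel \<eta> w"
    and velocity: "velocity_law v rmax"
    and initial: "initial_data rmax a b \<rho>0 \<omega>0"
    and rb_adm: "(rb, \<omega>0 b) \<in> admissible rmax" and v_rb: "v rb (\<omega>0 b) = vbar"
    and solution: "boundary_value_solution \<eta> w v rmax a b vbar rb \<rho>0 \<omega>0 \<rho> \<omega>"
    and equilibrium: "equilibrium_density v rmax a b vbar \<omega> \<rho>bar"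
    and regular: "C1_H2_loc \<rho>"
    and vmax_neg: "vmax' < 0"
    and vmax: "\<forall>om\<in>\<omega>0 ` {a..b}. \<forall>r\<in>{0..rmax om}. d_rho rmax v r om \<le> vmax'"
begin

definition dw :: "real \<Rightarrow> real" where
  "dw = (SOME w'. continuous_on {0..\<eta>} w' \<and>
     (\<forall>x\<in>{0..\<eta>}. (w has_real_derivative w' x) (at x within {0..\<eta>}) \<and> w' x \<le> 0))"

lemma dw: "continuous_on {0..\<eta>} dw"
  "x \<in> {0..\<eta>} \<Longrightarrow> (w has_real_derivative dw x) (at x within {0..\<eta>})" "x \<in> {0..\<eta>} \<Longrightarrow> dw x \<le> 0"
proof -
  have "\<exists>w'. continuous_on {0..\<eta>} w' \<and>
     (\<forall>x\<in>{0..\<eta>}. (w has_real_derivative w' x) (at x within {0..\<eta>}) \<and> w' x \<le> 0)"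
    using kernel unfolding nonlocal_kernel_def by blast
  from someI_ex[OF this]
  show "continuous_on {0..\<eta>} dw"
    "x \<in> {0..\<eta>} \<Longrightarrow> (w has_real_derivative dw x) (at x within {0..\<eta>})" "x \<in> {0..\<eta>} \<Longrightarrow> dw x \<le> 0"
    unfolding dw_def by auto
qed

lemma w_nonneg: "x \<in> {0..\<eta>} \<Longrightarrow> 0 \<le> w x" and w_integral: "(w has_integral 1) {0..\<eta>}"
  using kernel unfolding nonlocal_kernel_def by auto

lemma w_cont: "continuous_on {0..\<eta>} w"
  using dw(2) by (meson DERIV_continuous continuous_on_eq_continuous_within)

definition rt :: "real \<Rightarrow> real \<Rightarrow> real" where
  "rt = (SOME rt. halfplane_continuous rt \<and>
     (\<forall>t x. 0 \<le> t \<longrightarrow> ((\<lambda>s. \<rho> s x) has_real_derivative rt t x) (at t within {0..})))"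

definition rx :: "real \<Rightarrow> real \<Rightarrow> real" where "rx t = deriv (\<rho> t)"

lemma DERIV_rho_x: "0 \<le> t \<Longrightarrow> (\<rho> t has_real_derivative rx t x) (at x)"
  and rho_cont: "halfplane_continuous \<rho>"
  and rx_cont: "halfplane_continuous rx"
  unfolding rx_def using C1_H2_loc_classical[OF regular] by metis+

lemma rt_cont: "halfplane_continuous rt"
  and DERIV_rho_t: "0 \<le> t \<Longrightarrow> ((\<lambda>s. \<rho> s x) has_real_derivative rt t x) (at t within {0..})"
proof -
  have "\<exists>rt. halfplane_continuous rt \<and>
     (\<forall>t x. 0 \<le> t \<longrightarrow> ((\<lambda>s. \<rho> s x) has_real_derivative rt t x) (at t within {0..}))"
    using C1_H2_loc_classical[OF regular] by metis
  from someI_ex[OF this, folded rt_def]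
  show "halfplane_continuous rt"
    "0 \<le> t \<Longrightarrow> ((\<lambda>s. \<rho> s x) has_real_derivative rt t x) (at t within {0..})" by blast+
qed

abbreviation \<beta> :: "real \<Rightarrow> real" where "\<beta> \<equiv> right_boundary b vbar"

abbreviation V :: "real \<Rightarrow> real \<Rightarrow> real" where "V \<equiv> nonlocal_V \<eta> w v \<rho> \<omega>"

definition g :: "real \<Rightarrow> real \<Rightarrow> real" where "g t x = v (\<rho> t x) (\<omega> t x)"

lemma weak: "weak_solution \<eta> w v rmax \<rho> \<omega>"
  and rho_0: "\<rho> 0 = extend_data a b 0 rb \<rho>0"
  and omega_0: "\<omega> 0 = extend_data a b (\<omega>0 a) (\<omega>0 b) \<omega>0"
  and boundary: "0 < t \<Longrightarrow> \<beta> t \<le> y \<Longrightarrow> \<rho> t y = rb" "0 < t \<Longrightarrow> \<beta> t \<le> y \<Longrightarrow> \<omega> t y = \<omega>0 b"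
  using solution unfolding boundary_value_solution_def by auto

lemma adm: "0 \<le> t \<Longrightarrow> (\<rho> t x, \<omega> t x) \<in> admissible rmax"
  using weak unfolding weak_solution_def by blast

lemma rho_nonneg: "0 \<le> t \<Longrightarrow> 0 \<le> \<rho> t x" and omega_pos: "0 \<le> t \<Longrightarrow> 0 < \<omega> t x" and rho_le_rmax: "0 \<le> t \<Longrightarrow> \<rho> t x \<le> rmax (\<omega> t x)"
  using adm[of t x] unfolding admissible_def by auto

definition M where "M = (SOME M. \<forall>t\<ge>0. \<forall>x. \<omega> t x \<le> M)"

lemma omega_le_M: "0 \<le> t \<Longrightarrow> \<omega> t x \<le> M"
proof -
  have "\<exists>M. \<forall>t\<ge>0. \<forall>x. \<omega> t x \<le> M" using weak unfolding weak_solution_def by blast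
  from someI_ex[OF this] show "0 \<le> t \<Longrightarrow> \<omega> t x \<le> M" unfolding M_def by blast
qed

lemma M_pos: "0 < M" using omega_pos[of 0 0] omega_le_M[of 0 0] by simp

lemma omega_measurable: "halfplane_measurable \<omega>"
  using weak unfolding weak_solution_def by (auto intro: measurable_extend)

lemma v_cont: "continuous_on ({0..} \<times> {0..}) (\<lambda>(r, om). v r om)"
  using velocity unfolding velocity_law_def by blast

text \<open>\<open>v\<close> is continuous on the closed quadrant only; clamping the arguments gives
  a continuous function on the plane, as \<open>L1_continuous_compose\<close> requires.\<close>

definition vc :: "real \<times> real \<Rightarrow> real" where "vc p = v (max 0 (fst p)) (max 0 (snd p))"

lemma vc_cont: "continuous_on UNIV vc"
proof -
  have "continuous_on UNIV (\<lambda>p. (max 0 (fst p), max 0 (snd p)) :: real \<times> real)" by (intro continuous_intros)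
  from continuous_on_compose2[OF v_cont this] show ?thesis by (auto simp: vc_def[abs_def] image_subset_iff)
qed

lemma g_vc: "0 \<le> t \<Longrightarrow> g t x = vc (\<rho> t x, \<omega> t x)"
  using rho_nonneg[of t x] omega_pos[of t x] by (simp add: g_def vc_def max_absorb2)

lemma g_nonneg: "0 \<le> t \<Longrightarrow> 0 \<le> g t x"
  using velocity adm[of t x] unfolding velocity_law_def g_def by auto

lemma omega_L1: "0 \<le> t \<Longrightarrow> ((\<lambda>s. integral {-k..k} (\<lambda>x. \<bar>\<omega> s x - \<omega> t x\<bar>)) \<longlongrightarrow> 0) (at t within {0..})"
proof -
  assume t: "0 \<le> t"
  show ?thesis
  proof (cases "k > 0")
    case True then show ?thesis using weak t unfolding weak_solution_def by blast
  next
    case False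
    then have "integral {-k..k} f = 0" for f :: "real \<Rightarrow> real" by (cases "k = 0") auto
    then show ?thesis by simp
  qed
qed

lemma L1_continuous_omega: "L1_continuous \<omega>"
proof -
  have "\<bar>\<omega> t x\<bar> \<le> M" if "0 \<le> t" for t x using omega_pos[OF that, of x] omega_le_M[OF that, of x] by simp
  then show ?thesis unfolding L1_continuous_def using omega_measurable omega_L1 by (auto intro!: exI[of _ M])
qed

lemma L1_continuous_g: "L1_continuous g"
  by (rule L1_continuous_cong[OF _ L1_continuous_compose[OF vc_cont L1_continuous_continuous[OF rho_cont] L1_continuous_omega]])
     (simp add: g_vc)

lemmas g_bounded = L1_continuous_bound[OF L1_continuous_g]
  and g_aint = L1_continuous_aint[OF L1_continuous_g]
  and omega_aint = L1_continuous_aint[OF L1_continuous_omega]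

lemma g_measurable: "halfplane_measurable g"
  using L1_continuous_g by (simp add: L1_continuous_def)

lemma V_eq: "V t x = integral {x..x + \<eta>} (\<lambda>y. w (y - x) * g t y)"
  by (simp add: nonlocal_V_def g_def)

lemma V_primitive: "0 \<le> t \<Longrightarrow> V t x = w \<eta> * (primitive (g t) (x + \<eta>) - primitive (g t) x) -
    integral {0..\<eta>} (\<lambda>\<tau>. dw \<tau> * (primitive (g t) (x + \<tau>) - primitive (g t) x))"
  unfolding V_eq using \<eta>_pos dw g_aint by (intro kernel_integral_eq) auto

lemma w_shift_cont: "continuous_on {x..x + \<eta>} (\<lambda>y. w (y - x))"
  by (rule continuous_on_compose2[OF w_cont]) (auto intro!: continuous_intros)

lemma wg_integrable: "0 \<le> t \<Longrightarrow> (\<lambda>y. w (y - x) * g t y) integrable_on {x..x + \<eta>}"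
  using absolutely_integrable_imp_integrable[OF absolutely_integrable_mult_continuous[OF g_aint w_shift_cont]] by (simp add: mult.commute)

lemma V_nonneg: "0 \<le> t \<Longrightarrow> 0 \<le> V t x"
  unfolding V_eq by (intro integral_nonneg wg_integrable) (auto intro!: mult_nonneg_nonneg w_nonneg g_nonneg)

text \<open>Only the size of \<open>g\<close> enters, through the Lipschitz bound for its primitive.
  Hence characteristics are well defined although the speed under the integral may be
  discontinuous.\<close>

lemma V_lipschitz: obtains L where "0 \<le> L"
  "\<And>t x y. t \<in> {0..T} \<Longrightarrow> x \<in> {p..q} \<Longrightarrow> y \<in> {p..q} \<Longrightarrow> \<bar>V t x - V t y\<bar> \<le> L * \<bar>x - y\<bar>"
proof -
  obtain C where C: "0 \<le> C" "\<And>s x. s \<in> {0..T} \<Longrightarrow> x \<in> {p..q + \<eta>} \<Longrightarrow> \<bar>g s x\<bar> \<le> C" using g_bounded by metis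
  have "bounded (dw ` {0..\<eta>})" by (intro compact_imp_bounded compact_continuous_image dw) auto
  then obtain D where D: "\<And>\<tau>. \<tau> \<in> {0..\<eta>} \<Longrightarrow> \<bar>dw \<tau>\<bar> \<le> D" unfolding bounded_iff by force
  have D0: "0 \<le> D" using D[of 0] \<eta>_pos by auto
  have w0: "0 \<le> w \<eta>" using w_nonneg \<eta>_pos by auto
  show ?thesis
  proof (rule that[of "2 * C * w \<eta> + \<eta> * (D * (2 * C))"])
    show "0 \<le> 2 * C * w \<eta> + \<eta> * (D * (2 * C))" using C(1) D0 w0 \<eta>_pos by simp
    fix t x y assume t: "t \<in> {0..T}" and x: "x \<in> {p..q}" and y: "y \<in> {p..q}"
    have t0: "0 \<le> t" using t by simp
    let ?P = "primitive (g t)"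
    have P: "\<bar>?P (x + \<tau>) - ?P (y + \<tau>)\<bar> \<le> C * \<bar>x - y\<bar>" if "\<tau> \<in> {0..\<eta>}" for \<tau>
      using primitive_lipschitz[OF g_aint[OF t0], of p "q + \<eta>" C "y + \<tau>" "x + \<tau>"] C(2)[OF t] that x y by auto
    have P0: "\<bar>?P x - ?P y\<bar> \<le> C * \<bar>x - y\<bar>" using P[of 0] \<eta>_pos by simp
    have i: "(\<lambda>\<tau>. dw \<tau> * (?P (z + \<tau>) - ?P z)) integrable_on {0..\<eta>}" for z
      by (intro integrable_continuous_interval continuous_intros dw g_aint t0)
    have I: "integral {0..\<eta>} (\<lambda>\<tau>. dw \<tau> * (?P (x + \<tau>) - ?P x)) - integral {0..\<eta>} (\<lambda>\<tau>. dw \<tau> * (?P (y + \<tau>) - ?P y))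
      = integral {0..\<eta>} (\<lambda>\<tau>. dw \<tau> * (?P (x + \<tau>) - ?P x) - dw \<tau> * (?P (y + \<tau>) - ?P y))"
      using i by (simp add: integral_diff)
    have "\<bar>\<dots>\<bar> \<le> integral {0..\<eta>} (\<lambda>\<tau>. D * (2 * C * \<bar>x - y\<bar>))"
    proof (intro integral_norm_bound_integral[where 'a=real, simplified real_norm_def] integrable_diff i)
      fix \<tau> assume \<tau>: "\<tau> \<in> {0..\<eta>}"
      have "\<bar>(?P (x + \<tau>) - ?P x) - (?P (y + \<tau>) - ?P y)\<bar> \<le> 2 * C * \<bar>x - y\<bar>" using P[OF \<tau>] P0 by (simp add: abs_le_iff)
      then have "\<bar>dw \<tau>\<bar> * \<bar>(?P (x + \<tau>) - ?P x) - (?P (y + \<tau>) - ?P y)\<bar> \<le> D * (2 * C * \<bar>x - y\<bar>)"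
        using D[OF \<tau>] D0 by (intro mult_mono) auto
      then show "\<bar>dw \<tau> * (?P (x + \<tau>) - ?P x) - dw \<tau> * (?P (y + \<tau>) - ?P y)\<bar> \<le> D * (2 * C * \<bar>x - y\<bar>)"
        by (simp add: right_diff_distrib[symmetric] abs_mult)
    qed auto
    then have 1: "\<bar>integral {0..\<eta>} (\<lambda>\<tau>. dw \<tau> * (?P (x + \<tau>) - ?P x)) - integral {0..\<eta>} (\<lambda>\<tau>. dw \<tau> * (?P (y + \<tau>) - ?P y))\<bar>
      \<le> \<eta> * (D * (2 * C)) * \<bar>x - y\<bar>" using \<eta>_pos unfolding I by (simp add: mult_ac)
    have "\<bar>(?P (x + \<eta>) - ?P x) - (?P (y + \<eta>) - ?P y)\<bar> \<le> 2 * C * \<bar>x - y\<bar>" using P[of \<eta>] P0 \<eta>_pos by (simp add: abs_le_iff)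
    then have "w \<eta> * \<bar>(?P (x + \<eta>) - ?P x) - (?P (y + \<eta>) - ?P y)\<bar> \<le> w \<eta> * (2 * C * \<bar>x - y\<bar>)" using w0 by (intro mult_left_mono)
    then have "\<bar>w \<eta> * (?P (x + \<eta>) - ?P x) - w \<eta> * (?P (y + \<eta>) - ?P y)\<bar> \<le> 2 * C * w \<eta> * \<bar>x - y\<bar>"
      using w0 by (simp add: right_diff_distrib[symmetric] abs_mult mult_ac)
    with 1 show "\<bar>V t x - V t y\<bar> \<le> (2 * C * w \<eta> + \<eta> * (D * (2 * C))) * \<bar>x - y\<bar>"
      unfolding V_primitive[OF t0] by (simp add: distrib_right abs_le_iff)
  qed
qed

lemma V_cont: "halfplane_continuous V"
proof -
  have P: "continuous_on S (\<lambda>p. primitive (g (f p)) (h p))"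
    if "continuous_on S f" "continuous_on S h" "\<And>p. p \<in> S \<Longrightarrow> 0 \<le> f p" for S :: "'a::topological_space set" and f h
    using continuous_on_compose2[OF L1_continuous_primitive[OF L1_continuous_g] continuous_on_Pair[OF that(1,2)]] that(3) by auto
  have "continuous_on (({0..} \<times> UNIV) \<times> cbox 0 \<eta>)
      (\<lambda>(p, \<tau>). dw \<tau> * (primitive (g (fst p)) (snd p + \<tau>) - primitive (g (fst p)) (snd p)))"
    unfolding case_prod_unfold by (intro continuous_intros P continuous_on_compose2[OF dw(1)]) auto
  from integral_continuous_on_param[OF this]
  have "continuous_on ({0..} \<times> UNIV) (\<lambda>p. w \<eta> * (primitive (g (fst p)) (snd p + \<eta>) - primitive (g (fst p)) (snd p)) -
      integral {0..\<eta>} (\<lambda>\<tau>. dw \<tau> * (primitive (g (fst p)) (snd p + \<tau>) - primitive (g (fst p)) (snd p))))"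
    by (intro continuous_intros P) auto
  then show ?thesis by (rule continuous_on_eq) (auto simp: V_primitive)
qed

text \<open>The formal derivative of the expression in \<open>V_primitive\<close>, defined at every
  point through the values of \<open>g\<close>; it is the derivative of \<open>V t\<close> off a
  null set.\<close>

definition Vx :: "real \<Rightarrow> real \<Rightarrow> real" where
  "Vx t x = w \<eta> * (g t (x + \<eta>) - g t x) - integral {0..\<eta>} (\<lambda>\<tau>. dw \<tau> * (g t (x + \<tau>) - g t x))"

lemma dwg_integrable: "0 \<le> t \<Longrightarrow> (\<lambda>\<tau>. dw \<tau> * g t (x + \<tau>)) integrable_on {0..\<eta>}"
  using absolutely_integrable_imp_integrable[OF absolutely_integrable_mult_continuous[OF absolutely_integrable_shift_real[OF g_aint] dw(1)]]
  by (simp add: mult.commute)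

text \<open>The convolution part is differentiable everywhere; outside of it the primitive of
  \<open>g\<close> is evaluated only at \<open>x\<close> and at \<open>x + \<eta>\<close>, so its
  derivatives are required at these two points.\<close>

lemma DERIV_V:
  assumes t: "0 \<le> t" and P: "(primitive (g t) has_real_derivative g t x) (at x)"
    "(primitive (g t) has_real_derivative g t (x + \<eta>)) (at (x + \<eta>))"
  shows "(V t has_real_derivative Vx t x) (at x)"
proof -
  let ?P = "primitive (g t)"
  obtain C where C: "\<And>s y. s \<in> {0..t} \<Longrightarrow> y \<in> {x - 1..x + \<eta> + 1} \<Longrightarrow> \<bar>g s y\<bar> \<le> C" using g_bounded by metis
  have i: "dw integrable_on {0..\<eta>}" by (intro integrable_continuous_interval dw)
  have iP: "(\<lambda>\<tau>. dw \<tau> * ?P (z + \<tau>)) integrable_on {0..\<eta>}" for z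
    by (intro integrable_continuous_interval continuous_intros dw g_aint t)
  have Veq: "V t = (\<lambda>y. w \<eta> * (?P (y + \<eta>) - ?P y) - (integral {0..\<eta>} (\<lambda>\<tau>. dw \<tau> * ?P (y + \<tau>)) - integral {0..\<eta>} dw * ?P y))"
    using iP i unfolding V_primitive[OF t] by (intro ext) (simp add: right_diff_distrib integral_diff integrable_on_mult_left)
  have Vxeq: "Vx t x = w \<eta> * (g t (x + \<eta>) - g t x) - (integral {0..\<eta>} (\<lambda>\<tau>. dw \<tau> * g t (x + \<tau>)) - integral {0..\<eta>} dw * g t x)"
    unfolding Vx_def using dwg_integrable[OF t] i by (simp add: right_diff_distrib integral_diff integrable_on_mult_left)
  have P2: "((\<lambda>y. ?P (y + \<eta>)) has_real_derivative g t (x + \<eta>)) (at x)"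
    using P(2) DERIV_shift[of ?P "g t (x + \<eta>)" x \<eta>] by simp
  show ?thesis unfolding Veq Vxeq
  proof (intro DERIV_diff DERIV_cmult P P2)
    show "((\<lambda>y. integral {0..\<eta>} (\<lambda>\<tau>. dw \<tau> * ?P (y + \<tau>))) has_real_derivative integral {0..\<eta>} (\<lambda>\<tau>. dw \<tau> * g t (x + \<tau>))) (at x)"
      using t \<eta>_pos by (intro DERIV_convolution_primitive[where C=C] dw g_aint C) auto
  qed
qed

lemma ae_DERIV_V: "0 \<le> t \<Longrightarrow> negligible {x. \<not> (V t has_real_derivative Vx t x) (at x)}"
proof -
  assume t: "0 \<le> t"
  let ?N = "{x. \<not> (primitive (g t) has_real_derivative g t x) (at x)}"
  have N: "negligible ?N" by (rule ae_DERIV_primitive[OF g_aint[OF t]])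
  have "{x. \<not> (V t has_real_derivative Vx t x) (at x)} \<subseteq> ?N \<union> {x. x + \<eta> \<in> ?N}" using DERIV_V[OF t] by blast
  then show ?thesis using N negligible_translation_real[OF N, of \<eta>] negligible_subset negligible_Un by blast
qed

end

text \<open>A weak identity tested with functions of time becomes an increment formula: Fubini's
  theorem reduces it to one variable, and \<open>weak_derivative_increment\<close> evaluates it
  between two times. \<open>F1\<close> is the transported quantity and \<open>F2\<close> its rate;
  the spatial test function is already part of both.\<close>

lemma halfplane_weak_increment:
  fixes F1 F2 :: "real \<Rightarrow> real \<Rightarrow> real"
  assumes m1: "halfplane_measurable F1"
    and m2: "halfplane_measurable F2"
    and b: "\<And>t x. t \<in> {0..q} \<Longrightarrow> \<bar>F1 t x\<bar> \<le> C \<and> \<bar>F2 t x\<bar> \<le> C"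
    and z: "\<And>t x. t \<in> {0..q} \<Longrightarrow> x \<notin> {-k..k} \<Longrightarrow> F1 t x = 0 \<and> F2 t x = 0"
    and weak: "\<And>\<theta> \<theta>'. \<lbrakk>\<And>t. (\<theta> has_real_derivative \<theta>' t) (at t); continuous_on UNIV \<theta>';
        \<exists>p' q'. 0 < p' \<and> q' < q \<and> (\<forall>t. t \<notin> {p'..q'} \<longrightarrow> \<theta> t = 0 \<and> \<theta>' t = 0)\<rbrakk>
        \<Longrightarrow> integral ({0..} \<times> UNIV) (\<lambda>(t, x). F1 t x * \<theta>' t + F2 t x * \<theta> t) = 0"
    and cont: "continuous_on {0..q} (\<lambda>t. integral {-k..k} (F1 t))"
    and st: "0 \<le> s" "s \<le> t" "t < q"
  shows "integral {-k..k} (F1 t) - integral {-k..k} (F1 s) = integral {s..t} (\<lambda>\<tau>. integral {-k..k} (F2 \<tau>)) \<and>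
    (\<lambda>\<tau>. integral {-k..k} (F2 \<tau>)) integrable_on {s..t}"
proof -
  define K where "K t = integral {-k..k} (F1 t)" for t
  define B where "B t = integral {-k..k} (F2 t)" for t
  have C0: "0 \<le> C" using b[of 0 0] st by auto
  define G where "G p = indicator {0..q} (fst p) * F2 (max 0 (fst p)) (snd p)" for p
  have Gm: "G \<in> borel_measurable borel" unfolding G_def
    by (intro borel_measurable_times m2 measurable_compose[OF _ borel_measurable_indicator]) (auto simp: borel_prod[symmetric])
  have "(\<lambda>t. integral {-k..k} (\<lambda>x. G (t, x))) absolutely_integrable_on {0..q}"
    by (rule integral_halfplane_iterated(2)[OF Gm, where C=C])
      (use b z C0 in \<open>auto simp: G_def indicator_def max_absorb2\<close>)
  then have B: "B absolutely_integrable_on {0..q}"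
    by (rule absolutely_integrable_spike[OF _ negligible_empty]) (auto simp: G_def B_def max_absorb2)
  have inc: "K t - K s = integral {s..t} B" if s: "0 < s" "s \<le> t" for s
  proof (rule weak_derivative_increment[where p=0 and q=q])
    fix \<theta> \<theta>' assume 1: "\<And>t. (\<theta> has_real_derivative \<theta>' t) (at t)" "continuous_on UNIV \<theta>'"
      "\<exists>p' q'. 0 < p' \<and> q' < q \<and> (\<forall>t. t \<notin> {p'..q'} \<longrightarrow> \<theta> t = 0 \<and> \<theta>' t = 0)"
    then obtain p' q' where pq: "0 < p'" "q' < q" "\<And>t. t \<notin> {p'..q'} \<Longrightarrow> \<theta> t = 0 \<and> \<theta>' t = 0" by blast
    have \<theta>c: "continuous_on UNIV \<theta>" using 1(1) by (meson DERIV_isCont continuous_at_imp_continuous_on)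
    define F where "F p = F1 (max 0 (fst p)) (snd p) * \<theta>' (fst p) + F2 (max 0 (fst p)) (snd p) * \<theta> (fst p)" for p
    have "(\<lambda>p. \<theta> (fst p)) \<in> borel_measurable (borel :: (real \<times> real) measure)" "(\<lambda>p. \<theta>' (fst p)) \<in> borel_measurable (borel :: (real \<times> real) measure)"
      using \<theta>c 1(2) by (auto intro!: borel_measurable_continuous_onI continuous_on_compose2[OF \<theta>c] continuous_on_compose2[OF 1(2)] continuous_intros)
    then have Fm: "F \<in> borel_measurable borel" unfolding F_def
      by (intro borel_measurable_times borel_measurable_add m1 m2)
    have "bounded (\<theta> ` {p'..q'})" "bounded (\<theta>' ` {p'..q'})"
      by (auto intro!: compact_imp_bounded compact_continuous_image continuous_on_subset[OF \<theta>c] continuous_on_subset[OF 1(2)])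
    then obtain D1 D2 where D: "\<And>t. t \<in> {p'..q'} \<Longrightarrow> \<bar>\<theta> t\<bar> \<le> D1" "\<And>t. t \<in> {p'..q'} \<Longrightarrow> \<bar>\<theta>' t\<bar> \<le> D2"
      unfolding bounded_iff by (metis imageI real_norm_def)
    have Fb: "\<bar>F p\<bar> \<le> C * \<bar>D2\<bar> + C * \<bar>D1\<bar>" for p
    proof (cases "fst p \<in> {p'..q'}")
      case True
      then have "\<bar>F1 (max 0 (fst p)) (snd p) * \<theta>' (fst p)\<bar> \<le> C * \<bar>D2\<bar>" "\<bar>F2 (max 0 (fst p)) (snd p) * \<theta> (fst p)\<bar> \<le> C * \<bar>D1\<bar>"
        using b[of "max 0 (fst p)" "snd p"] D[of "fst p"] pq C0 unfolding abs_mult by (auto intro!: mult_mono)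
      then show ?thesis unfolding F_def by linarith
    next
      case False then show ?thesis using pq(3)[of "fst p"] C0 by (simp add: F_def)
    qed
    have Fz: "F (t, x) = 0" if "0 \<le> t" "t \<notin> {0..q} \<or> x \<notin> {-k..k}" for t x
    proof (cases "t \<in> {p'..q'}")
      case True
      then have "t \<in> {0..q}" using pq by auto
      then show ?thesis using that z[of t x] by (auto simp: F_def max_absorb2)
    next
      case False then show ?thesis using pq(3)[of t] by (simp add: F_def)
    qed
    have "integral {0..q} (\<lambda>t. integral {-k..k} (\<lambda>x. F (t, x))) = integral ({0..} \<times> UNIV) F"
      by (rule integral_halfplane_iterated(1)[symmetric, OF Fm Fb Fz])
    also have "\<dots> = integral ({0..} \<times> UNIV) (\<lambda>(t, x). F1 t x * \<theta>' t + F2 t x * \<theta> t)"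
      by (intro integral_cong) (auto simp: F_def max_absorb2)
    also have "\<dots> = 0" by (rule weak[OF 1])
    also have "integral {0..q} (\<lambda>t. integral {-k..k} (\<lambda>x. F (t, x))) = integral {0..q} (\<lambda>t. K t * \<theta>' t + B t * \<theta> t)"
    proof (intro integral_cong)
      fix t assume t: "t \<in> {0..q}"
      have "F1 t \<in> borel_measurable borel" "F2 t \<in> borel_measurable borel"
        using measurable_compose[OF _ m1, of "\<lambda>x. (t, x)" borel] measurable_compose[OF _ m2, of "\<lambda>x. (t, x)" borel] t
        by (simp_all add: borel_prod[symmetric] max_absorb2)
      then have "F1 t absolutely_integrable_on {-k..k}" "F2 t absolutely_integrable_on {-k..k}"
        using b t by (auto intro!: absolutely_integrable_bounded_borel[where C=C])
      then have "(\<lambda>x. F1 t x * \<theta>' t) integrable_on {-k..k}" "(\<lambda>x. F2 t x * \<theta> t) integrable_on {-k..k}"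
        by (auto intro!: integrable_on_mult_left absolutely_integrable_imp_integrable)
      then show "integral {-k..k} (\<lambda>x. F (t, x)) = K t * \<theta>' t + B t * \<theta> t"
        using t by (simp add: F_def max_absorb2 integral_add K_def B_def)
    qed
    finally show "integral {0..q} (\<lambda>t. K t * \<theta>' t + B t * \<theta> t) = 0" .
  next
    show "K absolutely_integrable_on {0..q}"
      using absolutely_integrable_continuous_real[OF cont] by (simp add: K_def[abs_def])
    fix x e :: real assume "x = s \<or> x = t" "0 < e"
    then show "\<exists>d>0. \<forall>h. 0 < h \<and> h < d \<longrightarrow> integral {x - h..x + h} (\<lambda>y. \<bar>K y - K x\<bar>) < e * h"
      using s st by (intro continuous_lebesgue_point[where p=0 and q=q]) (auto simp: K_def[abs_def] cont)
  qed (use B s st in auto)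
  have Bi: "B integrable_on {x..y}" if "0 \<le> x" "y \<le> q" for x y
    using absolutely_integrable_imp_integrable[OF B] that by (auto intro: integrable_on_subinterval)
  have "K t - K s = integral {s..t} B"
  \<comment> \<open>The test functions vanish near time zero, so the formula at \<open>s = 0\<close>
    is the limit of the formulas for positive \<open>s\<close>, by continuity of both sides.\<close>
  proof (cases "s = 0")
    case False then show ?thesis using inc[of s] st by auto
  next
    case s0: True
    show ?thesis
    proof (cases "t = 0")
      case True then show ?thesis using s0 by simp
    next
      case False
      then have t: "0 < t" using st by auto
      define H where "H r = K r + (integral {0..t} B - integral {0..r} B) - K t" for r
      have Hc: "continuous_on {0..t} H" unfolding H_def
        using st Bi t by (intro continuous_intros indefinite_integral_continuous_1 continuous_on_subset[OF cont[folded K_def]]) auto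
      have H0: "H r = 0" if r: "0 < r" "r \<le> t" for r
        using inc[of r] r st Bi integral_split[of 0 r t B] by (auto simp: H_def)
      have "(H \<longlongrightarrow> H 0) (at 0 within {0..t})" using Hc t by (simp add: continuous_on)
      moreover have "(H \<longlongrightarrow> 0) (at 0 within {0..t})"
        by (rule tendsto_eventually) (auto simp: eventually_at_filter H0)
      moreover have "at 0 within {0..t} \<noteq> bot" using t by (simp add: trivial_limit_within islimpt_Icc)
      ultimately have "H 0 = 0" using tendsto_unique by blast
      then show ?thesis using s0 by (simp add: H_def)
    qed
  qed
  then show ?thesis using Bi[of s t] st by (simp add: K_def B_def[abs_def])
qed

text \<open>For continuous \<open>U\<close> the inequality for an increment follows from nearby
  rational ones. With countably many conditions, the set of points where a measurable candidate is
  the derivative becomes measurable.\<close>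

lemma DERIV_iff_rational:
  fixes U :: "real \<Rightarrow> real"
  assumes U: "continuous_on UNIV U"
  shows "(U has_real_derivative D) (at x) \<longleftrightarrow>
    (\<forall>n::nat. \<exists>m::nat. \<forall>q\<in>\<rat>. \<bar>q\<bar> < 1 / Suc m \<longrightarrow> \<bar>U (x + q) - U x - q * D\<bar> \<le> \<bar>q\<bar> / Suc n)" (is "_ \<longleftrightarrow> ?R")
proof
  assume D: "(U has_real_derivative D) (at x)"
  show ?R
  proof
    fix n :: nat
    have "((\<lambda>h. (U (x + h) - U x) / h) \<longlongrightarrow> D) (at 0)" using D by (simp add: DERIV_def)
    then have "\<forall>\<^sub>F h in at 0. dist ((U (x + h) - U x) / h) D < 1 / Suc n" by (rule tendstoD) simp
    then obtain d where d: "0 < d" "\<And>h. h \<noteq> 0 \<Longrightarrow> dist h 0 < d \<Longrightarrow> dist ((U (x + h) - U x) / h) D < 1 / Suc n"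
      unfolding eventually_at by auto
    obtain m where m: "1 / Suc m < d" using d(1) reals_Archimedean[of d] by (auto simp: inverse_eq_divide)
    show "\<exists>m::nat. \<forall>q\<in>\<rat>. \<bar>q\<bar> < 1 / Suc m \<longrightarrow> \<bar>U (x + q) - U x - q * D\<bar> \<le> \<bar>q\<bar> / Suc n"
    proof (intro exI[of _ m] ballI impI)
      fix q :: real assume q: "\<bar>q\<bar> < 1 / Suc m"
      show "\<bar>U (x + q) - U x - q * D\<bar> \<le> \<bar>q\<bar> / Suc n"
      proof (cases "q = 0")
        case False
        have "\<bar>(U (x + q) - U x) / q - D\<bar> \<le> 1 / Suc n" using d(2)[of q] q m False by (simp add: dist_real_def)
        then have "\<bar>q\<bar> * \<bar>(U (x + q) - U x) / q - D\<bar> \<le> \<bar>q\<bar> * (1 / Suc n)" by (intro mult_left_mono) auto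
        moreover have "q * ((U (x + q) - U x) / q - D) = U (x + q) - U x - q * D" using False by (simp add: field_simps)
        ultimately show ?thesis by (simp add: abs_mult[symmetric])
      qed simp
    qed
  qed
next
  assume R: ?R
  show "(U has_real_derivative D) (at x)" unfolding DERIV_def
  proof (rule tendstoI)
    fix e :: real assume e: "0 < e"
    obtain n :: nat where n: "1 / Suc n < e" using e reals_Archimedean[of e] by (auto simp: inverse_eq_divide)
    obtain m :: nat where m: "\<And>q. q \<in> \<rat> \<Longrightarrow> \<bar>q\<bar> < 1 / Suc m \<Longrightarrow> \<bar>U (x + q) - U x - q * D\<bar> \<le> \<bar>q\<bar> / Suc n"
      using R by metis
    have all: "\<bar>U (x + h) - U x - h * D\<bar> \<le> \<bar>h\<bar> / Suc n" if h: "\<bar>h\<bar> < 1 / Suc m" for h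
    proof (rule ccontr)
      assume neg: "\<not> \<bar>U (x + h) - U x - h * D\<bar> \<le> \<bar>h\<bar> / Suc n"
      define W where "W = {h. \<bar>h\<bar> / Suc n < \<bar>U (x + h) - U x - h * D\<bar>} \<inter> {h. \<bar>h\<bar> < 1 / Suc m}"
      have "open W" unfolding W_def
        by (intro open_Int open_Collect_less continuous_intros continuous_on_compose2[OF U]) auto
      moreover have "h \<in> W" using neg h by (simp add: W_def)
      ultimately obtain d where "0 < d" "ball h d \<subseteq> W" by (meson open_contains_ball)
      moreover obtain q where q: "q \<in> \<rat>" "h < q" "q < h + d" using Rats_dense_in_real[of h "h + d"] \<open>0 < d\<close> by auto
      ultimately have "q \<in> W" by (auto simp: dist_real_def subset_iff)
      then show False using m[OF q(1)] by (auto simp: W_def)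
    qed
    show "\<forall>\<^sub>F h in at 0. dist ((U (x + h) - U x) / h) D < e"
      unfolding eventually_at
    proof (intro exI[of _ "1 / Suc m"] conjI ballI impI)
      fix h :: real assume h: "h \<noteq> 0 \<and> dist h 0 < 1 / Suc m"
      then have "\<bar>U (x + h) - U x - h * D\<bar> / \<bar>h\<bar> \<le> 1 / Suc n"
        using all[of h] by (simp add: divide_le_eq)
      moreover have "\<bar>(U (x + h) - U x) / h - D\<bar> = \<bar>U (x + h) - U x - h * D\<bar> / \<bar>h\<bar>"
        using h by (simp add: abs_divide[symmetric] diff_divide_distrib)
      ultimately show "dist ((U (x + h) - U x) / h) D < e" using n by (simp add: dist_real_def)
    qed simp
  qed
qed

section \<open>Measurability of the velocity gradient\<close>

context boundary_flow
begin

text \<open>The gauge integral in \<open>Vx\<close> is rewritten as an integral over Lebesgue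
  measure on the Borel sets, where a jointly measurable integrand has a measurable parametrised
  integral.\<close>

lemma Vx_measurable: "halfplane_measurable Vx"
proof -
  let ?g = "\<lambda>p. g (max 0 (fst p)) (snd p)"
  define I where "I p = (LBINT \<tau>. (indicator {0..\<eta>} \<tau> *\<^sub>R dw \<tau>) * (?g (fst p, snd p + \<tau>) - ?g p))" for p
  have "(\<lambda>(p, \<tau>). (indicator {0..\<eta>} \<tau> *\<^sub>R dw \<tau>) * (?g (fst p, snd p + \<tau>) - ?g p)) \<in> borel_measurable (borel \<Otimes>\<^sub>M lborel)"
  proof -
    have d: "(\<lambda>\<tau>. indicator {0..\<eta>} \<tau> *\<^sub>R dw \<tau>) \<in> borel_measurable borel"
      by (intro borel_measurable_continuous_on_indicator dw) auto
    have "(\<lambda>(p, \<tau>). (fst p, snd p + \<tau>)) \<in> borel_measurable (borel :: ((real \<times> real) \<times> real) measure)"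
      by (intro borel_measurable_continuous_onI) (auto simp: case_prod_beta intro!: continuous_intros)
    from measurable_compose[OF this g_measurable]
    have 1: "(\<lambda>(p, \<tau>). ?g (fst p, snd p + \<tau>)) \<in> borel_measurable borel" by (simp add: case_prod_beta)
    have 2: "(\<lambda>(p, \<tau>). ?g p) \<in> borel_measurable (borel :: ((real \<times> real) \<times> real) measure)"
      using measurable_compose[OF _ g_measurable, of fst "borel :: ((real \<times> real) \<times> real) measure"] by (simp add: case_prod_beta borel_prod[symmetric])
    have 3: "(\<lambda>(p, \<tau>). indicator {0..\<eta>} \<tau> *\<^sub>R dw \<tau>) \<in> borel_measurable (borel :: ((real \<times> real) \<times> real) measure)"
      using measurable_compose[OF _ d, of snd "borel :: ((real \<times> real) \<times> real) measure"] by (simp add: case_prod_beta borel_prod[symmetric])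
    have "(\<lambda>(p, \<tau>). (indicator {0..\<eta>} \<tau> *\<^sub>R dw \<tau>) * (?g (fst p, snd p + \<tau>) - ?g p)) \<in> borel_measurable borel"
      using borel_measurable_times[OF 3 borel_measurable_diff[OF 1 2]] by (simp add: case_prod_beta)
    moreover have "sets (borel \<Otimes>\<^sub>M lborel) = sets (borel :: ((real \<times> real) \<times> real) measure)"
      by (simp add: borel_prod[symmetric] cong: sets_pair_measure_cong)
    ultimately show ?thesis using measurable_cong_sets by blast
  qed
  then have Im: "I \<in> borel_measurable borel" unfolding I_def
    by (rule lborel.borel_measurable_lebesgue_integral)
  have IE: "integral {0..\<eta>} (\<lambda>\<tau>. dw \<tau> * (g t (x + \<tau>) - g t x)) = I (t, x)" if t: "0 \<le> t" for t x
  proof -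
    have "(\<lambda>\<tau>. g t (x + \<tau>) - g t x) absolutely_integrable_on {0..\<eta>}"
    proof (rule set_integral_diff(1))
      show "(\<lambda>\<tau>. g t (x + \<tau>)) absolutely_integrable_on {0..\<eta>}" by (rule absolutely_integrable_shift_real[OF g_aint[OF t]])
      show "(\<lambda>\<tau>. g t x) absolutely_integrable_on {0..\<eta>}" by (rule absolutely_integrable_on_const) simp
    qed
    from absolutely_integrable_mult_continuous[OF this dw(1)]
    have a: "(\<lambda>\<tau>. dw \<tau> * (g t (x + \<tau>) - g t x)) absolutely_integrable_on {0..\<eta>}"
      by (simp add: mult.commute)
    have e: "(\<lambda>\<tau>. indicator {0..\<eta>} \<tau> *\<^sub>R (dw \<tau> * (g t (x + \<tau>) - g t x))) = (\<lambda>\<tau>. (indicator {0..\<eta>} \<tau> *\<^sub>R dw \<tau>) * (g t (x + \<tau>) - g t x))"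
      by auto
    have m: "(\<lambda>\<tau>. (indicator {0..\<eta>} \<tau> *\<^sub>R dw \<tau>) * (g t (x + \<tau>) - g t x)) \<in> borel_measurable borel"
    proof (intro borel_measurable_times borel_measurable_diff borel_measurable_const)
      show "(\<lambda>\<tau>. indicator {0..\<eta>} \<tau> *\<^sub>R dw \<tau>) \<in> borel_measurable borel"
        by (intro borel_measurable_continuous_on_indicator dw) auto
      show "(\<lambda>\<tau>. g t (x + \<tau>)) \<in> borel_measurable borel"
        using slice_measurable[OF g_measurable t] by (rule measurable_compose[rotated]) simp
    qed
    have "integral {0..\<eta>} (\<lambda>\<tau>. dw \<tau> * (g t (x + \<tau>) - g t x)) = (LINT \<tau>:{0..\<eta>}|lebesgue. dw \<tau> * (g t (x + \<tau>) - g t x))"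
      using set_lebesgue_integral_eq_integral(2)[OF a] by simp
    also have "\<dots> = I (t, x)" unfolding set_lebesgue_integral_def I_def e using t m by (simp add: integral_completion max_absorb2)
    finally show ?thesis .
  qed
  have "(\<lambda>p. (fst p, snd p + \<eta>)) \<in> borel_measurable (borel :: (real \<times> real) measure)"
    by (intro borel_measurable_continuous_onI continuous_intros)
  from measurable_compose[OF this g_measurable]
  have "(\<lambda>p. g (max 0 (fst p)) (snd p + \<eta>)) \<in> borel_measurable borel" by simp
  moreover have "(\<lambda>p. I (max 0 (fst p), snd p)) \<in> borel_measurable borel"
    by (rule measurable_compose[OF _ Im]) (intro borel_measurable_continuous_onI continuous_intros)
  ultimately have "(\<lambda>p. w \<eta> * (g (max 0 (fst p)) (snd p + \<eta>) - ?g p) - I (max 0 (fst p), snd p)) \<in> borel_measurable borel"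
    by (intro borel_measurable_diff borel_measurable_times g_measurable) auto
  then show ?thesis unfolding Vx_def by (subst IE) auto
qed

text \<open>The marker equation contains \<open>deriv\<close> under an integral over space and time,
  so the exceptional set must be null in the plane. Each time slice is null; since the set of good
  points is Borel, by \<open>DERIV_iff_rational\<close>, Fubini's theorem applies.\<close>

lemma ae_DERIV_V_joint:
  "negligible {p. 0 \<le> fst p \<and> \<not> (V (fst p) has_real_derivative Vx (fst p) (snd p)) (at (snd p))}"
proof -
  let ?V = "\<lambda>p. V (max 0 (fst p)) (snd p)" and ?N = "\<lambda>p. Vx (max 0 (fst p)) (snd p)"
  define Gd where "Gd p \<longleftrightarrow> (V (max 0 (fst p)) has_real_derivative ?N p) (at (snd p))" for p
  have Gd_iff: "Gd p \<longleftrightarrow> (\<forall>n::nat. \<exists>m::nat. \<forall>q\<in>\<rat>. \<bar>q\<bar> < 1 / Suc m \<longrightarrow> \<bar>?V (fst p, snd p + q) - ?V p - q * ?N p\<bar> \<le> \<bar>q\<bar> / Suc n)" for p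
    unfolding Gd_def using DERIV_iff_rational[OF continuous_on_halfplane_slice[OF V_cont, of "max 0 (fst p)"]] by simp
  have Vs: "(\<lambda>p. ?V (fst p, snd p + q)) \<in> borel_measurable borel" for q
  proof -
    have "(\<lambda>p. (fst p, snd p + q)) \<in> borel_measurable (borel :: (real \<times> real) measure)"
      by (intro borel_measurable_continuous_onI continuous_intros)
    from measurable_compose[OF this borel_extend[OF V_cont]] show ?thesis by simp
  qed
  have A: "{p. \<bar>?V (fst p, snd p + q) - ?V p - q * ?N p\<bar> \<le> \<bar>q\<bar> / Suc n} \<in> sets borel" for q n
    by (rule borel_measurable_le[where M=borel, simplified])
      (intro borel_measurable_abs borel_measurable_diff borel_measurable_times borel_measurable_const Vs borel_extend[OF V_cont] Vx_measurable)+
  have "{p. Gd p} = (\<Inter>n::nat. \<Union>m::nat. \<Inter>q\<in>{q\<in>\<rat>. \<bar>q\<bar> < 1 / Suc m}. {p. \<bar>?V (fst p, snd p + q) - ?V p - q * ?N p\<bar> \<le> \<bar>q\<bar> / Suc n})"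
    by (rule set_eqI) (simp only: Gd_iff mem_Collect_eq INT_iff UN_iff conj_imp_eq_imp_imp UNIV_I, blast)
  also have "\<dots> \<in> sets borel"
  proof (intro sets.countable_INT'' sets.countable_UN'' A)
    show "countable {q\<in>\<rat>. \<bar>q\<bar> < 1 / real (Suc m)}" for m by (rule countable_subset[OF _ countable_rat]) auto
  qed auto
  finally have Gs: "{p. Gd p} \<in> sets borel" .
  have "AE t in lborel. AE x in lborel. Gd (t, x)"
  proof (rule AE_I2)
    fix t :: real
    have n: "negligible {x. \<not> Gd (t, x)}" using ae_DERIV_V[of "max 0 t"] by (simp add: Gd_def)
    have "Pair t \<in> borel \<rightarrow>\<^sub>M (borel :: (real \<times> real) measure)"
      by (intro borel_measurable_continuous_onI continuous_intros)
    from measurable_sets[OF this, of "UNIV - {p. Gd p}"] Gs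
    have "Pair t -` (UNIV - {p. Gd p}) \<in> sets borel" by auto
    moreover have "{x. \<not> Gd (t, x)} = Pair t -` (UNIV - {p. Gd p})" by auto
    ultimately have "{x. \<not> Gd (t, x)} \<in> sets lborel" by simp
    moreover have "emeasure lebesgue {x. \<not> Gd (t, x)} = 0" using n by (simp add: negligible_iff_null_sets null_setsD1)
    ultimately have "{x. \<not> Gd (t, x)} \<in> null_sets lborel" by (auto intro!: null_setsI simp: emeasure_completion)
    then show "AE x in lborel. Gd (t, x)" by (rule AE_I') auto
  qed
  then have "AE p in lborel \<Otimes>\<^sub>M lborel. Gd p"
  proof (intro lborel_pair.AE_pair_measure)
    show "{x \<in> space (lborel \<Otimes>\<^sub>M lborel). Gd x} \<in> sets (lborel \<Otimes>\<^sub>M lborel)"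
      using Gs unfolding lborel_prod by simp
  qed
  then have ae: "AE p in lborel. Gd p" unfolding lborel_prod .
  have "{p. \<not> Gd p} = UNIV - {p. Gd p}" by auto
  then have "{p. \<not> Gd p} \<in> sets lborel" using Gs by simp
  then have "{p. \<not> Gd p} \<in> null_sets lborel" using ae by (simp add: AE_iff_null_sets)
  then have "{p. \<not> Gd p} \<in> null_sets lebesgue" by (rule null_sets_completionI)
  then have "negligible {p. \<not> Gd p}" by (simp add: negligible_iff_null_sets)
  then show ?thesis by (rule negligible_subset) (auto simp: Gd_def max_absorb2)
qed

end

lemma DERIV_within_Icc_unique:
  fixes f :: "real \<Rightarrow> real"
  assumes "(f has_real_derivative D) (at x within {a..b})" "(f has_real_derivative E) (at x within {a..b})" "a < b" "x \<in> {a..b}"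
  shows "D = E"
  using vector_derivative_unique_within_closed_interval[of a b x f D E] assms
  by (simp add: has_real_derivative_iff_has_vector_derivative)

section \<open>The two weak equations as pointwise and integral identities\<close>

context boundary_flow
begin

lemma weak_rho:
  "test_function \<phi> \<phi>t \<phi>x \<Longrightarrow>
    integral ({0..} \<times> UNIV) (\<lambda>(t, x). \<rho> t x * (\<phi>t t x + V t x * \<phi>x t x)) + integral UNIV (\<lambda>x. \<rho> 0 x * \<phi> 0 x) = 0"
  and weak_omega: "test_function \<phi> \<phi>t \<phi>x \<Longrightarrow>
    integral ({0..} \<times> UNIV) (\<lambda>(t, x). \<omega> t x * (\<phi>t t x + deriv (\<lambda>y. V t y * \<phi> t y) x)) + integral UNIV (\<lambda>x. \<omega> 0 x * \<phi> 0 x) = 0"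
  using weak unfolding weak_solution_def by blast+

lemma DERIV_support_zero:
  fixes \<psi> :: "real \<Rightarrow> real"
  assumes "(\<psi> has_real_derivative D) (at x)" "\<And>y. y \<notin> {p..q} \<Longrightarrow> \<psi> y = 0" "x \<notin> {p..q}"
  shows "D = 0"
proof -
  have "(\<psi> has_real_derivative 0) (at x)"
  proof (rule has_field_derivative_transform_within_open[where S="- {p..q}" and f="\<lambda>_. 0"])
  qed (use assms in auto)
  then show ?thesis using assms(1) DERIV_unique by blast
qed

text \<open>The integral of \<open>\<rho> t x * \<psi> x\<close> is differentiated in time in two
  ways: by the weak equation, tested with products \<open>\<theta> t * \<psi> x\<close>, and under
  the integral sign.\<close>

lemma rho_weak_x:
  assumes \<psi>: "\<And>x. (\<psi> has_real_derivative \<psi>' x) (at x)" "continuous_on UNIV \<psi>'"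
    and k: "\<And>x. x \<notin> {-k..k} \<Longrightarrow> \<psi> x = 0" and t: "0 \<le> t"
  shows "integral {-k..k} (\<lambda>x. rt t x * \<psi> x) = integral {-k..k} (\<lambda>x. \<rho> t x * V t x * \<psi>' x)"
proof -
  have k': "\<psi>' x = 0" if "x \<notin> {-k..k}" for x by (rule DERIV_support_zero[OF \<psi>(1) k that])
  have \<psi>c: "continuous_on UNIV \<psi>" using \<psi>(1) by (meson DERIV_isCont continuous_at_imp_continuous_on)
  have \<psi>s: "continuous_on S (\<lambda>p. \<psi> (snd p))" "continuous_on S (\<lambda>p. \<psi>' (snd p))" for S :: "(real \<times> real) set"
    by (auto intro!: continuous_on_compose2[OF \<psi>c] continuous_on_compose2[OF \<psi>(2)] continuous_intros)
  let ?F1 = "\<lambda>t x. \<rho> t x * \<psi> x" and ?F2 = "\<lambda>t x. \<rho> t x * V t x * \<psi>' x"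
  have c1: "continuous_on ({0..} \<times> UNIV) (\<lambda>(t, x). ?F1 t x)" and c2: "continuous_on ({0..} \<times> UNIV) (\<lambda>(t, x). ?F2 t x)"
    and c3: "continuous_on ({0..} \<times> UNIV) (\<lambda>(t, x). rt t x * \<psi> x)"
    using continuous_on_mult[OF rho_cont \<psi>s(1)] continuous_on_mult[OF continuous_on_mult[OF rho_cont V_cont] \<psi>s(2)]
     continuous_on_mult[OF rt_cont \<psi>s(1)] by (simp_all add: case_prod_beta)
  define K where "K t = integral {-k..k} (?F1 t)" for t
  define B where "B t = integral {-k..k} (?F2 t)" for t
  have Kc: "continuous_on {0..} K" and Bc: "continuous_on {0..} B" unfolding K_def B_def
    using integral_continuous_on_param[of "{0..}" "-k" k ?F1] integral_continuous_on_param[of "{0..}" "-k" k ?F2]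
      continuous_on_subset[OF c1] continuous_on_subset[OF c2] by (auto simp: Sigma_mono)
  obtain C1 where C1: "\<And>s x. s \<in> {0..t+1} \<Longrightarrow> x \<in> {-k..k} \<Longrightarrow> \<bar>?F1 s x\<bar> \<le> C1" "0 \<le> C1" using bounded_on_halfplane_rectangle[OF c1] by metis
  obtain C2 where C2: "\<And>s x. s \<in> {0..t+1} \<Longrightarrow> x \<in> {-k..k} \<Longrightarrow> \<bar>?F2 s x\<bar> \<le> C2" "0 \<le> C2" using bounded_on_halfplane_rectangle[OF c2] by metis
  have inc: "K r - K s = integral {s..r} B" if r: "0 \<le> s" "s \<le> r" "r < t + 1" for r s
    unfolding K_def B_def
  proof (rule conjunct1[OF halfplane_weak_increment[where q="t+1" and C="max C1 C2"]])
    show "\<bar>?F1 s x\<bar> \<le> max C1 C2 \<and> \<bar>?F2 s x\<bar> \<le> max C1 C2" if "s \<in> {0..t+1}" for s x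
      using C1(1)[OF that, of x] C2(1)[OF that, of x] k[of x] k'[of x] C1(2) by (cases "x \<in> {-k..k}") (auto simp: le_max_iff_disj)
    show "continuous_on {0..t+1} (\<lambda>t. integral {-k..k} (?F1 t))" using continuous_on_subset[OF Kc] by (auto simp: K_def[abs_def])
    fix \<theta> \<theta>' assume \<theta>: "\<And>t. (\<theta> has_real_derivative \<theta>' t) (at t)" "continuous_on UNIV \<theta>'"
        "\<exists>p' q'. 0 < p' \<and> q' < t+1 \<and> (\<forall>t. t \<notin> {p'..q'} \<longrightarrow> \<theta> t = 0 \<and> \<theta>' t = 0)"
    then obtain p' q' where pq: "0 < p'" "q' < t+1" "\<And>t. t \<notin> {p'..q'} \<Longrightarrow> \<theta> t = 0 \<and> \<theta>' t = 0" by blast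
    have \<theta>c: "continuous_on UNIV \<theta>" using \<theta>(1) by (meson DERIV_isCont continuous_at_imp_continuous_on)
    have "test_function (\<lambda>t x. \<theta> t * \<psi> x) (\<lambda>t x. \<theta>' t * \<psi> x) (\<lambda>t x. \<theta> t * \<psi>' x)"
      unfolding test_function_def
    proof (intro conjI allI)
      show "((\<lambda>s. \<theta> s * \<psi> x) has_real_derivative \<theta>' t * \<psi> x) (at t)" for t x by (intro DERIV_cmult_right \<theta>)
      show "((\<lambda>y. \<theta> t * \<psi> y) has_real_derivative \<theta> t * \<psi>' x) (at x)" for t x by (intro DERIV_cmult \<psi>)
      show "continuous_on UNIV (\<lambda>(t, x). \<theta>' t * \<psi> x)" "continuous_on UNIV (\<lambda>(t, x). \<theta> t * \<psi>' x)"
        unfolding case_prod_beta by (intro continuous_intros \<psi>s continuous_on_compose2[OF \<theta>(2)] continuous_on_compose2[OF \<theta>c]; simp)+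
      show "\<exists>N. \<forall>t x. N \<le> \<bar>t\<bar> \<or> N \<le> \<bar>x\<bar> \<longrightarrow> \<theta> t * \<psi> x = 0"
      proof (intro exI[of _ "\<bar>k\<bar> + \<bar>q'\<bar> + 1"] allI impI)
        fix s x assume *: "\<bar>k\<bar> + \<bar>q'\<bar> + 1 \<le> \<bar>s\<bar> \<or> \<bar>k\<bar> + \<bar>q'\<bar> + 1 \<le> \<bar>x\<bar>"
        then have "s \<notin> {p'..q'} \<or> x \<notin> {-k..k}" using pq(1) by auto
        then show "\<theta> s * \<psi> x = 0" using pq(3) k by auto
      qed
    qed
    from weak_rho[OF this] have "integral ({0..} \<times> UNIV) (\<lambda>(t, x). \<rho> t x * (\<theta>' t * \<psi> x + V t x * (\<theta> t * \<psi>' x))) = 0"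
      using pq(3)[of 0] pq(1) by simp
    then show "integral ({0..} \<times> UNIV) (\<lambda>(t, x). ?F1 t x * \<theta>' t + ?F2 t x * \<theta> t) = 0" by (simp add: algebra_simps)
  qed (use borel_extend[OF c1] borel_extend[OF c2] k k' r in auto)
  have "((\<lambda>r. K 0 + integral {0..r} B) has_real_derivative 0 + B t) (at t within {0..t+1/2})"
    using t by (intro DERIV_add DERIV_const integral_has_derivative_within continuous_on_subset[OF Bc]) auto
  then have "(K has_real_derivative B t) (at t within {0..t+1/2})"
  proof -
    have "K 0 + integral {0..r} B = K r" if "r \<in> {0..t+1/2}" for r using inc[of 0 r] that by auto
    then show ?thesis
      using has_field_derivative_transform_within[OF \<open>((\<lambda>r. K 0 + integral {0..r} B) has_real_derivative 0 + B t) (at t within {0..t+1/2})\<close>, of 1 K] t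
      by simp
  qed
  moreover have "(K has_real_derivative integral {-k..k} (\<lambda>x. rt t x * \<psi> x)) (at t within {0..t+1/2})"
  proof -
    have "((\<lambda>t. integral (cbox (-k) k) (?F1 t)) has_real_derivative integral (cbox (-k) k) (\<lambda>x. rt t x * \<psi> x)) (at t within {0..})"
    proof (rule leibniz_rule_field_derivative)
      show "((\<lambda>t. \<rho> t x * \<psi> x) has_real_derivative rt t x * \<psi> x) (at t within {0..})" if "t \<in> {0..}" for t x
        using that by (intro DERIV_cmult_right DERIV_rho_t) auto
      show "?F1 t integrable_on cbox (-k) k" if "t \<in> {0..}" for t
        using that continuous_on_halfplane_slice[OF c1, of t] by (intro integrable_continuous) auto
      show "continuous_on ({0..} \<times> cbox (-k) k) (\<lambda>(t, x). rt t x * \<psi> x)" by (rule continuous_on_subset[OF c3]) auto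
    qed (use t in auto)
    then show ?thesis unfolding K_def by (auto intro: DERIV_subset)
  qed
  ultimately show ?thesis using DERIV_within_Icc_unique[of K "B t" t 0 "t+1/2"] t unfolding B_def by auto
qed

text \<open>The weak derivative of the flux is the continuous function \<open>- rt\<close>, so the
  flux is differentiable at every point, including those where \<open>V t\<close> is not.\<close>

lemma DERIV_flux:
  assumes t: "0 \<le> t"
  shows "((\<lambda>y. \<rho> t y * V t y) has_real_derivative - rt t x) (at x)"
proof -
  have fc: "continuous_on S (\<lambda>y. \<rho> t y * V t y)" for S
    by (intro continuous_intros continuous_on_halfplane_slice[OF rho_cont t] continuous_on_halfplane_slice[OF V_cont t])
  have rc: "continuous_on S (\<lambda>y. - rt t y)" for S by (intro continuous_intros continuous_on_halfplane_slice[OF rt_cont t])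
  have inc: "\<rho> t y * V t y - \<rho> t z * V t z = integral {z..y} (\<lambda>x. - rt t x)" if "z \<le> y" for z y
  proof (rule weak_derivative_increment[where p="z-1" and q="y+1" and g="\<lambda>y. \<rho> t y * V t y"])
    fix \<psi> \<psi>' assume \<psi>: "\<And>x. (\<psi> has_real_derivative \<psi>' x) (at x)" "continuous_on UNIV \<psi>'"
      "\<exists>p' q'. z-1 < p' \<and> q' < y+1 \<and> (\<forall>x. x \<notin> {p'..q'} \<longrightarrow> \<psi> x = 0 \<and> \<psi>' x = 0)"
    define k where "k = \<bar>z\<bar> + \<bar>y\<bar> + 2"
    have sub: "{z-1..y+1} \<subseteq> {-k..k}" by (auto simp: k_def)
    have o: "\<psi> x = 0 \<and> \<psi>' x = 0" if "x \<notin> {z-1..y+1}" for x using \<psi>(3) that by fastforce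
    then have o2: "\<psi> x = 0" if "x \<notin> {-k..k}" for x using sub that by blast
    have \<psi>c: "continuous_on S \<psi>" "continuous_on S \<psi>'" for S
      using \<psi>(1,2) by (meson DERIV_isCont continuous_at_imp_continuous_on continuous_on_subset subset_UNIV)+
    have "integral {-k..k} (\<lambda>x. rt t x * \<psi> x) = integral {-k..k} (\<lambda>x. \<rho> t x * V t x * \<psi>' x)"
      by (rule rho_weak_x[OF \<psi>(1,2) o2 t])
    moreover have "integral {-k..k} (\<lambda>x. rt t x * \<psi> x) = integral {z-1..y+1} (\<lambda>x. rt t x * \<psi> x)"
      "integral {-k..k} (\<lambda>x. \<rho> t x * V t x * \<psi>' x) = integral {z-1..y+1} (\<lambda>x. \<rho> t x * V t x * \<psi>' x)"
      using o by (auto intro!: integral_eq_on_support[OF sub])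
    moreover have "(\<lambda>x. \<rho> t x * V t x * \<psi>' x) integrable_on {z-1..y+1}" "(\<lambda>x. rt t x * \<psi> x) integrable_on {z-1..y+1}"
      by (intro integrable_continuous_interval continuous_intros fc continuous_on_halfplane_slice[OF rt_cont t] \<psi>c)+
    ultimately show "integral {z-1..y+1} (\<lambda>x. \<rho> t x * V t x * \<psi>' x + - rt t x * \<psi> x) = 0"
      by (simp add: integral_diff)
  next
    fix x e :: real assume "x = z \<or> x = y" "0 < e"
    then show "\<exists>d>0. \<forall>h. 0 < h \<and> h < d \<longrightarrow> integral {x - h..x + h} (\<lambda>y. \<bar>\<rho> t y * V t y - \<rho> t x * V t x\<bar>) < e * h"
      using that by (intro continuous_lebesgue_point[OF fc, of "z-1" x "y+1"]) auto
  qed (use that in \<open>auto intro!: absolutely_integrable_continuous_real fc rc\<close>)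
  have "((\<lambda>y. \<rho> t (x-1) * V t (x-1) + integral {x-1..y} (\<lambda>x. - rt t x)) has_real_derivative 0 + - rt t x) (at x within {x-1..x+1})"
    by (intro DERIV_add DERIV_const integral_has_derivative_within rc) auto
  then have "((\<lambda>y. \<rho> t (x-1) * V t (x-1) + integral {x-1..y} (\<lambda>x. - rt t x)) has_real_derivative - rt t x) (at x)"
    by (simp add: at_within_Icc_at)
  then show ?thesis
  proof (rule has_field_derivative_transform_within_open)
    show "\<rho> t (x-1) * V t (x-1) + integral {x-1..y} (\<lambda>x. - rt t x) = \<rho> t y * V t y" if "y \<in> {x-1<..<x+1}" for y
      using inc[of "x-1" y] that by simp
  qed auto
qed

text \<open>\<open>N\<close> stands for the space derivative of \<open>V * f\<close>. It is
  prescribed off a null set of the plane, on which the value that \<open>deriv\<close> takes in the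
  weak equation does not affect the integral.\<close>

lemma omega_increment:
  fixes f ft fx N :: "real \<Rightarrow> real \<Rightarrow> real"
  assumes c: "halfplane_continuous f" "halfplane_continuous ft"
      "halfplane_continuous fx"
    and Dt: "\<And>t x. 0 < t \<Longrightarrow> t < q \<Longrightarrow> ((\<lambda>s. f s x) has_real_derivative ft t x) (at t)"
    and Dx: "\<And>t x. 0 \<le> t \<Longrightarrow> (f t has_real_derivative fx t x) (at x)"
    and z: "\<And>t x. t \<in> {0..q} \<Longrightarrow> x \<notin> {-k..k} \<Longrightarrow> f t x = 0 \<and> ft t x = 0 \<and> N t x = 0"
    and Nm: "halfplane_measurable N"
    and Nb: "\<And>t x. t \<in> {0..q} \<Longrightarrow> x \<in> {-k..k} \<Longrightarrow> \<bar>N t x\<bar> \<le> C"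
    and neg: "negligible {p. fst p \<in> {0..q} \<and> \<not> ((\<lambda>y. V (fst p) y * f (fst p) y) has_real_derivative N (fst p) (snd p)) (at (snd p))}"
    and st: "0 \<le> s" "s \<le> t" "t < q"
  shows "integral {-k..k} (\<lambda>x. \<omega> t x * f t x) - integral {-k..k} (\<lambda>x. \<omega> s x * f s x) =
    integral {s..t} (\<lambda>\<tau>. integral {-k..k} (\<lambda>x. \<omega> \<tau> x * (ft \<tau> x + N \<tau> x))) \<and>
    (\<lambda>\<tau>. integral {-k..k} (\<lambda>x. \<omega> \<tau> x * (ft \<tau> x + N \<tau> x))) integrable_on {s..t}"
proof -
  obtain C1 where C1: "\<And>s x. s \<in> {0..q} \<Longrightarrow> x \<in> {-k..k} \<Longrightarrow> \<bar>f s x\<bar> \<le> C1" "0 \<le> C1" using bounded_on_halfplane_rectangle[OF c(1)] by metis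
  obtain C2 where C2: "\<And>s x. s \<in> {0..q} \<Longrightarrow> x \<in> {-k..k} \<Longrightarrow> \<bar>ft s x\<bar> \<le> C2" "0 \<le> C2" using bounded_on_halfplane_rectangle[OF c(2)] by metis
  let ?C = "M * C1 + M * (C2 + \<bar>C\<bar>)"
  have fc: "continuous_on UNIV (f t)" if "0 \<le> t" for t using continuous_on_halfplane_slice[OF c(1) that] .
  show ?thesis
  proof (rule halfplane_weak_increment[where q=q and C="?C"])
    fix s x assume s: "s \<in> {0..q}"
    have M: "\<bar>\<omega> s x\<bar> \<le> M" using omega_pos[of s x] omega_le_M[of s x] s by auto
    show "\<bar>\<omega> s x * f s x\<bar> \<le> ?C \<and> \<bar>\<omega> s x * (ft s x + N s x)\<bar> \<le> ?C"
    proof (cases "x \<in> {-k..k}")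
      case True
      have "\<bar>ft s x + N s x\<bar> \<le> C2 + \<bar>C\<bar>" using C2(1)[OF s True] Nb[OF s True] by linarith
      then have "\<bar>\<omega> s x\<bar> * \<bar>f s x\<bar> \<le> M * C1" "\<bar>\<omega> s x\<bar> * \<bar>ft s x + N s x\<bar> \<le> M * (C2 + \<bar>C\<bar>)"
        using C1(1)[OF s True] M M_pos by (auto intro!: mult_mono)
      moreover have "0 \<le> M * C1" "0 \<le> M * (C2 + \<bar>C\<bar>)" using M_pos C1(2) C2(2) by auto
      ultimately show ?thesis unfolding abs_mult by linarith
    next
      case False then show ?thesis using z[OF s False] M_pos C1(2) C2(2) by simp
    qed
    show "\<omega> s x * f s x = 0 \<and> \<omega> s x * (ft s x + N s x) = 0" if "x \<notin> {-k..k}" using z[OF s that] by simp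
  next
    show "(\<lambda>p. \<omega> (max 0 (fst p)) (snd p) * f (max 0 (fst p)) (snd p)) \<in> borel_measurable borel"
      by (intro borel_measurable_times omega_measurable borel_extend c)
    show "(\<lambda>p. \<omega> (max 0 (fst p)) (snd p) * (ft (max 0 (fst p)) (snd p) + N (max 0 (fst p)) (snd p))) \<in> borel_measurable borel"
      by (intro borel_measurable_times borel_measurable_add omega_measurable borel_extend c Nm)
    show "continuous_on {0..q} (\<lambda>t. integral {-k..k} (\<lambda>x. \<omega> t x * f t x))"
    proof (cases "-k \<le> k")
      case True
      then show ?thesis
        by (intro L1_continuous_moving_integral[where X="\<lambda>_. -k" and Y="\<lambda>_. k"] L1_continuous_mult L1_continuous_omega L1_continuous_continuous c continuous_intros) auto
    qed auto
    fix \<theta> \<theta>' assume \<theta>: "\<And>t. (\<theta> has_real_derivative \<theta>' t) (at t)" "continuous_on UNIV \<theta>'"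
        "\<exists>p' q'. 0 < p' \<and> q' < q \<and> (\<forall>t. t \<notin> {p'..q'} \<longrightarrow> \<theta> t = 0 \<and> \<theta>' t = 0)"
    then obtain p' q' where pq: "0 < p'" "q' < q" "\<And>t. t \<notin> {p'..q'} \<Longrightarrow> \<theta> t = 0 \<and> \<theta>' t = 0" by blast
    have \<theta>c: "continuous_on UNIV \<theta>" using \<theta>(1) by (meson DERIV_isCont continuous_at_imp_continuous_on)
    \<comment> \<open>\<open>f\<close> is given for nonnegative times. As \<open>\<theta>\<close>
      vanishes near 0, freezing negative times still yields a C1 test function.\<close>
    let ?\<phi> = "\<lambda>t x. \<theta> t * f (max 0 t) x"
    let ?\<phi>t = "\<lambda>t x. \<theta>' t * f (max 0 t) x + \<theta> t * ft (max 0 t) x"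
    have tf: "test_function ?\<phi> ?\<phi>t (\<lambda>t x. \<theta> t * fx (max 0 t) x)"
      unfolding test_function_def
    proof (intro conjI allI)
      fix t x
      show "((\<lambda>s. \<theta> s * f (max 0 s) x) has_real_derivative ?\<phi>t t x) (at t)"
      proof (cases "t \<in> {p'..q'}")
        case False
        have "((\<lambda>s. \<theta> s * f (max 0 s) x) has_real_derivative 0) (at t)"
          by (rule has_field_derivative_transform_within_open[where S="- {p'..q'}" and f="\<lambda>_. 0"]) (use False pq in auto)
        then show ?thesis using pq(3)[of t] False by simp
      next
        case True
        then have t: "0 < t" "t < q" using pq by auto
        have "((\<lambda>s. f (max 0 s) x) has_real_derivative ft t x) (at t)"
          by (rule has_field_derivative_transform_within_open[OF Dt[OF t], where S="{0<..}"]) (use t in \<open>auto simp: max_absorb2\<close>)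
        from DERIV_mult[OF \<theta>(1) this] show ?thesis using t by (simp add: max_absorb2 mult.commute add.commute)
      qed
      show "((\<lambda>y. \<theta> t * f (max 0 t) y) has_real_derivative \<theta> t * fx (max 0 t) x) (at x)" by (intro DERIV_cmult Dx) auto
    next
      show "continuous_on UNIV (\<lambda>(t, x). ?\<phi>t t x)" "continuous_on UNIV (\<lambda>(t, x). \<theta> t * fx (max 0 t) x)"
        unfolding case_prod_beta
        by (intro continuous_on_add continuous_on_mult continuous_on_extend c continuous_on_compose2[OF \<theta>(2)] continuous_on_compose2[OF \<theta>c] continuous_intros; simp)+
      show "\<exists>N. \<forall>t x. N \<le> \<bar>t\<bar> \<or> N \<le> \<bar>x\<bar> \<longrightarrow> \<theta> t * f (max 0 t) x = 0"
      proof (intro exI[of _ "\<bar>k\<bar> + \<bar>q'\<bar> + 1"] allI impI)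
        fix s x assume *: "\<bar>k\<bar> + \<bar>q'\<bar> + 1 \<le> \<bar>s\<bar> \<or> \<bar>k\<bar> + \<bar>q'\<bar> + 1 \<le> \<bar>x\<bar>"
        then have "s \<notin> {p'..q'} \<or> (s \<in> {p'..q'} \<and> x \<notin> {-k..k})" using pq(1) by auto
        moreover have "max 0 s \<in> {0..q}" if "s \<in> {p'..q'}" using that pq by auto
        ultimately show "\<theta> s * f (max 0 s) x = 0" using pq(3)[of s] z[of "max 0 s" x] by auto
      qed
    qed
    have "integral ({0..} \<times> UNIV) (\<lambda>(t, x). \<omega> t x * (?\<phi>t t x + deriv (\<lambda>y. V t y * ?\<phi> t y) x)) = 0"
      using weak_omega[OF tf] pq(3)[of 0] pq(1) by simp
    also have "integral ({0..} \<times> UNIV) (\<lambda>(t, x). \<omega> t x * (?\<phi>t t x + deriv (\<lambda>y. V t y * ?\<phi> t y) x)) =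
      integral ({0..} \<times> UNIV) (\<lambda>(t, x). \<omega> t x * f t x * \<theta>' t + \<omega> t x * (ft t x + N t x) * \<theta> t)"
    proof (rule integral_spike[OF neg])
      fix p :: "real \<times> real"
      assume p: "p \<in> {0..} \<times> UNIV - {p. fst p \<in> {0..q} \<and> \<not> ((\<lambda>y. V (fst p) y * f (fst p) y) has_real_derivative N (fst p) (snd p)) (at (snd p))}"
      obtain t x where px: "p = (t, x)" by (cases p)
      have t: "0 \<le> t" using p px by auto
      have "deriv (\<lambda>y. V t y * (\<theta> t * f t y)) x = \<theta> t * N t x"
      proof (cases "t \<in> {0..q}")
        case True
        then have "((\<lambda>y. V t y * f t y) has_real_derivative N t x) (at x)" using p px by auto
        then have "((\<lambda>y. \<theta> t * (V t y * f t y)) has_real_derivative \<theta> t * N t x) (at x)" by (intro DERIV_cmult)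
        then show ?thesis by (intro DERIV_imp_deriv) (simp add: mult_ac)
      next
        case False
        then have "\<theta> t = 0" using pq t by auto
        then show ?thesis by simp
      qed
      then show "(case p of (t, x) \<Rightarrow> \<omega> t x * f t x * \<theta>' t + \<omega> t x * (ft t x + N t x) * \<theta> t) =
        (case p of (t, x) \<Rightarrow> \<omega> t x * (?\<phi>t t x + deriv (\<lambda>y. V t y * ?\<phi> t y) x))"
        using t px by (simp add: max_absorb2 algebra_simps)
    qed
    finally show "integral ({0..} \<times> UNIV) (\<lambda>(t, x). \<omega> t x * f t x * \<theta>' t + \<omega> t x * (ft t x + N t x) * \<theta> t) = 0" .
  qed (use st in auto)
qed

end

text \<open>The increment splits into a step in time at the fixed place \<open>X s\<close>,
  controlled by the mean value theorem and the continuity of \<open>ft\<close>, and a step in space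
  at the fixed time \<open>t\<close>, where the ordinary chain rule applies.\<close>

lemma DERIV_along_curve:
  fixes f ft fx :: "real \<Rightarrow> real \<Rightarrow> real"
  assumes Dt: "\<And>t x. 0 \<le> t \<Longrightarrow> ((\<lambda>s. f s x) has_real_derivative ft t x) (at t within {0..})"
    and Dx: "\<And>t x. 0 \<le> t \<Longrightarrow> (f t has_real_derivative fx t x) (at x)"
    and ftc: "halfplane_continuous ft"
    and X: "(X has_real_derivative X') (at t within {0..T})" and t: "t \<in> {0..T}"
  shows "((\<lambda>s. f s (X s)) has_real_derivative ft t (X t) + fx t (X t) * X') (at t within {0..T})"
proof -
  have 2: "((\<lambda>s. f t (X s)) has_real_derivative fx t (X t) * X') (at t within {0..T})"
    using DERIV_chain2[OF Dx X] t by auto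
  have 1: "((\<lambda>s. f s (X s) - f t (X s)) has_real_derivative ft t (X t)) (at t within {0..T})"
    unfolding has_field_derivative_iff
  proof (rule tendstoI)
    fix e :: real assume e: "0 < e"
    have t0: "(t, X t) \<in> {0..} \<times> UNIV" using t by auto
    obtain d where d: "0 < d" "\<And>p. p \<in> {0..} \<times> UNIV \<Longrightarrow> dist p (t, X t) < d \<Longrightarrow> dist (case p of (t, x) \<Rightarrow> ft t x) (ft t (X t)) < e"
      using ftc[unfolded continuous_on_iff, rule_format, OF t0 e] by auto
    have "(X \<longlongrightarrow> X t) (at t within {0..T})" using DERIV_continuous[OF X] by (simp add: continuous_within)
    then have "\<forall>\<^sub>F s in at t within {0..T}. dist (X s) (X t) < d / 2" using d(1) by (intro tendstoD) auto
    moreover have "\<forall>\<^sub>F s in at t within {0..T}. s \<in> {0..T} \<and> s \<noteq> t \<and> dist s t < d / 2"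
      unfolding eventually_at using d(1) by (intro exI[of _ "d/2"]) auto
    ultimately show "\<forall>\<^sub>F s in at t within {0..T}. dist ((f s (X s) - f t (X s) - (f t (X t) - f t (X t))) / (s - t)) (ft t (X t)) < e"
    proof eventually_elim
      case (elim s)
      have near: "dist (ft \<sigma> (X s)) (ft t (X t)) < e" if "0 \<le> \<sigma>" "\<bar>\<sigma> - t\<bar> \<le> \<bar>s - t\<bar>" for \<sigma>
      proof -
        have "dist (\<sigma>, X s) (t, X t) \<le> \<bar>\<sigma> - t\<bar> + \<bar>X s - X t\<bar>"
          using sqrt_sum_squares_le_sum_abs by (simp add: dist_Pair_Pair dist_real_def)
        also have "\<dots> < d" using elim that by (simp add: dist_real_def)
        finally show ?thesis using d(2)[of "(\<sigma>, X s)"] that by auto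
      qed
      have mv: "\<exists>\<sigma>\<in>{p<..<q}. f q x - f p x = (q - p) * ft \<sigma> x" if "0 \<le> p" "p < q" for p q x
      proof -
        have "\<exists>\<sigma>\<in>{p<..<q}. (\<lambda>s. f s x) q - (\<lambda>s. f s x) p = (\<lambda>h. ft \<sigma> x * h) (q - p)"
        proof (rule mvt_simple[OF that(2), of "\<lambda>s. f s x" "\<lambda>\<sigma> h. ft \<sigma> x * h"])
          fix \<sigma> assume \<sigma>: "p \<le> \<sigma>" "\<sigma> \<le> q"
          have "((\<lambda>s. f s x) has_real_derivative ft \<sigma> x) (at \<sigma> within {p..q})"
            using \<sigma> that by (intro DERIV_subset[OF Dt]) auto
          then show "((\<lambda>s. f s x) has_derivative (\<lambda>h. ft \<sigma> x * h)) (at \<sigma> within {p..q})"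
            by (simp add: has_field_derivative_def)
        qed
        then show ?thesis by (simp add: mult.commute)
      qed
      show ?case
      proof (cases "t < s")
        case True
        then obtain \<sigma> where \<sigma>: "\<sigma> \<in> {t<..<s}" "f s (X s) - f t (X s) = (s - t) * ft \<sigma> (X s)" using mv[of t s "X s"] t by force
        then show ?thesis using near[of \<sigma>] t True by simp
      next
        case False
        then have st: "s < t" using elim by auto
        then obtain \<sigma> where \<sigma>: "\<sigma> \<in> {s<..<t}" "f t (X s) - f s (X s) = (t - s) * ft \<sigma> (X s)" using mv[of s t "X s"] elim by force
        then have "f s (X s) - f t (X s) = (s - t) * ft \<sigma> (X s)" by (simp add: algebra_simps)
        then show ?thesis using near[of \<sigma>] elim \<sigma>(1) st by simp
      qed
    qed
  qed
  show ?thesis using DERIV_add[OF 1 2] by simp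
qed

section \<open>Values at and beyond the right boundary\<close>

context boundary_flow
begin

lemma beta_eq: "\<beta> t = b + t * vbar" by (simp add: right_boundary_def)

lemma beta_mono: "s \<le> t \<Longrightarrow> \<beta> s \<le> \<beta> t" using vbar_pos by (simp add: beta_eq)

lemma ab': "a < b" "a \<le> b - \<eta>" using ab \<eta>_pos by auto

lemma rho_0_eq: "x \<in> {a..b} \<Longrightarrow> \<rho> 0 x = \<rho>0 x" and omega_0_eq: "x \<in> {a..b} \<Longrightarrow> \<omega> 0 x = \<omega>0 x"
  by (auto simp: rho_0 omega_0 extend_data_def)

text \<open>For positive times this is the boundary condition. At time 0 the extended data equal
  \<open>rb\<close> by definition only to the right of \<open>b\<close>; at \<open>b\<close> itself
  the value follows from the continuity of \<open>\<rho> 0\<close>.\<close>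

lemma rho_boundary: "0 \<le> t \<Longrightarrow> \<beta> t \<le> y \<Longrightarrow> \<rho> t y = rb"
proof -
  assume t: "0 \<le> t" and y: "\<beta> t \<le> y"
  have far: "\<rho> 0 y = rb" if "b < y" for y using that ab' by (simp add: rho_0 extend_data_def)
  have "\<rho> 0 b = rb"
  proof -
    have "continuous_on {b..b+1} (\<rho> 0)" by (rule continuous_on_halfplane_slice[OF rho_cont]) simp
    then have "(\<rho> 0 \<longlongrightarrow> \<rho> 0 b) (at b within {b..b+1})" by (simp add: continuous_on)
    moreover have "(\<rho> 0 \<longlongrightarrow> rb) (at b within {b..b+1})"
      by (rule tendsto_eventually) (auto simp: eventually_at_filter far)
    moreover have "at b within {b..b+1} \<noteq> bot" by (simp add: trivial_limit_within islimpt_Icc)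
    ultimately show ?thesis using tendsto_unique by blast
  qed
  then have "\<rho> 0 y = rb" if "b \<le> y" for y using far[of y] that by (cases "y = b") auto
  then show ?thesis using t y boundary(1)[of t y] by (cases "t = 0") (auto simp: beta_eq)
qed

lemma omega_boundary: "0 \<le> t \<Longrightarrow> \<beta> t \<le> y \<Longrightarrow> \<omega> t y = \<omega>0 b"
proof -
  assume t: "0 \<le> t" and y: "\<beta> t \<le> y"
  have "\<omega> 0 y = \<omega>0 b" if "b \<le> y" for y using that ab' by (auto simp: omega_0 extend_data_def)
  then show ?thesis using t y boundary(2)[of t y] by (cases "t = 0") (auto simp: beta_eq)
qed

lemma g_boundary: "0 \<le> t \<Longrightarrow> \<beta> t \<le> y \<Longrightarrow> g t y = vbar"
  by (simp add: g_def rho_boundary omega_boundary v_rb)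

lemma w_shift_integral: "((\<lambda>y. w (y - x)) has_integral 1) {x..x + \<eta>}"
  using has_integral_shift_Icc_real[of "\<lambda>y. w (y - x)" x 1 0 \<eta>] w_integral by (simp add: o_def add.commute)

lemma V_boundary: "0 \<le> t \<Longrightarrow> \<beta> t \<le> x \<Longrightarrow> V t x = vbar"
proof -
  assume *: "0 \<le> t" "\<beta> t \<le> x"
  have "V t x = integral {x..x + \<eta>} (\<lambda>y. w (y - x) * vbar)"
    unfolding V_eq using * by (intro integral_cong) (auto simp: g_boundary)
  also have "\<dots> = vbar" using integral_unique[OF has_integral_mult_left[OF w_shift_integral, of x vbar]] by simp
  finally show ?thesis .
qed

text \<open>Where \<open>V t\<close> is differentiable, \<open>rt + rx * V\<close> equals
  \<open>- \<rho>\<close> times its derivative. At the other points one works with difference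
  quotients of the flux, in which the quotients of \<open>V\<close> are bounded by \<open>L\<close>;
  the bound survives the limit.\<close>

lemma rho_transport_bound:
  assumes t: "0 \<le> t" and L: "\<And>y. \<bar>y - x\<bar> < 1 \<Longrightarrow> \<bar>V t y - V t x\<bar> \<le> L * \<bar>y - x\<bar>"
  shows "\<bar>rt t x + rx t x * V t x\<bar> \<le> L * \<rho> t x"
proof -
  have "((\<lambda>y. (\<rho> t y * V t y - \<rho> t x * V t x) / (y - x) - V t x * ((\<rho> t y - \<rho> t x) / (y - x))) \<longlongrightarrow> - rt t x - V t x * rx t x) (at x)"
    using DERIV_flux[OF t, of x] DERIV_rho_x[OF t, of x] unfolding has_field_derivative_iff by (intro tendsto_intros)
  then have lim: "((\<lambda>y. \<bar>(\<rho> t y * V t y - \<rho> t x * V t x) / (y - x) - V t x * ((\<rho> t y - \<rho> t x) / (y - x))\<bar>) \<longlongrightarrow> \<bar>- rt t x - V t x * rx t x\<bar>) (at x)"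
    by (rule tendsto_rabs)
  have "isCont (\<rho> t) x" using DERIV_rho_x[OF t] DERIV_isCont by blast
  then have "((\<lambda>y. L * \<rho> t y) \<longlongrightarrow> L * \<rho> t x) (at x)" by (intro tendsto_intros) (simp add: isCont_def)
  moreover have "\<forall>\<^sub>F y in at x. \<bar>(\<rho> t y * V t y - \<rho> t x * V t x) / (y - x) - V t x * ((\<rho> t y - \<rho> t x) / (y - x))\<bar> \<le> L * \<rho> t y"
    unfolding eventually_at
  proof (intro exI[of _ 1] conjI ballI impI)
    fix y assume y: "y \<noteq> x \<and> dist y x < 1"
    \<comment> \<open>The product rule for difference quotients: once the part due to
      \<open>\<rho>\<close> is removed, \<open>\<rho> t y\<close> times the quotient of
      \<open>V\<close> remains.\<close>
    have "(\<rho> t y * V t y - \<rho> t x * V t x) / (y - x) - V t x * ((\<rho> t y - \<rho> t x) / (y - x)) = \<rho> t y * ((V t y - V t x) / (y - x))"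
    proof -
      have "(\<rho> t y * V t y - \<rho> t x * V t x) / (y - x) - V t x * ((\<rho> t y - \<rho> t x) / (y - x)) =
        (\<rho> t y * V t y - \<rho> t x * V t x - V t x * (\<rho> t y - \<rho> t x)) / (y - x)" by (simp add: diff_divide_distrib right_diff_distrib)
      also have "\<rho> t y * V t y - \<rho> t x * V t x - V t x * (\<rho> t y - \<rho> t x) = \<rho> t y * (V t y - V t x)" by (simp add: algebra_simps)
      finally show ?thesis by simp
    qed
    moreover have "\<bar>(V t y - V t x) / (y - x)\<bar> \<le> L" using L[of y] y by (simp add: abs_divide divide_le_eq dist_real_def)
    ultimately show "\<bar>(\<rho> t y * V t y - \<rho> t x * V t x) / (y - x) - V t x * ((\<rho> t y - \<rho> t x) / (y - x))\<bar> \<le> L * \<rho> t y"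
      using mult_left_mono[of "\<bar>(V t y - V t x) / (y - x)\<bar>" L "\<rho> t y"] rho_nonneg[OF t, of y] by (simp add: abs_mult mult.commute)
  qed simp
  ultimately have "\<bar>- rt t x - V t x * rx t x\<bar> \<le> L * \<rho> t x"
    by (intro tendsto_le[OF _ _ lim]) auto
  then show ?thesis by (simp add: abs_le_iff algebra_simps)
qed

end

section \<open>Characteristics\<close>

text \<open>The bounds on \<open>V\<close> and \<open>\<rho>\<close> are uniform on bounded time
  intervals, so the flow is studied up to a finite horizon.\<close>

locale flow_on = boundary_flow +
  fixes T :: real
  assumes T_pos: "0 < T"
begin

text \<open>The strip contains all characteristics with labels in \<open>{b - \<eta>..b}\<close>.
  The margin 1 leaves room for neighbouring points at distance below 1 and for steps of width at
  most 1 carried by the flow.\<close>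

definition lip :: real where
  "lip = (SOME L. 0 \<le> L \<and> (\<forall>t\<in>{0..T}. \<forall>x\<in>{b - \<eta> - 1..\<beta> T + 1}. \<forall>y\<in>{b - \<eta> - 1..\<beta> T + 1}. \<bar>V t x - V t y\<bar> \<le> L * \<bar>x - y\<bar>))"

lemma lip: "0 \<le> lip" "t \<in> {0..T} \<Longrightarrow> x \<in> {b - \<eta> - 1..\<beta> T + 1} \<Longrightarrow> y \<in> {b - \<eta> - 1..\<beta> T + 1} \<Longrightarrow> \<bar>V t x - V t y\<bar> \<le> lip * \<bar>x - y\<bar>"
proof -
  have "\<exists>L. 0 \<le> L \<and> (\<forall>t\<in>{0..T}. \<forall>x\<in>{b - \<eta> - 1..\<beta> T + 1}. \<forall>y\<in>{b - \<eta> - 1..\<beta> T + 1}. \<bar>V t x - V t y\<bar> \<le> L * \<bar>x - y\<bar>)"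
    using V_lipschitz[of T "b - \<eta> - 1" "\<beta> T + 1"] by metis
  from someI_ex[OF this, folded lip_def]
  show "0 \<le> lip" "t \<in> {0..T} \<Longrightarrow> x \<in> {b - \<eta> - 1..\<beta> T + 1} \<Longrightarrow> y \<in> {b - \<eta> - 1..\<beta> T + 1} \<Longrightarrow> \<bar>V t x - V t y\<bar> \<le> lip * \<bar>x - y\<bar>" by auto
qed

text \<open>Meaningful for labels in \<open>{b - \<eta>..b}\<close> and times in \<open>{0..T}\<close> only.\<close>

definition X :: "real \<Rightarrow> real \<Rightarrow> real" where
  "X t \<xi> = (SOME Y. Y 0 = \<xi> \<and> (\<forall>t\<in>{0..T}. (Y has_real_derivative V t (Y t)) (at t within {0..T}) \<and> \<xi> \<le> Y t \<and> Y t \<le> \<beta> t)) t"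

text \<open>Clamping the position to the strip makes the velocity globally Lipschitz. The solution
  never feels the clamp: it does not move to the left because \<open>V\<close> is nonnegative, and
  it cannot overtake the boundary because the velocity beyond it is exactly
  \<open>vbar\<close>.\<close>

lemma X_exists:
  assumes \<xi>: "\<xi> \<in> {b - \<eta>..b}"
  shows "\<exists>Y. Y 0 = \<xi> \<and> (\<forall>t\<in>{0..T}. (Y has_real_derivative V t (Y t)) (at t within {0..T}) \<and> \<xi> \<le> Y t \<and> Y t \<le> \<beta> t)"
proof -
  define cl where "cl x = max (b - \<eta>) (min (\<beta> T) x)" for x
  have bT: "b \<le> \<beta> T" using T_pos vbar_pos by (simp add: beta_eq)
  have cl: "cl x \<in> {b - \<eta>..\<beta> T}" "\<bar>cl x - cl y\<bar> \<le> \<bar>x - y\<bar>" for x y using bT \<eta>_pos by (auto simp: cl_def)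
  have "continuous_on ({0..T} \<times> UNIV) (\<lambda>p. (fst p, cl (snd p)))" unfolding cl_def by (intro continuous_intros)
  from continuous_on_compose2[OF V_cont this]
  have c: "continuous_on ({0..T} \<times> UNIV) (\<lambda>(t, x). V t (cl x))" by (auto simp: case_prod_beta image_subset_iff)
  have l: "\<bar>V t (cl x) - V t (cl y)\<bar> \<le> lip * \<bar>x - y\<bar>" if "t \<in> {0..T}" for t x y
  proof -
    have "\<bar>V t (cl x) - V t (cl y)\<bar> \<le> lip * \<bar>cl x - cl y\<bar>" using cl(1)[of x] cl(1)[of y] that by (intro lip) auto
    also have "\<dots> \<le> lip * \<bar>x - y\<bar>" by (intro mult_left_mono cl lip)
    finally show ?thesis .
  qed
  obtain Y where Y: "Y 0 = \<xi>" "\<And>t. t \<in> {0..T} \<Longrightarrow> (Y has_real_derivative V t (cl (Y t))) (at t within {0..T})"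
    using picard_lindelof_real[OF _ c l lip(1), of \<xi>] T_pos by (metis less_imp_le)
  have up: "0 \<le> \<beta> t - Y t" if t: "t \<in> {0..T}" for t
  proof (rule DERIV_within_barrier[where C=0, OF _ _ _ t])
    show "((\<lambda>t. \<beta> t - Y t) has_real_derivative vbar - V s (cl (Y s))) (at s within {0..T})" if "s \<in> {0..T}" for s
    proof (intro DERIV_diff Y that)
      show "(\<beta> has_real_derivative vbar) (at s within {0..T})"
        unfolding beta_eq[abs_def] by (auto intro!: derivative_eq_intros)
    qed
    show "0 * (\<beta> s - Y s) \<le> vbar - V s (cl (Y s))" if "s \<in> {0..T}" "\<beta> s - Y s < 0" for s
    proof -
      \<comment> \<open>The upper clamp \<open>\<beta> T\<close> is not to the left of
        \<open>\<beta> s\<close>, so the clamped position is still at or beyond the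
        boundary.\<close>
      have "\<beta> s \<le> cl (Y s)" using that beta_mono[of s T] by (auto simp: cl_def)
      then show ?thesis using V_boundary[of s "cl (Y s)"] that by simp
    qed
  qed (use Y \<xi> in \<open>auto simp: beta_eq\<close>)
  have lo: "0 \<le> Y t - \<xi>" if t: "t \<in> {0..T}" for t
  proof (rule DERIV_within_barrier[where C=0, OF _ _ _ t])
    show "((\<lambda>t. Y t - \<xi>) has_real_derivative V s (cl (Y s)) - 0) (at s within {0..T})" if "s \<in> {0..T}" for s
      by (intro DERIV_diff DERIV_const Y that)
  qed (use Y V_nonneg in auto)
  have "cl (Y t) = Y t" if "t \<in> {0..T}" for t using up[OF that] lo[OF that] \<xi> beta_mono[of t T] that by (auto simp: cl_def)
  then show ?thesis using Y up lo by (intro exI[of _ Y]) auto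
qed

context
  fixes \<xi> assumes \<xi>: "\<xi> \<in> {b - \<eta>..b}"
begin

lemma X_props: "X 0 \<xi> = \<xi>"
  "t \<in> {0..T} \<Longrightarrow> ((\<lambda>t. X t \<xi>) has_real_derivative V t (X t \<xi>)) (at t within {0..T})"
  "t \<in> {0..T} \<Longrightarrow> \<xi> \<le> X t \<xi>" "t \<in> {0..T} \<Longrightarrow> X t \<xi> \<le> \<beta> t"
  using someI_ex[OF X_exists[OF \<xi>]] unfolding X_def by auto

lemma X_range: "t \<in> {0..T} \<Longrightarrow> X t \<xi> \<in> {b - \<eta>..\<beta> T}"
  using X_props(3,4)[of t] \<xi> beta_mono[of t T] by auto

lemma X_cont: "continuous_on {0..T} (\<lambda>t. X t \<xi>)"
  using X_props(2) by (meson DERIV_continuous continuous_on_eq_continuous_within)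

end

lemma X_diff_bounds:
  assumes \<xi>: "\<xi> \<in> {b - \<eta>..b}" "\<zeta> \<in> {b - \<eta>..b}" and t: "t \<in> {0..T}"
  shows "\<bar>\<zeta> - \<xi>\<bar> * exp (- (lip * t)) \<le> \<bar>X t \<zeta> - X t \<xi>\<bar>" "\<bar>X t \<zeta> - X t \<xi>\<bar> \<le> \<bar>\<zeta> - \<xi>\<bar> * exp (lip * t)"
proof -
  have D: "((\<lambda>t. X t \<zeta> - X t \<xi>) has_real_derivative V s (X s \<zeta>) - V s (X s \<xi>)) (at s within {0..T})" if "s \<in> {0..T}" for s
    by (intro DERIV_diff X_props \<xi> that)
  have le: "\<bar>V s (X s \<zeta>) - V s (X s \<xi>)\<bar> \<le> lip * \<bar>X s \<zeta> - X s \<xi>\<bar>" if "s \<in> {0..T}" for s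
    using X_range[OF \<xi>(1) that] X_range[OF \<xi>(2) that] by (intro lip that) auto
  show "\<bar>\<zeta> - \<xi>\<bar> * exp (- (lip * t)) \<le> \<bar>X t \<zeta> - X t \<xi>\<bar>" "\<bar>X t \<zeta> - X t \<xi>\<bar> \<le> \<bar>\<zeta> - \<xi>\<bar> * exp (lip * t)"
    using DERIV_within_abs_le_exp[OF D le t] X_props(1)[OF \<xi>(1)] X_props(1)[OF \<xi>(2)] by auto
qed

text \<open>Characteristics that exchange their order would meet at some time, against the
  exponential lower bound on their distance.\<close>

lemma X_strict_mono:
  assumes \<xi>: "\<xi> \<in> {b - \<eta>..b}" "\<zeta> \<in> {b - \<eta>..b}" "\<xi> < \<zeta>" and t: "t \<in> {0..T}"
  shows "X t \<xi> < X t \<zeta>"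
proof (rule ccontr)
  assume "\<not> X t \<xi> < X t \<zeta>"
  then have "(\<lambda>t. X t \<zeta> - X t \<xi>) t \<le> 0" by simp
  moreover have "0 \<le> (\<lambda>t. X t \<zeta> - X t \<xi>) 0" using X_props(1) \<xi> by simp
  moreover have "continuous_on {0..t} (\<lambda>t. X t \<zeta> - X t \<xi>)"
    using t by (intro continuous_intros continuous_on_subset[OF X_cont] \<xi>) auto
  ultimately obtain s where s: "0 \<le> s" "s \<le> t" "X s \<zeta> - X s \<xi> = 0"
    using IVT2'[of "\<lambda>t. X t \<zeta> - X t \<xi>" t 0 0] t by auto
  have "0 < \<bar>\<zeta> - \<xi>\<bar> * exp (- (lip * s))" using \<xi>(3) by simp
  then show False using X_diff_bounds(1)[OF \<xi>(1,2), of s] s t by auto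
qed

lemma X_mono: "\<xi> \<in> {b - \<eta>..b} \<Longrightarrow> \<zeta> \<in> {b - \<eta>..b} \<Longrightarrow> \<xi> \<le> \<zeta> \<Longrightarrow> t \<in> {0..T} \<Longrightarrow> X t \<xi> \<le> X t \<zeta>"
  using X_strict_mono[of \<xi> \<zeta> t] by (cases "\<xi> = \<zeta>") auto

lemma X_less_iff: "\<xi> \<in> {b - \<eta>..b} \<Longrightarrow> \<zeta> \<in> {b - \<eta>..b} \<Longrightarrow> t \<in> {0..T} \<Longrightarrow> X t \<xi> < X t \<zeta> \<longleftrightarrow> \<xi> < \<zeta>"
  using X_strict_mono[of \<xi> \<zeta> t] X_mono[of \<zeta> \<xi> t] by (meson linorder_not_less)

text \<open>The boundary solves the differential equation of the characteristics with the same
  initial point.\<close>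

lemma X_b: "t \<in> {0..T} \<Longrightarrow> X t b = \<beta> t"
proof -
  assume t: "t \<in> {0..T}"
  have b: "b \<in> {b - \<eta>..b}" using \<eta>_pos by auto
  have "\<bar>\<beta> t - X t b\<bar> \<le> \<bar>\<beta> 0 - X 0 b\<bar> * exp (lip * t)"
  proof (rule DERIV_within_abs_le_exp(2)[OF _ _ t])
    show "((\<lambda>t. \<beta> t - X t b) has_real_derivative vbar - V s (X s b)) (at s within {0..T})" if "s \<in> {0..T}" for s
    proof (intro DERIV_diff X_props b that)
      show "(\<beta> has_real_derivative vbar) (at s within {0..T})"
        unfolding beta_eq[abs_def] by (auto intro!: derivative_eq_intros)
    qed
    show "\<bar>vbar - V s (X s b)\<bar> \<le> lip * \<bar>\<beta> s - X s b\<bar>" if s: "s \<in> {0..T}" for s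
      using lip(2)[OF s, of "\<beta> s" "X s b"] X_range[OF b s] V_boundary[of s "\<beta> s"] beta_mono[of s T] beta_mono[of 0 s] s \<eta>_pos
      by (auto simp: beta_eq)
  qed
  then show ?thesis using X_props(1)[OF b] by (simp add: beta_eq)
qed

lemma X_cont_label: "t \<in> {0..T} \<Longrightarrow> continuous_on {b - \<eta>..b} (X t)"
proof -
  assume t: "t \<in> {0..T}"
  have "(exp (lip * t))-lipschitz_on {b - \<eta>..b} (X t)"
    using X_diff_bounds(2)[OF _ _ t] by (intro lipschitz_onI) (auto simp: dist_real_def mult.commute)
  then show ?thesis by (rule lipschitz_on_continuous_on)
qed

lemma X_image:
  assumes "\<xi> \<in> {b - \<eta>..b}" "\<zeta> \<in> {b - \<eta>..b}" "\<xi> \<le> \<zeta>" "t \<in> {0..T}"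
  shows "X t ` {\<xi>..\<zeta>} = {X t \<xi>..X t \<zeta>}"
proof
  show "X t ` {\<xi>..\<zeta>} \<subseteq> {X t \<xi>..X t \<zeta>}" using assms by (auto intro!: X_mono)
  show "{X t \<xi>..X t \<zeta>} \<subseteq> X t ` {\<xi>..\<zeta>}"
  proof
    fix y assume "y \<in> {X t \<xi>..X t \<zeta>}"
    then obtain \<theta> where "\<xi> \<le> \<theta>" "\<theta> \<le> \<zeta>" "X t \<theta> = y"
      using IVT'[of "X t" \<xi> y \<zeta>] continuous_on_subset[OF X_cont_label[OF assms(4)], of "{\<xi>..\<zeta>}"] assms by auto
    then show "y \<in> X t ` {\<xi>..\<zeta>}" by auto
  qed
qed

definition r :: "real \<Rightarrow> real \<Rightarrow> real" where "r t \<xi> = \<rho> t (X t \<xi>)"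

definition r' :: "real \<Rightarrow> real \<Rightarrow> real" where "r' t \<xi> = rt t (X t \<xi>) + rx t (X t \<xi>) * V t (X t \<xi>)"

lemma DERIV_r:
  assumes \<xi>: "\<xi> \<in> {b - \<eta>..b}" and t: "t \<in> {0..T}"
  shows "((\<lambda>t. r t \<xi>) has_real_derivative r' t \<xi>) (at t within {0..T})" "\<bar>r' t \<xi>\<bar> \<le> lip * r t \<xi>"
proof -
  show "((\<lambda>t. r t \<xi>) has_real_derivative r' t \<xi>) (at t within {0..T})"
    unfolding r_def r'_def
    by (rule DERIV_along_curve[OF DERIV_rho_t DERIV_rho_x rt_cont X_props(2)[OF \<xi> t] t]) auto
  show "\<bar>r' t \<xi>\<bar> \<le> lip * r t \<xi>" unfolding r_def r'_def
  proof (rule rho_transport_bound)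
    fix y assume "\<bar>y - X t \<xi>\<bar> < 1"
    then show "\<bar>V t y - V t (X t \<xi>)\<bar> \<le> lip * \<bar>y - X t \<xi>\<bar>"
      using X_range[OF \<xi> t] t by (intro lip) auto
  qed (use t in auto)
qed

lemma r_nonneg: "t \<in> {0..T} \<Longrightarrow> 0 \<le> r t \<xi>" by (simp add: r_def rho_nonneg)

lemma r_0: "\<xi> \<in> {b - \<eta>..b} \<Longrightarrow> r 0 \<xi> = \<rho>0 \<xi>"
  using ab' by (simp add: r_def X_props rho_0_eq)

text \<open>By \<open>\<bar>r'\<bar> \<le> lip * r\<close>, a characteristic neither leaves vacuum
  nor enters it.\<close>

lemma r_bounds:
  assumes \<xi>: "\<xi> \<in> {b - \<eta>..b}" and t: "t \<in> {0..T}"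
  shows "\<rho>0 \<xi> * exp (- (lip * t)) \<le> r t \<xi>" "r t \<xi> \<le> \<rho>0 \<xi> * exp (lip * t)"
proof -
  have 0: "0 \<in> {0..T}" using T_pos by auto
  have "\<bar>r' s \<xi>\<bar> \<le> lip * \<bar>r s \<xi>\<bar>" if "s \<in> {0..T}" for s using DERIV_r(2)[OF \<xi> that] r_nonneg[OF that, of \<xi>] by simp
  from DERIV_within_abs_le_exp[OF DERIV_r(1)[OF \<xi>] this t]
  show "\<rho>0 \<xi> * exp (- (lip * t)) \<le> r t \<xi>" "r t \<xi> \<le> \<rho>0 \<xi> * exp (lip * t)"
    using r_nonneg[OF t, of \<xi>] r_nonneg[OF 0, of \<xi>] r_0[OF \<xi>] by auto
qed

lemma rho_integrable: "0 \<le> t \<Longrightarrow> \<rho> t integrable_on {p..q}"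
  by (intro integrable_continuous_interval continuous_on_halfplane_slice[OF rho_cont])

text \<open>\<open>P t x\<close> is the signed mass between the fixed point \<open>x0\<close> and
  \<open>x\<close>. Along any characteristic it grows at the rate of the flux through
  \<open>x0\<close>, the same for both ends, so the mass in between is constant.\<close>

lemma mass_conserved:
  assumes \<xi>: "\<xi> \<in> {b - \<eta>..b}" "\<zeta> \<in> {b - \<eta>..b}" "\<xi> \<le> \<zeta>" and t: "t \<in> {0..T}"
  shows "integral {X t \<xi>..X t \<zeta>} (\<rho> t) = integral {\<xi>..\<zeta>} (\<rho> 0)"
proof -
  define x0 where "x0 = b - \<eta> - 1"
  define P where "P t x = primitive (\<rho> t) x - primitive (\<rho> t) x0" for t x
  have a: "\<rho> t absolutely_integrable_on {p..q}" if "0 \<le> t" for t p q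
    by (intro absolutely_integrable_continuous_real continuous_on_halfplane_slice[OF rho_cont] that)
  have Px: "(P t has_real_derivative \<rho> t x) (at x)" if "0 \<le> t" for t x
  proof -
    have "(primitive (\<rho> t) has_real_derivative \<rho> t x) (at x)"
      by (rule DERIV_primitive_lebesgue_point[OF a[OF that] continuous_lebesgue_point[of "x-1" "x+1"]])
        (auto intro!: continuous_on_halfplane_slice[OF rho_cont] that)
    from DERIV_diff[OF this DERIV_const, of "primitive (\<rho> t) x0"] show ?thesis by (simp add: P_def[abs_def])
  qed
  define fl where "fl t x = - (\<rho> t x * V t x - \<rho> t x0 * V t x0)" for t x
  have flc: "halfplane_continuous fl"
  proof -
    have 1: "continuous_on ({0..} \<times> UNIV) (\<lambda>(t, x). \<rho> t x * V t x)"
      using continuous_on_mult[OF rho_cont V_cont] by (simp add: case_prod_beta)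
    have "continuous_on ({0..} \<times> (UNIV :: real set)) (\<lambda>p. (fst p, x0))" by (intro continuous_intros)
    from continuous_on_compose2[OF 1 this] have 2: "continuous_on ({0..} \<times> (UNIV :: real set)) (\<lambda>p. \<rho> (fst p) x0 * V (fst p) x0)"
      by (auto simp: image_subset_iff)
    show ?thesis using continuous_on_minus[OF continuous_on_diff[OF 1 2]] by (simp add: fl_def case_prod_beta)
  qed
  have Pt: "((\<lambda>s. P s x) has_real_derivative fl t x) (at t within {0..})" if t: "0 \<le> t" for t x
  proof -
    have main: "((\<lambda>s. integral {p..q} (\<rho> s)) has_real_derivative integral {p..q} (rt t)) (at t within {0..})" for p q
      unfolding interval_cbox
    proof (rule leibniz_rule_field_derivative)
      show "((\<lambda>t. \<rho> t x) has_real_derivative rt t x) (at t within {0..})" if "t \<in> {0..}" for t x using DERIV_rho_t that by auto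
      show "\<rho> t integrable_on cbox p q" if "t \<in> {0..}" for t using rho_integrable that by auto
      show "continuous_on ({0..} \<times> cbox p q) (\<lambda>(t, x). rt t x)" by (rule continuous_on_subset[OF rt_cont]) auto
    qed (use t in auto)
    have flux: "integral {p..q} (rt t) = - (\<rho> t q * V t q - \<rho> t p * V t p)" if "p \<le> q" for p q
    proof -
      have "((\<lambda>x. - rt t x) has_integral (\<rho> t q * V t q - \<rho> t p * V t p)) {p..q}"
        by (rule fundamental_theorem_of_calculus[OF that])
          (use DERIV_flux[OF t] in \<open>auto simp: has_real_derivative_iff_has_vector_derivative[symmetric] intro: DERIV_subset\<close>)
      from integral_unique[OF has_integral_neg[OF this]] show ?thesis by simp
    qed
    show ?thesis
    proof (cases "x0 \<le> x")
      case True
      have "((\<lambda>s. integral {x0..x} (\<rho> s)) has_real_derivative fl t x) (at t within {0..})"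
        using main[of x0 x] flux[OF True] by (simp add: fl_def)
      then show ?thesis
        by (rule has_field_derivative_transform_within[where d=1]) (use t True primitive_diff[OF a] in \<open>auto simp: P_def\<close>)
    next
      case False
      have "((\<lambda>s. - integral {x..x0} (\<rho> s)) has_real_derivative fl t x) (at t within {0..})"
        using DERIV_minus[OF main[of x x0]] flux[of x x0] False by (simp add: fl_def)
      then show ?thesis
      proof (rule has_field_derivative_transform_within[where d=1])
        show "- integral {x..x0} (\<rho> s) = P s x" if "s \<in> {0..}" for s
          using primitive_diff[OF a, of s x x0] that False by (simp add: P_def)
      qed (use t in auto)
    qed
  qed
  have D: "((\<lambda>s. P s (X s \<xi>)) has_real_derivative \<rho> s x0 * V s x0) (at s within {0..T})" if s: "s \<in> {0..T}" and \<xi>: "\<xi> \<in> {b - \<eta>..b}" for s \<xi>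
  proof -
    have "((\<lambda>s. P s (X s \<xi>)) has_real_derivative fl s (X s \<xi>) + \<rho> s (X s \<xi>) * V s (X s \<xi>)) (at s within {0..T})"
      by (rule DERIV_along_curve[OF Pt Px flc X_props(2)[OF \<xi> s] s]) auto
    then show ?thesis by (simp add: fl_def)
  qed
  have "((\<lambda>s. P s (X s \<zeta>) - P s (X s \<xi>)) has_real_derivative 0) (at s within {0..T})" if "s \<in> {0..T}" for s
    using DERIV_diff[OF D[OF that \<xi>(2)] D[OF that \<xi>(1)]] by simp
  then obtain c where c: "\<And>s. s \<in> {0..T} \<Longrightarrow> P s (X s \<zeta>) - P s (X s \<xi>) = c"
    using has_field_derivative_zero_constant[of "{0..T}" "\<lambda>s. P s (X s \<zeta>) - P s (X s \<xi>)"] by auto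
  have "P s (X s \<zeta>) - P s (X s \<xi>) = integral {X s \<xi>..X s \<zeta>} (\<rho> s)" if "s \<in> {0..T}" for s
    using primitive_diff[OF a X_mono[OF \<xi> that]] that by (simp add: P_def)
  then show ?thesis using c[OF t] c[of 0] t X_props(1) \<xi> by simp
qed

abbreviation \<alpha> :: "real \<Rightarrow> real" where "\<alpha> \<equiv> alpha \<eta> b vbar \<rho>"
abbreviation cr :: real where "cr \<equiv> c_rho \<eta> b vbar \<rho>"

lemma mass_nonneg: "0 \<le> t \<Longrightarrow> 0 \<le> integral {p..q} (\<rho> t)"
  by (intro integral_nonneg rho_integrable rho_nonneg) auto

lemma cr_le: "0 \<le> t \<Longrightarrow> cr \<le> integral {\<beta> t - \<eta>..\<beta> t} (\<rho> t)"
  unfolding c_rho_def by (intro cINF_lower bdd_belowI2[of _ 0] mass_nonneg) auto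

lemma cr_nonneg: "0 \<le> cr"
  unfolding c_rho_def by (intro cINF_greatest mass_nonneg) auto

text \<open>The supremum is attained because the mass ahead of \<open>x\<close> depends continuously
  on \<open>x\<close>; the set is nonempty because \<open>c_rho\<close> is a lower bound for the
  mass on the last interval of length \<open>\<eta>\<close> at all times.\<close>

lemma alpha_props:
  assumes t: "0 \<le> t"
  shows "\<alpha> t \<in> {\<beta> t - \<eta>..\<beta> t}" "cr \<le> integral {\<alpha> t..\<beta> t} (\<rho> t)"
    "\<And>x. \<alpha> t < x \<Longrightarrow> x \<le> \<beta> t \<Longrightarrow> integral {x..\<beta> t} (\<rho> t) < cr"
proof -
  define S where "S = {x \<in> {\<beta> t - \<eta>..\<beta> t}. cr \<le> integral {x..\<beta> t} (\<rho> t)}"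
  have a: "\<alpha> t = Sup S" by (simp add: alpha_def S_def)
  have ne: "\<beta> t - \<eta> \<in> S" using cr_le[OF t] \<eta>_pos by (simp add: S_def)
  have ac: "\<rho> t absolutely_integrable_on {p..q}" for p q
    by (intro absolutely_integrable_continuous_real continuous_on_halfplane_slice[OF rho_cont] t)
  have "S = {\<beta> t - \<eta>..\<beta> t} \<inter> (\<lambda>x. primitive (\<rho> t) (\<beta> t) - primitive (\<rho> t) x) -` {cr..}"
    by (auto simp: S_def primitive_diff[OF ac])
  moreover have "closed \<dots>"
    by (intro continuous_closed_preimage continuous_intros continuous_on_primitive ac closed_atLeast)
  ultimately have cl: "closed S" by simp
  have bd: "bdd_above S" by (rule bdd_aboveI[of _ "\<beta> t"]) (auto simp: S_def)
  have "\<alpha> t \<in> S" unfolding a using closed_contains_Sup[OF _ bd cl] ne by auto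
  then show "\<alpha> t \<in> {\<beta> t - \<eta>..\<beta> t}" "cr \<le> integral {\<alpha> t..\<beta> t} (\<rho> t)" by (auto simp: S_def)
  fix x assume x: "\<alpha> t < x" "x \<le> \<beta> t"
  have "x \<notin> S" using cSup_upper[OF _ bd, of x] x a by auto
  then show "integral {x..\<beta> t} (\<rho> t) < cr" using x \<open>\<alpha> t \<in> S\<close> by (auto simp: S_def)
qed

lemma alpha_0: "\<alpha> 0 \<in> {b - \<eta>..b}" using alpha_props(1)[of 0] by (simp add: beta_eq)

lemma b_label: "b \<in> {b - \<eta>..b}" using \<eta>_pos by auto

text \<open>Mass alone does not single out a point when the density has gaps. But
  \<open>\<alpha> t\<close> is the last point, and \<open>\<alpha> 0\<close> the last label, with
  mass at least \<open>cr\<close> ahead, and the flow preserves both mass and order.\<close>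

lemma alpha_flow:
  assumes t: "t \<in> {0..T}"
  shows "\<alpha> t = X t (\<alpha> 0)"
proof -
  have t0: "0 \<le> t" using t by auto
  have mass: "integral {X t \<xi>..\<beta> t} (\<rho> t) = integral {\<xi>..b} (\<rho> 0)" if "\<xi> \<in> {b - \<eta>..b}" for \<xi>
    using mass_conserved[OF that b_label _ t] that X_b[OF t] by simp
  have less: "integral {\<xi>..b} (\<rho> 0) < cr" if "\<alpha> 0 < \<xi>" "\<xi> \<le> b" for \<xi>
    using alpha_props(3)[of 0 \<xi>] that by (simp add: beta_eq)
  have pre: "\<exists>\<xi>\<in>{\<alpha> 0..b}. X t \<xi> = x" if "X t (\<alpha> 0) \<le> x" "x \<le> \<beta> t" for x
    using X_image[OF alpha_0 b_label _ t] alpha_0 that X_b[OF t] by (auto simp: image_iff set_eq_iff) metis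
  show ?thesis
  proof (rule antisym)
    show "\<alpha> t \<le> X t (\<alpha> 0)"
    proof (rule ccontr)
      assume "\<not> \<alpha> t \<le> X t (\<alpha> 0)"
      then obtain \<xi> where \<xi>: "\<xi> \<in> {\<alpha> 0..b}" "X t \<xi> = \<alpha> t" using pre[of "\<alpha> t"] alpha_props(1)[OF t0] by auto
      then have "\<xi> \<noteq> \<alpha> 0" using \<open>\<not> \<alpha> t \<le> X t (\<alpha> 0)\<close> by auto
      then have "integral {\<xi>..b} (\<rho> 0) < cr" using less \<xi> by auto
      then show False using alpha_props(2)[OF t0] mass[of \<xi>] \<xi> alpha_0 by auto
    qed
    show "X t (\<alpha> 0) \<le> \<alpha> t"
    proof (rule ccontr)
      assume "\<not> X t (\<alpha> 0) \<le> \<alpha> t"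
      then have "integral {X t (\<alpha> 0)..\<beta> t} (\<rho> t) < cr"
        using alpha_props(3)[OF t0] X_props(4)[OF alpha_0 t] by auto
      then show False using mass[OF alpha_0] alpha_props(2)[of 0] by (simp add: beta_eq)
    qed
  qed
qed

end

section \<open>Integrals of the marker over intervals carried by the flow\<close>

context flow_on
begin

text \<open>
  The indicator of the interval between two characteristics is approximated by steps of width \<open>e\<close>
  carried by the flow. The error terms contain the derivative of the step, of size \<open>1 / e\<close>,
  multiplied by a difference of velocities at distance at most \<open>e\<close>; they stay bounded and tend to zero
  pointwise.
\<close>

lemma transported_integral:
  fixes h ht hx N :: "real \<Rightarrow> real \<Rightarrow> real"
  assumes c: "halfplane_continuous h" "halfplane_continuous ht"
      "halfplane_continuous hx"
    and Dt: "\<And>t x. 0 < t \<Longrightarrow> ((\<lambda>s. h s x) has_real_derivative ht t x) (at t)"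
    and Dx: "\<And>t x. 0 \<le> t \<Longrightarrow> (h t has_real_derivative hx t x) (at x)"
    and Nm: "halfplane_measurable N"
    and Nb: "\<And>t x. t \<in> {0..T} \<Longrightarrow> x \<in> {b - \<eta>..\<beta> T + 1} \<Longrightarrow> \<bar>N t x\<bar> \<le> C"
    and neg: "negligible {p. fst p \<in> {0..T} \<and> \<not> ((\<lambda>y. V (fst p) y * h (fst p) y) has_real_derivative N (fst p) (snd p)) (at (snd p))}"
    and \<xi>: "\<xi> \<in> {b - \<eta>..b}" "\<zeta> \<in> {b - \<eta>..b}" "\<xi> \<le> \<zeta>" and st: "0 \<le> s" "s \<le> t" "t < T"
  shows "integral {X t \<xi>..X t \<zeta>} (\<lambda>x. \<omega> t x * h t x) - integral {X s \<xi>..X s \<zeta>} (\<lambda>x. \<omega> s x * h s x) =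
    integral {s..t} (\<lambda>\<tau>. integral {X \<tau> \<xi>..X \<tau> \<zeta>} (\<lambda>x. \<omega> \<tau> x * (ht \<tau> x + N \<tau> x))) \<and>
    (\<lambda>\<tau>. integral {X \<tau> \<xi>..X \<tau> \<zeta>} (\<lambda>x. \<omega> \<tau> x * (ht \<tau> x + N \<tau> x))) integrable_on {s..t}"
proof -
  \<comment> \<open>Times are clamped to \<open>{0..T}\<close> so that the moving steps are
    continuous on the whole half plane, as \<open>omega_increment\<close> requires.\<close>
  define Y where "Y z t = X (min T (max 0 t)) z" for z t
  define U where "U z t = V (min T (max 0 t)) (Y z t)" for z t
  define k where "k = max \<bar>b - \<eta>\<bar> \<bar>\<beta> T + 1\<bar>"
  define e where "e n = 1 / real (Suc n)" for n
  have k0: "0 \<le> k" by (simp add: k_def le_max_iff_disj)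
  have e: "0 < e n" "e n \<le> 1" for n by (auto simp: e_def)
  have clamp: "min T (max 0 t) \<in> {0..T}" for t using T_pos by auto
  have Yr: "Y z t \<in> {b - \<eta>..\<beta> T}" if "z \<in> {b - \<eta>..b}" for z t unfolding Y_def by (intro X_range that clamp)
  have Yc: "continuous_on UNIV (Y z)" if "z \<in> {b - \<eta>..b}" for z
    unfolding Y_def by (rule continuous_on_compose2[OF X_cont[OF that]]) (use clamp in \<open>auto intro!: continuous_intros\<close>)
  have Uc: "continuous_on UNIV (U z)" if "z \<in> {b - \<eta>..b}" for z
  proof -
    have "continuous_on UNIV (\<lambda>t. (min T (max 0 t), Y z t))" by (intro continuous_intros Yc that)
    from continuous_on_compose2[OF V_cont this] show ?thesis using T_pos by (auto simp: U_def image_subset_iff)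
  qed
  have DY: "(Y z has_real_derivative U z t) (at t)" if z: "z \<in> {b - \<eta>..b}" and t: "0 < t" "t < T" for z t
  proof -
    have "((\<lambda>t. X t z) has_real_derivative V t (X t z)) (at t)"
      using X_props(2)[OF z, of t] t by (simp add: at_within_Icc_at)
    then have "((\<lambda>t. X t z) has_real_derivative U z t) (at t)" using t by (simp add: U_def Y_def)
    then show ?thesis
      by (rule has_field_derivative_transform_within_open[where S="{0<..<T}"]) (use t in \<open>auto simp: Y_def\<close>)
  qed
  define st1 where "st1 z n t x = sstep ((x - Y z t) / e n)" for z n t x
  define sx where "sx z n t x = sstep' ((x - Y z t) / e n) / e n" for z n t x
  define f where "f n t x = h t x * (st1 \<xi> n t x - st1 \<zeta> n t x)" for n t x
  define ft where "ft n t x = ht t x * (st1 \<xi> n t x - st1 \<zeta> n t x) - h t x * (sx \<xi> n t x * U \<xi> t - sx \<zeta> n t x * U \<zeta> t)" for n t x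
  define fx where "fx n t x = hx t x * (st1 \<xi> n t x - st1 \<zeta> n t x) + h t x * (sx \<xi> n t x - sx \<zeta> n t x)" for n t x
  define Nf where "Nf n t x = N t x * (st1 \<xi> n t x - st1 \<zeta> n t x) + V t x * h t x * (sx \<xi> n t x - sx \<zeta> n t x)" for n t x
  have pc: "continuous_on S (\<lambda>p. st1 z n (fst p) (snd p))" "continuous_on S (\<lambda>p. sx z n (fst p) (snd p))" "continuous_on S (\<lambda>p. U z (fst p))"
    if "z \<in> {b - \<eta>..b}" for z n and S :: "(real \<times> real) set"
  proof -
    have 1: "continuous_on S (\<lambda>p. Y z (fst p))"
      by (rule continuous_on_compose2[OF Yc[OF that]]) (auto intro!: continuous_intros)
    show "continuous_on S (\<lambda>p. st1 z n (fst p) (snd p))" unfolding st1_def using e(1)[of n] by (intro continuous_intros 1) auto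
    show "continuous_on S (\<lambda>p. sx z n (fst p) (snd p))" unfolding sx_def using e(1)[of n] by (intro continuous_intros 1) auto
    show "continuous_on S (\<lambda>p. U z (fst p))"
      by (rule continuous_on_compose2[OF Uc[OF that]]) (auto intro!: continuous_intros)
  qed
  note cc = c[unfolded case_prod_beta] V_cont[unfolded case_prod_beta] pc[OF \<xi>(1)] pc[OF \<xi>(2)]
  have fc: "halfplane_continuous (f n)" "halfplane_continuous (ft n)"
    "halfplane_continuous (fx n)" for n
    unfolding case_prod_beta f_def ft_def fx_def
    by (intro continuous_intros cc)+
  have Dst: "(st1 z n t has_real_derivative sx z n t x) (at x)" for z n t x
    unfolding st1_def sx_def by (rule DERIV_sstep_scaled[OF e(1)])
  have Dst_t: "((\<lambda>s. st1 z n s x) has_real_derivative - (sx z n t x * U z t)) (at t)"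
    if z: "z \<in> {b - \<eta>..b}" and t: "0 < t" "t < T" for z n t x
  proof -
    have "((\<lambda>s. (x - Y z s) / e n) has_real_derivative (0 - U z t) / e n) (at t)"
      by (intro DERIV_cdivide DERIV_diff DERIV_const DY z t)
    from DERIV_chain2[OF DERIV_sstep this] show ?thesis by (simp add: st1_def sx_def)
  qed
  have le\<xi>: "Y \<xi> t \<le> Y \<zeta> t" for t unfolding Y_def by (intro X_mono \<xi> clamp)
  \<comment> \<open>The characteristics lie in \<open>{b - \<eta>..\<beta> T}\<close> and the steps
    have width at most 1. So outside the enlarged strip both steps are 0 or both are 1, and their
    difference vanishes.\<close>
  have out: "st1 \<xi> n t x - st1 \<zeta> n t x = 0 \<and> sx \<xi> n t x = 0 \<and> sx \<zeta> n t x = 0" if x: "x \<notin> {b - \<eta>..\<beta> T + 1}" for n t x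
  proof -
    have "x \<le> Y z t \<or> Y z t + 1 \<le> x" if "z \<in> {b - \<eta>..b}" for z using Yr[OF that, of t] x by auto
    moreover have "(x \<le> Y \<xi> t \<longleftrightarrow> x \<le> Y \<zeta> t)" using Yr[OF \<xi>(1), of t] Yr[OF \<xi>(2), of t] x by auto
    ultimately consider "x \<le> Y \<xi> t" "x \<le> Y \<zeta> t" | "Y \<xi> t + 1 \<le> x" "Y \<zeta> t + 1 \<le> x" using \<xi> by blast
    then show ?thesis
    proof cases
      case 1
      then have "(x - Y \<xi> t) / e n \<le> 0" "(x - Y \<zeta> t) / e n \<le> 0" using e(1)[of n] by (auto simp: divide_le_0_iff)
      then show ?thesis by (simp add: st1_def sx_def sstep_eq_0 sstep'_eq_0)
    next
      case 2
      then have "1 \<le> (x - Y \<xi> t) / e n" "1 \<le> (x - Y \<zeta> t) / e n" using e[of n] by (auto simp: le_divide_eq)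
      then show ?thesis by (simp add: st1_def sx_def sstep_eq_1 sstep'_eq_0)
    qed
  qed
  have ksub: "x \<notin> {b - \<eta>..\<beta> T + 1}" if "x \<notin> {-k..k}" for x using that by (auto simp: k_def)
  obtain CV where CV: "\<And>t x. t \<in> {0..T} \<Longrightarrow> x \<in> {-k..k} \<Longrightarrow> \<bar>V t x\<bar> \<le> CV" "0 \<le> CV" using bounded_on_halfplane_rectangle[OF V_cont] by metis
  obtain Ch where Ch: "\<And>t x. t \<in> {0..T} \<Longrightarrow> x \<in> {-k..k} \<Longrightarrow> \<bar>h t x\<bar> \<le> Ch" "0 \<le> Ch" using bounded_on_halfplane_rectangle[OF c(1)] by metis
  obtain Ct where Ct: "\<And>t x. t \<in> {0..T} \<Longrightarrow> x \<in> {-k..k} \<Longrightarrow> \<bar>ht t x\<bar> \<le> Ct" "0 \<le> Ct" using bounded_on_halfplane_rectangle[OF c(2)] by metis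
  have stb: "\<bar>st1 \<xi> n t x - st1 \<zeta> n t x\<bar> \<le> 1" for n t x
    using sstep_bounds[of "(x - Y \<xi> t) / e n"] sstep_bounds[of "(x - Y \<zeta> t) / e n"] unfolding st1_def by linarith
  have sxb: "\<bar>sx z n t x\<bar> \<le> 2 / e n" for z n t x
    unfolding sx_def using e(1)[of n] sstep'_bounds by (auto simp: abs_divide intro!: divide_right_mono)
  have eq: "integral {-k..k} (\<lambda>x. \<omega> t x * f n t x) - integral {-k..k} (\<lambda>x. \<omega> s x * f n s x) =
    integral {s..t} (\<lambda>\<tau>. integral {-k..k} (\<lambda>x. \<omega> \<tau> x * (ft n \<tau> x + Nf n \<tau> x))) \<and>
    (\<lambda>\<tau>. integral {-k..k} (\<lambda>x. \<omega> \<tau> x * (ft n \<tau> x + Nf n \<tau> x))) integrable_on {s..t}" for n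
  proof (rule omega_increment[OF fc, where q=T and C="\<bar>C\<bar> + CV * Ch * (4 / e n)"])
    fix t x assume t: "0 < t" "t < T"
    have "((\<lambda>s. h s x * (st1 \<xi> n s x - st1 \<zeta> n s x)) has_real_derivative
      ht t x * (st1 \<xi> n t x - st1 \<zeta> n t x) + (- (sx \<xi> n t x * U \<xi> t) - - (sx \<zeta> n t x * U \<zeta> t)) * h t x) (at t)"
      by (intro DERIV_mult DERIV_diff Dt Dst_t \<xi> t)
    then show "((\<lambda>s. f n s x) has_real_derivative ft n t x) (at t)" by (simp add: f_def ft_def algebra_simps)
  next
    fix t x :: real assume t: "0 \<le> t"
    have "((\<lambda>y. h t y * (st1 \<xi> n t y - st1 \<zeta> n t y)) has_real_derivative
      hx t x * (st1 \<xi> n t x - st1 \<zeta> n t x) + (sx \<xi> n t x - sx \<zeta> n t x) * h t x) (at x)"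
      by (intro DERIV_mult DERIV_diff Dx Dst t)
    then show "(f n t has_real_derivative fx n t x) (at x)" by (simp add: f_def[abs_def] fx_def algebra_simps)
  next
    show "f n t x = 0 \<and> ft n t x = 0 \<and> Nf n t x = 0" if "x \<notin> {-k..k}" for t x
      using out[OF ksub[OF that], of n t] by (simp add: f_def ft_def Nf_def)
    have pcm: "(\<lambda>p. st1 z n (max 0 (fst p)) (snd p)) \<in> borel_measurable borel" "(\<lambda>p. sx z n (max 0 (fst p)) (snd p)) \<in> borel_measurable borel"
      if "z \<in> {b - \<eta>..b}" for z
      using pc(1)[OF that, of "{0..} \<times> UNIV"] pc(2)[OF that, of "{0..} \<times> UNIV"] borel_extend[of "st1 z n"] borel_extend[of "sx z n"]
      by (auto simp: case_prod_beta)
    show "halfplane_measurable (Nf n)"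
      unfolding Nf_def
      by (intro borel_measurable_add borel_measurable_times borel_measurable_diff Nm borel_extend[OF V_cont] borel_extend[OF c(1)] pcm \<xi>)
    fix t x assume t: "t \<in> {0..T}" and x: "x \<in> {-k..k}"
    show "\<bar>Nf n t x\<bar> \<le> \<bar>C\<bar> + CV * Ch * (4 / e n)"
    proof (cases "x \<in> {b - \<eta>..\<beta> T + 1}")
      case True
      have "\<bar>N t x * (st1 \<xi> n t x - st1 \<zeta> n t x)\<bar> \<le> \<bar>C\<bar> * 1"
        unfolding abs_mult using Nb[OF t True] by (intro mult_mono stb) auto
      moreover have "\<bar>V t x * h t x * (sx \<xi> n t x - sx \<zeta> n t x)\<bar> \<le> CV * Ch * (4 / e n)"
        unfolding abs_mult using CV(1)[OF t x] Ch(1)[OF t x] CV(2) Ch(2) sxb[of \<xi> n t x] sxb[of \<zeta> n t x] by (intro mult_mono) auto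
      ultimately show ?thesis unfolding Nf_def by linarith
    next
      case False
      then show ?thesis using out[OF False, of n t] CV(2) Ch(2) e(1)[of n] by (simp add: Nf_def)
    qed
  next
    show "negligible {p. fst p \<in> {0..T} \<and> \<not> ((\<lambda>y. V (fst p) y * f n (fst p) y) has_real_derivative Nf n (fst p) (snd p)) (at (snd p))}"
    proof (rule negligible_subset[OF neg], clarify)
      fix t x
      assume *: "fst (t, x) \<in> {0..T}" "\<not> ((\<lambda>y. V (fst (t, x)) y * f n (fst (t, x)) y) has_real_derivative Nf n (fst (t, x)) (snd (t, x))) (at (snd (t, x)))"
        "((\<lambda>y. V (fst (t, x)) y * h (fst (t, x)) y) has_real_derivative N (fst (t, x)) (snd (t, x))) (at (snd (t, x)))"
      have "((\<lambda>y. (V t y * h t y) * (st1 \<xi> n t y - st1 \<zeta> n t y)) has_real_derivative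
        N t x * (st1 \<xi> n t x - st1 \<zeta> n t x) + (sx \<xi> n t x - sx \<zeta> n t x) * (V t x * h t x)) (at x)"
        using *(3) by (intro DERIV_mult DERIV_diff Dst) simp
      then show False using *(2) by (simp add: f_def[abs_def] Nf_def mult_ac)
    qed
  qed (use st in auto)
  have ind: "(\<lambda>n. st1 \<xi> n t x - st1 \<zeta> n t x) \<longlonglongrightarrow> (if x \<in> {Y \<xi> t<..Y \<zeta> t} then 1 else 0)"
    and sx0: "\<forall>\<^sub>F n in sequentially. sx z n t x = 0" for t x z
  proof -
    have e0: "e \<longlonglongrightarrow> 0" unfolding e_def[abs_def] by (rule LIMSEQ_inverse_real_of_nat[unfolded inverse_eq_divide])
    have one: "\<forall>\<^sub>F n in sequentially. st1 z n t x = (if x \<le> Y z t then 0 else 1) \<and> sx z n t x = 0" for z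
    proof (cases "x \<le> Y z t")
      case True
      then have "(x - Y z t) / e n \<le> 0" for n using e(1)[of n] by (auto simp: divide_le_0_iff)
      then show ?thesis using True by (simp add: st1_def sx_def sstep_eq_0 sstep'_eq_0)
    next
      case False
      have "\<forall>\<^sub>F n in sequentially. e n < x - Y z t" using False e0 by (intro order_tendstoD(2)[of e 0]) auto
      then show ?thesis
      proof eventually_elim
        case (elim n)
        then have "1 \<le> (x - Y z t) / e n" using e(1)[of n] by (simp add: le_divide_eq)
        then show ?case using False by (simp add: st1_def sx_def sstep_eq_1 sstep'_eq_0)
      qed
    qed
    show "\<forall>\<^sub>F n in sequentially. sx z n t x = 0" using one[of z] by eventually_elim auto
    have "\<forall>\<^sub>F n in sequentially. st1 \<xi> n t x - st1 \<zeta> n t x = (if x \<in> {Y \<xi> t<..Y \<zeta> t} then 1 else 0)"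
      using one[of \<xi>] one[of \<zeta>] by eventually_elim (use le\<xi>[of t] in auto)
    then show "(\<lambda>n. st1 \<xi> n t x - st1 \<zeta> n t x) \<longlonglongrightarrow> (if x \<in> {Y \<xi> t<..Y \<zeta> t} then 1 else 0)" by (rule tendsto_eventually)
  qed
  have lim: "(\<lambda>n. integral {-k..k} (\<lambda>x. F n x)) \<longlonglongrightarrow> integral {X t \<xi>..X t \<zeta>} G"
    if t: "t \<in> {0..T}" and i: "\<And>n. F n integrable_on {-k..k}" and b: "\<And>n x. x \<in> {-k..k} \<Longrightarrow> \<bar>F n x\<bar> \<le> D"
      and l: "\<And>x. (\<lambda>n. F n x) \<longlonglongrightarrow> G x * (if x \<in> {Y \<xi> t<..Y \<zeta> t} then 1 else 0)"
    for t D and F :: "nat \<Rightarrow> real \<Rightarrow> real" and G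
  proof -
    have "(\<lambda>n. integral {-k..k} (F n)) \<longlonglongrightarrow> integral {-k..k} (\<lambda>x. G x * (if x \<in> {Y \<xi> t<..Y \<zeta> t} then 1 else 0))"
      by (rule dominated_convergence(2)[OF i, where h="\<lambda>_. D"]) (use b l in auto)
    also have "integral {-k..k} (\<lambda>x. G x * (if x \<in> {Y \<xi> t<..Y \<zeta> t} then 1 else 0)) = integral {Y \<xi> t<..Y \<zeta> t} (\<lambda>x. G x * (if x \<in> {Y \<xi> t<..Y \<zeta> t} then 1 else 0))"
      using Yr[OF \<xi>(1), of t] Yr[OF \<xi>(2), of t] by (intro integral_eq_on_support) (auto simp: k_def)
    also have "\<dots> = integral {Y \<xi> t<..Y \<zeta> t} G" by (intro integral_cong) auto
    also have "\<dots> = integral {Y \<xi> t..Y \<zeta> t} G"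
      by (rule integral_subset_negligible) (auto intro: negligible_subset[of "{Y \<xi> t}"])
    finally show ?thesis using t by (simp add: Y_def)
  qed
  have om: "\<bar>\<omega> t x\<bar> \<le> M" if "t \<in> {0..T}" for t x using omega_pos[of t x] omega_le_M[of t x] that by auto
  have lim1: "(\<lambda>n. integral {-k..k} (\<lambda>x. \<omega> t x * f n t x)) \<longlonglongrightarrow> integral {X t \<xi>..X t \<zeta>} (\<lambda>x. \<omega> t x * h t x)"
    if t: "t \<in> {0..T}" for t
  proof (rule lim[OF t, where D="M * (Ch * 1)"])
    have t0: "0 \<le> t" using t by simp
    show "(\<lambda>x. \<omega> t x * f n t x) integrable_on {-k..k}" for n
      by (intro absolutely_integrable_imp_integrable absolutely_integrable_mult_continuous omega_aint t0 continuous_on_halfplane_slice[OF fc(1)])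
    show "\<bar>\<omega> t x * f n t x\<bar> \<le> M * (Ch * 1)" if "x \<in> {-k..k}" for n x
      unfolding f_def abs_mult using om[OF t, of x] Ch(1)[OF t that] Ch(2) M_pos stb by (intro mult_mono) auto
    show "(\<lambda>n. \<omega> t x * f n t x) \<longlonglongrightarrow> \<omega> t x * h t x * (if x \<in> {Y \<xi> t<..Y \<zeta> t} then 1 else 0)" for x
      unfolding f_def mult.assoc by (intro tendsto_mult tendsto_const ind)
  qed
  \<comment> \<open>The time derivative of a step brings in the velocity of the carrying
    characteristic, the space derivative the velocity at \<open>x\<close>; the large factor
    \<open>sx\<close> multiplies only their difference.\<close>
  have key: "ft n t x + Nf n t x = (ht t x + N t x) * (st1 \<xi> n t x - st1 \<zeta> n t x)
     + h t x * (sx \<xi> n t x * (V t x - U \<xi> t) - sx \<zeta> n t x * (V t x - U \<zeta> t))" for n t x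
    by (simp add: ft_def Nf_def algebra_simps)
  have sxV: "\<bar>sx z n t x * (V t x - U z t)\<bar> \<le> 2 * lip" if t: "t \<in> {0..T}" and z: "z \<in> {b - \<eta>..b}" for z n t x
  proof (cases "x \<in> {Y z t..Y z t + e n}")
    case True
    have "\<bar>V t x - V t (Y z t)\<bar> \<le> lip * \<bar>x - Y z t\<bar>" using Yr[OF z, of t] True e(2)[of n] by (intro lip t) auto
    also have "\<dots> \<le> lip * e n" using True lip(1) by (intro mult_left_mono) auto
    finally have "\<bar>V t x - U z t\<bar> \<le> lip * e n" using t by (simp add: U_def)
    then have "\<bar>sx z n t x\<bar> * \<bar>V t x - U z t\<bar> \<le> 2 / e n * (lip * e n)" using sxb[of z n t x] e(1)[of n] by (intro mult_mono) auto
    then show ?thesis using e(1)[of n] by (simp add: abs_mult)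
  next
    case False
    then have "(x - Y z t) / e n \<le> 0 \<or> 1 \<le> (x - Y z t) / e n" using e(1)[of n] by (auto simp: divide_le_0_iff le_divide_eq)
    then show ?thesis using lip(1) by (simp add: sx_def sstep'_eq_0)
  qed
  define D where "D = M * ((Ct + \<bar>C\<bar>) * 1 + Ch * (4 * lip))"
  have bnd: "\<bar>\<omega> t x * (ft n t x + Nf n t x)\<bar> \<le> D" if t: "t \<in> {0..T}" and x: "x \<in> {-k..k}" for n t x
  proof -
    have 1: "\<bar>(ht t x + N t x) * (st1 \<xi> n t x - st1 \<zeta> n t x)\<bar> \<le> (Ct + \<bar>C\<bar>) * 1"
    proof (cases "x \<in> {b - \<eta>..\<beta> T + 1}")
      case True
      then have "\<bar>ht t x + N t x\<bar> \<le> Ct + \<bar>C\<bar>" using Ct(1)[OF t x] Nb[OF t True] by linarith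
      then show ?thesis unfolding abs_mult by (intro mult_mono stb) auto
    next
      case False then show ?thesis using out[OF False, of n t] Ct(2) by simp
    qed
    have "\<bar>sx \<xi> n t x * (V t x - U \<xi> t) - sx \<zeta> n t x * (V t x - U \<zeta> t)\<bar> \<le> 4 * lip"
      using sxV[OF t \<xi>(1), of n x] sxV[OF t \<xi>(2), of n x] by linarith
    then have 2: "\<bar>h t x * (sx \<xi> n t x * (V t x - U \<xi> t) - sx \<zeta> n t x * (V t x - U \<zeta> t))\<bar> \<le> Ch * (4 * lip)"
      unfolding abs_mult using Ch(1)[OF t x] Ch(2) by (intro mult_mono) auto
    have "\<bar>ft n t x + Nf n t x\<bar> \<le> (Ct + \<bar>C\<bar>) * 1 + Ch * (4 * lip)" unfolding key using 1 2 by linarith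
    then show ?thesis unfolding D_def abs_mult using om[OF t, of x] M_pos by (intro mult_mono) auto
  qed
  have Nfa: "(\<lambda>x. \<omega> t x * (ft n t x + Nf n t x)) integrable_on {-k..k}" if t: "t \<in> {0..T}" for n t
  proof (intro absolutely_integrable_imp_integrable absolutely_integrable_bounded_borel[OF _ bnd[OF t]])
    have t0: "0 \<le> t" using t by simp
    have sl: "u t \<in> borel_measurable borel" if "halfplane_continuous u" for u :: "real \<Rightarrow> real \<Rightarrow> real"
      by (intro borel_measurable_continuous_onI continuous_on_halfplane_slice[OF that] t0)
    have "N t \<in> borel_measurable borel" by (rule slice_measurable[OF Nm t0])
    moreover have "st1 z n t \<in> borel_measurable borel" "sx z n t \<in> borel_measurable borel" if "z \<in> {b - \<eta>..b}" for z
      using sl[of "st1 z n"] sl[of "sx z n"] pc(1,2)[OF that, of "{0..} \<times> UNIV" n] by (auto simp: case_prod_beta)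
    ultimately show "(\<lambda>x. \<omega> t x * (ft n t x + Nf n t x)) \<in> borel_measurable borel"
      unfolding key using \<xi> sl[OF V_cont] sl[OF c(1)] sl[OF c(2)] slice_measurable[OF omega_measurable t0]
      by (intro borel_measurable_times borel_measurable_add borel_measurable_diff) auto
  qed
  have lim2: "(\<lambda>n. integral {-k..k} (\<lambda>x. \<omega> t x * (ft n t x + Nf n t x))) \<longlonglongrightarrow> integral {X t \<xi>..X t \<zeta>} (\<lambda>x. \<omega> t x * (ht t x + N t x))"
    if t: "t \<in> {0..T}" for t
  proof (rule lim[OF t Nfa[OF t] bnd[OF t]])
    fix x
    have z: "(\<lambda>n. h t x * (sx \<xi> n t x * (V t x - U \<xi> t) - sx \<zeta> n t x * (V t x - U \<zeta> t))) \<longlonglongrightarrow> 0"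
      by (rule tendsto_eventually) (use sx0[of \<xi> t x] sx0[of \<zeta> t x] in \<open>eventually_elim, auto\<close>)
    have "(\<lambda>n. \<omega> t x * (ft n t x + Nf n t x)) \<longlonglongrightarrow> \<omega> t x * ((ht t x + N t x) * (if x \<in> {Y \<xi> t<..Y \<zeta> t} then 1 else 0) + 0)"
      unfolding key by (intro tendsto_mult tendsto_const tendsto_add z ind)
    then show "(\<lambda>n. \<omega> t x * (ft n t x + Nf n t x)) \<longlonglongrightarrow> \<omega> t x * (ht t x + N t x) * (if x \<in> {Y \<xi> t<..Y \<zeta> t} then 1 else 0)"
      by (simp add: mult.assoc)
  qed
  have sub: "\<tau> \<in> {0..T}" if "\<tau> \<in> {s..t}" for \<tau> using that st by auto
  have bo: "\<bar>integral {-k..k} (\<lambda>x. \<omega> \<tau> x * (ft n \<tau> x + Nf n \<tau> x))\<bar> \<le> 2 * k * D" if "\<tau> \<in> {s..t}" for n \<tau>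
  proof -
    have "\<bar>integral {-k..k} (\<lambda>x. \<omega> \<tau> x * (ft n \<tau> x + Nf n \<tau> x))\<bar> \<le> integral {-k..k} (\<lambda>_. D)"
      by (intro integral_norm_bound_integral[where 'a=real, simplified real_norm_def] Nfa bnd sub that) auto
    also have "\<dots> = 2 * k * D" using k0 by simp
    finally show ?thesis .
  qed
  have L2: "(\<lambda>\<tau>. integral {X \<tau> \<xi>..X \<tau> \<zeta>} (\<lambda>x. \<omega> \<tau> x * (ht \<tau> x + N \<tau> x))) integrable_on {s..t}"
    "(\<lambda>n. integral {s..t} (\<lambda>\<tau>. integral {-k..k} (\<lambda>x. \<omega> \<tau> x * (ft n \<tau> x + Nf n \<tau> x)))) \<longlonglongrightarrow>
     integral {s..t} (\<lambda>\<tau>. integral {X \<tau> \<xi>..X \<tau> \<zeta>} (\<lambda>x. \<omega> \<tau> x * (ht \<tau> x + N \<tau> x)))"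
  proof -
    have 1: "(\<lambda>\<tau>. integral {-k..k} (\<lambda>x. \<omega> \<tau> x * (ft n \<tau> x + Nf n \<tau> x))) integrable_on {s..t}" for n using eq[of n] by blast
    have 2: "(\<lambda>\<tau>. 2 * k * D) integrable_on {s..t}" by (rule integrable_const_ivl)
    have 3: "norm (integral {-k..k} (\<lambda>x. \<omega> \<tau> x * (ft n \<tau> x + Nf n \<tau> x))) \<le> 2 * k * D" if "\<tau> \<in> {s..t}" for n \<tau>
      using bo[OF that] by simp
    note DC = dominated_convergence[OF 1 2 3 lim2[OF sub]]
    show "(\<lambda>\<tau>. integral {X \<tau> \<xi>..X \<tau> \<zeta>} (\<lambda>x. \<omega> \<tau> x * (ht \<tau> x + N \<tau> x))) integrable_on {s..t}"
      "(\<lambda>n. integral {s..t} (\<lambda>\<tau>. integral {-k..k} (\<lambda>x. \<omega> \<tau> x * (ft n \<tau> x + Nf n \<tau> x)))) \<longlonglongrightarrow>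
       integral {s..t} (\<lambda>\<tau>. integral {X \<tau> \<xi>..X \<tau> \<zeta>} (\<lambda>x. \<omega> \<tau> x * (ht \<tau> x + N \<tau> x)))"
      by (rule DC; assumption)+
  qed
  have "(\<lambda>n. integral {s..t} (\<lambda>\<tau>. integral {-k..k} (\<lambda>x. \<omega> \<tau> x * (ft n \<tau> x + Nf n \<tau> x)))) \<longlonglongrightarrow>
     integral {X t \<xi>..X t \<zeta>} (\<lambda>x. \<omega> t x * h t x) - integral {X s \<xi>..X s \<zeta>} (\<lambda>x. \<omega> s x * h s x)"
    using tendsto_diff[OF lim1[of t] lim1[of s]] st eq by auto
  from LIMSEQ_unique[OF L2(2) this] show ?thesis using L2(1) by simp
qed

end

section \<open>The equilibrium density\<close>

text \<open>The derivative of the quotient is \<open>- G (r - P) (r + P) / r\<close>, which is at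
  most \<open>c W (r - P)\<^sup>2 / r\<close> times \<open>r + P\<close>; as \<open>c\<close> is
  negative, \<open>r + P \<ge> 2 * m\<close> yields the rate. That \<open>r\<close> stays above
  \<open>m\<close> is a barrier argument: where \<open>r < m \<le> P\<close>, the sign condition
  forces \<open>G \<le> 0\<close>, so \<open>r\<close> does not decrease.\<close>

lemma lyapunov_ode:
  fixes r r' G W :: "real \<Rightarrow> real"
  assumes D: "\<And>s. s \<in> {0..\<tau>} \<Longrightarrow> (r has_real_derivative r' s) (at s within {0..\<tau>})" and \<tau>: "0 \<le> \<tau>"
    and pos: "\<And>s. s \<in> {0..\<tau>} \<Longrightarrow> 0 < r s" and ode: "\<And>s. s \<in> {0..\<tau>} \<Longrightarrow> r' s = - r s * G s"
    and G: "\<And>s. s \<in> {0..\<tau>} \<Longrightarrow> - c * W s * (r s - P)\<^sup>2 \<le> G s * (r s - P)"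
    and W: "\<And>s. s \<in> {0..\<tau>} \<Longrightarrow> 0 \<le> W s" "continuous_on {0..\<tau>} W"
    and c: "c < 0" and m: "0 \<le> m" "m \<le> r 0" "m \<le> P"
  shows "(r \<tau> - P)\<^sup>2 / r \<tau> \<le> (r 0 - P)\<^sup>2 / r 0 * exp (2 * c * m * integral {0..\<tau>} W)"
proof -
  have G0: "0 \<le> G s * (r s - P)" if "s \<in> {0..\<tau>}" for s
  proof -
    have "0 \<le> - c * W s * (r s - P)\<^sup>2" using c W(1)[OF that] by (intro mult_nonneg_nonneg) auto
    then show ?thesis using G[OF that] by linarith
  qed
  have rm: "m \<le> r s" if s: "s \<in> {0..\<tau>}" for s
  proof -
    have "0 \<le> r s - m"
    proof (rule DERIV_within_barrier[where C=0, OF _ _ _ s])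
      show "((\<lambda>s. r s - m) has_real_derivative r' s - 0) (at s within {0..\<tau>})" if "s \<in> {0..\<tau>}" for s
        by (intro DERIV_diff D that DERIV_const)
      show "0 * (r s - m) \<le> r' s - 0" if "s \<in> {0..\<tau>}" "r s - m < 0" for s
      proof -
        have "r s - P < 0" using that(2) m(3) by linarith
        then have "G s \<le> 0" using G0[OF that(1)] by (simp add: zero_le_mult_iff)
        then show ?thesis using pos[OF that(1)] ode[OF that(1)] by (simp add: mult_nonneg_nonpos)
      qed
    qed (use m in auto)
    then show ?thesis by simp
  qed
  define E where "E s = exp (- 2 * c * m * integral {0..s} W)" for s
  define H' where "H' s = (r' s * (r s - P) * (r s + P) / (r s)\<^sup>2 - 2 * c * m * W s * ((r s - P)\<^sup>2 / r s)) * E s" for s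
  have DH: "((\<lambda>s. - ((r s - P)\<^sup>2 / r s * E s)) has_real_derivative - H' s) (at s within {0..\<tau>})" if s: "s \<in> {0..\<tau>}" for s
  proof -
    have r0: "r s \<noteq> 0" using pos[OF s] by simp
    have DI: "((\<lambda>s. integral {0..s} W) has_real_derivative W s) (at s within {0..\<tau>})"
      by (rule integral_has_derivative_within[OF W(2) s])
    have DE: "(E has_real_derivative E s * (- 2 * c * m * W s)) (at s within {0..\<tau>})"
      unfolding E_def[abs_def] by (rule derivative_eq_intros DI refl | simp)+
    have DQ: "((\<lambda>s. (r s - P)\<^sup>2 / r s) has_real_derivative r' s * (r s - P) * (r s + P) / (r s)\<^sup>2) (at s within {0..\<tau>})"
      by (rule derivative_eq_intros D[OF s] refl r0 | simp add: r0)+ (use r0 in \<open>simp add: field_simps power2_eq_square\<close>)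
    from DERIV_minus[OF DERIV_mult[OF DQ DE]] show ?thesis by (simp add: H'_def algebra_simps)
  qed
  have "- ((r 0 - P)\<^sup>2 / r 0 * E 0) \<le> - ((r \<tau> - P)\<^sup>2 / r \<tau> * E \<tau>)"
  proof (rule DERIV_within_nonneg_imp_le[OF \<tau> DH])
    fix s assume "s \<in> {0<..<\<tau>}"
    then have s: "s \<in> {0..\<tau>}" by auto
    have r: "0 < r s" by (rule pos[OF s])
    define Q where "Q = (r s - P)\<^sup>2 / r s"
    have Q: "0 \<le> Q" using r by (simp add: Q_def)
    have "r' s * (r s - P) * (r s + P) / (r s)\<^sup>2 = - (G s * (r s - P)) * ((r s + P) / r s)"
      using r ode[OF s] by (simp add: power2_eq_square)
    also have "\<dots> \<le> (c * W s * (r s - P)\<^sup>2) * ((r s + P) / r s)"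
    proof (rule mult_right_mono)
      show "0 \<le> (r s + P) / r s" using r m by simp
    qed (use G[OF s] in simp)
    also have "\<dots> = c * W s * Q * (r s + P)" by (simp add: Q_def)
    also have "\<dots> \<le> c * W s * Q * (2 * m)"
    proof (rule mult_left_mono_neg)
      show "c * W s * Q \<le> 0" using c W(1)[OF s] Q by (simp add: mult_nonneg_nonpos mult_nonneg_nonpos2 mult_nonpos_nonneg)
    qed (use rm[OF s] m in linarith)
    finally have "r' s * (r s - P) * (r s + P) / (r s)\<^sup>2 - 2 * c * m * W s * Q \<le> 0" by (simp add: algebra_simps)
    then show "0 \<le> - H' s" unfolding H'_def Q_def[symmetric] by (simp add: E_def mult_le_0_iff)
  qed auto
  then have "(r \<tau> - P)\<^sup>2 / r \<tau> * E \<tau> \<le> (r 0 - P)\<^sup>2 / r 0" by (simp add: E_def)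
  then have "(r \<tau> - P)\<^sup>2 / r \<tau> * E \<tau> * exp (2 * c * m * integral {0..\<tau>} W) \<le> (r 0 - P)\<^sup>2 / r 0 * exp (2 * c * m * integral {0..\<tau>} W)"
    by (intro mult_right_mono) auto
  moreover have "E \<tau> * exp (2 * c * m * integral {0..\<tau>} W) = 1" by (simp add: E_def exp_add[symmetric])
  ultimately show ?thesis by (simp add: mult.assoc)
qed

lemma DERIV_within_upper_slope:
  fixes f f' :: "real \<Rightarrow> real"
  assumes D: "\<And>x. x \<in> {a..b} \<Longrightarrow> (f has_real_derivative f' x) (at x within {a..b})"
    and le: "\<And>x. x \<in> {a..b} \<Longrightarrow> f' x \<le> c" and x: "x \<in> {a..b}" "y \<in> {a..b}" "x \<le> y"
  shows "f y - f x \<le> c * (y - x)"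
proof -
  have "c * x - f x \<le> c * y - f y"
  proof (rule DERIV_within_nonneg_imp_le[OF x(3)])
    show "((\<lambda>z. c * z - f z) has_real_derivative c * 1 - f' z) (at z within {x..y})" if "z \<in> {x..y}" for z
      using that x by (intro DERIV_diff DERIV_cmult DERIV_ident DERIV_subset[OF D]) auto
  qed (use le x in auto)
  then show ?thesis by (simp add: algebra_simps)
qed

context boundary_flow
begin

lemma v_deriv:
  assumes "(r, om) \<in> admissible rmax"
  shows "((\<lambda>s. v s om) has_real_derivative d_rho rmax v r om) (at r within {0..rmax om})"
proof -
  have d: "(\<lambda>s. v s om) differentiable (at r within {0..rmax om})" using velocity assms unfolding velocity_law_def by blast
  have "at r within {0..rmax om} \<noteq> bot"
    using velocity assms unfolding velocity_law_def admissible_def by (auto simp: trivial_limit_within islimpt_Icc)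
  then show ?thesis using d vector_derivative_works[of "\<lambda>s. v s om" "at r within {0..rmax om}"]
    unfolding d_rho_def has_real_derivative_iff_has_vector_derivative by simp
qed

lemma v_slope_le:
  assumes "om \<in> \<omega>0 ` {a..b}" "0 < om" "r1 \<in> {0..rmax om}" "r2 \<in> {0..rmax om}" "r1 \<le> r2"
  shows "v r2 om - v r1 om \<le> vmax' * (r2 - r1)"
  using assms vmax by (intro DERIV_within_upper_slope[OF v_deriv, of om]) (auto simp: admissible_def)

lemma omega0_pos: "x \<in> {a..b} \<Longrightarrow> 0 < \<omega>0 x"
  using omega_pos[of 0 x] omega_0_eq[of x] by simp

lemma v_slope:
  assumes "x \<in> {a..b}" "r1 \<in> {0..rmax (\<omega>0 x)}" "r2 \<in> {0..rmax (\<omega>0 x)}"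
  shows "(v r1 (\<omega>0 x) - v r2 (\<omega>0 x)) * (r1 - r2) \<le> vmax' * (r1 - r2)\<^sup>2"
proof -
  have main: "(v r1 (\<omega>0 x) - v r2 (\<omega>0 x)) * (r1 - r2) \<le> vmax' * (r1 - r2)\<^sup>2"
    if "r1 \<in> {0..rmax (\<omega>0 x)}" "r2 \<in> {0..rmax (\<omega>0 x)}" "r1 \<le> r2" for r1 r2
  proof -
    have "(v r2 (\<omega>0 x) - v r1 (\<omega>0 x)) * (r2 - r1) \<le> vmax' * (r2 - r1) * (r2 - r1)"
      using v_slope_le[OF _ omega0_pos[OF assms(1)] that] assms(1) that by (intro mult_right_mono) auto
    then show ?thesis by (simp add: power2_eq_square algebra_simps)
  qed
  show ?thesis using main[of r1 r2] main[of r2 r1] assms by (cases "r1 \<le> r2") (auto simp: power2_commute algebra_simps)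
qed

lemma v_inj:
  assumes "x \<in> {a..b}" "r1 \<in> {0..rmax (\<omega>0 x)}" "r2 \<in> {0..rmax (\<omega>0 x)}" "v r1 (\<omega>0 x) = v r2 (\<omega>0 x)"
  shows "r1 = r2"
proof -
  have "0 \<le> vmax' * (r1 - r2)\<^sup>2" using v_slope[OF assms(1-3)] assms(4) by simp
  then show ?thesis using vmax_neg by (simp add: zero_le_mult_iff)
qed

lemma v_strict:
  assumes "x \<in> {a..b}" "r1 \<in> {0..rmax (\<omega>0 x)}" "r2 \<in> {0..rmax (\<omega>0 x)}" "r1 < r2"
  shows "v r2 (\<omega>0 x) < v r1 (\<omega>0 x)"
proof -
  have "v r2 (\<omega>0 x) - v r1 (\<omega>0 x) \<le> vmax' * (r2 - r1)" using assms omega0_pos by (intro v_slope_le) auto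
  also have "\<dots> < 0" using assms(4) vmax_neg by (simp add: mult_neg_pos)
  finally show ?thesis by simp
qed

lemma v_0: "0 < om \<Longrightarrow> v 0 om = om" and rmax_pos: "0 < om \<Longrightarrow> 0 < rmax om" and v_rmax: "0 < om \<Longrightarrow> v (rmax om) om = 0"
  using velocity unfolding velocity_law_def by auto

lemma v_cont_rho: "0 \<le> om \<Longrightarrow> continuous_on S f \<Longrightarrow> (\<And>s. s \<in> S \<Longrightarrow> 0 \<le> f s) \<Longrightarrow> continuous_on S (\<lambda>s. v (f s) om)"
proof -
  assume *: "0 \<le> om" "continuous_on S f" "\<And>s. s \<in> S \<Longrightarrow> 0 \<le> f s"
  have "continuous_on S (\<lambda>s. (f s, om))" by (intro continuous_intros *)
  from continuous_on_compose2[OF v_cont this] show ?thesis using * by (auto simp: image_subset_iff)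
qed

definition P :: "real \<Rightarrow> real" where "P = \<rho>bar 0"

lemma rhobar_props: "0 \<le> t \<Longrightarrow> x \<in> {a..\<beta> t} \<Longrightarrow> \<rho>bar t x \<in> {0..rmax (\<omega> t x)}"
  "0 \<le> t \<Longrightarrow> x \<in> {a..\<beta> t} \<Longrightarrow> v (\<rho>bar t x) (\<omega> t x) = vbar"
  using equilibrium unfolding equilibrium_density_def admissible_def by fastforce+

lemma P_props: "x \<in> {a..b} \<Longrightarrow> P x \<in> {0..rmax (\<omega>0 x)}" "x \<in> {a..b} \<Longrightarrow> v (P x) (\<omega>0 x) = vbar"
  using rhobar_props[of 0 x] omega_0_eq[of x] by (auto simp: P_def beta_eq)

lemma rhobar_eq_P: "0 \<le> t \<Longrightarrow> x \<in> {a..\<beta> t} \<Longrightarrow> \<xi> \<in> {a..b} \<Longrightarrow> \<omega> t x = \<omega>0 \<xi> \<Longrightarrow> \<rho>bar t x = P \<xi>"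
  using rhobar_props[of t x] P_props[of \<xi>] v_inj[of \<xi> "\<rho>bar t x" "P \<xi>"] by auto

text \<open>Between the densities 0 and \<open>P x\<close> the speed drops from
  \<open>\<omega>0 x\<close> to \<open>vbar\<close> with slope at most \<open>vmax'\<close>.\<close>

lemma P_bounded: "x \<in> {a..b} \<Longrightarrow> P x \<le> M / (- vmax')"
proof -
  assume x: "x \<in> {a..b}"
  have "vbar - \<omega>0 x \<le> vmax' * P x"
    using v_slope_le[of "\<omega>0 x" 0 "P x"] x omega0_pos[OF x] P_props[OF x] v_0[OF omega0_pos[OF x]] rmax_pos[OF omega0_pos[OF x]] by auto
  then have "- vmax' * P x \<le> M" using omega_le_M[of 0 x] omega_0_eq[OF x] vbar_pos by simp
  then show ?thesis using vmax_neg by (subst pos_le_divide_eq) (auto simp: mult.commute)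
qed

text \<open>
  The equilibrium density is the first root of \<open>v \<cdot> om = vbar\<close>, so a lower bound for it only
  involves the values of \<open>v\<close> on countably many densities.
\<close>

lemma P_gt_iff:
  assumes x: "x \<in> {a..b}" and c: "0 \<le> c"
  shows "c < P x \<longleftrightarrow> (\<exists>n::nat. \<forall>q\<in>\<rat> \<inter> {0..c}. vbar + 1 / Suc n \<le> v q (\<omega>0 x)) \<and> vbar < v c (\<omega>0 x)"
proof
  assume cP: "c < P x"
  have r: "c \<in> {0..rmax (\<omega>0 x)}" using c cP P_props(1)[OF x] by auto
  have "vbar < v c (\<omega>0 x)" using v_strict[OF x r P_props(1)[OF x] cP] P_props(2)[OF x] by simp
  moreover obtain n :: nat where n: "1 / Suc n < v c (\<omega>0 x) - vbar"
    using calculation reals_Archimedean[of "v c (\<omega>0 x) - vbar"] by (auto simp: inverse_eq_divide)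
  moreover have "\<And>q. q \<in> {0..c} \<Longrightarrow> v c (\<omega>0 x) \<le> v q (\<omega>0 x)"
    using v_strict[OF x, of _ c] r by (metis atLeastAtMost_iff less_eq_real_def order_trans)
  ultimately show "(\<exists>n::nat. \<forall>q\<in>\<rat> \<inter> {0..c}. vbar + 1 / Suc n \<le> v q (\<omega>0 x)) \<and> vbar < v c (\<omega>0 x)"
  proof (intro conjI exI[of _ n] ballI)
    fix q assume "q \<in> \<rat> \<inter> {0..c}"
    then have "v c (\<omega>0 x) \<le> v q (\<omega>0 x)" using \<open>\<And>q. q \<in> {0..c} \<Longrightarrow> v c (\<omega>0 x) \<le> v q (\<omega>0 x)\<close> by blast
    then show "vbar + 1 / Suc n \<le> v q (\<omega>0 x)" using n by linarith
  qed
next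
  assume R: "(\<exists>n::nat. \<forall>q\<in>\<rat> \<inter> {0..c}. vbar + 1 / Suc n \<le> v q (\<omega>0 x)) \<and> vbar < v c (\<omega>0 x)"
  then obtain n :: nat where n: "\<And>q. q \<in> \<rat> \<Longrightarrow> q \<in> {0..c} \<Longrightarrow> vbar + 1 / Suc n \<le> v q (\<omega>0 x)"
    by blast
  show "c < P x"
  \<comment> \<open>Beyond the admissible range \<open>v\<close> need not be monotone, but it is
    continuous at the root. If \<open>P x < c\<close>, a rational \<open>q\<close> just to the right
    of \<open>P x\<close> has a speed below \<open>vbar + 1 / Suc n\<close>.\<close>
  proof (rule ccontr)
    assume "\<not> c < P x"
    moreover have "P x \<noteq> c" using R P_props(2)[OF x] by auto
    ultimately have Pc: "P x < c" by simp
    have P0: "0 \<le> P x" using P_props(1)[OF x] by simp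
    have "continuous_on {0..c} (\<lambda>s. v s (\<omega>0 x))" using omega0_pos[OF x] by (intro v_cont_rho continuous_intros) auto
    then obtain d where d: "0 < d" "\<And>s. s \<in> {0..c} \<Longrightarrow> dist s (P x) < d \<Longrightarrow> dist (v s (\<omega>0 x)) (v (P x) (\<omega>0 x)) < 1 / Suc n"
      unfolding continuous_on_iff using P0 Pc by (metis atLeastAtMost_iff less_imp_le of_nat_0_less_iff zero_less_Suc zero_less_divide_1_iff)
    obtain q where q: "q \<in> \<rat>" "P x < q" "q < min c (P x + d)" using Rats_dense_in_real[of "P x" "min c (P x + d)"] Pc d(1) by auto
    have "dist (v q (\<omega>0 x)) vbar < 1 / Suc n" using d(2)[of q] q P0 P_props(2)[OF x] by (auto simp: dist_real_def)
    then show False using n[of q] q P0 by (auto simp: dist_real_def)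
  qed
qed

text \<open>The equilibrium density is given pointwise by an equation; its measurability comes from
  the countable description of the superlevel sets in \<open>P_gt_iff\<close>. The equation is
  imposed on \<open>{a..b}\<close>, hence the value 0 elsewhere.\<close>

lemma P_measurable: "(\<lambda>x. if x \<in> {a..b} then P x else 0) \<in> borel_measurable borel"
proof (rule borel_measurableI_greater)
  fix c :: real
  have om: "\<omega> 0 \<in> borel_measurable borel" by (rule slice_measurable[OF omega_measurable]) simp
  have vm: "(\<lambda>x. vc (q, \<omega> 0 x)) \<in> borel_measurable borel" for q
  proof -
    have "(\<lambda>z. vc (q, z)) \<in> borel_measurable borel"
      by (intro borel_measurable_continuous_onI continuous_on_compose2[OF vc_cont] continuous_intros) auto
    from measurable_compose[OF om this] show ?thesis .
  qed
  show "{x \<in> space borel. c < (if x \<in> {a..b} then P x else 0)} \<in> sets borel"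
  proof (cases "0 \<le> c")
    case True
    have vceq: "vc (q, \<omega> 0 x) = v q (\<omega>0 x)" if "0 \<le> q" "x \<in> {a..b}" for q x
      using that omega0_pos[OF that(2)] by (simp add: vc_def omega_0_eq max_absorb2)
    have "c < (if x \<in> {a..b} then P x else 0) \<longleftrightarrow>
      x \<in> {a..b} \<and> (\<exists>n::nat. \<forall>q\<in>\<rat> \<inter> {0..c}. vbar + 1 / Suc n \<le> vc (q, \<omega> 0 x)) \<and> vbar < vc (c, \<omega> 0 x)" for x
    proof (cases "x \<in> {a..b}")
      case x: True
      have "(\<forall>q\<in>\<rat> \<inter> {0..c}. vbar + 1 / Suc n \<le> vc (q, \<omega> 0 x)) = (\<forall>q\<in>\<rat> \<inter> {0..c}. vbar + 1 / Suc n \<le> v q (\<omega>0 x))" for n :: nat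
        using vceq x by (intro ball_cong) auto
      then show ?thesis using x P_gt_iff[OF x True] vceq[OF True x] by (simp only: if_True simp_thms)
    qed (use True in auto)
    then have "{x \<in> space borel. c < (if x \<in> {a..b} then P x else 0)} =
      {a..b} \<inter> ((\<Union>n::nat. \<Inter>q\<in>\<rat> \<inter> {0..c}. {x \<in> space borel. vbar + 1 / Suc n \<le> vc (q, \<omega> 0 x)}) \<inter> {x \<in> space borel. vbar < vc (c, \<omega> 0 x)})"
      by (intro set_eqI) (simp only: mem_Collect_eq Int_iff UN_iff INT_iff UNIV_I space_borel simp_thms, blast)
    also have "\<dots> \<in> sets borel"
    proof (intro sets.Int sets.countable_UN'' sets.countable_INT'' borel_measurable_le borel_measurable_less borel_measurable_const vm)
      show "countable (\<rat> \<inter> {0..c})" by (rule countable_subset[OF _ countable_rat]) auto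
    qed (auto intro!: borel_measurable_le borel_measurable_less vm)
    finally show ?thesis .
  next
    case False
    then have "{x \<in> space borel. c < (if x \<in> {a..b} then P x else 0)} = UNIV"
      using P_props(1) by fastforce
    then show ?thesis by simp
  qed
qed

end

section \<open>The marker and the change of variables in label coordinates\<close>

context flow_on
begin

text \<open>With \<open>h = \<rho>\<close>, the continuity equation makes \<open>ht + N\<close>
  vanish at every point, so the transported integral has no source.\<close>

lemma omega_rho_transported:
  assumes \<xi>: "\<xi> \<in> {b - \<eta>..b}" "\<zeta> \<in> {b - \<eta>..b}" "\<xi> \<le> \<zeta>" and t: "0 \<le> t" "t < T"
  shows "integral {X t \<xi>..X t \<zeta>} (\<lambda>x. \<omega> t x * \<rho> t x) = integral {\<xi>..\<zeta>} (\<lambda>x. \<omega> 0 x * \<rho> 0 x)"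
proof -
  have c: "continuous_on ({0..} \<times> UNIV) (\<lambda>(t, x). - rt t x)"
    using continuous_on_minus[OF rt_cont] by (simp add: case_prod_beta)
  obtain C where C: "\<And>t x. t \<in> {0..T} \<Longrightarrow> x \<in> {b - \<eta>..\<beta> T + 1} \<Longrightarrow> \<bar>- rt t x\<bar> \<le> C" using bounded_on_halfplane_rectangle[OF c] by metis
  have Dt: "((\<lambda>s. \<rho> s x) has_real_derivative rt t x) (at t)" if "0 < t" for t x
    using DERIV_rho_t[of t x] that at_within_interior[of t "{0..}"] by (simp add: interior_Ici[of "-1"])
  have flux: "((\<lambda>y. V t y * \<rho> t y) has_real_derivative - rt t x) (at x)" if "0 \<le> t" for t x
    using DERIV_flux[OF that] by (simp add: mult.commute)
  have neg: "negligible {p. fst p \<in> {0..T} \<and> \<not> ((\<lambda>y. V (fst p) y * \<rho> (fst p) y) has_real_derivative - rt (fst p) (snd p)) (at (snd p))}"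
  proof -
    have "{p. fst p \<in> {0..T} \<and> \<not> ((\<lambda>y. V (fst p) y * \<rho> (fst p) y) has_real_derivative - rt (fst p) (snd p)) (at (snd p))} = {}"
      using flux by auto
    then show ?thesis by (simp only: negligible_empty)
  qed
  have "integral {X t \<xi>..X t \<zeta>} (\<lambda>x. \<omega> t x * \<rho> t x) - integral {X 0 \<xi>..X 0 \<zeta>} (\<lambda>x. \<omega> 0 x * \<rho> 0 x) =
    integral {0..t} (\<lambda>\<tau>. integral {X \<tau> \<xi>..X \<tau> \<zeta>} (\<lambda>x. \<omega> \<tau> x * (rt \<tau> x + - rt \<tau> x)))"
    using t by (intro conjunct1[OF transported_integral[OF rho_cont rt_cont rx_cont Dt DERIV_rho_x borel_extend[OF c] C neg \<xi>]]) auto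
  then show ?thesis using X_props(1)[OF \<xi>(1)] X_props(1)[OF \<xi>(2)] by simp
qed

lemma DERIV_primitive_rho: "0 \<le> t \<Longrightarrow> (primitive (\<rho> t) has_real_derivative \<rho> t x) (at x)"
  by (rule DERIV_primitive_lebesgue_point[OF _ continuous_lebesgue_point[of "x-1" "x+1"]])
    (auto intro!: continuous_on_halfplane_slice[OF rho_cont] absolutely_integrable_continuous_real)

lemma rho_aint: "0 \<le> t \<Longrightarrow> \<rho> t absolutely_integrable_on {p..q}"
  by (intro absolutely_integrable_continuous_real continuous_on_halfplane_slice[OF rho_cont])

text \<open>\<open>V\<close> is only Lipschitz in space, so the flow is not differentiated through
  its equation. By conservation of mass \<open>X t\<close> intertwines two mass functions, with
  derivatives \<open>\<rho>0\<close> at the label and \<open>r\<close> at its position; the quotient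
  is the Jacobian.\<close>

lemma DERIV_X_label:
  assumes \<xi>: "\<xi> \<in> {b - \<eta><..<b}" and pos: "0 < \<rho>0 \<xi>" and t: "t \<in> {0..T}"
  shows "(X t has_real_derivative \<rho>0 \<xi> / r t \<xi>) (at \<xi>)"
proof -
  have t0: "0 \<le> t" using t by simp
  have \<xi>': "\<xi> \<in> {b - \<eta>..b}" using \<xi> by auto
  have r: "0 < r t \<xi>"
    using r_bounds(1)[OF \<xi>' t] mult_pos_pos[OF pos exp_gt_zero[of "- (lip * t)"]] by linarith
  have ab: "\<xi> \<in> {a..b}" using \<xi>' ab' by auto
  let ?P = "primitive (\<rho> t)" and ?Q = "primitive (\<rho> 0)"
  have inc: "?P (X t \<zeta>) - ?P (X t \<xi>) = ?Q \<zeta> - ?Q \<xi>" if \<zeta>: "\<zeta> \<in> {b - \<eta>..b}" for \<zeta>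
  proof (cases "\<xi> \<le> \<zeta>")
    case True
    then show ?thesis using mass_conserved[OF \<xi>' \<zeta> True t] X_mono[OF \<xi>' \<zeta> True t] primitive_diff[OF rho_aint[OF t0]] primitive_diff[OF rho_aint[of 0]] by simp
  next
    case False
    then have le: "\<zeta> \<le> \<xi>" by simp
    then show ?thesis using mass_conserved[OF \<zeta> \<xi>' le t] X_mono[OF \<zeta> \<xi>' le t] primitive_diff[OF rho_aint[OF t0], of "X t \<zeta>" "X t \<xi>"] primitive_diff[OF rho_aint[of 0], of \<zeta> \<xi>] by simp
  qed
  have ev: "\<forall>\<^sub>F \<zeta> in at \<xi>. \<zeta> \<in> {b - \<eta><..<b} \<and> \<zeta> \<noteq> \<xi>"
    using eventually_at_in_open[of "{b - \<eta><..<b}" \<xi>] \<xi> by auto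
  have "isCont (X t) \<xi>" using continuous_on_interior[OF X_cont_label[OF t]] \<xi> by simp
  then have Xl: "(X t \<longlongrightarrow> X t \<xi>) (at \<xi>)" by (simp add: isCont_def)
  have ne: "\<forall>\<^sub>F \<zeta> in at \<xi>. X t \<zeta> \<noteq> X t \<xi>"
    using ev
  proof (rule eventually_mono)
    fix \<zeta> assume \<zeta>: "\<zeta> \<in> {b - \<eta><..<b} \<and> \<zeta> \<noteq> \<xi>"
    then have "\<zeta> \<in> {b - \<eta>..b}" by auto
    then show "X t \<zeta> \<noteq> X t \<xi>" using X_less_iff[OF \<xi>' _ t, of \<zeta>] X_less_iff[OF _ \<xi>' t, of \<zeta>] \<zeta> by force
  qed
  have Xf: "filterlim (X t) (at (X t \<xi>)) (at \<xi>)" by (rule filterlim_atI[OF Xl ne])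
  have "((\<lambda>y. (?P y - ?P (X t \<xi>)) / (y - X t \<xi>)) \<longlongrightarrow> \<rho> t (X t \<xi>)) (at (X t \<xi>))"
    using DERIV_primitive_rho[OF t0] by (simp add: has_field_derivative_iff)
  from filterlim_compose[OF this Xf]
  have 1: "((\<lambda>\<zeta>. (?P (X t \<zeta>) - ?P (X t \<xi>)) / (X t \<zeta> - X t \<xi>)) \<longlongrightarrow> r t \<xi>) (at \<xi>)" by (simp add: r_def)
  have 2: "((\<lambda>\<zeta>. (?Q \<zeta> - ?Q \<xi>) / (\<zeta> - \<xi>)) \<longlongrightarrow> \<rho>0 \<xi>) (at \<xi>)"
    using DERIV_primitive_rho[of 0 \<xi>] rho_0_eq[OF ab] by (simp add: has_field_derivative_iff)
  have 3: "((\<lambda>\<zeta>. ((?Q \<zeta> - ?Q \<xi>) / (\<zeta> - \<xi>)) / ((?P (X t \<zeta>) - ?P (X t \<xi>)) / (X t \<zeta> - X t \<xi>))) \<longlongrightarrow> \<rho>0 \<xi> / r t \<xi>) (at \<xi>)"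
    using r by (intro tendsto_divide 1 2) auto
  \<comment> \<open>Near \<open>\<xi>\<close> the mass quotient in space is positive like its limit,
    which permits the division.\<close>
  have nz: "\<forall>\<^sub>F \<zeta> in at \<xi>. (?P (X t \<zeta>) - ?P (X t \<xi>)) / (X t \<zeta> - X t \<xi>) > 0" using r by (rule order_tendstoD(1)[OF 1])
  show ?thesis unfolding has_field_derivative_iff
  proof (rule Lim_transform_eventually[OF 3])
    show "\<forall>\<^sub>F \<zeta> in at \<xi>. ((?Q \<zeta> - ?Q \<xi>) / (\<zeta> - \<xi>)) / ((?P (X t \<zeta>) - ?P (X t \<xi>)) / (X t \<zeta> - X t \<xi>)) = (X t \<zeta> - X t \<xi>) / (\<zeta> - \<xi>)"
      using ev ne nz
    proof eventually_elim
      case (elim \<zeta>)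
      have e: "?P (X t \<zeta>) - ?P (X t \<xi>) = ?Q \<zeta> - ?Q \<xi>" using elim by (intro inc) auto
      have gen: "(B / d) / (B / D) = D / d" if "0 < B / D" "d \<noteq> 0" for B D d :: real
        using that by (cases "B = 0"; cases "D = 0") (simp_all add: field_simps)
      have "((?P (X t \<zeta>) - ?P (X t \<xi>)) / (\<zeta> - \<xi>)) / ((?P (X t \<zeta>) - ?P (X t \<xi>)) / (X t \<zeta> - X t \<xi>)) = (X t \<zeta> - X t \<xi>) / (\<zeta> - \<xi>)"
        using elim by (intro gen) auto
      then show ?case by (simp only: e)
    qed
  qed
qed

lemma X_inj: "t \<in> {0..T} \<Longrightarrow> inj_on (X t) {b - \<eta>..b}"
  using X_less_iff by (intro inj_onI) (metis less_irrefl linorder_neq_iff)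

lemma X_image_open:
  assumes "p \<in> {b - \<eta>..b}" "q \<in> {b - \<eta>..b}" "p \<le> q" "t \<in> {0..T}"
  shows "X t ` {p<..<q} = {X t p<..<X t q}"
proof -
  have eq: "{p<..<q} = {p..q} - {p, q}" "{X t p<..<X t q} = {X t p..X t q} - {X t p, X t q}" by auto
  note inj = X_inj[OF assms(4)]
  have "X t ` ({p..q} - {p, q}) = X t ` {p..q} - X t ` {p, q}"
    using assms by (intro inj_on_image_set_diff[OF inj]) auto
  then show ?thesis unfolding eq using X_image[OF assms] by simp
qed

text \<open>The value \<open>I\<close> is left free so that the equivalence transfers both
  integrability and the value of the integral, in either direction.\<close>

lemma change_of_labels:
  fixes f :: "real \<Rightarrow> real"
  assumes pq: "p \<in> {b - \<eta>..b}" "q \<in> {b - \<eta>..b}" "p \<le> q" and pos: "\<And>\<xi>. \<xi> \<in> {p<..<q} \<Longrightarrow> 0 < \<rho>0 \<xi>" and t: "t \<in> {0..T}"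
  shows "(\<lambda>\<xi>. \<rho>0 \<xi> / r t \<xi> * f (X t \<xi>)) absolutely_integrable_on {p<..<q} \<and>
      integral {p<..<q} (\<lambda>\<xi>. \<rho>0 \<xi> / r t \<xi> * f (X t \<xi>)) = I
    \<longleftrightarrow> f absolutely_integrable_on {X t p<..<X t q} \<and> integral {X t p<..<X t q} f = I"
proof -
  have r: "0 \<le> \<rho>0 \<xi> / r t \<xi>" if "\<xi> \<in> {p<..<q}" for \<xi> using r_nonneg[OF t, of \<xi>] pos[OF that] by simp
  have inj: "inj_on (X t) {p<..<q}"
    using X_inj[OF t] by (rule inj_on_subset) (use pq in auto)
  have "(\<lambda>\<xi>. \<bar>\<rho>0 \<xi> / r t \<xi>\<bar> * f (X t \<xi>)) absolutely_integrable_on {p<..<q} \<and>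
      integral {p<..<q} (\<lambda>\<xi>. \<bar>\<rho>0 \<xi> / r t \<xi>\<bar> * f (X t \<xi>)) = I
    \<longleftrightarrow> f absolutely_integrable_on X t ` {p<..<q} \<and> integral (X t ` {p<..<q}) f = I"
    using pq pos by (intro has_absolute_integral_change_of_variables_1' DERIV_subset[OF DERIV_X_label[OF _ _ t]] inj) auto
  moreover have "(\<lambda>\<xi>. \<bar>\<rho>0 \<xi> / r t \<xi>\<bar> * f (X t \<xi>)) absolutely_integrable_on {p<..<q} \<longleftrightarrow> (\<lambda>\<xi>. \<rho>0 \<xi> / r t \<xi> * f (X t \<xi>)) absolutely_integrable_on {p<..<q}"
    by (intro set_integrable_cong refl) (subst abs_of_nonneg[OF r], assumption, rule refl)
  moreover have "integral {p<..<q} (\<lambda>\<xi>. \<bar>\<rho>0 \<xi> / r t \<xi>\<bar> * f (X t \<xi>)) = integral {p<..<q} (\<lambda>\<xi>. \<rho>0 \<xi> / r t \<xi> * f (X t \<xi>))"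
    by (intro integral_cong) (subst abs_of_nonneg[OF r], assumption, rule refl)
  ultimately show ?thesis using X_image_open[OF pq t] by simp
qed

text \<open>The inverse of the flow is Lipschitz with constant \<open>exp (lip * t)\<close>, by the
  lower bound on the distance of characteristics.\<close>

lemma X_preimage_negligible:
  assumes N: "negligible N" and t: "t \<in> {0..T}"
  shows "negligible {\<xi> \<in> {b - \<eta>..b}. X t \<xi> \<in> N}"
proof -
  define J where "J = the_inv_into {b - \<eta>..b} (X t)"
  note inj = X_inj[OF t]
  have J: "J (X t \<xi>) = \<xi>" if "\<xi> \<in> {b - \<eta>..b}" for \<xi> unfolding J_def using inj that by (rule the_inv_into_f_f)
  let ?S = "N \<inter> X t ` {b - \<eta>..b}"
  have "negligible (J ` ?S)"
  proof (rule negligible_locally_Lipschitz_image)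
    show "negligible ?S" using N by (rule negligible_subset) auto
    fix x assume "x \<in> ?S"
    then obtain \<xi> where \<xi>: "\<xi> \<in> {b - \<eta>..b}" "x = X t \<xi>" by auto
    show "\<exists>U B. open U \<and> x \<in> U \<and> (\<forall>y\<in>?S \<inter> U. norm (J y - J x) \<le> B * norm (y - x))"
    proof (intro exI[of _ UNIV] exI[of _ "exp (lip * t)"] conjI ballI)
      fix y assume "y \<in> ?S \<inter> UNIV"
      then obtain \<zeta> where \<zeta>: "\<zeta> \<in> {b - \<eta>..b}" "y = X t \<zeta>" by auto
      have "\<bar>\<zeta> - \<xi>\<bar> * exp (- (lip * t)) * exp (lip * t) \<le> \<bar>X t \<zeta> - X t \<xi>\<bar> * exp (lip * t)"
        by (intro mult_right_mono X_diff_bounds \<xi> \<zeta> t) auto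
      moreover have "\<bar>\<zeta> - \<xi>\<bar> * exp (- (lip * t)) * exp (lip * t) = \<bar>\<zeta> - \<xi>\<bar>" by (simp add: mult.assoc exp_add[symmetric])
      ultimately show "norm (J y - J x) \<le> exp (lip * t) * norm (y - x)"
        using J[OF \<xi>(1)] J[OF \<zeta>(1)] \<xi> \<zeta> by (metis mult.commute real_norm_def)
    qed auto
  qed auto
  moreover have "{\<xi> \<in> {b - \<eta>..b}. X t \<xi> \<in> N} \<subseteq> J ` ?S"
  proof
    fix \<xi> assume "\<xi> \<in> {\<xi> \<in> {b - \<eta>..b}. X t \<xi> \<in> N}"
    then show "\<xi> \<in> J ` ?S" using J[of \<xi>] by (intro image_eqI[of _ _ "X t \<xi>"]) auto
  qed
  ultimately show ?thesis using negligible_subset by blast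
qed

lemma X_image_negligible:
  assumes N: "negligible N" "N \<subseteq> {b - \<eta>..b}" and t: "t \<in> {0..T}"
  shows "negligible (X t ` N)"
proof (rule negligible_locally_Lipschitz_image[OF _ N(1)])
  fix x assume x: "x \<in> N"
  show "\<exists>U B. open U \<and> x \<in> U \<and> (\<forall>y\<in>N \<inter> U. norm (X t y - X t x) \<le> B * norm (y - x))"
  proof (intro exI[of _ UNIV] exI[of _ "exp (lip * t)"] conjI ballI)
    fix y assume "y \<in> N \<inter> UNIV"
    then have "\<bar>X t y - X t x\<bar> \<le> \<bar>y - x\<bar> * exp (lip * t)" using x N(2) by (intro X_diff_bounds t) auto
    then show "norm (X t y - X t x) \<le> exp (lip * t) * norm (y - x)" by (simp add: mult.commute)
  qed auto
qed auto

text \<open>Weighted with \<open>\<rho>0\<close>, the markers at time \<open>t\<close> and at time 0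
  have the same integral over every interval of labels. Dividing by the positive weight gives
  equality, though only off a null set that depends on \<open>t\<close>.\<close>

lemma omega_transported:
  assumes pq: "p \<in> {b - \<eta>..b}" "q \<in> {b - \<eta>..b}" "p \<le> q" and pos: "\<And>\<xi>. \<xi> \<in> {p<..<q} \<Longrightarrow> 0 < \<rho>0 \<xi>" and t: "0 \<le> t" "t < T"
  shows "negligible {\<xi> \<in> {p<..<q}. \<omega> t (X t \<xi>) \<noteq> \<omega>0 \<xi>}"
proof -
  have tT: "t \<in> {0..T}" using t by auto
  let ?f = "\<lambda>\<xi>. \<omega> t (X t \<xi>) * \<rho>0 \<xi>" and ?g = "\<lambda>\<xi>. \<omega> 0 \<xi> * \<rho> 0 \<xi>"
  have ga: "(\<lambda>x. \<omega> s x * \<rho> s x) absolutely_integrable_on {c..d}" if "0 \<le> s" for s c d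
    by (intro absolutely_integrable_mult_continuous omega_aint continuous_on_halfplane_slice[OF rho_cont] that)
  have op: "f absolutely_integrable_on {c<..<d} \<longleftrightarrow> f absolutely_integrable_on {c..d}" "integral {c<..<d} f = integral {c..d} f"
    for c d and f :: "real \<Rightarrow> real"
  proof -
    have n: "negligible {x \<in> {c<..<d} - {c..d}. f x \<noteq> 0}" "negligible {x \<in> {c..d} - {c<..<d}. f x \<noteq> 0}"
      by (auto intro: negligible_subset[of "{c, d}"])
    show "f absolutely_integrable_on {c<..<d} \<longleftrightarrow> f absolutely_integrable_on {c..d}"
      by (rule absolutely_integrable_spike_set_eq[OF n])
    show "integral {c<..<d} f = integral {c..d} f" by (rule integral_spike_set[OF n])
  qed
  have main: "?f absolutely_integrable_on {x<..<y} \<and> integral {x<..<y} ?f = integral {X t x<..<X t y} (\<lambda>x. \<omega> t x * \<rho> t x)"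
    if "p \<le> x" "x \<le> y" "y \<le> q" for x y
  proof -
    have xy: "x \<in> {b - \<eta>..b}" "y \<in> {b - \<eta>..b}" "x \<le> y" using that pq by auto
    have ps: "0 < \<rho>0 \<xi>" if "\<xi> \<in> {x<..<y}" for \<xi> using that pos[of \<xi>] \<open>p \<le> x\<close> \<open>y \<le> q\<close> by auto
    have e: "\<rho>0 \<xi> / r t \<xi> * (\<omega> t (X t \<xi>) * \<rho> t (X t \<xi>)) = ?f \<xi>" if "\<xi> \<in> {x<..<y}" for \<xi>
    proof -
      have "0 < \<rho>0 \<xi> * exp (- (lip * t))" using ps[OF that] by simp
      then have "0 < r t \<xi>" using r_bounds(1)[of \<xi> t] that xy tT by force
      then show ?thesis by (simp add: r_def)
    qed
    have "(\<lambda>\<xi>. \<rho>0 \<xi> / r t \<xi> * (\<omega> t (X t \<xi>) * \<rho> t (X t \<xi>))) absolutely_integrable_on {x<..<y} \<and>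
      integral {x<..<y} (\<lambda>\<xi>. \<rho>0 \<xi> / r t \<xi> * (\<omega> t (X t \<xi>) * \<rho> t (X t \<xi>))) = integral {X t x<..<X t y} (\<lambda>x. \<omega> t x * \<rho> t x)"
      using change_of_labels[OF xy ps tT, of "\<lambda>x. \<omega> t x * \<rho> t x"] ga[OF t(1)] op by blast
    moreover have "integral {x<..<y} (\<lambda>\<xi>. \<rho>0 \<xi> / r t \<xi> * (\<omega> t (X t \<xi>) * \<rho> t (X t \<xi>))) = integral {x<..<y} ?f"
      using e by (intro integral_cong) auto
    moreover have "(\<lambda>\<xi>. \<rho>0 \<xi> / r t \<xi> * (\<omega> t (X t \<xi>) * \<rho> t (X t \<xi>))) absolutely_integrable_on {x<..<y} \<longleftrightarrow> ?f absolutely_integrable_on {x<..<y}"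
      using e by (intro set_integrable_cong) auto
    ultimately show ?thesis by simp
  qed
  have "negligible {\<xi> \<in> {p..q}. ?f \<xi> \<noteq> ?g \<xi>}"
  proof (rule negligible_diff_if_integrals_eq)
    show "?f absolutely_integrable_on {p..q}" using main[of p q] pq op by auto
    show "?g absolutely_integrable_on {p..q}" by (rule ga) simp
    fix x y assume xy: "p \<le> x" "x \<le> y" "y \<le> q"
    show "integral {x..y} ?f = integral {x..y} ?g"
      using main[OF xy] omega_rho_transported[of x y t] op xy pq t by auto
  qed
  moreover have "{\<xi> \<in> {p<..<q}. \<omega> t (X t \<xi>) \<noteq> \<omega>0 \<xi>} \<subseteq> {\<xi> \<in> {p..q}. ?f \<xi> \<noteq> ?g \<xi>}"
  proof clarify
    fix \<xi> assume \<xi>: "\<xi> \<in> {p<..<q}" "\<omega> t (X t \<xi>) \<noteq> \<omega>0 \<xi>"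
    have "\<xi> \<in> {a..b}" using \<xi> pq ab' by auto
    then have "?g \<xi> = \<omega>0 \<xi> * \<rho>0 \<xi>" by (simp add: rho_0_eq omega_0_eq)
    then show "\<xi> \<in> {p..q} \<and> ?f \<xi> \<noteq> ?g \<xi>" using \<xi> pos[of \<xi>] by auto
  qed
  ultimately show ?thesis using negligible_subset by blast
qed

lemma r'_eq_Vx: "0 \<le> t \<Longrightarrow> (V t has_real_derivative D) (at (X t \<xi>)) \<Longrightarrow> r' t \<xi> = - r t \<xi> * D"
proof -
  assume t: "0 \<le> t" and D: "(V t has_real_derivative D) (at (X t \<xi>))"
  have "((\<lambda>y. \<rho> t y * V t y) has_real_derivative rx t (X t \<xi>) * V t (X t \<xi>) + D * \<rho> t (X t \<xi>)) (at (X t \<xi>))"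
    by (rule DERIV_mult[OF DERIV_rho_x[OF t] D])
  from DERIV_unique[OF this DERIV_flux[OF t]] show ?thesis by (simp add: r'_def r_def algebra_simps)
qed

lemma r'_ae:
  assumes "t \<in> {0..T}"
  shows "negligible {\<xi> \<in> {b - \<eta>..b}. r' t \<xi> \<noteq> - r t \<xi> * Vx t (X t \<xi>)}"
proof -
  have "negligible {\<xi> \<in> {b - \<eta>..b}. X t \<xi> \<in> {x. \<not> (V t has_real_derivative Vx t x) (at x)}}"
    using assms by (intro X_preimage_negligible ae_DERIV_V) auto
  then show ?thesis by (rule negligible_subset) (use r'_eq_Vx assms in auto)
qed

lemma r'_cont: "\<xi> \<in> {b - \<eta>..b} \<Longrightarrow> continuous_on {0..T} (\<lambda>t. r' t \<xi>)"
  and r_cont: "\<xi> \<in> {b - \<eta>..b} \<Longrightarrow> continuous_on {0..T} (\<lambda>t. r t \<xi>)"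
  unfolding r'_def r_def
  by (intro continuous_intros continuous_on_halfplane_curve[OF rt_cont] continuous_on_halfplane_curve[OF rx_cont]
      continuous_on_halfplane_curve[OF V_cont] continuous_on_halfplane_curve[OF rho_cont] X_cont; force)+

end

section \<open>Vacuum in front of the right boundary\<close>

text \<open>Meant for the flow in vacuum, where the Jacobian \<open>\<rho>0 / r\<close> is 0 / 0;
  Riemann sums replace the substitution rule. On a cell shorter than \<open>d\<close> the function
  varies by less than \<open>e\<close>, and the image is no longer than the cell, so
  \<open>D\<close> drops by at most \<open>2 * e\<close> times the length.\<close>

lemma contraction_pushforward_continuous:
  fixes X J \<psi> :: "real \<Rightarrow> real"
  assumes kb: "k \<le> b" and X: "\<And>x y. x \<in> {k..b} \<Longrightarrow> y \<in> {k..b} \<Longrightarrow> x < y \<Longrightarrow> X x < X y \<and> X y - X x \<le> y - x"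
    and im: "X ` {k..b} = {X k..X b}" and J: "\<And>x. x \<in> {k..b} \<Longrightarrow> J (X x) = x"
    and \<psi>: "continuous_on {k..b} \<psi>" and nn: "\<And>x. x \<in> {k..b} \<Longrightarrow> 0 \<le> \<psi> x"
  shows "continuous_on {X k..X b} J" "integral {X k..X b} (\<lambda>x. \<psi> (J x)) \<le> integral {k..b} \<psi>"
proof -
  have Xc: "continuous_on {k..b} X"
  proof -
    have "\<bar>X x - X y\<bar> \<le> \<bar>x - y\<bar>" if "x \<in> {k..b}" "y \<in> {k..b}" for x y
      using X[of x y] X[of y x] that by (cases x y rule: linorder_cases) auto
    then have "1-lipschitz_on {k..b} X" by (intro lipschitz_onI) (auto simp: dist_real_def)
    then show ?thesis by (rule lipschitz_on_continuous_on)
  qed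
  show Jc: "continuous_on {X k..X b} J"
    using continuous_on_inv[OF Xc compact_Icc, of J] J im by auto
  have Jr: "J x \<in> {k..b}" if "x \<in> {X k..X b}" for x using that J im by (metis imageE)
  have mono: "X x \<le> X y" if "x \<in> {k..b}" "y \<in> {k..b}" "x \<le> y" for x y using X[of x y] that by (cases "x = y") auto
  have Jmono: "J x \<le> J y" if xy: "x \<in> {X k..X b}" "y \<in> {X k..X b}" "x \<le> y" for x y
  proof (rule ccontr)
    assume "\<not> J x \<le> J y"
    moreover obtain x' y' where "x' \<in> {k..b}" "x = X x'" "y' \<in> {k..b}" "y = X y'" using xy(1,2) unfolding im[symmetric] by auto
    ultimately show False using X[of y' x'] J xy(3) by auto
  qed
  have Pc: "continuous_on {X k..X b} (\<lambda>x. \<psi> (J x))" by (rule continuous_on_compose2[OF \<psi> Jc]) (use Jr in auto)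
  define D where "D x = integral {k..x} \<psi> - integral {X k..X x} (\<lambda>x. \<psi> (J x))" for x
  have nonneg: "- (2 * e * (b - k)) \<le> D b" if e: "0 < e" for e
  proof -
    have "uniformly_continuous_on {k..b} \<psi>" by (rule compact_uniformly_continuous[OF \<psi> compact_Icc])
    then obtain d where d: "0 < d" "\<And>x y. x \<in> {k..b} \<Longrightarrow> y \<in> {k..b} \<Longrightarrow> dist y x < d \<Longrightarrow> dist (\<psi> y) (\<psi> x) < e"
      using e unfolding uniformly_continuous_on_def by metis
    have step: "D x - (2 * e) * (y - x) \<le> D y" if xy: "x \<in> {k..b}" "y \<in> {k..b}" "x \<le> y" "y - x < d" for x y
    proof -
      \<comment> \<open>The last two integrals cancel; the content is that \<open>\<psi>\<close>
        stays above \<open>\<psi> x - e\<close> on the cell.\<close>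
      have 1: "(\<psi> x - e) * (y - x) + integral {k..x} \<psi> \<le> integral {k..y} \<psi> - integral {x..y} (\<lambda>z. \<psi> z - (\<psi> x - e)) + integral {x..y} (\<lambda>z. \<psi> z - (\<psi> x - e))"
      proof -
        have i: "\<psi> integrable_on {p..q}" if "k \<le> p" "q \<le> b" for p q
          using that by (intro integrable_continuous_interval continuous_on_subset[OF \<psi>]) auto
        have "integral {x..y} (\<lambda>z. \<psi> x - e) \<le> integral {x..y} \<psi>"
        proof (intro integral_le i)
          fix z assume "z \<in> {x..y}"
          then show "\<psi> x - e \<le> \<psi> z" using d(2)[of x z] xy by (auto simp: dist_real_def abs_less_iff)
        qed (use xy in auto)
        moreover have "integral {k..x} \<psi> + integral {x..y} \<psi> = integral {k..y} \<psi>"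
          using xy by (intro integral_split i) auto
        ultimately show ?thesis using xy by (simp add: mult.commute)
      qed
      have 2: "integral {X k..X y} (\<lambda>x. \<psi> (J x)) \<le> integral {X k..X x} (\<lambda>x. \<psi> (J x)) + (\<psi> x + e) * (X y - X x)"
      proof -
        have k: "k \<in> {k..b}" "b \<in> {k..b}" using kb by auto
        have i: "(\<lambda>x. \<psi> (J x)) integrable_on {p..q}" if "X k \<le> p" "q \<le> X b" for p q
          using that by (intro integrable_continuous_interval continuous_on_subset[OF Pc]) auto
        have X': "X k \<le> X x" "X x \<le> X y" "X y \<le> X b" using xy k by (auto intro!: mono)
        have "integral {X x..X y} (\<lambda>x. \<psi> (J x)) \<le> integral {X x..X y} (\<lambda>z. \<psi> x + e)"
        proof (intro integral_le i)
          fix z assume z: "z \<in> {X x..X y}"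
          then have zr: "z \<in> {X k..X b}" using X' by auto
          have "x \<le> J z" "J z \<le> y" using Jmono[of "X x" z] Jmono[of z "X y"] z zr X' J xy by auto
          then show "\<psi> (J z) \<le> \<psi> x + e" using d(2)[of x "J z"] xy by (auto simp: dist_real_def abs_less_iff)
        qed (use X' in auto)
        moreover have "integral {X k..X x} (\<lambda>x. \<psi> (J x)) + integral {X x..X y} (\<lambda>x. \<psi> (J x)) = integral {X k..X y} (\<lambda>x. \<psi> (J x))"
          using X' by (intro integral_split i) auto
        ultimately show ?thesis using X' by (simp add: mult.commute)
      qed
      have "X y - X x \<le> y - x" using X[of x y] xy by (cases "x = y") auto
      moreover have "0 \<le> X y - X x" using mono[of x y] xy by simp
      ultimately have "(\<psi> x + e) * (X y - X x) \<le> (\<psi> x + e) * (y - x)" using nn[of x] xy e by (intro mult_left_mono) auto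
      with 1 2 show ?thesis by (simp add: D_def algebra_simps)
    qed
    obtain N :: nat where N: "(b - k) / d < real N" using reals_Archimedean2 by blast
    then have N0: "0 < N" using kb d(1) by (cases N) (auto simp: divide_less_0_iff)
    define p where "p i = k + real i * ((b - k) / N)" for i :: nat
    have le: "(b - k) / N < d" "0 \<le> (b - k) / N" using N N0 d(1) kb by (auto simp: divide_simps mult.commute)
    have "p i \<in> {k..b}" if "i \<le> N" for i
    proof -
      have "real i * ((b - k) / N) \<le> real N * ((b - k) / N)" using that le(2) by (intro mult_right_mono) auto
      moreover have "0 \<le> real i * ((b - k) / N)" by (intro mult_nonneg_nonneg le(2)) auto
      ultimately show ?thesis using N0 unfolding p_def by auto
    qed
    then have pr: "i \<le> N \<Longrightarrow> p i \<in> {k..b}" for i by blast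
    have "- (2 * e * (p i - k)) \<le> D (p i)" if "i \<le> N" for i
      using that
    proof (induction i)
      case 0
      then show ?case by (simp add: p_def D_def)
    next
      case (Suc i)
      have *: "p (Suc i) - p i = (b - k) / N" unfolding p_def by (simp add: distrib_right del: times_divide_eq_right)
      have "D (p i) - (2 * e) * (p (Suc i) - p i) \<le> D (p (Suc i))"
        using step[OF pr pr, of i "Suc i"] Suc.prems le unfolding * by (simp add: algebra_simps * [symmetric])
      then show ?case using Suc by (simp add: algebra_simps)
    qed
    from this[of N] show ?thesis using N0 by (simp add: p_def)
  qed
  have "0 \<le> D b"
  proof (rule ccontr)
    assume neg: "\<not> 0 \<le> D b"
    define e where "e = - D b / (4 * (b - k + 1))"
    have "0 < e" unfolding e_def using kb neg by (intro divide_pos_pos) auto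
    moreover have "4 * e * (b - k + 1) = - D b" unfolding e_def using kb by (simp add: divide_simps)
    ultimately show False using nonneg[of e] neg kb mult_nonneg_nonneg[of e "b - k"] by (auto simp: distrib_left mult.assoc)
  qed
  then show "integral {X k..X b} (\<lambda>x. \<psi> (J x)) \<le> integral {k..b} \<psi>" by (simp add: D_def)
qed

lemma bounded_convergence_ae:
  fixes f :: "nat \<Rightarrow> real \<Rightarrow> real"
  assumes N: "negligible N" and f: "\<And>n. f n integrable_on {p..q}" and bd: "\<And>n x. x \<in> {p..q} \<Longrightarrow> \<bar>f n x\<bar> \<le> C"
    and lim: "\<And>x. x \<in> {p..q} - N \<Longrightarrow> (\<lambda>n. f n x) \<longlonglongrightarrow> g x"
  shows "g integrable_on {p..q}" "(\<lambda>n. integral {p..q} (f n)) \<longlonglongrightarrow> integral {p..q} g"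
proof -
  have eq: "(h integrable_on {p..q} - N) = (h integrable_on {p..q})" "integral ({p..q} - N) h = integral {p..q} h" for h :: "real \<Rightarrow> real"
    by (rule integrable_spike_set_eq integral_spike_set; rule negligible_subset[OF N]; auto)+
  have "(\<lambda>_. C) integrable_on {p..q} - N" unfolding eq by (rule integrable_const_ivl)
  then show "g integrable_on {p..q}" "(\<lambda>n. integral {p..q} (f n)) \<longlonglongrightarrow> integral {p..q} g"
    using dominated_convergence[of f "{p..q} - N" "\<lambda>_. C" g] f bd lim by (simp_all add: eq)
qed

text \<open>A measurable function is a limit almost everywhere of continuous ones, here truncated to
  values between 0 and \<open>C\<close> for bounded convergence. On the image side the convergence
  can fail only on the image of the null set, which is null by \<open>null\<close>.\<close>

lemma contraction_pushforward:
  fixes X J q :: "real \<Rightarrow> real"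
  assumes kb: "k \<le> b" and X: "\<And>x y. x \<in> {k..b} \<Longrightarrow> y \<in> {k..b} \<Longrightarrow> x < y \<Longrightarrow> X x < X y \<and> X y - X x \<le> y - x"
    and im: "X ` {k..b} = {X k..X b}" and J: "\<And>x. x \<in> {k..b} \<Longrightarrow> J (X x) = x"
    and q: "q \<in> borel_measurable (lebesgue_on {k..b})" and bd: "\<And>x. x \<in> {k..b} \<Longrightarrow> 0 \<le> q x \<and> q x \<le> C"
    and null: "\<And>N. negligible N \<Longrightarrow> negligible (X ` (N \<inter> {k..b}))"
  shows "(\<lambda>x. q (J x)) integrable_on {X k..X b}" "integral {X k..X b} (\<lambda>x. q (J x)) \<le> integral {k..b} q"
proof -
  have "q measurable_on {k..b}" using q by (simp add: measurable_on_iff_borel_measurable)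
  then obtain N g where N: "negligible N" and g: "\<And>n. continuous_on UNIV (g n)"
    and gl: "\<And>x. x \<notin> N \<Longrightarrow> (\<lambda>n. g n x :: real) \<longlonglongrightarrow> (if x \<in> {k..b} then q x else 0)"
    unfolding measurable_on_def by blast
  have C: "0 \<le> C" using bd[of k] kb by auto
  define h where "h n x = max 0 (min C (g n x))" for n x
  have h: "continuous_on S (h n)" "0 \<le> h n x" "h n x \<le> C" for S n x
    unfolding h_def using C by (auto intro!: continuous_intros continuous_on_subset[OF g])
  have hl: "(\<lambda>n. h n x) \<longlonglongrightarrow> q x" if "x \<in> {k..b} - N" for x
  proof -
    have "(\<lambda>n. h n x) \<longlonglongrightarrow> max 0 (min C (q x))"
      unfolding h_def using gl[of x] that by (auto intro!: tendsto_intros)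
    then show ?thesis using bd[of x] that by auto
  qed
  have cont: "continuous_on {X k..X b} J" "integral {X k..X b} (\<lambda>x. h n (J x)) \<le> integral {k..b} (h n)" for n
    using contraction_pushforward_continuous[OF kb X im J, of "h n"] h by auto
  have Jr: "J x \<in> {k..b}" "X (J x) = x" if "x \<in> {X k..X b}" for x using that J im by (metis imageE)+
  define M where "M = X ` (N \<inter> {k..b})"
  have M: "negligible M" unfolding M_def by (rule null[OF N])
  have hb: "\<bar>h n x\<bar> \<le> C" for n x using h(2,3) by simp
  have A: "(\<lambda>n. integral {k..b} (h n)) \<longlonglongrightarrow> integral {k..b} q"
    by (rule bounded_convergence_ae[OF N _ hb hl]) (auto intro: integrable_continuous_interval h)
  have lim: "(\<lambda>n. h n (J x)) \<longlonglongrightarrow> q (J x)" if "x \<in> {X k..X b} - M" for x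
    using hl[of "J x"] Jr[of x] that unfolding M_def by (metis DiffD1 DiffD2 DiffI IntI imageI)
  have "(\<lambda>x. h n (J x)) integrable_on {X k..X b}" for n
    by (intro integrable_continuous_interval continuous_on_compose2[OF h(1) cont(1)]) auto
  note B = bounded_convergence_ae[OF M this hb lim]
  show "(\<lambda>x. q (J x)) integrable_on {X k..X b}" by (rule B(1))
  show "integral {X k..X b} (\<lambda>x. q (J x)) \<le> integral {k..b} q"
    by (rule LIMSEQ_le[OF B(2) A]) (use cont(2) in auto)
qed

section \<open>Monotonicity of the velocity law in density and marker\<close>

context boundary_flow
begin

text \<open>The slope bound \<open>vmax'\<close> concerns only markers of the initial data. For a
  general marker use the concavity of the flow rate \<open>r * v\<close>, which vanishes at 0:
  \<open>v\<close> is its mean slope over \<open>{0..r}\<close>, and mean slopes of a concave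
  function decrease.\<close>

lemma v_antimono:
  assumes om: "0 < om" and r: "0 \<le> r1" "r1 \<le> r2" "r2 \<le> rmax om"
  shows "v r2 om \<le> v r1 om"
proof (cases "r1 = r2")
  case False
  then have r': "r1 < r2" using r by auto
  let ?S = "{0..rmax om}"
  define f where "f r = r * v r om" for r
  define f1 where "f1 r = d_rho rmax (\<lambda>r om. r * v r om) r om" for r
  have bot: "at x within ?S \<noteq> bot" if "x \<in> ?S" for x
    using rmax_pos[OF om] that by (auto simp: trivial_limit_within islimpt_Icc)
  have adm: "(x, om) \<in> admissible rmax" if "x \<in> ?S" for x using that om by (auto simp: admissible_def)
  have D: "(f has_real_derivative v x om + x * d_rho rmax v x om) (at x within ?S)" if "x \<in> ?S" for x
    unfolding f_def using v_deriv[OF adm[OF that]] by (auto intro!: derivative_eq_intros)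
  have f1: "f1 x = v x om + x * d_rho rmax v x om" if "x \<in> ?S" for x
    using D[OF that] bot[OF that] unfolding f1_def d_rho_def[of rmax "\<lambda>r om. r * v r om"] f_def has_real_derivative_iff_has_vector_derivative
    by (rule vector_derivative_within[rotated])
  have D1: "(f1 has_real_derivative d_rho rmax (d_rho rmax (\<lambda>r om. r * v r om)) x om) (at x within ?S)" if x: "x \<in> ?S" for x
  proof -
    have "(\<lambda>s. d_rho rmax v s om) differentiable (at x within ?S)" "(\<lambda>s. v s om) differentiable (at x within ?S)"
      using velocity adm[OF x] unfolding velocity_law_def by blast+
    then have "(\<lambda>x. v x om + x * d_rho rmax v x om) differentiable (at x within ?S)" by (intro derivative_intros)
    then have "f1 differentiable (at x within ?S)"
      unfolding differentiable_def by (rule ex_forward) (rule has_derivative_transform[OF x], use f1 in auto)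
    then show ?thesis using vector_derivative_works[of f1 "at x within ?S"]
      unfolding d_rho_def[of rmax "d_rho rmax (\<lambda>r om. r * v r om)"] f1_def[abs_def] has_real_derivative_iff_has_vector_derivative by simp
  qed
  have neg: "d_rho rmax (d_rho rmax (\<lambda>r om. r * v r om)) x om < 0" if "x \<in> ?S" for x
    using velocity adm[OF that] unfolding velocity_law_def by blast
  have f1_le: "f1 y \<le> f1 x" if "x \<in> ?S" "y \<in> ?S" "x \<le> y" for x y
    using DERIV_within_upper_slope[OF D1 less_imp_le[OF neg] that] by simp
  have mvt: "\<exists>c\<in>{x<..<y}. f y - f x = f1 c * (y - x)" if "x \<in> ?S" "y \<in> ?S" "x < y" for x y
  proof (rule mvt_simple[OF that(3), where f'="\<lambda>c h. f1 c * h"])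
    fix z assume z: "x \<le> z" "z \<le> y"
    have "(f has_real_derivative f1 z) (at z within {x..y})"
      using D[of z] f1[of z] z that by (auto intro: DERIV_subset)
    then show "(f has_derivative (\<lambda>h. f1 z * h)) (at z within {x..y})" by (simp add: has_field_derivative_def)
  qed
  show ?thesis
  proof (cases "r1 = 0")
    case True
    \<comment> \<open>At density 0 the mean slope becomes the derivative of the flow rate at 0,
      which is \<open>v 0 om\<close>.\<close>
    obtain c where c: "c \<in> {0<..<r2}" "f r2 - f 0 = f1 c * (r2 - 0)" using mvt[of 0 r2] r r' by auto
    then have "v r2 om = f1 c" using r r' by (simp add: f_def)
    also have "f1 c \<le> f1 0" using c r by (intro f1_le) auto
    finally show ?thesis using f1[of 0] True r by simp
  next
    case False
    then have r1: "0 < r1" using r by simp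
    obtain c1 where c1: "c1 \<in> {0<..<r1}" "f r1 - f 0 = f1 c1 * (r1 - 0)" using mvt[of 0 r1] r r' r1 by auto
    obtain c2 where c2: "c2 \<in> {r1<..<r2}" "f r2 - f r1 = f1 c2 * (r2 - r1)" using mvt[of r1 r2] r r' by auto
    have v1: "v r1 om = f1 c1" using c1(2) r1 by (simp add: f_def)
    have "f1 c2 \<le> f1 c1" using c1 c2 r by (intro f1_le) auto
    then have "f1 c2 * (r2 - r1) \<le> f1 c1 * (r2 - r1)" using r' by (intro mult_right_mono) auto
    then have "r2 * v r2 om \<le> r2 * v r1 om" using c2(2) v1 by (simp add: f_def algebra_simps)
    then show ?thesis using r1 r' by simp
  qed
qed simp

lemma v_deriv_omega:
  assumes "(r, om) \<in> admissible rmax" and e: "0 < e" "\<And>s. \<bar>s - om\<bar> < e \<Longrightarrow> 0 < s \<and> r \<le> rmax s"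
  shows "((\<lambda>s. v r s) has_real_derivative d_omega rmax v r om) (at om)" "0 < d_omega rmax v r om"
proof -
  have "om \<in> interior {s. 0 < s \<and> r \<le> rmax s}"
    by (rule interiorI[of "ball om e"]) (use e in \<open>auto simp: dist_real_def abs_minus_commute\<close>)
  then have "at om within {s. 0 < s \<and> r \<le> rmax s} = at om" by (rule at_within_interior)
  moreover have "(\<lambda>s. v r s) differentiable (at om within {s. 0 < s \<and> r \<le> rmax s})" "0 < d_omega rmax v r om"
    using velocity assms(1) unfolding velocity_law_def by blast+
  ultimately show "((\<lambda>s. v r s) has_real_derivative d_omega rmax v r om) (at om)" "0 < d_omega rmax v r om"
    unfolding d_omega_def by (simp_all add: vector_derivative_works has_real_derivative_iff_has_vector_derivative)
qed

text \<open>Drawn from the continuity of \<open>v\<close>. If \<open>rmax s < R\<close> for some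
  \<open>s\<close> close to \<open>om\<close>, then the speed at density \<open>rmax s\<close> is 0
  for the marker \<open>s\<close> but at least \<open>v R om > 0\<close> for the marker
  \<open>om\<close>.\<close>

lemma rmax_open:
  assumes om: "0 < om" and R: "0 \<le> R" "R \<le> rmax om" "0 < v R om"
  obtains e where "0 < e" "\<And>s. \<bar>s - om\<bar> < e \<Longrightarrow> 0 < s \<and> R \<le> rmax s"
proof -
  let ?K = "{0..R} \<times> {om / 2..2 * om}"
  have "uniformly_continuous_on ?K (\<lambda>(r, s). v r s)"
    by (intro compact_uniformly_continuous continuous_on_subset[OF v_cont] compact_Times compact_Icc) (use om in auto)
  then obtain d where d: "0 < d" "\<And>x y. x \<in> ?K \<Longrightarrow> y \<in> ?K \<Longrightarrow> dist y x < d \<Longrightarrow> dist ((\<lambda>(r, s). v r s) y) ((\<lambda>(r, s). v r s) x) < v R om"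
    using R(3) unfolding uniformly_continuous_on_def by metis
  show ?thesis
  proof (rule that[of "min d (om / 2)"])
    fix s assume s: "\<bar>s - om\<bar> < min d (om / 2)"
    then have s': "s \<in> {om / 2..2 * om}" "0 < s" using om by (simp_all add: abs_less_iff, linarith+)
    have "R \<le> rmax s"
    proof (rule ccontr)
      assume n: "\<not> R \<le> rmax s"
      have m: "0 < rmax s" "v (rmax s) s = 0" using rmax_pos v_rmax s' by auto
      have "dist (v (rmax s) s) (v (rmax s) om) < v R om"
        using d(2)[of "(rmax s, om)" "(rmax s, s)"] n m s s' om by (auto simp: dist_Pair_Pair dist_real_def)
      moreover have "v R om \<le> v (rmax s) om" using n m R om by (intro v_antimono) auto
      ultimately show False using m by (simp add: dist_real_def)
    qed
    with s' show "0 < s \<and> R \<le> rmax s" by simp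
  qed (use d om in auto)
qed

text \<open>A continuation argument, since the markers for which \<open>R\<close> is admissible are
  not known to form an interval. The condition passes to limits from the left by continuity, and
  beyond a marker that satisfies it by \<open>rmax_open\<close> and the positive derivative in the
  marker.\<close>

lemma v_increasing_marker:
  assumes om: "0 < om1" "om1 \<le> om2" and R: "0 \<le> R" "R \<le> rmax om1" "v R om1 = c" "0 < c"
  shows "R \<le> rmax om2" "c \<le> v R om2"
proof -
  define S where "S = {s \<in> {om1..om2}. \<forall>z\<in>{om1..s}. R \<le> rmax z \<and> c \<le> v R z}"
  define s where "s = Sup S"
  have S: "om1 \<in> S" "bdd_above S" using om R by (auto simp: S_def bdd_above_def)
  have s: "s \<in> {om1..om2}" unfolding s_def using S by (auto intro!: cSup_upper cSup_least simp: S_def)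
  have below: "R \<le> rmax z \<and> c \<le> v R z" if "z \<in> {om1..<s}" for z
  proof -
    have "\<exists>y\<in>S. z < y" using less_cSupD[of S z] S that by (force simp: s_def)
    then obtain y where "y \<in> S" "z < y" by blast
    then show ?thesis using that by (auto simp: S_def)
  qed
  have cont: "((\<lambda>z. v r z) \<longlongrightarrow> v r s) (at_left s)" if "0 \<le> r" for r
  proof -
    have "continuous_on {0..} (\<lambda>z. v r z)"
      using continuous_on_compose2[OF v_cont continuous_on_Pair[OF continuous_on_const continuous_on_id], of r "{0..}"] that by auto
    then have "isCont (\<lambda>z. v r z) s" using s om by (intro continuous_on_interior[of "{0..}"]) auto
    then show ?thesis unfolding isCont_def using filterlim_at_split by blast
  qed
  have at_s: "R \<le> rmax s \<and> c \<le> v R s"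
  proof (cases "s = om1")
    case False
    then have lt: "om1 < s" using s by simp
    have ev: "eventually (\<lambda>z. z \<in> {om1..<s}) (at_left s)" using eventually_at_left_real[OF lt] by (auto elim: eventually_mono)
    have "c \<le> v R s" by (rule tendsto_lowerbound[OF cont[OF R(1)]]) (use ev below in \<open>auto elim: eventually_mono\<close>)
    \<comment> \<open>Were \<open>R\<close> inadmissible at \<open>s\<close>, the smaller density
      \<open>rmax s\<close> would have speed at least \<open>c\<close> for markers just below
      \<open>s\<close>, yet speed 0 at \<open>s\<close>.\<close>
    moreover have "R \<le> rmax s"
    proof (rule ccontr)
      assume n: "\<not> R \<le> rmax s"
      have m: "0 < rmax s" "v (rmax s) s = 0" using rmax_pos v_rmax s om by auto
      have "c \<le> v (rmax s) s"
      proof (rule tendsto_lowerbound[OF cont])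
        show "eventually (\<lambda>z. c \<le> v (rmax s) z) (at_left s)"
        proof (rule eventually_mono[OF ev])
          fix z assume z: "z \<in> {om1..<s}"
          have "v R z \<le> v (rmax s) z" using n m below[OF z] om z by (intro v_antimono) auto
          then show "c \<le> v (rmax s) z" using below[OF z] by simp
        qed
      qed (use m in auto)
      then show False using m R by simp
    qed
    ultimately show ?thesis by simp
  qed (use R in auto)
  have "s = om2"
  proof (rule ccontr)
    assume "s \<noteq> om2"
    then have lt: "s < om2" using s by simp
    have s0: "0 < s" using s om by auto
    obtain e where e: "0 < e" "\<And>z. \<bar>z - s\<bar> < e \<Longrightarrow> 0 < z \<and> R \<le> rmax z"
      using rmax_open[of s R] s0 at_s R by auto
    have adm: "(R, s) \<in> admissible rmax" using s0 at_s R by (simp add: admissible_def)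
    obtain d where d: "0 < d" "\<And>h. 0 < h \<Longrightarrow> h < d \<Longrightarrow> v R s < v R (s + h)"
      using DERIV_pos_inc_right[OF v_deriv_omega[OF adm e]] by auto
    define m where "m = min (min d e) (om2 - s)"
    have "0 < m" "m \<le> d" "m \<le> e" "m \<le> om2 - s" using d(1) e(1) lt by (auto simp: m_def)
    define h where "h = m / 2"
    have h: "0 < h" "h < d" "h < e" "s + h \<le> om2"
      using \<open>0 < m\<close> \<open>m \<le> d\<close> \<open>m \<le> e\<close> \<open>m \<le> om2 - s\<close> by (auto simp: h_def)
    have "s + h \<in> S" unfolding S_def
    proof (intro CollectI conjI ballI)
      fix z assume z: "z \<in> {om1..s + h}"
      consider "z < s" | "z = s" | "s < z" by linarith
      then have "R \<le> rmax z \<and> c \<le> v R z"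
      proof cases
        case 3
        then show ?thesis using e(2)[of z] d(2)[of "z - s"] at_s h z by auto
      qed (use below at_s z in auto)
      then show "R \<le> rmax z" "c \<le> v R z" by auto
    qed (use s h in auto)
    then have "s + h \<le> s" unfolding s_def by (intro cSup_upper S)
    then show False using h by simp
  qed
  then show "R \<le> rmax om2" "c \<le> v R om2" using at_s by auto
qed

text \<open>The equilibrium density of the smaller marker remains admissible for the larger one and
  has speed at least \<open>vbar\<close> there, so it cannot exceed the root for the larger
  marker.\<close>

lemma equilibrium_mono:
  assumes t: "0 \<le> t" "x \<in> {a..\<beta> t}" and \<xi>: "\<xi> \<in> {a..b}" and le: "\<omega> t x \<le> \<omega>0 \<xi>"
  shows "\<rho>bar t x \<le> P \<xi>"
proof (rule ccontr)
  assume n: "\<not> \<rho>bar t x \<le> P \<xi>"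
  have R: "\<rho>bar t x \<in> {0..rmax (\<omega> t x)}" "v (\<rho>bar t x) (\<omega> t x) = vbar" using rhobar_props[OF t] by auto
  have "\<rho>bar t x \<le> rmax (\<omega>0 \<xi>)" "vbar \<le> v (\<rho>bar t x) (\<omega>0 \<xi>)"
    using v_increasing_marker[OF omega_pos[OF t(1)] le _ _ R(2) vbar_pos] R(1) by auto
  moreover have "v (\<rho>bar t x) (\<omega>0 \<xi>) < v (P \<xi>) (\<omega>0 \<xi>)" using n R P_props[OF \<xi>] calculation by (intro v_strict[OF \<xi>]) auto
  ultimately show False using P_props[OF \<xi>] by simp
qed

end

context flow_on
begin

text \<open>\<open>k\<close> is the right end of the support. It exceeds \<open>\<alpha> 0\<close>
  because positive mass lies ahead of \<open>\<alpha> 0\<close>; the left end is at most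
  \<open>\<alpha> 0\<close>, for otherwise it would be a later point with the same mass ahead. If
  \<open>k < b\<close>, the density vanishes at \<open>k\<close> by continuity, and its value
  \<open>rb\<close> at \<open>b\<close> vanishes because \<open>b\<close> is outside the
  support.\<close>

lemma support_front:
  assumes cr: "0 < cr"
  obtains k where "\<alpha> 0 < k" "k \<le> b" "\<And>\<xi>. \<xi> \<in> {\<alpha> 0<..<k} \<Longrightarrow> 0 < \<rho>0 \<xi>"
    "\<And>\<xi>. k < b \<Longrightarrow> \<xi> \<in> {k..b} \<Longrightarrow> \<rho>0 \<xi> = 0" "k < b \<Longrightarrow> rb = 0"
proof -
  define K where "K = closure {x\<in>{a..b}. \<rho>0 x \<noteq> 0}"
  have K: "connected K" "compact K" "\<forall>x\<in>interior K. 0 < \<rho>0 x"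
    using initial unfolding initial_data_def K_def Let_def by auto
  obtain p q where pq: "K = {p..q}" using K(1,2) connected_compact_interval_1 by blast
  have sub: "K \<subseteq> {a..b}" unfolding K_def by (intro closure_minimal) auto
  have out: "\<rho>0 x = 0" if "x \<in> {a..b}" "x \<notin> {p..q}" for x
    using that closure_subset[of "{x\<in>{a..b}. \<rho>0 x \<noteq> 0}"] unfolding pq[symmetric] K_def by blast
  have aa: "a < \<alpha> 0" "\<alpha> 0 \<le> b" using alpha_0 ab by auto
  have zero: "integral {x..y} (\<rho> 0) = 0" if "x \<in> {a..b}" "y \<in> {a..b}" "y < p \<or> q < x" for x y
  proof -
    have "integral {x..y} (\<rho> 0) = integral {x..y} (\<lambda>_. 0)"
      by (intro integral_cong) (use that out rho_0_eq in auto)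
    then show ?thesis by simp
  qed
  have m: "cr \<le> integral {\<alpha> 0..b} (\<rho> 0)" using alpha_props(2)[of 0] by (simp add: beta_eq)
  have ne: "p \<le> q"
  proof (rule ccontr)
    assume "\<not> p \<le> q"
    then have "integral {\<alpha> 0..b} (\<rho> 0) = integral {\<alpha> 0..b} (\<lambda>_. 0)"
      by (intro integral_cong) (use aa out rho_0_eq in auto)
    then show False using m cr by simp
  qed
  then have pqb: "a \<le> p" "q \<le> b" using sub pq by auto
  have p: "p \<le> \<alpha> 0"
  proof (rule ccontr)
    assume n: "\<not> p \<le> \<alpha> 0"
    have "integral {\<alpha> 0..p} (\<rho> 0) = integral {\<alpha> 0..p} (\<lambda>_. 0)"
      by (rule integral_spike[of "{p}"]) (use n aa out rho_0_eq pqb ne in auto)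
    moreover have "integral {\<alpha> 0..p} (\<rho> 0) + integral {p..b} (\<rho> 0) = integral {\<alpha> 0..b} (\<rho> 0)"
      using n ne pqb by (intro integral_split rho_integrable) auto
    ultimately show False using alpha_props(3)[of 0 p] n m ne pqb by (simp add: beta_eq)
  qed
  have q: "\<alpha> 0 < q"
  proof (rule ccontr)
    assume n: "\<not> \<alpha> 0 < q"
    have "integral {\<alpha> 0..b} (\<rho> 0) = integral {\<alpha> 0..b} (\<lambda>_. 0)"
      by (rule integral_spike[of "{q}"]) (use n aa out rho_0_eq in auto)
    then show False using m cr by simp
  qed
  have lim: "y = \<rho> 0 x" if "eventually (\<lambda>z. \<rho> 0 z = y) (at_right x)" for x y
  proof -
    have "((\<rho> 0) \<longlongrightarrow> \<rho> 0 x) (at_right x)"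
      using continuous_on_halfplane_slice[OF rho_cont, of 0 UNIV] filterlim_at_split[of "\<rho> 0" "nhds (\<rho> 0 x)" x]
      by (auto simp: continuous_on_eq_continuous_at isCont_def)
    moreover have "((\<rho> 0) \<longlongrightarrow> y) (at_right x)" using that by (rule tendsto_eventually)
    ultimately show ?thesis using tendsto_unique trivial_limit_at_right_real by blast
  qed
  show ?thesis
  proof (rule that[of q])
    show "0 < \<rho>0 \<xi>" if "\<xi> \<in> {\<alpha> 0<..<q}" for \<xi> using K(3) that p pq by auto
    assume lt: "q < b"
    have 0: "\<rho> 0 q = 0"
      by (rule lim[symmetric]) (use eventually_at_right_real[OF lt] out rho_0_eq pqb ne in \<open>auto elim!: eventually_mono\<close>)
    show "\<rho>0 \<xi> = 0" if "\<xi> \<in> {q..b}" for \<xi> using 0 out[of \<xi>] rho_0_eq[of q] that pqb ne by (cases "\<xi> = q") auto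
    show "rb = 0" using rho_boundary[of 0 b] rho_0_eq[of b] out[of b] lt aa by (simp add: beta_eq)
  qed (use q pqb in auto)
qed

end

context boundary_flow
begin

text \<open>\<open>V t\<close> is known to be differentiable only almost everywhere, so the terms of
  its formula are treated separately: the primitive of \<open>g\<close> has the right increments by
  construction, and the convolution is differentiable everywhere.\<close>

lemma V_increment:
  assumes t: "0 \<le> t" and xy: "x \<le> y"
  shows "(Vx t has_integral V t y - V t x) {x..y}"
proof -
  define Q where "Q = primitive (g t)"
  define \<Phi> where "\<Phi> y = integral {0..\<eta>} (\<lambda>\<tau>. dw \<tau> * Q (y + \<tau>))" for y
  define D where "D = integral {0..\<eta>} dw"
  note aint = g_aint[OF t]
  have Qc: "continuous_on UNIV Q" unfolding Q_def by (rule continuous_on_primitive[OF aint])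
  have Q: "(g t has_integral Q q - Q p) {p..q}" if "p \<le> q" for p q
    using primitive_diff[OF aint that] absolutely_integrable_imp_integrable[OF aint] unfolding Q_def by (metis integrable_integral)
  have "(\<lambda>x. g t (\<eta> + x)) integrable_on {x..y}"
    using absolutely_integrable_imp_integrable[OF absolutely_integrable_shift_real[OF aint]] .
  moreover have "integral {x..y} (\<lambda>x. g t (\<eta> + x)) = Q (\<eta> + y) - Q (\<eta> + x)"
    using integral_shift_real[of x y "g t" \<eta>] integral_unique[OF Q, of "\<eta> + x" "\<eta> + y"] xy by simp
  ultimately have s: "((\<lambda>x. g t (x + \<eta>)) has_integral Q (y + \<eta>) - Q (x + \<eta>)) {x..y}"
    unfolding add.commute[of _ \<eta>] has_integral_iff by simp
  have c: "((\<lambda>z. integral {0..\<eta>} (\<lambda>\<tau>. dw \<tau> * g t (z + \<tau>))) has_integral \<Phi> y - \<Phi> x) {x..y}"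
  proof (rule fundamental_theorem_of_calculus[OF xy])
    fix z
    obtain C where "\<And>s y. s \<in> {0..t} \<Longrightarrow> y \<in> {z - 1..z + \<eta> + 1} \<Longrightarrow> \<bar>g s y\<bar> \<le> C" using g_bounded by metis
    then have "(\<Phi> has_real_derivative integral {0..\<eta>} (\<lambda>\<tau>. dw \<tau> * g t (z + \<tau>))) (at z)"
      unfolding \<Phi>_def[abs_def] Q_def using \<eta>_pos t by (intro DERIV_convolution_primitive[OF dw(1) _ aint]) auto
    then show "(\<Phi> has_vector_derivative integral {0..\<eta>} (\<lambda>\<tau>. dw \<tau> * g t (z + \<tau>))) (at z within {x..y})"
      by (simp add: has_real_derivative_iff_has_vector_derivative has_vector_derivative_at_within)
  qed
  have dwi: "dw integrable_on {0..\<eta>}" by (intro integrable_continuous_interval dw)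
  have "(\<lambda>\<tau>. dw \<tau> * Q (z + \<tau>)) integrable_on {0..\<eta>}" for z
    by (intro integrable_continuous_interval continuous_intros dw continuous_on_compose2[OF Qc]) auto
  then have V: "V t z = w \<eta> * (Q (z + \<eta>) - Q z) - (\<Phi> z - D * Q z)" for z
    unfolding V_primitive[OF t] Q_def[symmetric] \<Phi>_def D_def right_diff_distrib
    using dwi by (subst Henstock_Kurzweil_Integration.integral_diff) (auto intro: integrable_on_mult_left)
  have Vx: "Vx t z = w \<eta> * (g t (z + \<eta>) - g t z) - (integral {0..\<eta>} (\<lambda>\<tau>. dw \<tau> * g t (z + \<tau>)) - D * g t z)" for z
    unfolding Vx_def D_def right_diff_distrib
    using dwi dwg_integrable[OF t] by (subst Henstock_Kurzweil_Integration.integral_diff) (auto intro: integrable_on_mult_left)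
  have "((\<lambda>z. w \<eta> * (g t (z + \<eta>) - g t z) - (integral {0..\<eta>} (\<lambda>\<tau>. dw \<tau> * g t (z + \<tau>)) - D * g t z))
      has_integral w \<eta> * ((Q (y + \<eta>) - Q (x + \<eta>)) - (Q y - Q x)) - ((\<Phi> y - \<Phi> x) - D * (Q y - Q x))) {x..y}"
    by (intro has_integral_diff has_integral_mult_right s c Q xy)
  moreover have "w \<eta> * ((Q (y + \<eta>) - Q (x + \<eta>)) - (Q y - Q x)) - ((\<Phi> y - \<Phi> x) - D * (Q y - Q x)) = V t y - V t x"
    unfolding V by algebra
  ultimately show ?thesis unfolding Vx[abs_def] by simp
qed

lemma Vx_bounded:
  obtains C where "0 \<le> C" "\<And>t x. t \<in> {0..T} \<Longrightarrow> x \<in> {p..q} \<Longrightarrow> \<bar>Vx t x\<bar> \<le> C"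
proof -
  obtain C where C: "0 \<le> C" "\<And>s x. s \<in> {0..T} \<Longrightarrow> x \<in> {p..q + \<eta>} \<Longrightarrow> \<bar>g s x\<bar> \<le> C" using g_bounded by metis
  have "bounded (dw ` {0..\<eta>})" by (intro compact_imp_bounded compact_continuous_image dw) auto
  then obtain D where D: "0 < D" "\<And>\<tau>. \<tau> \<in> {0..\<eta>} \<Longrightarrow> \<bar>dw \<tau>\<bar> \<le> D" unfolding bounded_pos by force
  show ?thesis
  proof (rule that[of "\<bar>w \<eta>\<bar> * (2 * C) + D * (2 * C) * \<eta>"])
    fix t x assume t: "t \<in> {0..T}" and x: "x \<in> {p..q}"
    have d: "\<bar>g t (x + \<tau>) - g t x\<bar> \<le> 2 * C" if "\<tau> \<in> {0..\<eta>}" for \<tau>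
      using C(2)[OF t, of x] C(2)[OF t, of "x + \<tau>"] x that by auto
    have i: "(\<lambda>\<tau>. dw \<tau> * (g t (x + \<tau>) - g t x)) integrable_on {0..\<eta>}"
      unfolding right_diff_distrib using t
      by (intro integrable_diff dwg_integrable integrable_on_mult_left integrable_continuous_interval dw) auto
    have "\<bar>integral {0..\<eta>} (\<lambda>\<tau>. dw \<tau> * (g t (x + \<tau>) - g t x))\<bar> \<le> integral {0..\<eta>} (\<lambda>_. D * (2 * C))"
    proof (rule integral_norm_bound_integral[where 'a=real, simplified real_norm_def, OF i])
      fix \<tau> assume "\<tau> \<in> {0..\<eta>}"
      then show "\<bar>dw \<tau> * (g t (x + \<tau>) - g t x)\<bar> \<le> D * (2 * C)"
        unfolding abs_mult using D d C by (intro mult_mono) auto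
    qed (rule integrable_const_ivl)
    then have "\<bar>integral {0..\<eta>} (\<lambda>\<tau>. dw \<tau> * (g t (x + \<tau>) - g t x))\<bar> \<le> D * (2 * C) * \<eta>"
      using \<eta>_pos by (simp add: mult_ac)
    moreover have "\<bar>w \<eta> * (g t (x + \<eta>) - g t x)\<bar> \<le> \<bar>w \<eta>\<bar> * (2 * C)"
      unfolding abs_mult using d[of \<eta>] \<eta>_pos by (intro mult_left_mono) auto
    ultimately show "\<bar>Vx t x\<bar> \<le> \<bar>w \<eta>\<bar> * (2 * C) + D * (2 * C) * \<eta>"
      unfolding Vx_def by linarith
  qed (use C D \<eta>_pos in auto)
qed

end

context flow_on
begin

text \<open>The case \<open>h = 1\<close>: the integral of the marker changes only through the
  compression or stretching \<open>Vx\<close> of the interval.\<close>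

lemma omega_increment_flow:
  assumes \<xi>: "\<xi> \<in> {b - \<eta>..b}" "\<zeta> \<in> {b - \<eta>..b}" "\<xi> \<le> \<zeta>" and st: "0 \<le> s" "s \<le> t" "t < T"
  shows "((\<lambda>\<tau>. integral {X \<tau> \<xi>..X \<tau> \<zeta>} (\<lambda>x. \<omega> \<tau> x * Vx \<tau> x)) has_integral
    integral {X t \<xi>..X t \<zeta>} (\<omega> t) - integral {X s \<xi>..X s \<zeta>} (\<omega> s)) {s..t}"
proof -
  obtain C where C: "\<And>t x. t \<in> {0..T} \<Longrightarrow> x \<in> {b - \<eta>..\<beta> T + 1} \<Longrightarrow> \<bar>Vx t x\<bar> \<le> C" using Vx_bounded by metis
  have "negligible {p. fst p \<in> {0..T} \<and> \<not> ((\<lambda>y. V (fst p) y * 1) has_real_derivative Vx (fst p) (snd p)) (at (snd p))}"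
    by (rule negligible_subset[OF ae_DERIV_V_joint]) auto
  from transported_integral[where h="\<lambda>_ _. 1" and ht="\<lambda>_ _. 0" and hx="\<lambda>_ _. 0" and N=Vx, OF _ _ _ _ _ Vx_measurable C this \<xi> st]
  show ?thesis by (auto simp: case_prod_beta has_integral_iff)
qed

lemma length_increment:
  assumes \<xi>: "\<xi> \<in> {b - \<eta>..b}" "\<zeta> \<in> {b - \<eta>..b}" "\<xi> \<le> \<zeta>" and t: "t \<in> {0..T}"
  shows "((\<lambda>t. X t \<zeta> - X t \<xi>) has_real_derivative integral {X t \<xi>..X t \<zeta>} (Vx t)) (at t within {0..T})"
proof -
  have "integral {X t \<xi>..X t \<zeta>} (Vx t) = V t (X t \<zeta>) - V t (X t \<xi>)"
    using V_increment[of t "X t \<xi>" "X t \<zeta>"] X_mono[OF \<xi> t] t by (auto simp: integral_unique)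
  then show ?thesis using X_props(2)[OF \<xi>(1) t] X_props(2)[OF \<xi>(2) t] by (auto intro!: derivative_eq_intros)
qed

end

context boundary_flow
begin

lemma dw_zero:
  assumes const: "\<forall>x\<in>{0..\<eta>}. w x = 1 / \<eta>" and x: "x \<in> {0..\<eta>}"
  shows "dw x = 0"
proof -
  have "(w has_real_derivative 0) (at x within {0..\<eta>})"
    unfolding has_real_derivative_iff_has_vector_derivative
    by (rule has_vector_derivative_transform[OF x, of _ "\<lambda>_. 1 / \<eta>"]) (use const in auto)
  then show ?thesis using DERIV_within_Icc_unique dw(2)[OF x] \<eta>_pos x by metis
qed

lemma Vx_const:
  assumes const: "\<forall>x\<in>{0..\<eta>}. w x = 1 / \<eta>"
  shows "Vx t x = (g t (x + \<eta>) - g t x) / \<eta>"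
proof -
  have "integral {0..\<eta>} (\<lambda>\<tau>. dw \<tau> * (g t (x + \<tau>) - g t x)) = integral {0..\<eta>} (\<lambda>_. 0)"
    by (intro integral_cong) (simp add: dw_zero[OF const])
  then show ?thesis using const \<eta>_pos by (simp add: Vx_def)
qed

end

section \<open>The region between the front of the support and the boundary\<close>

context flow_on
begin

context
  fixes k assumes k: "\<alpha> 0 \<le> k" "k < b" and empty: "\<And>\<xi>. \<xi> \<in> {k..b} \<Longrightarrow> \<rho>0 \<xi> = 0" and rb: "rb = 0"
begin

lemma k_label: "k \<in> {b - \<eta>..b}" using k alpha_0 by auto

lemma vacuum_marker_b: "\<omega>0 b = vbar"
  using v_rb v_0[OF omega0_pos[of b]] rb ab' by auto

lemma vacuum_rho:
  assumes t: "t \<in> {0..T}" and x: "x \<in> {X t k..\<beta> t}"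
  shows "\<rho> t x = 0"
proof -
  obtain \<xi> where \<xi>: "\<xi> \<in> {k..b}" "x = X t \<xi>"
    using x X_image[OF k_label b_label _ t] k X_b[OF t] by (metis imageE less_imp_le)
  then show ?thesis using r_bounds(2)[of \<xi> t] r_nonneg[OF t, of \<xi>] empty[of \<xi>] k_label t by (simp add: r_def)
qed

text \<open>At density 0 the speed is the marker, and it is the largest speed for that marker;
  solvability of the equilibrium equation puts \<open>vbar\<close> below it. Beyond the boundary the
  marker is \<open>\<omega>0 b = vbar\<close>.\<close>

lemma vacuum_g:
  assumes t: "t \<in> {0..T}" and x: "X t k \<le> x"
  shows "g t x = \<omega> t x" "vbar \<le> \<omega> t x"
proof -
  have "g t x = \<omega> t x \<and> vbar \<le> \<omega> t x"
  proof (cases "x \<le> \<beta> t")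
    case True
    have om: "0 < \<omega> t x" using omega_pos t by auto
    have "x \<in> {a..\<beta> t}" using True x X_range[OF k_label t] ab by auto
    then have R: "\<rho>bar t x \<in> {0..rmax (\<omega> t x)}" "v (\<rho>bar t x) (\<omega> t x) = vbar" using rhobar_props[of t x] t by auto
    have "v (\<rho>bar t x) (\<omega> t x) \<le> v 0 (\<omega> t x)" using R(1) om by (intro v_antimono) auto
    moreover have "\<rho> t x = 0" using vacuum_rho[OF t] x True by auto
    ultimately show ?thesis using R(2) v_0[OF om] by (simp add: g_def)
  next
    case False
    then show ?thesis using g_boundary[of t x] omega_boundary[of t x] vacuum_marker_b t by auto
  qed
  then show "g t x = \<omega> t x" "vbar \<le> \<omega> t x" by auto
qed

text \<open>Vacuum lies ahead of \<open>\<alpha> t\<close>, hence within \<open>\<eta>\<close> of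
  the boundary, so the look-ahead from there ends where the speed is \<open>vbar\<close>.\<close>

lemma vacuum_beyond: "t \<in> {0..T} \<Longrightarrow> X t k \<le> x \<Longrightarrow> \<beta> t \<le> x + \<eta>"
proof -
  assume *: "t \<in> {0..T}" "X t k \<le> x"
  have "\<beta> t - \<eta> \<le> X t (\<alpha> 0)" using alpha_props(1)[of t] alpha_flow[of t] * by auto
  also have "X t (\<alpha> 0) \<le> X t k" using alpha_0 k_label k * by (intro X_mono) auto
  finally show ?thesis using * by simp
qed

lemma omega_int: "0 \<le> t \<Longrightarrow> \<omega> t integrable_on {p..q}"
  by (intro absolutely_integrable_imp_integrable L1_continuous_aint L1_continuous_omega)

text \<open>
  For a constant kernel the mean of the marker between two characteristics decreases in vacuum,
  by the Cauchy--Schwarz inequality; a pointwise bound then follows from Lebesgue differentiation.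
\<close>

context
  assumes const: "\<forall>x\<in>{0..\<eta>}. w x = 1 / \<eta>"
begin

lemma vacuum_Vx: "t \<in> {0..T} \<Longrightarrow> X t k \<le> x \<Longrightarrow> Vx t x = (vbar - \<omega> t x) / \<eta>"
  using vacuum_g[of t x] vacuum_beyond[of t x] g_boundary[of t "x + \<eta>"] by (simp add: Vx_const[OF const])

lemma vacuum_mean:
  assumes \<xi>: "k \<le> \<xi>" "\<xi> < \<zeta>" "\<zeta> \<le> b" and t: "0 \<le> t" "t < T"
  shows "integral {X t \<xi>..X t \<zeta>} (\<omega> t) / (X t \<zeta> - X t \<xi>) \<le> integral {\<xi>..\<zeta>} (\<omega> 0) / (\<zeta> - \<xi>)"
    and "X t \<zeta> - X t \<xi> \<le> \<zeta> - \<xi>"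
proof -
  have lab: "\<xi> \<in> {b - \<eta>..b}" "\<zeta> \<in> {b - \<eta>..b}" "\<xi> \<le> \<zeta>" using k_label \<xi> by auto
  have sT: "s \<in> {0..T}" if "s \<in> {0..t}" for s using that t by auto
  \<comment> \<open>The length \<open>l\<close>, the integral \<open>A\<close> and the second moment
    \<open>E\<close> have the derivatives \<open>(vbar * l - A) / \<eta>\<close> for
    \<open>l\<close> and \<open>(vbar * A - E) / \<eta>\<close> for \<open>A\<close>. In the
    derivative \<open>(A\<^sup>2 - l * E) / (\<eta> * l\<^sup>2)\<close> of the mean
    \<open>A / l\<close> the velocity \<open>vbar\<close> cancels.\<close>
  define A where "A s = integral {X s \<xi>..X s \<zeta>} (\<omega> s)" for s
  define E where "E s = integral {X s \<xi>..X s \<zeta>} (\<lambda>x. \<omega> s x * \<omega> s x)" for s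
  define l where "l s = X s \<zeta> - X s \<xi>" for s
  have lpos: "0 < l s" if "s \<in> {0..t}" for s using X_strict_mono[OF lab(1,2) \<xi>(2) sT[OF that]] by (simp add: l_def)
  have above: "X s k \<le> x" if "s \<in> {0..t}" "x \<in> {X s \<xi>..X s \<zeta>}" for s x
    using X_mono[OF k_label lab(1) \<xi>(1) sT[OF that(1)]] that by auto
  have int: "\<omega> s integrable_on {X s \<xi>..X s \<zeta>}" "(\<lambda>x. \<omega> s x * \<omega> s x) integrable_on {X s \<xi>..X s \<zeta>}" if "s \<in> {0..t}" for s
    using that absolutely_integrable_imp_integrable[OF L1_continuous_aint[OF L1_continuous_mult[OF L1_continuous_omega L1_continuous_omega]]]
    by (auto intro: omega_int)
  have Xc: "continuous_on {0..t} (\<lambda>s. X s \<xi>)" "continuous_on {0..t} (\<lambda>s. X s \<zeta>)"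
    using X_cont[OF lab(1)] X_cont[OF lab(2)] t by (auto intro: continuous_on_subset)
  have le: "X s \<xi> \<le> X s \<zeta>" if "s \<in> {0..t}" for s using lpos[OF that] by (simp add: l_def)
  have Ac: "continuous_on {0..t} A" "continuous_on {0..t} E"
    unfolding A_def[abs_def] E_def[abs_def]
    by (intro L1_continuous_moving_integral L1_continuous_omega L1_continuous_mult Xc le; assumption)+
  have IV: "integral {X s \<xi>..X s \<zeta>} (Vx s) = (vbar * l s - A s) / \<eta>" if s: "s \<in> {0..t}" for s
  proof -
    have "integral {X s \<xi>..X s \<zeta>} (Vx s) = integral {X s \<xi>..X s \<zeta>} (\<lambda>x. (vbar - \<omega> s x) / \<eta>)"
      using vacuum_Vx[OF sT[OF s]] above[OF s] by (intro integral_cong) auto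
    also have "\<dots> = (integral {X s \<xi>..X s \<zeta>} (\<lambda>x. vbar) - A s) / \<eta>"
      unfolding A_def integral_divide by (subst Henstock_Kurzweil_Integration.integral_diff) (use int[OF s] in auto)
    finally show ?thesis using le[OF s] by (simp add: l_def mult.commute)
  qed
  have IW: "integral {X s \<xi>..X s \<zeta>} (\<lambda>x. \<omega> s x * Vx s x) = (vbar * A s - E s) / \<eta>" if s: "s \<in> {0..t}" for s
  proof -
    have "integral {X s \<xi>..X s \<zeta>} (\<lambda>x. \<omega> s x * Vx s x) = integral {X s \<xi>..X s \<zeta>} (\<lambda>x. (vbar * \<omega> s x - \<omega> s x * \<omega> s x) / \<eta>)"
      using vacuum_Vx[OF sT[OF s]] above[OF s] by (intro integral_cong) (auto simp: algebra_simps)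
    also have "\<dots> = (integral {X s \<xi>..X s \<zeta>} (\<lambda>x. vbar * \<omega> s x) - E s) / \<eta>"
      unfolding E_def integral_divide by (subst Henstock_Kurzweil_Integration.integral_diff) (use int[OF s] in \<open>auto intro: integrable_on_mult_right\<close>)
    finally show ?thesis by (simp add: A_def)
  qed
  have Dl: "(l has_real_derivative (vbar * l s - A s) / \<eta>) (at s within {0..t})" if s: "s \<in> {0..t}" for s
    using DERIV_subset[OF length_increment[OF lab sT[OF s]], of "{0..t}"] t IV[OF s] by (simp add: l_def[abs_def])
  have DA: "(A has_real_derivative (vbar * A s - E s) / \<eta>) (at s within {0..t})" if s: "s \<in> {0..t}" for s
  proof -
    define F where "F u = A 0 + integral {0..u} (\<lambda>s. (vbar * A s - E s) / \<eta>)" for u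
    have eq: "A u = F u" if u: "u \<in> {0..t}" for u
    proof -
      have "integral {0..u} (\<lambda>\<tau>. integral {X \<tau> \<xi>..X \<tau> \<zeta>} (\<lambda>x. \<omega> \<tau> x * Vx \<tau> x)) = integral {0..u} (\<lambda>s. (vbar * A s - E s) / \<eta>)"
        using IW u by (intro integral_cong) auto
      then show ?thesis using integral_unique[OF omega_increment_flow[OF lab, of 0 u]] u t by (simp add: A_def F_def)
    qed
    have DF: "(F has_real_derivative (vbar * A s - E s) / \<eta>) (at s within {0..t})"
      unfolding F_def[abs_def]
    proof (rule DERIV_cong[OF DERIV_add[OF DERIV_const]])
      show "((\<lambda>u. integral {0..u} (\<lambda>s. (vbar * A s - E s) / \<eta>)) has_real_derivative (vbar * A s - E s) / \<eta>) (at s within {0..t})"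
        using Ac \<eta>_pos by (intro integral_has_derivative_within[OF _ s] continuous_intros) auto
    qed simp
    show ?thesis unfolding has_real_derivative_iff_has_vector_derivative
      by (rule has_vector_derivative_transform[OF s eq DF[unfolded has_real_derivative_iff_has_vector_derivative]])
  qed
  have CS: "(A s)\<^sup>2 \<le> l s * E s" if s: "s \<in> {0..t}" for s
  proof -
    \<comment> \<open>\<open>c\<close> is the mean of the marker; expanding the integral of
      \<open>(\<omega> - c)\<^sup>2\<close> gives the inequality.\<close>
    define c where "c = A s / l s"
    have "(\<lambda>x. \<omega> s x * \<omega> s x - 2 * c * \<omega> s x + c\<^sup>2) = (\<lambda>x. (\<omega> s x - c)\<^sup>2)" by (auto simp: power2_eq_square algebra_simps)
    then have "0 \<le> integral {X s \<xi>..X s \<zeta>} (\<lambda>x. \<omega> s x * \<omega> s x - 2 * c * \<omega> s x + c\<^sup>2)"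
      using int[OF s] by (intro integral_nonneg integrable_add integrable_diff integrable_on_mult_right integrable_const_ivl) (auto simp: fun_eq_iff)
    moreover have "integral {X s \<xi>..X s \<zeta>} (\<lambda>x. \<omega> s x * \<omega> s x - 2 * c * \<omega> s x + c\<^sup>2) = E s - 2 * c * A s + c\<^sup>2 * l s"
      using int[OF s] le[OF s] unfolding E_def A_def l_def
      by (subst Henstock_Kurzweil_Integration.integral_add Henstock_Kurzweil_Integration.integral_diff; auto intro!: integrable_diff integrable_on_mult_right)+
    ultimately have "0 \<le> l s * (E s - 2 * c * A s + c\<^sup>2 * l s)" using lpos[OF s] by (intro mult_nonneg_nonneg) auto
    moreover have "c * l s = A s" using lpos[OF s] by (simp add: c_def)
    then have "l s * (E s - 2 * c * A s + c\<^sup>2 * l s) = l s * E s - (A s)\<^sup>2" by (auto simp: power2_eq_square algebra_simps)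
    ultimately show ?thesis by simp
  qed
  have X0: "X 0 \<xi> = \<xi>" "X 0 \<zeta> = \<zeta>" using X_props(1) lab by auto
  have "A t / l t \<le> A 0 / l 0"
  proof -
    have "- (A 0 / l 0) \<le> - (A t / l t)"
    proof (rule DERIV_within_nonneg_imp_le[OF t(1)])
      fix s assume s: "s \<in> {0..t}"
      show "((\<lambda>s. - (A s / l s)) has_real_derivative (l s * E s - (A s)\<^sup>2) / (\<eta> * (l s)\<^sup>2)) (at s within {0..t})"
        using lpos[OF s] \<eta>_pos by (auto intro!: derivative_eq_intros DA Dl s simp: power2_eq_square divide_simps) (simp add: algebra_simps)
    next
      fix s assume s: "s \<in> {0<..<t}"
      then show "0 \<le> (l s * E s - (A s)\<^sup>2) / (\<eta> * (l s)\<^sup>2)" using CS[of s] \<eta>_pos by (intro divide_nonneg_nonneg) auto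
    qed
    then show ?thesis by simp
  qed
  then show "integral {X t \<xi>..X t \<zeta>} (\<omega> t) / (X t \<zeta> - X t \<xi>) \<le> integral {\<xi>..\<zeta>} (\<omega> 0) / (\<zeta> - \<xi>)"
    by (simp add: A_def l_def X0)
  have "- l 0 \<le> - l t"
  proof (rule DERIV_within_nonneg_imp_le[OF t(1)])
    show "((\<lambda>s. - l s) has_real_derivative - ((vbar * l s - A s) / \<eta>)) (at s within {0..t})" if "s \<in> {0..t}" for s
      by (intro DERIV_minus Dl that)
    fix s assume "s \<in> {0<..<t}"
    then have s: "s \<in> {0..t}" by auto
    have "integral {X s \<xi>..X s \<zeta>} (\<lambda>x. vbar) \<le> A s"
      unfolding A_def using vacuum_g(2)[OF sT[OF s] above[OF s]] int[OF s] by (intro integral_le) auto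
    then have "vbar * l s \<le> A s" using le[OF s] by (simp add: l_def mult.commute)
    then show "0 \<le> - ((vbar * l s - A s) / \<eta>)" using \<eta>_pos by (simp add: divide_nonpos_pos)
  qed
  then show "X t \<zeta> - X t \<xi> \<le> \<zeta> - \<xi>" by (simp add: l_def X0)
qed

lemma vacuum_omega_le:
  assumes t: "0 \<le> t" "t < T"
  shows "negligible {\<xi> \<in> {k<..<b}. \<not> \<omega> t (X t \<xi>) \<le> \<omega>0 \<xi>}"
proof -
  have tT: "t \<in> {0..T}" using t by auto
  let ?N = "\<lambda>s. {x. \<not> (primitive (\<omega> s) has_real_derivative \<omega> s x) (at x)}"
  have N: "negligible (?N s)" if "0 \<le> s" for s
    by (rule ae_DERIV_primitive) (intro L1_continuous_aint L1_continuous_omega that)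
  have pd: "primitive (\<omega> s) y - primitive (\<omega> s) x = integral {x..y} (\<omega> s)" if "0 \<le> s" "x \<le> y" for s x y
    by (rule primitive_diff[OF _ that(2)]) (intro L1_continuous_aint L1_continuous_omega that(1))
  \<comment> \<open>As \<open>\<zeta>\<close> decreases to \<open>\<xi>\<close>, both means in
    \<open>vacuum_mean\<close> are difference quotients of primitives, one of them evaluated along
    the flow.\<close>
  have "\<omega> t (X t \<xi>) \<le> \<omega>0 \<xi>" if \<xi>: "\<xi> \<in> {k<..<b}" "X t \<xi> \<notin> ?N t" "\<xi> \<notin> ?N 0" for \<xi>
  proof -
    have lab: "\<xi> \<in> {b - \<eta>..b}" using \<xi> k_label by auto
    have ev: "eventually (\<lambda>\<zeta>. \<zeta> \<in> {\<xi><..<b}) (at_right \<xi>)" using \<xi> by (intro eventually_at_right_real) auto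
    have "((\<lambda>\<zeta>. (primitive (\<omega> 0) \<zeta> - primitive (\<omega> 0) \<xi>) / (\<zeta> - \<xi>)) \<longlongrightarrow> \<omega> 0 \<xi>) (at_right \<xi>)"
      using \<xi>(3) unfolding has_field_derivative_iff by (simp add: filterlim_at_split)
    moreover have "((\<lambda>\<zeta>. (primitive (\<omega> t) (X t \<zeta>) - primitive (\<omega> t) (X t \<xi>)) / (X t \<zeta> - X t \<xi>)) \<longlongrightarrow> \<omega> t (X t \<xi>)) (at_right \<xi>)"
    proof (rule filterlim_compose[where g="\<lambda>y. (primitive (\<omega> t) y - primitive (\<omega> t) (X t \<xi>)) / (y - X t \<xi>)"])
      show "((\<lambda>y. (primitive (\<omega> t) y - primitive (\<omega> t) (X t \<xi>)) / (y - X t \<xi>)) \<longlongrightarrow> \<omega> t (X t \<xi>)) (at (X t \<xi>))"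
        using \<xi>(2) unfolding has_field_derivative_iff by simp
      have "isCont (X t) \<xi>"
        using X_cont_label[OF tT] \<xi>(1) k_label by (intro continuous_on_interior[of "{b - \<eta>..b}"]) auto
      then have "(X t \<longlongrightarrow> X t \<xi>) (at_right \<xi>)" unfolding isCont_def by (simp add: filterlim_at_split)
      moreover have "eventually (\<lambda>\<zeta>. X t \<zeta> \<noteq> X t \<xi>) (at_right \<xi>)"
        by (rule eventually_mono[OF ev]) (use X_strict_mono[OF lab _ _ tT] lab in \<open>metis (no_types) atLeastAtMost_iff greaterThanLessThan_iff less_imp_le order_trans less_irrefl\<close>)
      ultimately show "filterlim (X t) (at (X t \<xi>)) (at_right \<xi>)" by (auto simp: filterlim_at)
    qed
    moreover have "eventually (\<lambda>\<zeta>. (primitive (\<omega> t) (X t \<zeta>) - primitive (\<omega> t) (X t \<xi>)) / (X t \<zeta> - X t \<xi>) \<le>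
        (primitive (\<omega> 0) \<zeta> - primitive (\<omega> 0) \<xi>) / (\<zeta> - \<xi>)) (at_right \<xi>)"
      using ev
    proof eventually_elim
      case (elim \<zeta>)
      then have "X t \<xi> \<le> X t \<zeta>" using lab by (intro X_mono tT) auto
      then show ?case using vacuum_mean(1)[of \<xi> \<zeta> t] \<xi>(1) elim t by (simp add: pd)
    qed
    ultimately have "\<omega> t (X t \<xi>) \<le> \<omega> 0 \<xi>" using tendsto_le[OF trivial_limit_at_right_real] by blast
    then show ?thesis using omega_0_eq[of \<xi>] lab ab by auto
  qed
  then have "{\<xi> \<in> {k<..<b}. \<not> \<omega> t (X t \<xi>) \<le> \<omega>0 \<xi>} \<subseteq> {\<xi> \<in> {b - \<eta>..b}. X t \<xi> \<in> ?N t} \<union> ?N 0" using k_label by auto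
  then show ?thesis using negligible_Un[OF X_preimage_negligible[OF N tT] N] t by (meson negligible_subset order_refl)
qed

text \<open>The marker has not increased, so \<open>\<rho>bar t\<close> is at most \<open>P\<close>
  at the label, almost everywhere; the contraction of characteristics bounds the integral of the
  transported \<open>P\<^sup>2\<close>. Integrability of the left-hand side is assumed here because
  \<open>\<rho>bar t\<close> comes without measurability.\<close>

lemma vacuum_equilibrium_le:
  assumes t: "0 \<le> t" "t < T" and i: "(\<lambda>x. (\<rho>bar t x)\<^sup>2) integrable_on {X t k..\<beta> t}"
  shows "integral {X t k..\<beta> t} (\<lambda>x. (\<rho>bar t x)\<^sup>2) \<le> integral {k..b} (\<lambda>\<xi>. (P \<xi>)\<^sup>2)"
proof -
  have tT: "t \<in> {0..T}" using t by auto
  have im: "X t ` {k..b} = {X t k..X t b}" using k by (intro X_image k_label b_label tT) auto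
  define J where "J = the_inv_into {k..b} (X t)"
  have inj: "inj_on (X t) {k..b}" using k_label by (intro inj_on_subset[OF X_inj[OF tT]]) auto
  have J: "J (X t x) = x" if "x \<in> {k..b}" for x using the_inv_into_f_f[OF inj that] by (simp add: J_def)
  have con: "X t x < X t y \<and> X t y - X t x \<le> y - x" if "x \<in> {k..b}" "y \<in> {k..b}" "x < y" for x y
    using X_strict_mono[of x y t] vacuum_mean(2)[of x y t] that t k_label by auto
  have ab: "{k..b} \<subseteq> {a..b}" using k_label ab by auto
  have qb: "0 \<le> (P x)\<^sup>2 \<and> (P x)\<^sup>2 \<le> (M / (- vmax'))\<^sup>2" if "x \<in> {k..b}" for x
    using P_bounded[of x] P_props(1)[of x] ab that by (intro conjI power_mono) auto
  have qm: "(\<lambda>x. (P x)\<^sup>2) \<in> borel_measurable (lebesgue_on {k..b})"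
  proof -
    have "(\<lambda>x. (if x \<in> {a..b} then P x else 0)\<^sup>2) \<in> borel_measurable (lebesgue_on {k..b})"
      using P_measurable by (intro borel_measurable_power measurable_restrict_space1 measurable_completion) simp
    then show ?thesis by (rule measurable_cong[THEN iffD1, rotated]) (use ab in auto)
  qed
  have null: "negligible (X t ` (N \<inter> {k..b}))" if "negligible N" for N
    using that k_label by (intro X_image_negligible tT) (auto intro: negligible_subset)
  note pf = contraction_pushforward[OF less_imp_le[OF k(2)] con im J qm qb null]
  \<comment> \<open>The comparison of markers was obtained for interior labels, so the two end
    labels join the exceptional set.\<close>
  define B where "B = {\<xi> \<in> {k<..<b}. \<not> \<omega> t (X t \<xi>) \<le> \<omega>0 \<xi>} \<union> {k, b}"
  have "negligible B" unfolding B_def by (intro negligible_Un vacuum_omega_le t) auto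
  then have NB: "negligible (X t ` B)" using k_label k by (intro X_image_negligible tT) (auto simp: B_def)
  have le: "(\<rho>bar t x)\<^sup>2 \<le> (P (J x))\<^sup>2" if x: "x \<in> {X t k..\<beta> t}" "x \<notin> X t ` B" for x
  proof -
    obtain \<xi> where \<xi>: "\<xi> \<in> {k..b}" "x = X t \<xi>" using x(1) im X_b[OF tT] by (metis imageE)
    then have "\<omega> t x \<le> \<omega>0 \<xi>" using x(2) unfolding B_def by (cases "\<xi> = k \<or> \<xi> = b") auto
    moreover have xa: "x \<in> {a..\<beta> t}" using x(1) X_range[OF k_label tT] boundary_flow.ab[OF boundary_flow_axioms] by auto
    ultimately have "\<rho>bar t x \<le> P \<xi>" using \<xi> ab t by (intro equilibrium_mono) auto
    then show ?thesis using \<xi> J rhobar_props(1)[OF t(1) xa] by (auto intro!: power_mono)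
  qed
  have "integral {X t k..\<beta> t} (\<lambda>x. if x \<in> X t ` B then 0 else (\<rho>bar t x)\<^sup>2) \<le> integral {X t k..\<beta> t} (\<lambda>x. (P (J x))\<^sup>2)"
    using le pf(1) X_b[OF tT] integrable_spike[OF i NB, of "\<lambda>x. if x \<in> X t ` B then 0 else (\<rho>bar t x)\<^sup>2"]
    by (intro integral_le) auto
  moreover have "integral {X t k..\<beta> t} (\<lambda>x. if x \<in> X t ` B then 0 else (\<rho>bar t x)\<^sup>2) = integral {X t k..\<beta> t} (\<lambda>x. (\<rho>bar t x)\<^sup>2)"
    by (rule integral_spike[OF NB]) auto
  ultimately show ?thesis using pf(2) X_b[OF tT] by simp
qed

end

text \<open>The excess of the marker over \<open>vbar\<close> is nonnegative in vacuum and vanishes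
  initially; its integral \<open>A\<close> grows at most at the rate \<open>C\<close>, a bound for
  \<open>Vx\<close>. Gronwall's lemma gives zero. The argument works for any kernel and serves the
  concave case.\<close>

lemma vacuum_constant_marker:
  assumes om: "\<And>x. x \<in> {k..b} \<Longrightarrow> \<omega>0 x = vbar" and t: "0 \<le> t" "t < T"
  shows "negligible {x \<in> {X t k..\<beta> t}. \<omega> t x \<noteq> vbar}"
proof -
  define A where "A s = integral {X s k..X s b} (\<lambda>x. \<omega> s x - vbar)" for s
  have kb: "k \<le> b" using k by simp
  have sT: "s \<in> {0..T}" if "s \<in> {0..t}" for s using that t by auto
  have le: "X s k \<le> X s b" if "s \<in> {0..t}" for s by (intro X_mono k_label b_label kb sT that)
  have int: "(\<lambda>x. \<omega> s x - vbar) integrable_on {p..q}" if "0 \<le> s" for s p q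
    by (intro integrable_diff omega_int that integrable_const_ivl)
  obtain C where C: "0 \<le> C" "\<And>t x. t \<in> {0..T} \<Longrightarrow> x \<in> {b - \<eta>..\<beta> T} \<Longrightarrow> \<bar>Vx t x\<bar> \<le> C" using Vx_bounded by metis
  have Xr: "x \<in> {b - \<eta>..\<beta> T}" "vbar \<le> \<omega> s x" if "s \<in> {0..t}" "x \<in> {X s k..X s b}" for s x
    using X_range[OF k_label sT[OF that(1)]] X_range[OF b_label sT[OF that(1)]] vacuum_g(2)[OF sT[OF that(1)]] that(2) by auto
  have Vi: "Vx s absolutely_integrable_on {X s k..X s b}" if s: "s \<in> {0..t}" for s
    by (rule absolutely_integrable_bounded_borel[of _ _ _ C]) (use s Xr C(2) sT slice_measurable[OF Vx_measurable] in auto)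
  have wVi: "(\<lambda>x. \<omega> s x * Vx s x) integrable_on {X s k..X s b}" if s: "s \<in> {0..t}" for s
  proof (rule absolutely_integrable_imp_integrable, rule absolutely_integrable_bounded_borel[of _ _ _ "M * C"])
    show "\<bar>\<omega> s x * Vx s x\<bar> \<le> M * C" if "x \<in> {X s k..X s b}" for x
      unfolding abs_mult using omega_pos[of s x] omega_le_M[of s x] C(2)[OF sT[OF s] Xr(1)[OF s that]] s by (intro mult_mono) auto
  qed (use s slice_measurable[OF Vx_measurable] slice_measurable[OF omega_measurable] in auto)
  \<comment> \<open>Subtracting \<open>vbar\<close> times the growth of the length leaves
    \<open>Vx\<close> integrated against the nonnegative excess.\<close>
  have le': "integral {X s k..X s b} (\<lambda>x. \<omega> s x * Vx s x) - vbar * integral {X s k..X s b} (Vx s) \<le> C * A s" if s: "s \<in> {0..t}" for s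
  proof -
    have "integral {X s k..X s b} (\<lambda>x. \<omega> s x * Vx s x) - vbar * integral {X s k..X s b} (Vx s) =
        integral {X s k..X s b} (\<lambda>x. \<omega> s x * Vx s x - vbar * Vx s x)"
      using wVi[OF s] absolutely_integrable_imp_integrable[OF Vi[OF s]]
      by (subst Henstock_Kurzweil_Integration.integral_diff) (auto intro: integrable_on_mult_right)
    also have "\<dots> \<le> integral {X s k..X s b} (\<lambda>x. C * (\<omega> s x - vbar))"
    proof (rule integral_le)
      show "(\<lambda>x. \<omega> s x * Vx s x - vbar * Vx s x) integrable_on {X s k..X s b}"
        using wVi[OF s] absolutely_integrable_imp_integrable[OF Vi[OF s]] by (intro integrable_diff integrable_on_mult_right)
      show "(\<lambda>x. C * (\<omega> s x - vbar)) integrable_on {X s k..X s b}" using int s by (intro integrable_on_mult_right) auto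
      show "\<omega> s x * Vx s x - vbar * Vx s x \<le> C * (\<omega> s x - vbar)" if "x \<in> {X s k..X s b}" for x
        using mult_right_mono[of "Vx s x" C "\<omega> s x - vbar"] C(2)[OF sT[OF s] Xr(1)[OF s that]] Xr(2)[OF s that] by (simp add: algebra_simps)
    qed
    finally show ?thesis by (simp add: A_def)
  qed
  have Aeq: "A s = integral {X s k..X s b} (\<omega> s) - vbar * (X s b - X s k)" if "s \<in> {0..t}" for s
    using le[OF that] omega_int[of s] that unfolding A_def by (subst Henstock_Kurzweil_Integration.integral_diff) (auto simp: mult.commute)
  have "L1_continuous (\<lambda>s x. \<omega> s x + - vbar)" by (intro L1_continuous_add L1_continuous_omega L1_continuous_const)
  from L1_continuous_moving_integral[OF this, of t "\<lambda>s. X s k" "\<lambda>s. X s b"]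
  have Ac: "continuous_on {0..t} A"
    unfolding A_def[abs_def] using le continuous_on_subset[OF X_cont[OF k_label], of "{0..t}"] continuous_on_subset[OF X_cont[OF b_label], of "{0..t}"] t by auto
  have A0: "A 0 = 0"
  proof -
    have "A 0 = integral {k..b} (\<lambda>x. 0)"
      unfolding A_def X_props(1)[OF k_label] X_props(1)[OF b_label]
      by (rule integral_cong) (use om omega_0_eq k_label ab in auto)
    then show ?thesis by simp
  qed
  have Al: "A u \<le> C * integral {0..u} A" if u: "u \<in> {0..t}" for u
  proof -
    have "((\<lambda>s. integral {X s k..X s b} (Vx s)) has_integral (X u b - X u k) - (X 0 b - X 0 k)) {0..u}"
    proof (rule fundamental_theorem_of_calculus)
      fix s assume "s \<in> {0..u}"
      then show "((\<lambda>s. X s b - X s k) has_vector_derivative integral {X s k..X s b} (Vx s)) (at s within {0..u})"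
        using DERIV_subset[OF length_increment[OF k_label b_label kb, of s], of "{0..u}"] u t
        by (simp add: has_real_derivative_iff_has_vector_derivative)
    qed (use u in auto)
    from has_integral_diff[OF omega_increment_flow[OF k_label b_label kb, of 0 u] has_integral_mult_right[OF this, of vbar]]
    have "((\<lambda>s. integral {X s k..X s b} (\<lambda>x. \<omega> s x * Vx s x) - vbar * integral {X s k..X s b} (Vx s)) has_integral A u - A 0) {0..u}"
      using u t by (simp add: Aeq algebra_simps)
    moreover have "((\<lambda>s. C * A s) has_integral C * integral {0..u} A) {0..u}"
      using u by (intro has_integral_mult_right integrable_integral integrable_continuous_interval continuous_on_subset[OF Ac]) auto
    ultimately show ?thesis using has_integral_le[of _ "A u - A 0" "{0..u}"] le' u A0 by fastforce
  qed
  have tt: "t \<in> {0..t}" using t by simp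
  have At: "A t \<le> 0" by (rule gronwall_zero[OF Ac C(1) Al tt])
  have "negligible {x \<in> {X t k..X t b}. \<omega> t x - vbar \<noteq> 0}"
  proof (rule negligible_diff_if_integrals_eq)
    show "integral {x..y} (\<lambda>x. \<omega> t x - vbar) = integral {x..y} (\<lambda>x. 0)" if xy: "X t k \<le> x" "x \<le> y" "y \<le> X t b" for x y
    proof -
    have "integral {x..y} (\<lambda>x. \<omega> t x - vbar) \<le> A t"
      unfolding A_def by (rule integral_subset_le) (use xy Xr(2)[OF tt] int t in auto)
    moreover have "0 \<le> integral {x..y} (\<lambda>x. \<omega> t x - vbar)" by (rule integral_nonneg) (use xy Xr(2)[OF tt] int t in auto)
    ultimately show ?thesis using At by simp
    qed
    show "(\<lambda>x. \<omega> t x - vbar) absolutely_integrable_on {X t k..X t b}"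
      by (rule set_integral_diff(1)) (use t in \<open>auto intro: L1_continuous_aint L1_continuous_omega absolutely_integrable_continuous_real\<close>)
  qed auto
  then show ?thesis using X_b t by simp
qed

end

end

section \<open>Decay of the deviation from equilibrium\<close>

text \<open>An open null set is empty, so the bound holds in the interior; continuity extends it to
  the end points.\<close>

lemma continuous_le_if_ae:
  fixes F :: "real \<Rightarrow> real"
  assumes F: "continuous_on {p..q} F" "p < q" and N: "negligible {x \<in> {p..q}. c < F x}" and x: "x \<in> {p..q}"
  shows "F x \<le> c"
proof (rule continuous_le_on_closure[of "{p<..<q}" F x c])
  have "open ({p<..<q} \<inter> F -` {c<..})"
    by (rule continuous_open_preimage[OF continuous_on_subset[OF F(1)]]) auto
  moreover have "negligible ({p<..<q} \<inter> F -` {c<..})" by (rule negligible_subset[OF N]) auto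
  ultimately have "{p<..<q} \<inter> F -` {c<..} = {}" using open_not_negligible by blast
  then show "F y \<le> c" if "y \<in> {p<..<q}" for y using that by (auto simp: not_less[symmetric])
qed (use F x in auto)

lemma Rats_dense_Ico: "s \<in> {0..T} \<Longrightarrow> 0 < T \<Longrightarrow> s \<in> closure ({0..<T} \<inter> \<rat>)" for s T :: real
  unfolding closure_approachable
proof (intro allI impI)
  fix e :: real assume s: "s \<in> {0..T}" "0 < T" and e: "0 < e"
  show "\<exists>y\<in>{0..<T} \<inter> \<rat>. dist y s < e"
  proof (cases "s < T")
    case True
    obtain q where "q \<in> \<rat>" "s < q" "q < min (s + e) T" using Rats_dense_in_real[of s "min (s + e) T"] True e by auto
    then show ?thesis using s by (intro bexI[of _ q]) (auto simp: dist_real_def)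
  next
    case False
    obtain q where "q \<in> \<rat>" "max 0 (T - e) < q" "q < T" using Rats_dense_in_real[of "max 0 (T - e)" T] s e by auto
    then show ?thesis using s False by (intro bexI[of _ q]) (auto simp: dist_real_def)
  qed
qed

context flow_on
begin

lemma ahead_of_boundary: "t \<in> {0..T} \<Longrightarrow> \<alpha> 0 \<le> \<xi> \<Longrightarrow> \<xi> \<le> b \<Longrightarrow> \<beta> t - X t \<xi> \<in> {0..\<beta> t - \<alpha> t}"
  "t \<in> {0..T} \<Longrightarrow> \<beta> t - \<alpha> t \<in> {0..\<eta>}"
proof -
  assume t: "t \<in> {0..T}"
  show "\<beta> t - \<alpha> t \<in> {0..\<eta>}" using alpha_props(1)[of t] t by auto
  assume "\<alpha> 0 \<le> \<xi>" "\<xi> \<le> b"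
  then have \<xi>: "\<xi> \<in> {b - \<eta>..b}" using alpha_0 by auto
  have "\<alpha> t \<le> X t \<xi>" using X_mono[OF alpha_0 \<xi> \<open>\<alpha> 0 \<le> \<xi>\<close> t] alpha_flow[OF t] by simp
  then show "\<beta> t - X t \<xi> \<in> {0..\<beta> t - \<alpha> t}" using X_props(4)[OF \<xi> t] by simp
qed

lemma W_cont: "continuous_on {0..T} (\<lambda>s. w (\<beta> s - \<alpha> s))" and W_nonneg: "s \<in> {0..T} \<Longrightarrow> 0 \<le> w (\<beta> s - \<alpha> s)"
proof -
  have "continuous_on {0..T} (\<lambda>s. \<beta> s - X s (\<alpha> 0))" unfolding beta_eq by (intro continuous_intros X_cont alpha_0)
  then have "continuous_on {0..T} (\<lambda>s. \<beta> s - \<alpha> s)" by (rule continuous_on_eq) (metis alpha_flow)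
  then show "continuous_on {0..T} (\<lambda>s. w (\<beta> s - \<alpha> s))"
    by (rule continuous_on_compose2[OF w_cont]) (use ahead_of_boundary(2) in blast)
  show "s \<in> {0..T} \<Longrightarrow> 0 \<le> w (\<beta> s - \<alpha> s)" using ahead_of_boundary(2) w_nonneg by blast
qed

text \<open>The estimate for a single label. The weight \<open>1 / r\<close> comes from the Jacobian
  \<open>\<rho>0 / r\<close>; multiplied by \<open>\<rho>0\<close> and integrated over the labels,
  the left-hand side is the Lyapunov functional.\<close>

definition decays :: "real \<Rightarrow> real \<Rightarrow> real \<Rightarrow> bool" where
  "decays m t \<xi> \<longleftrightarrow> (r t \<xi> - P \<xi>)\<^sup>2 / r t \<xi> \<le>
    (\<rho>0 \<xi> - P \<xi>)\<^sup>2 / \<rho>0 \<xi> * exp (2 * vmax' * m * integral {0..t} (\<lambda>s. w (\<beta> s - \<alpha> s)))"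

lemma decaysI:
  assumes \<xi>: "\<xi> \<in> {b - \<eta>..b}" and pos: "0 < \<rho>0 \<xi>" and t: "0 \<le> t" "t \<le> T"
    and ode: "\<And>s. s \<in> {0..t} \<Longrightarrow> r' s \<xi> = - r s \<xi> * G s"
    and G: "\<And>s. s \<in> {0..t} \<Longrightarrow> - vmax' * w (\<beta> s - \<alpha> s) * (r s \<xi> - P \<xi>)\<^sup>2 \<le> G s * (r s \<xi> - P \<xi>)"
    and m: "0 \<le> m" "m \<le> \<rho>0 \<xi>" "m \<le> P \<xi>"
  shows "decays m t \<xi>"
  unfolding decays_def r_0[OF \<xi>, symmetric]
proof (rule lyapunov_ode[OF _ t(1) _ ode G _ _ vmax_neg m(1) _ m(3)])
  show "((\<lambda>s. r s \<xi>) has_real_derivative r' s \<xi>) (at s within {0..t})" if "s \<in> {0..t}" for s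
    using that t by (intro DERIV_subset[OF DERIV_r(1)[OF \<xi>]]) auto
  show "0 < r s \<xi>" if "s \<in> {0..t}" for s
    using less_le_trans[OF mult_pos_pos[OF pos exp_gt_zero] r_bounds(1)[OF \<xi>, of s]] that t by auto
  show "continuous_on {0..t} (\<lambda>s. w (\<beta> s - \<alpha> s))" using W_cont t by (auto intro: continuous_on_subset)
  show "m \<le> r 0 \<xi>" using m r_0[OF \<xi>] by simp
qed (use W_nonneg t in auto)

lemma decay_const:
  assumes const: "\<forall>x\<in>{0..\<eta>}. w x = 1 / \<eta>"
    and k: "\<alpha> 0 < k" "k \<le> b" and pos: "\<And>\<xi>. \<xi> \<in> {\<alpha> 0<..<k} \<Longrightarrow> 0 < \<rho>0 \<xi>" and t: "0 \<le> t" "t < T"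
    and m: "0 \<le> m" "\<And>\<xi>. \<xi> \<in> {\<alpha> 0<..<k} \<Longrightarrow> m \<le> \<rho>0 \<xi> \<and> m \<le> P \<xi>"
  shows "negligible {\<xi> \<in> {\<alpha> 0<..<k}. \<not> decays m t \<xi>}"
proof -
  have kl: "k \<in> {b - \<eta>..b}" using k alpha_0 by auto
  define N where "N s = {\<xi> \<in> {b - \<eta>..b}. r' s \<xi> \<noteq> - r s \<xi> * Vx s (X s \<xi>)} \<union> {\<xi> \<in> {\<alpha> 0<..<k}. \<omega> s (X s \<xi>) \<noteq> \<omega>0 \<xi>}" for s
  have "negligible (\<Union>s\<in>{0..<T} \<inter> \<rat>. N s)"
  proof (intro negligible_countable_Union countable_image countable_Int2 countable_rat, clarify)
    fix s assume s: "s \<in> {0..<T}"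
    show "negligible (N s)"
      unfolding N_def by (intro negligible_Un r'_ae omega_transported alpha_0 kl) (use s k pos in auto)
  qed
  moreover have "decays m t \<xi>" if \<xi>: "\<xi> \<in> {\<alpha> 0<..<k}" "\<xi> \<notin> (\<Union>s\<in>{0..<T} \<inter> \<rat>. N s)" for \<xi>
  proof -
    have lab: "\<xi> \<in> {b - \<eta>..b}" "\<xi> \<in> {a..b}" using \<xi> kl alpha_0 ab by auto
    have om: "0 < \<omega>0 \<xi>" by (rule omega0_pos[OF lab(2)])
    define F where "F s = r' s \<xi> + r s \<xi> * ((vbar - v (r s \<xi>) (\<omega>0 \<xi>)) / \<eta>)" for s
    have Fc: "continuous_on {0..T} F"
      unfolding F_def[abs_def] using r_nonneg om
      by (intro continuous_intros r'_cont r_cont lab v_cont_rho) (use \<eta>_pos in auto)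
    have rat: "F s = 0 \<and> r s \<xi> \<le> rmax (\<omega>0 \<xi>)" if s: "s \<in> {0..<T} \<inter> \<rat>" for s
    proof -
      have sT: "s \<in> {0..T}" using s by auto
      have e: "r' s \<xi> = - r s \<xi> * Vx s (X s \<xi>)" "\<omega> s (X s \<xi>) = \<omega>0 \<xi>" using \<xi> s lab by (auto simp: N_def)
      have "Vx s (X s \<xi>) = (g s (X s \<xi> + \<eta>) - g s (X s \<xi>)) / \<eta>" by (rule Vx_const[OF const])
      also have "g s (X s \<xi> + \<eta>) = vbar"
        using ahead_of_boundary(1)[OF sT, of \<xi>] ahead_of_boundary(2)[OF sT] \<xi> lab sT by (intro g_boundary) auto
      also have "g s (X s \<xi>) = v (r s \<xi>) (\<omega>0 \<xi>)" using e by (simp add: g_def r_def)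
      finally show ?thesis using e adm[of s "X s \<xi>"] sT by (auto simp: F_def r_def admissible_def)
    qed
    have cl: "closure ({0..<T} \<inter> \<rat>) \<subseteq> {0..T}" by (intro closure_minimal) auto
    have F0: "F s = 0" if "s \<in> {0..T}" for s
      using continuous_constant_on_closure[of "{0..<T} \<inter> \<rat>" F 0 s] rat Rats_dense_Ico[OF that T_pos] continuous_on_subset[OF Fc cl] by blast
    have rm: "r s \<xi> \<le> rmax (\<omega>0 \<xi>)" if "s \<in> {0..T}" for s
      using continuous_le_on_closure[of "{0..<T} \<inter> \<rat>" "\<lambda>s. r s \<xi>" s "rmax (\<omega>0 \<xi>)"] rat Rats_dense_Ico[OF that T_pos]
        continuous_on_subset[OF r_cont[OF lab(1)] cl] by blast
    show ?thesis
    proof (rule decaysI[OF lab(1), where G="\<lambda>s. (vbar - v (r s \<xi>) (\<omega>0 \<xi>)) / \<eta>"])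
      fix s assume "s \<in> {0..t}"
      then have s: "s \<in> {0..T}" using t by auto
      show "r' s \<xi> = - r s \<xi> * ((vbar - v (r s \<xi>) (\<omega>0 \<xi>)) / \<eta>)" using F0[OF s] by (simp add: F_def)
      have "(v (r s \<xi>) (\<omega>0 \<xi>) - vbar) * (r s \<xi> - P \<xi>) \<le> vmax' * (r s \<xi> - P \<xi>)\<^sup>2"
        using v_slope[OF lab(2), of "r s \<xi>" "P \<xi>"] P_props[OF lab(2)] rm[OF s] r_nonneg[OF s] by auto
      then have "- vmax' * (r s \<xi> - P \<xi>)\<^sup>2 / \<eta> \<le> (vbar - v (r s \<xi>) (\<omega>0 \<xi>)) * (r s \<xi> - P \<xi>) / \<eta>"
        using \<eta>_pos by (intro divide_right_mono) (auto simp: algebra_simps)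
      then show "- vmax' * w (\<beta> s - \<alpha> s) * (r s \<xi> - P \<xi>)\<^sup>2 \<le> (vbar - v (r s \<xi>) (\<omega>0 \<xi>)) / \<eta> * (r s \<xi> - P \<xi>)"
        using const ahead_of_boundary(2)[OF s] by simp
    qed (use pos m t \<xi> in auto)
  qed
  ultimately show ?thesis by (elim negligible_subset) blast
qed

end

context boundary_flow
begin

text \<open>Concavity puts \<open>w\<close> below its tangents at interior points and, by continuity
  of \<open>dw\<close>, at the end points as well. Adding the tangent inequalities at
  \<open>c\<close> and \<open>d\<close> gives the claim.\<close>

lemma dw_antimono:
  assumes conc: "concave_on {0..\<eta>} w" and cd: "c \<in> {0..\<eta>}" "d \<in> {0..\<eta>}" "c < d"
  shows "dw d \<le> dw c"
proof -
  have tangent: "w x - w c - dw c * (x - c) \<le> 0" if "c \<in> {0..\<eta>}" "x \<in> {0..\<eta>}" for c x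
  proof (rule continuous_le_on_closure[of "{0<..<\<eta>}" "\<lambda>c. w x - w c - dw c * (x - c)"])
    show "w x - w c - dw c * (x - c) \<le> 0" if c: "c \<in> {0<..<\<eta>}" for c
      using convex_on_imp_above_tangent[of "{0..\<eta>}" "\<lambda>x. - w x" c x "- dw c"] conc c \<open>x \<in> {0..\<eta>}\<close> DERIV_minus[OF dw(2)[of c]]
      by (auto simp: concave_on_def)
  qed (use that \<eta>_pos in \<open>auto intro!: continuous_intros w_cont dw\<close>)
  have "0 \<le> (dw c - dw d) * (d - c)" using tangent[of c d] tangent[of d c] cd by (simp add: algebra_simps)
  then show ?thesis using cd by (simp add: zero_le_mult_iff)
qed

end

section \<open>Concave kernels: the velocity gradient for a constant marker\<close>

context boundary_flow
begin

text \<open>\<open>vmax'\<close> bounds the slope of \<open>v\<close> from above; the bound from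
  below comes from the continuity of the density derivative on the compact range of
  densities.\<close>

lemma v_lower_slope:
  obtains K where "0 \<le> K"
    "\<And>r1 r2. 0 \<le> r1 \<Longrightarrow> r1 \<le> r2 \<Longrightarrow> r2 \<le> rmax (\<omega>0 b) \<Longrightarrow> v r1 (\<omega>0 b) - v r2 (\<omega>0 b) \<le> K * (r2 - r1)"
proof -
  let ?om = "\<omega>0 b"
  have om: "0 < ?om" using omega0_pos ab' by simp
  have "continuous_on (admissible rmax) (\<lambda>(r, om). d_rho rmax v r om)" using velocity by (simp add: velocity_law_def)
  then have "continuous_on {0..rmax ?om} (\<lambda>s. case (s, ?om) of (r, om) \<Rightarrow> d_rho rmax v r om)"
    by (rule continuous_on_compose2) (use om in \<open>auto intro!: continuous_intros simp: admissible_def\<close>)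
  then have "compact ((\<lambda>s. d_rho rmax v s ?om) ` {0..rmax ?om})" by (intro compact_continuous_image) simp_all
  then obtain K where "\<forall>s\<in>{0..rmax ?om}. \<bar>d_rho rmax v s ?om\<bar> \<le> K"
    unfolding compact_eq_bounded_closed bounded_iff by auto
  then have K: "\<bar>d_rho rmax v s ?om\<bar> \<le> K" if "s \<in> {0..rmax ?om}" for s using that by blast
  show ?thesis
  proof (rule that[of K])
    show "0 \<le> K" using K[of 0] rmax_pos[OF om] by auto
    fix r1 r2 assume r: "0 \<le> r1" "r1 \<le> r2" "r2 \<le> rmax ?om"
    have "- v r2 ?om - - v r1 ?om \<le> K * (r2 - r1)"
    proof (rule DERIV_within_upper_slope)
      show "((\<lambda>s. - v s ?om) has_real_derivative - d_rho rmax v s ?om) (at s within {0..rmax ?om})" if "s \<in> {0..rmax ?om}" for s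
        using that om by (intro DERIV_minus v_deriv) (simp add: admissible_def)
      show "- d_rho rmax v s ?om \<le> K" if "s \<in> {0..rmax ?om}" for s using K[OF that] by linarith
    qed (use r in auto)
    then show "v r1 ?om - v r2 ?om \<le> K * (r2 - r1)" by simp
  qed
qed

lemma integral_dw: "0 \<le> p \<Longrightarrow> p \<le> q \<Longrightarrow> q \<le> \<eta> \<Longrightarrow> (dw has_integral w q - w p) {p..q}"
  by (rule fundamental_theorem_of_calculus)
     (auto simp: has_real_derivative_iff_has_vector_derivative[symmetric] intro!: DERIV_subset[OF dw(2)])

lemma integral_dw_lower:
  assumes f: "continuous_on {0..\<eta>} f" "\<And>\<tau>. \<tau> \<in> {0..\<eta>} \<Longrightarrow> f \<tau> \<le> B" and B: "0 \<le> B"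
  shows "- w 0 * B \<le> integral {0..\<eta>} (\<lambda>\<tau>. dw \<tau> * f \<tau>)"
proof -
  have "- w 0 * B \<le> (w \<eta> - w 0) * B" using w_nonneg[of \<eta>] \<eta>_pos B by (simp add: algebra_simps)
  also have "\<dots> \<le> integral {0..\<eta>} (\<lambda>\<tau>. dw \<tau> * f \<tau>)"
    by (rule has_integral_le[OF has_integral_mult_left[OF integral_dw] integrable_integral])
       (use \<eta>_pos f in \<open>auto intro!: integrable_continuous_interval continuous_intros dw mult_left_mono_neg\<close>)
  finally show ?thesis .
qed

definition u :: "real \<Rightarrow> real \<Rightarrow> real" where "u t x = vbar - v (\<rho> t x) (\<omega>0 b)"

text \<open>The expression for \<open>Vx\<close> when the marker is \<open>\<omega>0 b\<close> from
  \<open>x\<close> onwards; the term at \<open>x + \<eta>\<close> drops out because \<open>u\<close>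
  vanishes beyond the boundary. With the marker frozen it is continuous in \<open>x\<close>, so it
  can be used along every characteristic.\<close>

definition G :: "real \<Rightarrow> real \<Rightarrow> real" where
  "G t x = w 0 * u t x + integral {0..\<eta>} (\<lambda>\<tau>. dw \<tau> * u t (x + \<tau>))"

lemma omega0_b_pos: "0 < \<omega>0 b" using omega0_pos ab' by simp

lemma u_boundary: "0 \<le> t \<Longrightarrow> \<beta> t \<le> x \<Longrightarrow> u t x = 0"
  by (simp add: u_def rho_boundary v_rb)

lemma u_cont: "0 \<le> t \<Longrightarrow> continuous_on S f \<Longrightarrow> continuous_on S (\<lambda>x. u t (f x))"
  unfolding u_def using omega0_b_pos rho_nonneg
  by (intro continuous_intros v_cont_rho continuous_on_compose2[OF continuous_on_halfplane_slice[OF rho_cont, of t UNIV]]) auto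

lemma dw_u_cont: "0 \<le> t \<Longrightarrow> S \<subseteq> {0..\<eta>} \<Longrightarrow> continuous_on S (\<lambda>\<tau>. dw \<tau> * u t (x + \<tau>))"
  by (intro continuous_intros u_cont continuous_on_subset[OF dw(1)])

lemma G_cont:
  assumes t: "0 \<le> t"
  shows "continuous_on S (G t)"
proof -
  have "continuous_on (UNIV \<times> cbox 0 \<eta>) (\<lambda>(x, \<tau>). dw \<tau> * u t (x + \<tau>))"
    unfolding case_prod_unfold using t
    by (intro continuous_intros u_cont continuous_on_compose2[OF dw(1)]) auto
  from integral_continuous_on_param[OF this]
  have "continuous_on UNIV (\<lambda>x. integral {0..\<eta>} (\<lambda>\<tau>. dw \<tau> * u t (x + \<tau>)))" by simp
  then have "continuous_on UNIV (G t)"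
    unfolding G_def[abs_def] using t by (intro continuous_intros u_cont)
  then show ?thesis by (rule continuous_on_subset) simp
qed

lemma Vx_eq_G:
  assumes t: "0 \<le> t" and x: "\<beta> t - \<eta> \<le> x" "\<omega> t x = \<omega>0 b" and N: "negligible {y. x \<le> y \<and> \<omega> t y \<noteq> \<omega>0 b}"
  shows "Vx t x = G t x"
proof -
  have gu: "g t y = vbar - u t y" if "\<omega> t y = \<omega>0 b" for y using that by (simp add: g_def u_def)
  have "integral {0..\<eta>} (\<lambda>\<tau>. dw \<tau> * (g t (x + \<tau>) - g t x)) = integral {0..\<eta>} (\<lambda>\<tau>. dw \<tau> * (u t x - u t (x + \<tau>)))"
    by (rule integral_spike[OF negligible_translation_real[OF N, of x]]) (auto simp: gu x add.commute)
  also have "\<dots> = integral {0..\<eta>} (\<lambda>\<tau>. dw \<tau> * u t x) - integral {0..\<eta>} (\<lambda>\<tau>. dw \<tau> * u t (x + \<tau>))"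
    unfolding right_diff_distrib using t
    by (intro integral_diff integrable_continuous_interval dw_u_cont continuous_intros dw) auto
  also have "integral {0..\<eta>} (\<lambda>\<tau>. dw \<tau> * u t x) = (w \<eta> - w 0) * u t x"
    using \<eta>_pos by (intro integral_unique has_integral_mult_left integral_dw) auto
  finally have "Vx t x = w \<eta> * (g t (x + \<eta>) - g t x) - ((w \<eta> - w 0) * u t x - integral {0..\<eta>} (\<lambda>\<tau>. dw \<tau> * u t (x + \<tau>)))"
    by (simp add: Vx_def)
  then show ?thesis
    using g_boundary[OF t, of "x + \<eta>"] x gu[OF x(2)] by (simp add: G_def algebra_simps)
qed

text \<open>Align the two convolutions at common points: a shift by \<open>\<delta>\<close> pairs
  \<open>dw (\<delta> + \<tau>)\<close> with \<open>dw \<tau>\<close> at the same value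
  \<open>u t (y + \<tau>)\<close>, and concavity orders the two weights. The remaining piece of
  length \<open>\<delta>\<close> between \<open>x\<close> and \<open>y\<close> has the right sign
  because \<open>dw \<le> 0\<close>, and the last piece for \<open>y\<close> lies beyond the
  boundary.\<close>

lemma G_diff_le:
  assumes conc: "concave_on {0..\<eta>} w" and t: "0 \<le> t" and xy: "\<beta> t - \<eta> \<le> x" "x \<le> y" "y \<le> \<beta> t"
    and nn: "\<And>z. x \<le> z \<Longrightarrow> 0 \<le> \<sigma> * u t z"
  shows "\<sigma> * (G t x - G t y) \<le> w 0 * (\<sigma> * (u t x - u t y))"
proof (cases "x = y")
  case False
  define \<delta> where "\<delta> = y - x"
  have \<delta>: "0 < \<delta>" "\<delta> \<le> \<eta>" using xy False by (auto simp: \<delta>_def)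
  let ?J = "\<lambda>S x. integral S (\<lambda>\<tau>. dw \<tau> * u t (x + \<tau>))"
  have int: "(\<lambda>\<tau>. dw \<tau> * u t (z + \<tau>)) integrable_on {p..q}" if "0 \<le> p" "q \<le> \<eta>" for p q z
    using that t by (intro integrable_continuous_interval dw_u_cont) auto
  have split: "?J {0..p} z + ?J {p..\<eta>} z = ?J {0..\<eta>} z" if "p \<in> {0..\<eta>}" for p z
    using that by (intro integral_split int) auto
  have shift: "?J {\<delta>..\<eta>} x = integral {0..\<eta> - \<delta>} (\<lambda>\<tau>. dw (\<delta> + \<tau>) * u t (y + \<tau>))"
    using integral_shift_real[of 0 "\<eta> - \<delta>" "\<lambda>\<tau>. dw \<tau> * u t (x + \<tau>)" \<delta>] by (simp add: \<delta>_def algebra_simps)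
  have zero: "?J {\<eta> - \<delta>..\<eta>} y = 0"
    by (rule integral_unique, rule has_integral_is_0) (use u_boundary t xy in \<open>auto simp: \<delta>_def\<close>)
  have c2: "continuous_on {0..\<eta> - \<delta>} (\<lambda>\<tau>. dw (\<delta> + \<tau>) * u t (y + \<tau>))"
    using t \<delta> by (intro continuous_intros u_cont continuous_on_compose2[OF dw(1)]) auto
  have "0 \<le> integral {0..\<eta> - \<delta>} (\<lambda>\<tau>. (dw \<tau> * u t (y + \<tau>) - dw (\<delta> + \<tau>) * u t (y + \<tau>)) * \<sigma>)"
  proof (rule integral_nonneg)
    show "(\<lambda>\<tau>. (dw \<tau> * u t (y + \<tau>) - dw (\<delta> + \<tau>) * u t (y + \<tau>)) * \<sigma>) integrable_on {0..\<eta> - \<delta>}"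
      using t \<delta> by (intro integrable_continuous_interval continuous_on_mult_right continuous_on_diff c2 dw_u_cont) auto
    show "0 \<le> (dw \<tau> * u t (y + \<tau>) - dw (\<delta> + \<tau>) * u t (y + \<tau>)) * \<sigma>" if "\<tau> \<in> {0..\<eta> - \<delta>}" for \<tau>
      using mult_nonneg_nonneg[OF _ nn[of "y + \<tau>"], of "dw \<tau> - dw (\<delta> + \<tau>)"] dw_antimono[OF conc, of \<tau> "\<delta> + \<tau>"] that \<delta> xy
      by (auto simp: algebra_simps)
  qed
  also have "\<dots> = (?J {0..\<eta> - \<delta>} y - ?J {\<delta>..\<eta>} x) * \<sigma>"
    unfolding integral_mult_left shift using \<delta> by (subst integral_diff) (auto intro: int integrable_continuous_interval c2)
  finally have 1: "0 \<le> (?J {0..\<eta> - \<delta>} y - ?J {\<delta>..\<eta>} x) * \<sigma>" .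
  have "integral {0..\<delta>} (\<lambda>\<tau>. dw \<tau> * u t (x + \<tau>) * \<sigma>) \<le> integral {0..\<delta>} (\<lambda>\<tau>. 0)"
  proof (rule integral_le)
    show "(\<lambda>\<tau>. dw \<tau> * u t (x + \<tau>) * \<sigma>) integrable_on {0..\<delta>}"
      using \<delta> t by (intro integrable_continuous_interval continuous_on_mult_right dw_u_cont) auto
    show "dw \<tau> * u t (x + \<tau>) * \<sigma> \<le> 0" if "\<tau> \<in> {0..\<delta>}" for \<tau>
      using mult_nonpos_nonneg[OF dw(3)[of \<tau>] nn[of "x + \<tau>"]] that \<delta> by (simp add: ac_simps)
  qed auto
  then have 2: "?J {0..\<delta>} x * \<sigma> \<le> 0" by simp
  have "?J {0..\<eta>} x - ?J {0..\<eta>} y = ?J {0..\<delta>} x - (?J {0..\<eta> - \<delta>} y - ?J {\<delta>..\<eta>} x)"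
    using split[of \<delta> x] split[of "\<eta> - \<delta>" y] \<delta> zero by simp
  then have "(?J {0..\<eta>} x - ?J {0..\<eta>} y) * \<sigma> \<le> 0" using 1 2 by (simp only: left_diff_distrib)
  then show ?thesis by (simp add: G_def algebra_simps)
qed simp

text \<open>As \<open>dw \<le> 0\<close>, replacing \<open>\<sigma> * u\<close> ahead of
  \<open>x\<close> by its largest value, taken at \<open>x\<close>, lowers the integral. Beyond
  distance \<open>d\<close> the integrand is zero, so \<open>dw\<close> integrates to
  \<open>w d - w 0\<close>, and \<open>w 0\<close> cancels against the local term.\<close>

lemma G_lower:
  assumes t: "0 \<le> t" and x: "\<beta> t - x \<le> d" "0 \<le> d" "d \<le> \<eta>"
    and le: "\<And>z. x \<le> z \<Longrightarrow> \<sigma> * u t z \<le> \<sigma> * u t x"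
  shows "w d * (\<sigma> * u t x) \<le> \<sigma> * G t x"
proof -
  let ?J = "\<lambda>S. integral S (\<lambda>\<tau>. dw \<tau> * u t (x + \<tau>))"
  have int: "(\<lambda>\<tau>. dw \<tau> * u t (x + \<tau>)) integrable_on {0..q}" if "q \<le> \<eta>" for q
    using that t by (intro integrable_continuous_interval dw_u_cont) auto
  have "?J {0..d} + ?J {d..\<eta>} = ?J {0..\<eta>}"
    using x by (intro integral_split int) auto
  moreover have "?J {d..\<eta>} = 0"
    by (rule integral_unique, rule has_integral_is_0) (use u_boundary t x in auto)
  moreover have "(w d - w 0) * (\<sigma> * u t x) \<le> ?J {0..d} * \<sigma>"
  proof (rule has_integral_le[OF has_integral_mult_left[OF integral_dw] has_integral_mult_left[OF integrable_integral[OF int]]])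
    show "dw \<tau> * (\<sigma> * u t x) \<le> dw \<tau> * u t (x + \<tau>) * \<sigma>" if "\<tau> \<in> {0..d}" for \<tau>
      using mult_left_mono_neg[OF le[of "x + \<tau>"] dw(3)[of \<tau>]] that x by (simp add: ac_simps)
  qed (use x in auto)
  ultimately show ?thesis by (simp add: G_def algebra_simps)
qed

end

context flow_on
begin

context
  fixes k \<sigma> :: real
  assumes k: "\<alpha> 0 < k" "k \<le> b" and pos: "\<And>\<xi>. \<xi> \<in> {\<alpha> 0<..<k} \<Longrightarrow> 0 < \<rho>0 \<xi>"
    and empty: "\<And>\<xi>. k < b \<Longrightarrow> \<xi> \<in> {k..b} \<Longrightarrow> \<rho>0 \<xi> = 0" and front: "k < b \<Longrightarrow> rb = 0"
    and marker: "\<And>x. x \<in> {b - \<eta>..b} \<Longrightarrow> \<omega>0 x = \<omega>0 b"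
begin

text \<open>Three zones: on the support the marker is carried along, in the vacuum before the
  boundary it is \<open>vbar = \<omega>0 b\<close>, and beyond the boundary it is
  prescribed.\<close>

lemma constant_marker:
  assumes t: "0 \<le> t" "t < T"
  shows "negligible {x. \<alpha> t \<le> x \<and> \<omega> t x \<noteq> \<omega>0 b}"
proof -
  have tT: "t \<in> {0..T}" using t by simp
  have kl: "k \<in> {b - \<eta>..b}" using k alpha_0 by auto
  define A where "A = {\<xi> \<in> {\<alpha> 0<..<k}. \<omega> t (X t \<xi>) \<noteq> \<omega>0 \<xi>}"
  define B where "B = (if k < b then {x \<in> {X t k..\<beta> t}. \<omega> t x \<noteq> \<omega>0 b} else {})"
  have "negligible A" unfolding A_def using k pos t by (intro omega_transported alpha_0 kl) auto
  then have "negligible (X t ` A)"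
    by (rule X_image_negligible) (use tT alpha_0 kl in \<open>auto simp: A_def\<close>)
  moreover have "negligible B"
  proof (cases "k < b")
    case True
    have "\<omega>0 b = vbar" using v_rb v_0[OF omega0_b_pos] front[OF True] by simp
    then show ?thesis
      using vacuum_constant_marker[OF _ True empty front, of t] k marker kl True t by (auto simp: B_def)
  qed (simp add: B_def)
  moreover have "{x. \<alpha> t \<le> x \<and> \<omega> t x \<noteq> \<omega>0 b} \<subseteq> {\<alpha> t} \<union> X t ` A \<union> B"
  proof clarify
    fix x assume x: "\<alpha> t \<le> x" "\<omega> t x \<noteq> \<omega>0 b" "x \<notin> B" "x \<notin> X t ` A" "x \<notin> {}"
    have "x < \<beta> t" using omega_boundary[of t x] x t by force
    then have "x \<in> X t ` {\<alpha> 0..b}"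
      using X_image[OF alpha_0 b_label _ tT] alpha_0 x X_b[OF tT] alpha_flow[OF tT] by auto
    then obtain \<xi> where \<xi>: "\<xi> \<in> {\<alpha> 0..b}" "x = X t \<xi>" by auto
    have \<xi>l: "\<xi> \<in> {b - \<eta>..b}" using \<xi> alpha_0 by auto
    have "\<not> (\<alpha> 0 < \<xi> \<and> \<xi> < k)" using x \<xi> marker[OF \<xi>l] by (auto simp: A_def)
    moreover have "\<not> k \<le> \<xi>"
    proof
      assume "k \<le> \<xi>"
      then have "X t k \<le> x" using X_mono[OF kl \<xi>l _ tT] \<xi> by simp
      moreover have "k < b" using \<open>k \<le> \<xi>\<close> \<xi> \<open>x < \<beta> t\<close> X_b[OF tT] k by (cases "\<xi> = b") auto
      ultimately show False using x \<open>x < \<beta> t\<close> by (simp add: B_def)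
    qed
    ultimately show "x = \<alpha> t" using \<xi> alpha_flow[OF tT] by auto
  qed
  ultimately show ?thesis by (elim negligible_subset[rotated]) simp
qed

text \<open>Admissibility bounds the density by \<open>rmax\<close> of the current marker, which is
  \<open>\<omega>0 b\<close> almost everywhere; the density is continuous.\<close>

lemma rho_le_rmax_b:
  assumes t: "0 \<le> t" "t < T" and x: "\<alpha> t \<le> x"
  shows "\<rho> t x \<le> rmax (\<omega>0 b)"
proof (rule continuous_le_if_ae[of x "x + 1" "\<rho> t"])
  show "negligible {y \<in> {x..x + 1}. rmax (\<omega>0 b) < \<rho> t y}"
    by (rule negligible_subset[OF constant_marker[OF t]]) (use x rho_le_rmax[OF t(1)] in \<open>auto, metis not_le\<close>)
qed (use continuous_on_halfplane_slice[OF rho_cont t(1)] in auto)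

lemma u_mono:
  assumes t: "0 \<le> t" "t < T" and x: "\<alpha> t \<le> x" and le: "\<rho> t y \<le> \<rho> t x"
  shows "u t y \<le> u t x"
  unfolding u_def using v_antimono[OF omega0_b_pos rho_nonneg[OF t(1)] le rho_le_rmax_b[OF t x]] by simp

text \<open>For almost every label this is \<open>r'_ae\<close> with \<open>Vx\<close> rewritten as
  \<open>G\<close>; both sides are continuous in the label.\<close>

lemma r'_eq_G:
  assumes t: "0 \<le> t" "t < T" and \<xi>: "\<xi> \<in> {\<alpha> 0..b}"
  shows "r' t \<xi> = - r t \<xi> * G t (X t \<xi>)"
proof -
  have tT: "t \<in> {0..T}" using t by simp
  define F where "F \<xi> = r' t \<xi> + r t \<xi> * G t (X t \<xi>)" for \<xi>
  have sub: "{\<alpha> 0..b} \<subseteq> {b - \<eta>..b}" using alpha_0 by auto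
  have cX: "continuous_on {\<alpha> 0..b} (\<lambda>\<xi>. f (X t \<xi>))" if "continuous_on UNIV f" for f :: "real \<Rightarrow> real"
    by (rule continuous_on_compose2[OF that continuous_on_subset[OF X_cont_label[OF tT] sub]]) simp
  have c: "continuous_on {\<alpha> 0..b} F"
    unfolding F_def[abs_def] r'_def r_def using t(1)
    by (intro continuous_intros cX G_cont continuous_on_halfplane_slice[OF rt_cont] continuous_on_halfplane_slice[OF rx_cont]
        continuous_on_halfplane_slice[OF V_cont] continuous_on_halfplane_slice[OF rho_cont])
  have at: "\<beta> t - \<eta> \<le> \<alpha> t" "\<And>\<zeta>. \<zeta> \<in> {\<alpha> 0..b} \<Longrightarrow> \<alpha> t \<le> X t \<zeta>"
    using alpha_props(1)[OF t(1)] X_mono[OF alpha_0 _ _ tT] sub by (auto simp: alpha_flow[OF tT])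
  have N: "negligible ({\<zeta> \<in> {b - \<eta>..b}. r' t \<zeta> \<noteq> - r t \<zeta> * Vx t (X t \<zeta>)} \<union>
      {\<zeta> \<in> {b - \<eta>..b}. X t \<zeta> \<in> {x. \<alpha> t \<le> x \<and> \<omega> t x \<noteq> \<omega>0 b}})"
    by (intro negligible_Un r'_ae X_preimage_negligible constant_marker t tT)
  have "F \<zeta> = 0" if "\<zeta> \<in> {\<alpha> 0..b}" "r' t \<zeta> = - r t \<zeta> * Vx t (X t \<zeta>)" "\<omega> t (X t \<zeta>) = \<omega>0 b" for \<zeta>
  proof -
    have "Vx t (X t \<zeta>) = G t (X t \<zeta>)"
      by (rule Vx_eq_G[OF t(1) _ that(3) negligible_subset[OF constant_marker[OF t]]]) (use at at(2)[OF that(1)] in auto)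
    then show ?thesis using that by (simp add: F_def)
  qed
  then have sub: "{\<zeta> \<in> {\<alpha> 0..b}. F \<zeta> \<noteq> 0} \<subseteq> ({\<zeta> \<in> {b - \<eta>..b}. r' t \<zeta> \<noteq> - r t \<zeta> * Vx t (X t \<zeta>)} \<union>
      {\<zeta> \<in> {b - \<eta>..b}. X t \<zeta> \<in> {x. \<alpha> t \<le> x \<and> \<omega> t x \<noteq> \<omega>0 b}})"
    using sub at by blast
  have "F \<xi> \<le> 0" by (rule continuous_le_if_ae[OF c _ negligible_subset[OF N] \<xi>]) (use sub k in auto)
  moreover have "- F \<xi> \<le> 0"
    by (rule continuous_le_if_ae[OF continuous_on_minus[OF c] _ negligible_subset[OF N] \<xi>]) (use sub k in auto)
  ultimately show ?thesis by (simp add: F_def)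
qed

text \<open>The sign \<open>\<sigma>\<close> treats both alternatives at once: 1 for data above
  equilibrium that decrease towards the boundary, -1 for data below it that increase.\<close>

context
  assumes conc: "concave_on {0..\<eta>} w" and \<sigma>: "\<sigma> = 1 \<or> \<sigma> = -1"
    and side: "\<And>x. x \<in> {b - \<eta>..b} \<Longrightarrow> 0 \<le> \<sigma> * (\<rho>0 x - rb)"
    and ordered: "\<And>x y. b - \<eta> \<le> x \<Longrightarrow> x \<le> y \<Longrightarrow> y \<le> b \<Longrightarrow> 0 \<le> \<sigma> * (\<rho>0 x - \<rho>0 y)"
begin

lemma u_sigma:
  assumes t: "0 \<le> t" "t < T" and x: "\<alpha> t \<le> x" "\<alpha> t \<le> y" and le: "0 \<le> \<sigma> * (\<rho> t x - \<rho> t y)"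
  shows "0 \<le> \<sigma> * (u t x - u t y)"
  using \<sigma> u_mono[OF t x(1), of y] u_mono[OF t x(2), of x] le by auto

lemma label_ahead:
  assumes "t \<in> {0..T}" "\<xi> \<in> {\<alpha> 0..b}" "X t \<xi> \<le> z" "z \<le> \<beta> t"
  obtains \<zeta> where "\<zeta> \<in> {\<xi>..b}" "z = X t \<zeta>"
proof -
  have "\<xi> \<in> {b - \<eta>..b}" using assms alpha_0 by auto
  then have "z \<in> X t ` {\<xi>..b}" using X_image[OF _ b_label _ assms(1), of \<xi>] X_b assms by auto
  then show ?thesis using that by blast
qed

lemma label_props:
  assumes "t \<in> {0..T}" "\<xi> \<in> {\<alpha> 0..b}"
  shows "\<xi> \<in> {b - \<eta>..b}" "\<alpha> t \<le> X t \<xi>" "\<beta> t - \<eta> \<le> X t \<xi>" "X t \<xi> \<le> \<beta> t"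
proof -
  show \<xi>: "\<xi> \<in> {b - \<eta>..b}" using assms alpha_0 by auto
  show "\<alpha> t \<le> X t \<xi>" "X t \<xi> \<le> \<beta> t" using X_mono[OF alpha_0 \<xi> _ assms(1)] alpha_flow[OF assms(1)] X_props(4)[OF \<xi>] assms by auto
  then show "\<beta> t - \<eta> \<le> X t \<xi>" using alpha_props(1)[of t] assms by auto
qed

text \<open>
  The side condition propagates by iteration: a bound \<open>A * exp (\<kappa> * s)\<close> on its violation, for a
  suitable \<open>\<kappa>\<close>, improves to \<open>A / 2 * exp (\<kappa> * s)\<close>.
\<close>

lemma side_preserved:
  assumes t: "0 \<le> t" "t < T" and \<xi>: "\<xi> \<in> {\<alpha> 0..b}"
  shows "0 \<le> \<sigma> * (r t \<xi> - rb)"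
proof -
  obtain K where K: "0 \<le> K" "\<And>r1 r2. 0 \<le> r1 \<Longrightarrow> r1 \<le> r2 \<Longrightarrow> r2 \<le> rmax (\<omega>0 b) \<Longrightarrow> v r1 (\<omega>0 b) - v r2 (\<omega>0 b) \<le> K * (r2 - r1)"
    using v_lower_slope by metis
  obtain C where C: "0 \<le> C" "\<And>s x. s \<in> {0..T} \<Longrightarrow> x \<in> {b - \<eta>..\<beta> T} \<Longrightarrow> \<bar>\<rho> s x\<bar> \<le> C"
    using bounded_on_halfplane_rectangle[OF rho_cont] by metis
  have w0: "0 \<le> w 0" using w_nonneg \<eta>_pos by simp
  have rb: "0 \<le> rb" "rb \<le> rmax (\<omega>0 b)" using rb_adm by (auto simp: admissible_def)
  have rC: "r s \<zeta> \<le> C" if "s \<in> {0..T}" "\<zeta> \<in> {\<alpha> 0..b}" for s \<zeta>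
    using C(2)[OF that(1) X_range[OF label_props(1)[OF that] that(1)]] by (simp add: r_def)
  \<comment> \<open>Chosen so that the derivative of \<open>A / 2 * exp (\<kappa> * s)\<close>
    equals \<open>C * w 0 * K * A * exp (\<kappa> * s)\<close>, which is the bound found for the
    nonlocal part of \<open>r'\<close>.\<close>
  define \<kappa> where "\<kappa> = 2 * (C * w 0 * K)"
  have \<kappa>: "0 \<le> \<kappa>" using C K w0 by (simp add: \<kappa>_def)
  have step: "- (\<sigma> * (r s \<zeta> - rb)) \<le> A / 2 * exp (\<kappa> * s)"
    if A: "0 \<le> A" and le: "\<And>s \<zeta>. s \<in> {0..t} \<Longrightarrow> \<zeta> \<in> {\<alpha> 0..b} \<Longrightarrow> - (\<sigma> * (r s \<zeta> - rb)) \<le> A * exp (\<kappa> * s)"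
      and s: "s \<in> {0..t}" and \<zeta>: "\<zeta> \<in> {\<alpha> 0..b}" for A s \<zeta>
  proof -
    have "0 \<le> \<sigma> * (r s \<zeta> - rb) + A / 2 * exp (\<kappa> * s)"
    proof (rule DERIV_within_barrier[where C=0 and T=t and f="\<lambda>s. \<sigma> * (r s \<zeta> - rb) + A / 2 * exp (\<kappa> * s)"])
      fix s assume s: "s \<in> {0..t}"
      then have sT: "s \<in> {0..T}" "0 \<le> s" "s < T" using t by auto
      note lp = label_props[OF sT(1) \<zeta>]
      show "((\<lambda>s. \<sigma> * (r s \<zeta> - rb) + A / 2 * exp (\<kappa> * s)) has_real_derivative
          \<sigma> * r' s \<zeta> + A / 2 * (exp (\<kappa> * s) * \<kappa>)) (at s within {0..t})"
        using t by (auto intro!: derivative_eq_intros DERIV_subset[OF DERIV_r(1)[OF lp(1) sT(1)]])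
      let ?B = "K * (A * exp (\<kappa> * s))"
      assume neg: "\<sigma> * (r s \<zeta> - rb) + A / 2 * exp (\<kappa> * s) < 0"
      \<comment> \<open>A violation of the side condition by the density ahead passes to
        \<open>u\<close> with the Lipschitz constant \<open>K\<close>; beyond the boundary
        \<open>u\<close> is zero.\<close>
      have uneg: "- (\<sigma> * u s z) \<le> ?B" if z: "X s \<zeta> \<le> z" for z
      proof (cases "z \<le> \<beta> s")
        case True
        obtain \<theta> where \<theta>: "\<theta> \<in> {\<zeta>..b}" "z = X s \<theta>" using label_ahead[OF sT(1) \<zeta> z True] .
        have bd: "- (\<sigma> * (\<rho> s z - rb)) \<le> A * exp (\<kappa> * s)" using le[OF s, of \<theta>] \<theta> \<zeta> by (simp add: r_def)
        have zl: "\<alpha> s \<le> z" using lp(2) z by simp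
        have "- (\<sigma> * u s z) \<le> K * max 0 (- (\<sigma> * (\<rho> s z - rb)))"
          using \<sigma> K(2)[OF rho_nonneg[OF sT(2)], of z rb] K(2)[of rb "\<rho> s z"] rb rho_le_rmax_b[OF sT(2,3) zl]
            v_antimono[OF omega0_b_pos rho_nonneg[OF sT(2)], of z rb] v_antimono[OF omega0_b_pos rb(1), of "\<rho> s z"]
          by (auto simp: u_def v_rb max_def not_le algebra_simps)
        also have "\<dots> \<le> ?B" using bd A K(1) by (intro mult_left_mono) auto
        finally show ?thesis .
      qed (use u_boundary[OF sT(2), of z] K A in auto)
      \<comment> \<open>At the violating label itself the local term of \<open>G\<close> has the
        favourable sign, so only the integral over the points ahead has to be estimated.\<close>
      have "\<sigma> * (r s \<zeta> - rb) \<le> 0" using neg mult_nonneg_nonneg[OF A exp_ge_zero, of "\<kappa> * s"] by simp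
      then have "0 \<le> - \<sigma> * (\<rho> s (X s \<zeta>) - \<rho> s (\<beta> s))" using rho_boundary[OF sT(2)] by (simp add: r_def)
      then have "\<sigma> * u s (X s \<zeta>) \<le> 0"
        using \<sigma> u_mono[OF sT(2,3) lp(2), of "\<beta> s"] u_mono[OF sT(2,3), of "\<beta> s" "X s \<zeta>"] lp(2,4) u_boundary[OF sT(2), of "\<beta> s"]
        by auto
      moreover have "- w 0 * ?B \<le> integral {0..\<eta>} (\<lambda>\<tau>. dw \<tau> * - (\<sigma> * u s (X s \<zeta> + \<tau>)))"
        using sT K A by (intro integral_dw_lower continuous_intros u_cont uneg) auto
      then have "- w 0 * ?B \<le> - (\<sigma> * integral {0..\<eta>} (\<lambda>\<tau>. dw \<tau> * u s (X s \<zeta> + \<tau>)))"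
        by (simp add: mult.left_commute[of _ \<sigma>])
      ultimately have "\<sigma> * G s (X s \<zeta>) \<le> w 0 * ?B"
        using mult_nonneg_nonpos[OF w0, of "\<sigma> * u s (X s \<zeta>)"] by (simp add: G_def algebra_simps)
      then have "r s \<zeta> * (\<sigma> * G s (X s \<zeta>)) \<le> r s \<zeta> * (w 0 * ?B)" by (rule mult_left_mono) (rule r_nonneg[OF sT(1)])
      also have "\<dots> \<le> C * (w 0 * ?B)" using K A w0 by (intro mult_right_mono rC sT \<zeta>) auto
      finally show "0 * (\<sigma> * (r s \<zeta> - rb) + A / 2 * exp (\<kappa> * s)) \<le> \<sigma> * r' s \<zeta> + A / 2 * (exp (\<kappa> * s) * \<kappa>)"
        unfolding r'_eq_G[OF sT(2,3) \<zeta>] by (simp add: \<kappa>_def algebra_simps)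
    next
      have "\<zeta> \<in> {b - \<eta>..b}" using \<zeta> alpha_0 by auto
      then show "0 \<le> \<sigma> * (r 0 \<zeta> - rb) + A / 2 * exp (\<kappa> * 0)" using side[of \<zeta>] r_0 A by simp
    qed (rule s)
    then show ?thesis by simp
  qed
  \<comment> \<open>A crude first bound on any violation, from \<open>0 \<le> r\<close> and
    \<open>r \<le> C\<close>.\<close>
  define A where "A = C + rb"
  have iter: "- (\<sigma> * (r s \<zeta> - rb)) \<le> A / 2 ^ n * exp (\<kappa> * s)" if "s \<in> {0..t}" "\<zeta> \<in> {\<alpha> 0..b}" for s \<zeta> n
    using that
  proof (induction n arbitrary: s \<zeta>)
    case 0
    then have "- (\<sigma> * (r s \<zeta> - rb)) \<le> A" using rC[of s \<zeta>] r_nonneg[of s \<zeta>] rb C \<sigma> t by (auto simp: A_def)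
    also have "\<dots> \<le> A * exp (\<kappa> * s)" using 0 \<kappa> C rb by (simp add: A_def mult_le_cancel_left1)
    finally show ?case by simp
  next
    case (Suc n)
    from step[OF _ Suc.IH Suc.prems] show ?case using C rb by (simp add: A_def field_simps)
  qed
  have "(\<lambda>n. A / 2 ^ n * exp (\<kappa> * t)) \<longlonglongrightarrow> 0 * exp (\<kappa> * t)"
    by (intro tendsto_mult_right LIMSEQ_divide_realpow_zero) simp
  from LIMSEQ_le_const[OF this, of "- (\<sigma> * (r t \<xi> - rb))"] iter[of t \<xi>] t \<xi> show ?thesis by auto
qed

lemma u_side:
  assumes t: "0 \<le> t" "t < T" and x: "\<alpha> t \<le> x"
  shows "0 \<le> \<sigma> * u t x"
proof (cases "x \<le> \<beta> t")
  case True
  have tT: "t \<in> {0..T}" using t by simp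
  obtain \<xi> where \<xi>: "\<xi> \<in> {\<alpha> 0..b}" "x = X t \<xi>"
    using label_ahead[OF tT, of "\<alpha> 0" x] alpha_flow[OF tT] x True alpha_0 by auto
  show ?thesis
    using u_sigma[OF t x, of "\<beta> t"] side_preserved[OF t \<xi>(1)] \<xi> rho_boundary[OF t(1)] u_boundary[OF t(1)] alpha_props(1)[OF t(1)]
    by (auto simp: r_def)
qed (use u_boundary t in auto)

text \<open>Write \<open>r' \<xi> - r' \<zeta>\<close> as
  \<open>- G x * (r \<xi> - r \<zeta>) - r \<zeta> * (G x - G y)\<close> with \<open>x\<close>,
  \<open>y\<close> the positions of the labels. Where the order is violated, \<open>u\<close> is
  ordered the wrong way too, and \<open>G_diff_le\<close> gives the second term the right sign. The
  first is linear in the violation; a bound for its coefficient \<open>- G x\<close> is the constant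
  of the barrier.\<close>

lemma order_preserved:
  assumes t: "0 \<le> t" "t < T" and \<xi>: "\<xi> \<in> {\<alpha> 0..b}" "\<zeta> \<in> {\<alpha> 0..b}" "\<xi> \<le> \<zeta>"
  shows "0 \<le> \<sigma> * (r t \<xi> - r t \<zeta>)"
proof (rule DERIV_within_barrier[where C="2 * (w 0 * (vbar + \<omega>0 b))" and T=t and f="\<lambda>s. \<sigma> * (r s \<xi> - r s \<zeta>)"])
  fix s assume s: "s \<in> {0..t}"
  then have sT: "s \<in> {0..T}" "0 \<le> s" "s < T" using t by auto
  note l1 = label_props[OF sT(1) \<xi>(1)] and l2 = label_props[OF sT(1) \<xi>(2)]
  show "((\<lambda>s. \<sigma> * (r s \<xi> - r s \<zeta>)) has_real_derivative \<sigma> * (r' s \<xi> - r' s \<zeta>)) (at s within {0..t})"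
    using t by (auto intro!: DERIV_cmult DERIV_diff DERIV_subset[OF DERIV_r(1)[OF _ sT(1)]] l1 l2)
  assume neg: "\<sigma> * (r s \<xi> - r s \<zeta>) < 0"
  let ?x = "X s \<xi>" and ?y = "X s \<zeta>"
  have w0: "0 \<le> w 0" using w_nonneg \<eta>_pos by simp
  have xy: "?x \<le> ?y" using X_mono[OF l1(1) l2(1) \<xi>(3) sT(1)] .
  have "0 \<le> \<sigma> * (u s ?y - u s ?x)"
    using neg by (intro u_sigma sT l1 l2) (simp add: r_def algebra_simps)
  from mult_nonneg_nonneg[OF w0 this] have "w 0 * (\<sigma> * (u s ?x - u s ?y)) \<le> 0" by (simp add: algebra_simps)
  with G_diff_le[OF conc sT(2) l1(3) xy l2(4) u_side[OF sT(2,3)]] l1(2)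
  have "\<sigma> * (G s ?x - G s ?y) \<le> 0" by force
  from mult_nonneg_nonpos[OF r_nonneg[OF sT(1), of \<zeta>] this]
  have 1: "- G s ?x * (\<sigma> * (r s \<xi> - r s \<zeta>)) \<le> \<sigma> * (r' s \<xi> - r' s \<zeta>)"
    unfolding r'_eq_G[OF sT(2,3) \<xi>(1)] r'_eq_G[OF sT(2,3) \<xi>(2)] by (simp add: algebra_simps)
  have ub: "u s z \<le> vbar + \<omega>0 b" "- (vbar + \<omega>0 b) \<le> u s z" if "?x \<le> z" for z
    using v_antimono[OF omega0_b_pos order_refl rho_nonneg[OF sT(2)] rho_le_rmax_b[OF sT(2,3)], of z]
      v_antimono[OF omega0_b_pos rho_nonneg[OF sT(2)] rho_le_rmax_b[OF sT(2,3)] order_refl, of z]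
      v_0[OF omega0_b_pos] v_rmax[OF omega0_b_pos] l1(2) that omega0_b_pos vbar_pos
    by (auto simp: u_def)
  have "- w 0 * (vbar + \<omega>0 b) \<le> integral {0..\<eta>} (\<lambda>\<tau>. dw \<tau> * u s (?x + \<tau>))"
    using sT vbar_pos omega0_b_pos by (intro integral_dw_lower u_cont continuous_intros ub) auto
  moreover have "w 0 * - (vbar + \<omega>0 b) \<le> w 0 * u s ?x" using w0 by (intro mult_left_mono ub) auto
  ultimately have "- G s ?x \<le> 2 * (w 0 * (vbar + \<omega>0 b))" unfolding G_def mult_minus_left mult_minus_right by linarith
  from mult_right_mono_neg[OF this, of "\<sigma> * (r s \<xi> - r s \<zeta>)"] neg 1
  show "2 * (w 0 * (vbar + \<omega>0 b)) * (\<sigma> * (r s \<xi> - r s \<zeta>)) \<le> \<sigma> * (r' s \<xi> - r' s \<zeta>)" by linarith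
next
  show "0 \<le> \<sigma> * (r 0 \<xi> - r 0 \<zeta>)" using ordered[of \<xi> \<zeta>] \<xi> alpha_0 r_0 by auto
qed (use t in auto)

text \<open>Side and order make \<open>\<sigma> * u\<close> largest at \<open>X s \<xi>\<close>
  among all points ahead, so \<open>G_lower\<close> applies with
  \<open>d = \<beta> s - \<alpha> s\<close>. Multiplying by
  \<open>\<sigma> * (r - rb) \<ge> 0\<close> removes the sign, and the slope bound of
  \<open>v\<close> turns \<open>u\<close> into the deviation of the density.\<close>

lemma decay_concave:
  assumes t: "0 \<le> t" "t < T" and \<xi>: "\<xi> \<in> {\<alpha> 0<..<k}" and m: "0 \<le> m" "m \<le> \<rho>0 \<xi>" "m \<le> P \<xi>"
  shows "decays m t \<xi>"
proof -
  have \<xi>': "\<xi> \<in> {\<alpha> 0..b}" "\<xi> \<in> {b - \<eta>..b}" "\<xi> \<in> {a..b}" using \<xi> k alpha_0 ab' by auto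
  have rb: "rb \<in> {0..rmax (\<omega>0 b)}" using rb_adm by (auto simp: admissible_def)
  have P: "P \<xi> = rb"
    using v_inj[of b "P \<xi>" rb] P_props[OF \<xi>'(3)] marker[OF \<xi>'(2)] rb v_rb ab' by auto
  show ?thesis
  proof (rule decaysI[OF \<xi>'(2) pos[OF \<xi>] t(1) _ _ _ m, where G="\<lambda>s. G s (X s \<xi>)"])
    fix s assume "s \<in> {0..t}"
    then have s: "s \<in> {0..T}" "0 \<le> s" "s < T" using t by auto
    note l = label_props[OF s(1) \<xi>'(1)]
    show "r' s \<xi> = - r s \<xi> * G s (X s \<xi>)" by (rule r'_eq_G[OF s(2,3) \<xi>'(1)])
    have le: "\<sigma> * u s z \<le> \<sigma> * u s (X s \<xi>)" if z: "X s \<xi> \<le> z" for z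
    proof (cases "z \<le> \<beta> s")
      case True
      obtain \<zeta> where \<zeta>: "\<zeta> \<in> {\<xi>..b}" "z = X s \<zeta>" using label_ahead[OF s(1) \<xi>'(1) z True] .
      have "0 \<le> \<sigma> * (u s (X s \<xi>) - u s z)"
        by (rule u_sigma[OF s(2,3)]) (use order_preserved[OF s(2,3) \<xi>'(1), of \<zeta>] \<zeta> \<xi>' l z in \<open>auto simp: r_def\<close>)
      then show ?thesis by (simp add: algebra_simps)
    qed (use u_boundary[OF s(2), of z] u_side[OF s(2,3) l(2)] in auto)
    let ?W = "w (\<beta> s - \<alpha> s)" and ?x = "X s \<xi>"
    have "?W * (\<sigma> * u s ?x) \<le> \<sigma> * G s ?x"
      using ahead_of_boundary(2)[OF s(1)] l by (intro G_lower s le) auto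
    from mult_right_mono[OF this side_preserved[OF s(2,3) \<xi>'(1)]]
    have "?W * (u s ?x * (r s \<xi> - rb)) \<le> G s ?x * (r s \<xi> - rb)" using \<sigma> by (auto simp: algebra_simps)
    moreover have "(v (r s \<xi>) (\<omega>0 b) - v rb (\<omega>0 b)) * (r s \<xi> - rb) \<le> vmax' * (r s \<xi> - rb)\<^sup>2"
      using rho_le_rmax_b[OF s(2,3) l(2)] rho_nonneg[OF s(2)] rb ab' by (intro v_slope) (auto simp: r_def)
    then have "- vmax' * (r s \<xi> - rb)\<^sup>2 \<le> u s ?x * (r s \<xi> - rb)" by (simp add: u_def v_rb r_def algebra_simps)
    from mult_left_mono[OF this W_nonneg[OF s(1)]]
    have "?W * (- vmax' * (r s \<xi> - rb)\<^sup>2) \<le> ?W * (u s ?x * (r s \<xi> - rb))" .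
    ultimately show "- vmax' * ?W * (r s \<xi> - P \<xi>)\<^sup>2 \<le> G s ?x * (r s \<xi> - P \<xi>)" unfolding P by (simp add: ac_simps)
  qed (use t in auto)
qed

end

end

end

section \<open>Assembly of the Lyapunov estimate\<close>

context flow_on
begin

text \<open>With \<open>cr = 0\<close> the degenerate interval at the boundary already carries
  enough mass, so \<open>\<alpha> t = \<beta> t\<close> and the functional integrates over a
  point.\<close>

lemma lyapunov_zero_if_no_mass:
  assumes "cr = 0" "0 \<le> t"
  shows "lyapunov \<eta> b vbar \<rho> \<rho>bar t = 0"
proof -
  have "\<not> \<alpha> t < \<beta> t" using alpha_props(3)[OF assms(2), of "\<beta> t"] assms(1) by auto
  then have "\<alpha> t = \<beta> t" using alpha_props(1)[OF assms(2)] by simp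
  then show ?thesis by (simp add: lyapunov_def)
qed

lemma initial_deviation_integrable:
  assumes "a \<le> p" "q \<le> b"
  shows "(\<lambda>x. (\<rho>0 x - P x)\<^sup>2) integrable_on {p..q}"
proof -
  define D where "D x = (\<rho> 0 x - (if x \<in> {a..b} then P x else 0))\<^sup>2" for x
  obtain C where C: "0 \<le> C" "\<And>t x. t \<in> {0..0} \<Longrightarrow> x \<in> {p..q} \<Longrightarrow> \<bar>\<rho> t x\<bar> \<le> C"
    using bounded_on_halfplane_rectangle[OF rho_cont] by metis
  have "\<rho> 0 \<in> borel_measurable borel"
    using continuous_on_halfplane_slice[OF rho_cont, of 0 UNIV] by (intro borel_measurable_continuous_onI) simp
  then have "D \<in> borel_measurable borel" unfolding D_def[abs_def] using P_measurable by measurable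
  moreover have "\<bar>D x\<bar> \<le> (C + M / (- vmax'))\<^sup>2" if "x \<in> {p..q}" for x
  proof -
    have x: "x \<in> {a..b}" using that assms by auto
    have "\<bar>\<rho> 0 x - P x\<bar> \<le> C + M / (- vmax')" using C(2)[of 0 x] that P_bounded[OF x] P_props(1)[OF x] by auto
    then have "\<bar>\<rho> 0 x - P x\<bar>\<^sup>2 \<le> (C + M / (- vmax'))\<^sup>2" by (intro power_mono) auto
    then show ?thesis using x by (simp add: D_def)
  qed
  ultimately have "D absolutely_integrable_on {p..q}" by (rule absolutely_integrable_bounded_borel)
  then have "D integrable_on {p..q}" by (rule absolutely_integrable_imp_integrable)
  then show ?thesis by (rule integrable_eq) (use assms in \<open>auto simp: D_def rho_0_eq\<close>)
qed

text \<open>The interval is cut at the front \<open>X t k\<close> of the support. Behind it the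
  estimate for single labels is integrated against the Jacobian. Ahead of it the density and
  \<open>m\<close> vanish, the exponential factor is 1, and comparing the integrals of the squared
  equilibrium density suffices.\<close>

lemma lyapunov_decay:
  assumes k: "\<alpha> 0 < k" "k \<le> b" and pos: "\<And>\<xi>. \<xi> \<in> {\<alpha> 0<..<k} \<Longrightarrow> 0 < \<rho>0 \<xi>"
    and empty: "\<And>\<xi>. k < b \<Longrightarrow> \<xi> \<in> {k..b} \<Longrightarrow> \<rho>0 \<xi> = 0" and front: "k < b \<Longrightarrow> rb = 0"
    and t: "0 \<le> t" "t < T"
    and m: "0 \<le> m" "\<And>\<xi>. \<xi> \<in> {\<alpha> 0..b} \<Longrightarrow> m \<le> \<rho>0 \<xi>"
    and dec: "negligible {\<xi> \<in> {\<alpha> 0<..<k}. \<not> decays m t \<xi>}"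
    and vac: "k < b \<Longrightarrow> (\<lambda>x. (\<rho>bar t x)\<^sup>2) integrable_on {X t k..\<beta> t} \<Longrightarrow>
      integral {X t k..\<beta> t} (\<lambda>x. (\<rho>bar t x)\<^sup>2) \<le> integral {k..b} (\<lambda>\<xi>. (P \<xi>)\<^sup>2)"
  shows "lyapunov \<eta> b vbar \<rho> \<rho>bar t \<le> lyapunov \<eta> b vbar \<rho> \<rho>bar 0 *
    exp (2 * vmax' * m * integral {0..t} (\<lambda>s. w (\<beta> s - \<alpha> s)))"
proof -
  have tT: "t \<in> {0..T}" using t by simp
  have kl: "k \<in> {b - \<eta>..b}" using k alpha_0 by auto
  define f where "f x = (\<rho> t x - \<rho>bar t x)\<^sup>2" for x
  define h where "h \<xi> = (\<rho>0 \<xi> - P \<xi>)\<^sup>2" for \<xi>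
  define E where "E = exp (2 * vmax' * m * integral {0..t} (\<lambda>s. w (\<beta> s - \<alpha> s)))"
  have hi: "h integrable_on {p..q}" if "\<alpha> 0 \<le> p" "q \<le> b" for p q
    unfolding h_def using that alpha_0 ab' by (intro initial_deviation_integrable) auto
  have h0: "0 \<le> integral S h" for S by (cases "h integrable_on S") (auto simp: h_def not_integrable_integral intro: integral_nonneg)
  have L0: "lyapunov \<eta> b vbar \<rho> \<rho>bar 0 = integral {\<alpha> 0..b} h"
    unfolding lyapunov_def using alpha_0 ab' by (auto intro!: integral_cong simp: h_def P_def rho_0_eq beta_eq)
  show ?thesis
  proof (cases "f integrable_on {\<alpha> t..\<beta> t}")
    \<comment> \<open>\<open>\<rho>bar t\<close> comes without measurability; the integral of a
      non-integrable function is 0 by default, and the right-hand side is nonnegative.\<close>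
    case False
    then have "lyapunov \<eta> b vbar \<rho> \<rho>bar t = 0" by (simp add: lyapunov_def f_def[abs_def] not_integrable_integral)
    then show ?thesis unfolding L0 using h0 by simp
  next
    case True
    have Xk: "X t k \<in> {\<alpha> t..\<beta> t}" using X_mono[OF alpha_0 kl _ tT] X_props(4)[OF kl tT] k alpha_flow[OF tT] by simp
    have fi: "f integrable_on {\<alpha> t..X t k}" "f integrable_on {X t k..\<beta> t}"
      using integrable_on_subinterval[OF True] Xk by auto
    define I where "I = integral {X t (\<alpha> 0)<..<X t k} f"
    have "f absolutely_integrable_on {X t (\<alpha> 0)<..<X t k}"
      using fi(1) by (intro nonnegative_absolutely_integrable_1)
        (auto simp: f_def integrable_on_Icc_iff_Ioo alpha_flow[OF tT])
    then have pull: "(\<lambda>\<xi>. \<rho>0 \<xi> / r t \<xi> * f (X t \<xi>)) absolutely_integrable_on {\<alpha> 0<..<k}"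
        "integral {\<alpha> 0<..<k} (\<lambda>\<xi>. \<rho>0 \<xi> / r t \<xi> * f (X t \<xi>)) = I"
      using change_of_labels[OF alpha_0 kl less_imp_le[OF k(1)] pos tT, of f I] by (auto simp: I_def)
    define N where "N = {\<xi> \<in> {\<alpha> 0<..<k}. \<not> decays m t \<xi>} \<union> {\<xi> \<in> {\<alpha> 0<..<k}. \<omega> t (X t \<xi>) \<noteq> \<omega>0 \<xi>}"
    have N: "negligible N"
      unfolding N_def using k by (intro negligible_Un dec omega_transported alpha_0 kl pos t) auto
    define F where "F \<xi> = (if \<xi> \<in> N then 0 else \<rho>0 \<xi> / r t \<xi> * f (X t \<xi>))" for \<xi>
    have F: "F integrable_on {\<alpha> 0<..<k}" "integral {\<alpha> 0<..<k} F = I"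
      using integrable_spike[OF absolutely_integrable_imp_integrable[OF pull(1)] N, of F]
        integral_spike[OF N, of "{\<alpha> 0<..<k}" F "\<lambda>\<xi>. \<rho>0 \<xi> / r t \<xi> * f (X t \<xi>)"] pull(2) by (auto simp: F_def)
    have Fh: "F \<xi> \<le> E * h \<xi>" if \<xi>: "\<xi> \<in> {\<alpha> 0<..<k}" for \<xi>
    proof (cases "\<xi> \<in> N")
      case False
      have l: "\<xi> \<in> {b - \<eta>..b}" "\<xi> \<in> {a..b}" using \<xi> kl alpha_0 ab' by auto
      have "\<rho>bar t (X t \<xi>) = P \<xi>"
        using False \<xi> X_props(3,4)[OF l(1) tT] l by (intro rhobar_eq_P t) (auto simp: N_def)
      moreover have "\<rho>0 \<xi> * ((r t \<xi> - P \<xi>)\<^sup>2 / r t \<xi>) \<le> \<rho>0 \<xi> * (h \<xi> / \<rho>0 \<xi> * E)"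
        using False \<xi> pos[OF \<xi>] by (intro mult_left_mono) (auto simp: N_def decays_def h_def E_def)
      ultimately show ?thesis using False pos[OF \<xi>] by (simp add: F_def f_def r_def ac_simps)
    qed (simp add: F_def E_def h_def)
    have "I \<le> integral {\<alpha> 0<..<k} (\<lambda>\<xi>. E * h \<xi>)"
      unfolding F(2)[symmetric] using hi[of "\<alpha> 0" k] k
      by (intro integral_le F Fh integrable_on_mult_right) (auto simp: integrable_on_Icc_iff_Ioo)
    then have I: "I \<le> E * integral {\<alpha> 0..k} h" by (simp add: integral_open_interval_real)
    have J: "integral {X t k..\<beta> t} f \<le> E * integral {k..b} h"
    proof (cases "k < b")
      case True
      \<comment> \<open>The initial density vanishes at the label \<open>b\<close>, and
        \<open>m\<close> is a lower bound for it.\<close>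
      have "m = 0" using m(1) m(2)[of b] empty[OF True, of b] k by auto
      then have E: "E = 1" by (simp add: E_def)
      have fb: "f x = (\<rho>bar t x)\<^sup>2" if "x \<in> {X t k..\<beta> t}" for x
        using vacuum_rho[OF less_imp_le[OF k(1)] True empty[OF True] front[OF True] tT that] by (simp add: f_def)
      have "integral {X t k..\<beta> t} f = integral {X t k..\<beta> t} (\<lambda>x. (\<rho>bar t x)\<^sup>2)" by (rule integral_cong) (rule fb)
      also have "\<dots> \<le> integral {k..b} (\<lambda>\<xi>. (P \<xi>)\<^sup>2)" using fi(2) by (intro vac True integrable_eq[OF fi(2)] fb)
      also have "\<dots> = integral {k..b} h" by (rule integral_cong) (simp add: h_def empty[OF True])
      finally show ?thesis by (simp add: E)
    next
      case False
      then show ?thesis using k X_b[OF tT] by simp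
    qed
    have "lyapunov \<eta> b vbar \<rho> \<rho>bar t = integral {\<alpha> t..\<beta> t} f" by (simp add: lyapunov_def f_def[abs_def])
    also have "\<dots> = integral {\<alpha> t..X t k} f + integral {X t k..\<beta> t} f"
      using Xk by (intro integral_split[symmetric] True) auto
    also have "integral {\<alpha> t..X t k} f = I" by (simp add: I_def alpha_flow[OF tT] integral_open_interval_real)
    also have "I + integral {X t k..\<beta> t} f \<le> E * (integral {\<alpha> 0..k} h + integral {k..b} h)"
      using I J by (simp add: distrib_left)
    also have "integral {\<alpha> 0..k} h + integral {k..b} h = integral {\<alpha> 0..b} h"
      using k by (intro integral_split hi) auto
    finally show ?thesis unfolding L0 by (simp add: E_def mult.commute)
  qed
qed

text \<open>The marker is \<open>vbar\<close> almost everywhere in this vacuum, and for the marker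
  \<open>vbar\<close> the speed \<open>vbar\<close> is attained at density 0.\<close>

lemma vacuum_equilibrium_zero:
  assumes k: "\<alpha> 0 \<le> k" "k < b" and empty: "\<And>\<xi>. \<xi> \<in> {k..b} \<Longrightarrow> \<rho>0 \<xi> = 0" and rb: "rb = 0"
    and marker: "\<And>x. x \<in> {b - \<eta>..b} \<Longrightarrow> \<omega>0 x = \<omega>0 b" and t: "0 \<le> t" "t < T"
  shows "integral {X t k..\<beta> t} (\<lambda>x. (\<rho>bar t x)\<^sup>2) = 0"
proof -
  have tT: "t \<in> {0..T}" using t by simp
  have kl: "k \<in> {b - \<eta>..b}" using k alpha_0 by auto
  have om: "\<omega>0 b = vbar" by (rule vacuum_marker_b[OF k empty rb])
  have "negligible {x \<in> {X t k..\<beta> t}. \<omega> t x \<noteq> vbar}"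
    by (rule vacuum_constant_marker[OF k empty rb _ t]) (use marker om kl in auto)
  then have "integral {X t k..\<beta> t} (\<lambda>x. (\<rho>bar t x)\<^sup>2) = integral {X t k..\<beta> t} (\<lambda>x. 0)"
  proof (rule integral_spike)
    fix x assume x: "x \<in> {X t k..\<beta> t} - {x \<in> {X t k..\<beta> t}. \<omega> t x \<noteq> vbar}"
    then have xa: "x \<in> {a..\<beta> t}" using X_props(3)[OF kl tT] kl ab' by auto
    have "\<rho>bar t x = 0"
      using v_inj[of b "\<rho>bar t x" 0] rhobar_props[OF t(1) xa] v_rb rb x om ab' rmax_pos[OF omega0_b_pos] by auto
    then show "0 = (\<rho>bar t x)\<^sup>2" by simp
  qed
  then show ?thesis by simp
qed

end

theorem theorem3p11:
  fixes \<eta> a b vbar rb vmax' :: real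
    and w rmax \<rho>0 \<omega>0 :: "real \<Rightarrow> real"
    and v \<rho> \<omega> \<rho>bar :: "real \<Rightarrow> real \<Rightarrow> real"
  assumes "0 < \<eta>" and "a + \<eta> < b" and "0 < vbar"
    and "nonlocal_kernel \<eta> w"
    and "velocity_law v rmax"
    and "initial_data rmax a b \<rho>0 \<omega>0"
    and "(rb, \<omega>0 b) \<in> admissible rmax" and "v rb (\<omega>0 b) = vbar"
    and "boundary_value_solution \<eta> w v rmax a b vbar rb \<rho>0 \<omega>0 \<rho> \<omega>"
    and "equilibrium_density v rmax a b vbar \<omega> \<rho>bar"
    and "C1_H2_loc \<rho>"
    and "vmax' < 0"
    and "\<forall>om\<in>\<omega>0 ` {a..b}. \<forall>r\<in>{0..rmax om}. d_rho rmax v r om \<le> vmax'"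
    and "(\<forall>x\<in>{0..\<eta>}. w x = 1 / \<eta>) \<or>
         (concave_on {0..\<eta>} w \<and>
          (\<exists>om r. (\<forall>x\<in>{b - \<eta>..b}. \<omega>0 x = om) \<and>
             (r, om) \<in> admissible rmax \<and> v r om = vbar \<and>
             ((\<forall>x\<in>{b - \<eta>..b}. r \<le> \<rho>0 x) \<and> antimono_on {b - \<eta>..b} \<rho>0 \<or>
              (\<forall>x\<in>{b - \<eta>..b}. \<rho>0 x \<le> r) \<and> mono_on {b - \<eta>..b} \<rho>0)))"
  shows "\<forall>t\<ge>0. lyapunov \<eta> b vbar \<rho> \<rho>bar t \<le> lyapunov \<eta> b vbar \<rho> \<rho>bar 0 *
           exp (2 * vmax' * rho_min \<eta> b vbar \<rho>0 \<rho> \<rho>bar *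
                integral {0..t} (\<lambda>s. w (right_boundary b vbar s - alpha \<eta> b vbar \<rho> s)))"
proof (intro allI impI)
  fix t :: real assume t: "0 \<le> t"
  \<comment> \<open>The horizon has to lie beyond \<open>t\<close>, since the transported integrals
    are evaluated strictly before it.\<close>
  interpret flow_on \<eta> a b vbar rb vmax' w rmax \<rho>0 \<omega>0 v \<rho> \<omega> \<rho>bar "t + 1"
    by (unfold_locales) (use assms t in auto)
  let ?m = "rho_min \<eta> b vbar \<rho>0 \<rho> \<rho>bar"
  have lo: "0 \<le> \<rho>0 x" "0 \<le> P x" if "x \<in> {\<alpha> 0..b}" for x
    using that alpha_0 ab' rho_nonneg[of 0 x] rho_0_eq[of x] P_props(1)[of x] by auto
  have m0: "0 \<le> ?m" unfolding rho_min_def using alpha_0 lo by (intro cINF_greatest) (auto simp: P_def)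
  have "?m \<le> min (\<rho>0 x) (P x)" if "x \<in> {\<alpha> 0..b}" for x
    unfolding rho_min_def P_def using lo that
    by (intro cINF_lower) (auto intro!: bdd_belowI[where m=0] simp: P_def)
  then have m: "?m \<le> \<rho>0 x" "?m \<le> P x" if "x \<in> {\<alpha> 0..b}" for x using that by auto
  show "lyapunov \<eta> b vbar \<rho> \<rho>bar t \<le> lyapunov \<eta> b vbar \<rho> \<rho>bar 0 *
      exp (2 * vmax' * ?m * integral {0..t} (\<lambda>s. w (\<beta> s - \<alpha> s)))"
  proof (cases "cr = 0")
    case True
    then show ?thesis using t by (simp add: lyapunov_zero_if_no_mass)
  next
    case False
    then have "0 < cr" using cr_nonneg by simp
    then obtain k where k: "\<alpha> 0 < k" "k \<le> b" and pos: "\<And>\<xi>. \<xi> \<in> {\<alpha> 0<..<k} \<Longrightarrow> 0 < \<rho>0 \<xi>"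
      and empty: "\<And>\<xi>. k < b \<Longrightarrow> \<xi> \<in> {k..b} \<Longrightarrow> \<rho>0 \<xi> = 0" and front: "k < b \<Longrightarrow> rb = 0"
      using support_front by metis
    have t1: "t < t + 1" by simp
    show ?thesis
      using assms(14)
    proof (elim disjE conjE exE)
      assume const: "\<forall>x\<in>{0..\<eta>}. w x = 1 / \<eta>"
      show ?thesis
      proof (rule lyapunov_decay[OF k pos empty front t t1 m0 m(1)])
        show "negligible {\<xi> \<in> {\<alpha> 0<..<k}. \<not> decays ?m t \<xi>}"
          by (rule decay_const[OF const k pos t t1 m0]) (use m k in auto)
      qed (use vacuum_equilibrium_le[OF less_imp_le[OF k(1)] _ empty front const t t1] in auto)
    next
      \<comment> \<open>Both monotone alternatives are instances of one statement with the sign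
        \<open>\<sigma>\<close> as a parameter.\<close>
      have concave: ?thesis
        if conc: "concave_on {0..\<eta>} w" and om: "\<forall>x\<in>{b - \<eta>..b}. \<omega>0 x = om"
          and \<sigma>: "\<sigma> = 1 \<or> \<sigma> = -1" and side: "\<And>x. x \<in> {b - \<eta>..b} \<Longrightarrow> 0 \<le> \<sigma> * (\<rho>0 x - rb)"
          and ordered: "\<And>x y. b - \<eta> \<le> x \<Longrightarrow> x \<le> y \<Longrightarrow> y \<le> b \<Longrightarrow> 0 \<le> \<sigma> * (\<rho>0 x - \<rho>0 y)" for om \<sigma>
      proof (rule lyapunov_decay[OF k pos empty front t t1 m0 m(1)])
        have marker: "\<omega>0 x = \<omega>0 b" if "x \<in> {b - \<eta>..b}" for x using om that \<eta>_pos by simp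
        have "decays ?m t \<xi>" if "\<xi> \<in> {\<alpha> 0<..<k}" for \<xi>
          using that k m
          by (intro decay_concave[OF k pos empty front marker conc \<sigma> side ordered t t1 that m0]) auto
        then have "{\<xi> \<in> {\<alpha> 0<..<k}. \<not> decays ?m t \<xi>} = {}" by blast
        then show "negligible {\<xi> \<in> {\<alpha> 0<..<k}. \<not> decays ?m t \<xi>}" by (simp only: negligible_empty)
        show "integral {X t k..\<beta> t} (\<lambda>x. (\<rho>bar t x)\<^sup>2) \<le> integral {k..b} (\<lambda>\<xi>. (P \<xi>)\<^sup>2)" if "k < b"
          using vacuum_equilibrium_zero[OF less_imp_le[OF k(1)] that empty[OF that] front[OF that] marker t t1]
            integral_nonneg[of "\<lambda>\<xi>. (P \<xi>)\<^sup>2" "{k..b}"] not_integrable_integral[of "\<lambda>\<xi>. (P \<xi>)\<^sup>2" "{k..b}"]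
          by (cases "(\<lambda>\<xi>. (P \<xi>)\<^sup>2) integrable_on {k..b}") auto
      qed
      fix om r0
      assume conc: "concave_on {0..\<eta>} w" and om: "\<forall>x\<in>{b - \<eta>..b}. \<omega>0 x = om"
        and r0: "(r0, om) \<in> admissible rmax" "v r0 om = vbar"
      have "\<omega>0 b = om" using om \<eta>_pos by simp
      \<comment> \<open>Injectivity of \<open>v\<close> in the density identifies the constant
        equilibrium density of the hypothesis with the boundary density.\<close>
      then have rb: "r0 = rb" using v_inj[of b r0 rb] r0 rb_adm v_rb ab' by (auto simp: admissible_def)
      show ?thesis if "\<forall>x\<in>{b - \<eta>..b}. r0 \<le> \<rho>0 x" "antimono_on {b - \<eta>..b} \<rho>0"
        by (rule concave[OF conc om, of 1]) (use that in \<open>auto simp: rb monotone_on_def\<close>)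
      show ?thesis if "\<forall>x\<in>{b - \<eta>..b}. \<rho>0 x \<le> r0" "mono_on {b - \<eta>..b} \<rho>0"
        by (rule concave[OF conc om, of "-1"]) (use that in \<open>auto simp: rb monotone_on_def\<close>)
    qed
  qed
qed

end
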